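(* For $N\ge0$, the character $\mathrm{ch}_{V_N}(y;q)$ of the $V^G$-module $V_N:=V_{\lambda_N}$ decomposes into a sum of atypical (massless) characters $\mathrm{ch}_N^a(y;q)$ and a sum of typical (massive) characters $\mathrm{ch}_N^t(y;q)$ of the $\mathcal{N}=4$ super Virasoro algebra of central charge six, where $$\mathrm{ch}_{V_N}(y;q)=\mathrm{ch}_N^a(y;q)+\mathrm{ch}_N^t(y;q),$$ $$\mathrm{ch}_N^a(y;q)=\frac{\vartheta_3(y;q)}{\eta(q)^3}\sum_{\alpha\in\mathbb{Z}+\frac12}\frac{y^{\alpha+1/2}q^{\alpha(\alpha-1)/2}}{1+yq^\alpha}\times\begin{cases}-2&\text{if }N=0,\\ 1&\text{if }N=1,\\ 0&\text{else,}\end{cases}$$ $$\mathrm{ch}_N^t(y;q)=\frac{\vartheta_3(y;q)^2}{\eta(q)^3}\bigl(h_N(q)-2h_{N+1}(q)+2h_{N+3}(q)-h_{N+4}(q)\bigr),$$ and the functions $h_k$ are given, for integers $N$, by $$h_{N+1}(q)=\frac{1}{\eta(q)^3}\sum_{\substack{m,r,s\in\mathbb{Z}+\frac12\\ r,s>0}}(-1)^{r+s+1}q^{\,r|m|+s|N-m|+(\mathrm{sgn}(m)r+\mathrm{sgn}(m-N)s)^2/2-N/2}.$$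
   Context: $V$ is the vertex operator superalgebra generated by odd fields $b_1,b_2,c_1,c_2$ and even fields $x_1,x_2,y_1,y_2$ with non-regular operator products $b_i(z)c_j(w)\sim\delta_{i,j}/(z-w)$, $x_i(z)y_j(w)\sim\delta_{i,j}/(z-w)^2$. $G=\mathrm{SL}(2,\mathbb{C})$ acts on $V$ by automorphisms: $(b_1,b_2)^t$ and $(x_1,x_2)^t$ carry the standard representation, $(c_1,c_2)$ and $(y_1,y_2)$ the dual one (the conjugate one for $\mathrm{SU}(2)$). $V^G$ is the fixed-point subalgebra. Let $\lambda_N$ be the $(N+1)$-dimensional irreducible representation of $G$; then $V=\bigoplus_{N\ge0}\lambda_N\otimes V_{\lambda_N}$ as $G\times V^G$-module, which defines the $V^G$-modules $V_{\lambda_N}$. The Virasoro field is $\sum_i{:}x_iy_i{:}+\frac12\sum_i({:}\partial b_i\,c_i{:}-{:}b_i\,\partial c_i{:})$ (central charge $6$), with zero mode $L_0$; so $b_i,c_i$ have conformal weight $\frac12$ and $x_i,y_i$ weight $1$. The Heisenberg field is $J=\sum_i{:}b_ic_i{:}$ with zero mode $J_0$. The character of a module $W$ is $\mathrm{ch}_W(y;q)=\mathrm{tr}_W(q^{L_0-1/4}y^{J_0})$ (ordinary trace, not supertrace), for $0<|q|<1$. $\vartheta_3(y;q)=\sum_{n\in\mathbb{Z}}y^nq^{n^2/2}$ and $\eta(q)=q^{1/24}\prod_{n\ge1}(1-q^n)$. Characters of the $\mathcal{N}=4$ super Virasoro algebra at central charge $6$: the typical (massive) characters are $\mathrm{ch}_h(y;q)=q^{h-3/8}\vartheta_3(y;q)^2/\eta(q)^3$;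 the atypical (massless) characters are $\mathrm{ch}_{1/4,0}(y;q)=\frac{\vartheta_3(y;q)}{\eta(q)^3}\sum_{\alpha\in\mathbb{Z}+\frac12}\frac{y^{\alpha+1/2}q^{\alpha(\alpha-1)/2}}{1+yq^\alpha}$ and $\mathrm{ch}_{1/4,1}$, determined by $\mathrm{ch}_{1/4}=2\,\mathrm{ch}_{1/4,0}+\mathrm{ch}_{1/4,1}$.
   Formalization: The exponent α(α−1)/2 in the massless sum (in ch_N^a and ch_{1/4,0}) is replaced by α(α+1)/2: as printed, N=0 would give leading coefficient 1−2y instead of 1, and N=1 also fails. The identity is stated where no denominator 1+yq^α vanishes. *)

theory Defs
  imports
    "HOL-Analysis.Analysis"
    "HOL-Library.Function_Algebras"
    "HOL-Library.Groups_Big_Fun"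
begin

section \<open>Vertex superalgebras\<close>

text \<open>
  The modes of the state-field correspondence are the \<open>n\<close>-th products \<open>prd n a b\<close>, i.e.
  \<open>Y(a, z) b = (\<Sum>n\<in>\<int>. prd n a b z^(-n-1))\<close>; \<open>par False\<close> and \<open>par True\<close> are the even and
  the odd subspace. In the Borcherds identity \<open>Sum_any\<close> is the sum over all natural numbers
  \<open>j\<close>; by truncation only finitely many terms are nonzero. The translation operator is
  \<open>T a = prd (-2) a vac\<close>; its covariance property is a consequence of the axioms.
\<close>

locale vertex_superalgebra = vector_space scl
  for scl :: "complex \<Rightarrow> 'v::ab_group_add \<Rightarrow> 'v" +
  fixes par :: "bool \<Rightarrow> 'v set"
    and vac :: 'v
    and prd :: "int \<Rightarrow> 'v \<Rightarrow> 'v \<Rightarrow> 'v"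
  assumes part_subspace: "module.subspace scl (par p)"
    and part_disjoint: "par False \<inter> par True = {0}"
    and part_span: "\<exists>u\<in>par False. \<exists>w\<in>par True. v = u + w"
    and linear_right: "Vector_Spaces.linear scl scl (\<lambda>b. prd n a b)"
    and linear_left: "Vector_Spaces.linear scl scl (\<lambda>a. prd n a b)"
    and prd_part: "a \<in> par p \<Longrightarrow> b \<in> par p' \<Longrightarrow> prd n a b \<in> par (p \<noteq> p')"
    and truncation: "\<exists>K. \<forall>n\<ge>K. prd n a b = 0"
    and vac_even: "vac \<in> par False"
    and vac_nonzero: "vac \<noteq> 0"
    and vac_left: "prd n vac a = (if n = -1 then a else 0)"
    and vac_right: "prd (-1) a vac = a"
    and vac_right_regular: "n \<ge> 0 \<Longrightarrow> prd n a vac = 0"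
    and borcherds: "a \<in> par p \<Longrightarrow> b \<in> par p' \<Longrightarrow>
      Sum_any (\<lambda>j::nat. scl (of_int m gchoose j) (prd (m + k - int j) (prd (n + int j) a b) c)) =
      Sum_any (\<lambda>j::nat. scl ((-1) ^ j * (of_int n gchoose j))
        (prd (m + n - int j) a (prd (k + int j) b c)
         - scl ((-1) powi n * (if p \<and> p' then -1 else 1))
             (prd (n + k - int j) b (prd (m + int j) a c))))"

definition vertex_subalgebra ::
  "(complex \<Rightarrow> 'v::ab_group_add \<Rightarrow> 'v) \<Rightarrow> 'v \<Rightarrow> (int \<Rightarrow> 'v \<Rightarrow> 'v \<Rightarrow> 'v) \<Rightarrow> 'v set \<Rightarrow> bool" where
  "vertex_subalgebra scl vac prd U \<longleftrightarrow>
     module.subspace scl U \<and> vac \<in> U \<and> (\<forall>n. \<forall>a\<in>U. \<forall>b\<in>U. prd n a b \<in> U)"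

definition va_automorphism ::
  "(complex \<Rightarrow> 'v::ab_group_add \<Rightarrow> 'v) \<Rightarrow> (bool \<Rightarrow> 'v set) \<Rightarrow> 'v \<Rightarrow>
   (int \<Rightarrow> 'v \<Rightarrow> 'v \<Rightarrow> 'v) \<Rightarrow> ('v \<Rightarrow> 'v) \<Rightarrow> bool" where
  "va_automorphism scl par vac prd \<sigma> \<longleftrightarrow>
     Vector_Spaces.linear scl scl \<sigma> \<and> bij \<sigma> \<and> (\<forall>p. \<sigma> ` par p \<subseteq> par p) \<and> \<sigma> vac = vac \<and>
     (\<forall>n a b. \<sigma> (prd n a b) = prd n (\<sigma> a) (\<sigma> b))"


section \<open>The free field algebra\<close>

datatype generator = B "2" | C "2" | X "2" | Y "2"

fun is_odd :: "generator \<Rightarrow> bool" where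
  "is_odd (B _) = True" | "is_odd (C _) = True" | "is_odd (X _) = False" | "is_odd (Y _) = False"

text \<open>
  \<open>contraction u v n\<close> is the coefficient of \<open>(z - w)^(-n-1)\<close> in \<open>u(z) v(w)\<close>. The values for
  \<open>(c, b)\<close> and \<open>(y, x)\<close> are those forced by skew-symmetry.
\<close>

fun contraction :: "generator \<Rightarrow> generator \<Rightarrow> int \<Rightarrow> complex" where
  "contraction (B i) (C j) n = (if i = j \<and> n = 0 then 1 else 0)"
| "contraction (C i) (B j) n = (if i = j \<and> n = 0 then 1 else 0)"
| "contraction (X i) (Y j) n = (if i = j \<and> n = 1 then 1 else 0)"
| "contraction (Y i) (X j) n = (if i = j \<and> n = 1 then 1 else 0)"
| "contraction _ _ n = 0"

locale free_field_algebra = vertex_superalgebra scl par vac prd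
  for scl :: "complex \<Rightarrow> 'v::ab_group_add \<Rightarrow> 'v"
    and par :: "bool \<Rightarrow> 'v set"
    and vac :: 'v
    and prd :: "int \<Rightarrow> 'v \<Rightarrow> 'v \<Rightarrow> 'v" +
  fixes \<phi> :: "generator \<Rightarrow> 'v"
  assumes generator_part: "\<phi> u \<in> par (is_odd u)"
    and operator_product: "n \<ge> 0 \<Longrightarrow> prd n (\<phi> u) (\<phi> v) = scl (contraction u v n) vac"
    and generated: "vertex_subalgebra scl vac prd U \<Longrightarrow> range \<phi> \<subseteq> U \<Longrightarrow> U = UNIV"

definition conformal_vector ::
  "(complex \<Rightarrow> 'v::ab_group_add \<Rightarrow> 'v) \<Rightarrow> 'v \<Rightarrow> (int \<Rightarrow> 'v \<Rightarrow> 'v \<Rightarrow> 'v) \<Rightarrow> (generator \<Rightarrow> 'v) \<Rightarrow> 'v" where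
  "conformal_vector scl vac prd \<phi> =
     (let T = (\<lambda>a. prd (-2) a vac) in
      (\<Sum>i\<in>UNIV. prd (-1) (\<phi> (X i)) (\<phi> (Y i))) +
      scl (1/2) (\<Sum>i\<in>UNIV. prd (-1) (T (\<phi> (B i))) (\<phi> (C i)) - prd (-1) (\<phi> (B i)) (T (\<phi> (C i)))))"

definition heisenberg_vector ::
  "(int \<Rightarrow> 'v::ab_group_add \<Rightarrow> 'v \<Rightarrow> 'v) \<Rightarrow> (generator \<Rightarrow> 'v) \<Rightarrow> 'v" where
  "heisenberg_vector prd \<phi> = (\<Sum>i\<in>UNIV. prd (-1) (\<phi> (B i)) (\<phi> (C i)))"


section \<open>The action of \<open>SL(2, \<complex>)\<close>\<close>

definition SL2 :: "(complex^2^2) set" where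
  "SL2 = {g. det g = 1}"

text \<open>
  The span of \<open>b\<^sub>1, b\<^sub>2\<close> is \<open>\<complex>\<^sup>2\<close> with its standard basis, on which \<open>g\<close> acts by
  \<open>g e\<^sub>j = (\<Sum>i. g\<^sub>i\<^sub>j e\<^sub>i)\<close>, and \<open>c\<^sub>1, c\<^sub>2\<close> is the dual basis of the dual representation.
\<close>

locale SL2_free_field_algebra = free_field_algebra scl par vac prd \<phi>
  for scl :: "complex \<Rightarrow> 'v::ab_group_add \<Rightarrow> 'v"
    and par :: "bool \<Rightarrow> 'v set"
    and vac :: 'v
    and prd :: "int \<Rightarrow> 'v \<Rightarrow> 'v \<Rightarrow> 'v"
    and \<phi> :: "generator \<Rightarrow> 'v" +
  fixes \<rho> :: "complex^2^2 \<Rightarrow> 'v \<Rightarrow> 'v"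
  assumes action_automorphism: "g \<in> SL2 \<Longrightarrow> va_automorphism scl par vac prd (\<rho> g)"
    and action_one: "\<rho> (mat 1) v = v"
    and action_mult: "g \<in> SL2 \<Longrightarrow> h \<in> SL2 \<Longrightarrow> \<rho> (g ** h) v = \<rho> g (\<rho> h v)"
    and action_B: "g \<in> SL2 \<Longrightarrow> \<rho> g (\<phi> (B j)) = (\<Sum>i\<in>UNIV. scl (g $ i $ j) (\<phi> (B i)))"
    and action_X: "g \<in> SL2 \<Longrightarrow> \<rho> g (\<phi> (X j)) = (\<Sum>i\<in>UNIV. scl (g $ i $ j) (\<phi> (X i)))"
    and action_C: "g \<in> SL2 \<Longrightarrow> \<rho> g (\<phi> (C j)) = (\<Sum>i\<in>UNIV. scl (matrix_inv g $ j $ i) (\<phi> (C i)))"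
    and action_Y: "g \<in> SL2 \<Longrightarrow> \<rho> g (\<phi> (Y j)) = (\<Sum>i\<in>UNIV. scl (matrix_inv g $ j $ i) (\<phi> (Y i)))"

definition fixed_points :: "(complex^2^2 \<Rightarrow> 'v \<Rightarrow> 'v) \<Rightarrow> 'v set" where
  "fixed_points \<rho> = {v. \<forall>g\<in>SL2. \<rho> g v = v}"

text \<open>
  The irreducible representation \<open>\<lambda>\<^sub>N\<close> of dimension \<open>N + 1\<close>: binary forms of degree \<open>N\<close>,
  as polynomial functions on \<open>\<complex>\<^sup>2\<close>.
\<close>

definition binary_forms :: "nat \<Rightarrow> (complex^2 \<Rightarrow> complex) set" where
  "binary_forms N =
     module.span (\<lambda>c f z. c * f z) {\<lambda>z. (z $ 1) ^ k * (z $ 2) ^ (N - k) | k. k \<le> N}"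

definition form_action :: "complex^2^2 \<Rightarrow> (complex^2 \<Rightarrow> complex) \<Rightarrow> complex^2 \<Rightarrow> complex" where
  "form_action g f = (\<lambda>z. f (matrix_inv g *v z))"

text \<open>
  The multiplicity space of \<open>\<lambda>\<^sub>N\<close> in \<open>V\<close> is \<open>Hom\<^sub>G(\<lambda>\<^sub>N, V)\<close>; evaluation of homomorphisms gives
  the decomposition \<open>V = (\<Oplus>N. \<lambda>\<^sub>N \<otimes> V\<^bsub>\<lambda>\<^sub>N\<^esub>)\<close>. Homomorphisms are extended by \<open>0\<close> outside
  \<open>\<lambda>\<^sub>N\<close>, and \<open>V\<^sup>G\<close> acts by postcomposition with its modes.
\<close>

definition multiplicity_space ::
  "(complex \<Rightarrow> 'v::ab_group_add \<Rightarrow> 'v) \<Rightarrow> (complex^2^2 \<Rightarrow> 'v \<Rightarrow> 'v) \<Rightarrow> nat \<Rightarrow>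
   ((complex^2 \<Rightarrow> complex) \<Rightarrow> 'v) set" where
  "multiplicity_space scl \<rho> N = {F.
     (\<forall>f\<in>binary_forms N. \<forall>g\<in>binary_forms N. F (\<lambda>z. f z + g z) = F f + F g) \<and>
     (\<forall>f\<in>binary_forms N. \<forall>c. F (\<lambda>z. c * f z) = scl c (F f)) \<and>
     (\<forall>f\<in>binary_forms N. \<forall>g\<in>SL2. F (form_action g f) = \<rho> g (F f)) \<and>
     (\<forall>f. f \<notin> binary_forms N \<longrightarrow> F f = 0)}"

definition hom_scale ::
  "(complex \<Rightarrow> 'v \<Rightarrow> 'v) \<Rightarrow> complex \<Rightarrow> ((complex^2 \<Rightarrow> complex) \<Rightarrow> 'v) \<Rightarrow> (complex^2 \<Rightarrow> complex) \<Rightarrow> 'v" where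
  "hom_scale scl c F = (\<lambda>f. scl c (F f))"

definition hom_mode ::
  "(int \<Rightarrow> 'v \<Rightarrow> 'v \<Rightarrow> 'v) \<Rightarrow> int \<Rightarrow> 'v \<Rightarrow> ((complex^2 \<Rightarrow> complex) \<Rightarrow> 'v) \<Rightarrow> (complex^2 \<Rightarrow> complex) \<Rightarrow> 'v" where
  "hom_mode prd n a F = (\<lambda>f. prd n a (F f))"

context SL2_free_field_algebra
begin

lemma linear_facts:
  assumes "Vector_Spaces.linear scl scl f"
  shows "f (a + b) = f a + f b" "f (scl k a) = scl k (f a)" "f 0 = 0"
proof -
  interpret L: Vector_Spaces.linear scl scl f by fact
  show "f (a + b) = f a + f b" "f (scl k a) = scl k (f a)" "f 0 = 0"
    by (rule L.add L.scale L.zero)+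
qed

lemma vertex_subalgebra_fixed_points:
  "vertex_subalgebra scl vac prd (fixed_points \<rho>)"
proof -
  have lin: "Vector_Spaces.linear scl scl (\<rho> g)" and one: "\<rho> g vac = vac"
    and mult: "\<And>n a b. \<rho> g (prd n a b) = prd n (\<rho> g a) (\<rho> g b)" if "g \<in> SL2" for g
    using action_automorphism[OF that] by (auto simp: va_automorphism_def)
  have "module.subspace scl (fixed_points \<rho>)"
    unfolding subspace_def fixed_points_def
    by (auto simp: linear_facts[OF lin])
  then show ?thesis
    unfolding vertex_subalgebra_def by (auto simp: fixed_points_def one mult)
qed

lemma prd_add: "prd n (a + a') b = prd n a b + prd n a' b" "prd n a (b + b') = prd n a b + prd n a b'"
  by (rule linear_facts[OF linear_left] linear_facts[OF linear_right])+

lemma prd_scale: "prd n (scl k a) b = scl k (prd n a b)" "prd n a (scl k b) = scl k (prd n a b)"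
  by (rule linear_facts[OF linear_left] linear_facts[OF linear_right])+

lemma pairing_invariant:
  fixes u v :: "2 \<Rightarrow> 'v"
  assumes g: "g \<in> SL2"
  shows "(\<Sum>j\<in>UNIV. prd n (\<Sum>i\<in>UNIV. scl (g $ i $ j) (u i)) (\<Sum>i\<in>UNIV. scl (matrix_inv g $ j $ i) (v i)))
       = (\<Sum>j\<in>UNIV. prd n (u j) (v j))"
proof -
  have "invertible g"
    using g by (simp add: SL2_def invertible_det_nz)
  then have eq: "g ** matrix_inv g = mat 1"
    unfolding matrix_inv_def invertible_def by (rule someI2_ex) simp
  have e: "g $ i $ 1 * matrix_inv g $ 1 $ k + g $ i $ 2 * matrix_inv g $ 2 $ k = (if i = k then 1 else 0)" for i k
    using arg_cong[OF eq, of "\<lambda>A. A $ i $ k"]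
    by (simp add: matrix_matrix_mult_def mat_def UNIV_2)
  have "(\<Sum>j\<in>UNIV. prd n (\<Sum>i\<in>UNIV. scl (g $ i $ j) (u i)) (\<Sum>i\<in>UNIV. scl (matrix_inv g $ j $ i) (v i)))
      = (\<Sum>i\<in>UNIV. \<Sum>k\<in>UNIV. scl (g $ i $ 1 * matrix_inv g $ 1 $ k + g $ i $ 2 * matrix_inv g $ 2 $ k) (prd n (u i) (v k)))"
    by (simp add: UNIV_2 prd_add prd_scale scale_left_distrib scale_right_distrib ac_simps)
  also have "\<dots> = (\<Sum>j\<in>UNIV. prd n (u j) (v j))"
    unfolding e by (simp add: UNIV_2)
  finally show ?thesis .
qed

lemma heisenberg_vector_fixed: "heisenberg_vector prd \<phi> \<in> fixed_points \<rho>"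
proof -
  have "\<rho> g (heisenberg_vector prd \<phi>) = heisenberg_vector prd \<phi>" if g: "g \<in> SL2" for g
  proof -
    interpret L: Vector_Spaces.linear scl scl "\<rho> g"
      using action_automorphism[OF g] by (simp add: va_automorphism_def)
    have mult: "\<And>n a b. \<rho> g (prd n a b) = prd n (\<rho> g a) (\<rho> g b)"
      using action_automorphism[OF g] by (simp add: va_automorphism_def)
    show ?thesis
      unfolding heisenberg_vector_def L.sum mult action_B[OF g] action_C[OF g]
      by (rule pairing_invariant[OF g])
  qed
  then show ?thesis by (simp add: fixed_points_def)
qed

lemma conformal_vector_fixed: "conformal_vector scl vac prd \<phi> \<in> fixed_points \<rho>"
proof -
  have "\<rho> g (conformal_vector scl vac prd \<phi>) = conformal_vector scl vac prd \<phi>" if g: "g \<in> SL2" for g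
  proof -
    interpret L: Vector_Spaces.linear scl scl "\<rho> g"
      using action_automorphism[OF g] by (simp add: va_automorphism_def)
    have mult: "\<And>n a b. \<rho> g (prd n a b) = prd n (\<rho> g a) (\<rho> g b)" and one: "\<rho> g vac = vac"
      using action_automorphism[OF g] by (simp_all add: va_automorphism_def)
    have T: "prd (-2) (\<Sum>i\<in>(UNIV :: 2 set). scl (k i) (w i)) vac =
        (\<Sum>i\<in>UNIV. scl (k i) (prd (-2) (w i) vac))" for k w
      by (simp add: UNIV_2 prd_add prd_scale)
    show ?thesis
      unfolding conformal_vector_def Let_def L.add L.scale L.sum sum_subtractf L.diff mult one
        action_B[OF g] action_C[OF g] action_X[OF g] action_Y[OF g] T
      by (simp only: pairing_invariant[OF g])
  qed
  then show ?thesis by (simp add: fixed_points_def)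
qed

lemma hom_mode_closed:
  assumes "a \<in> fixed_points \<rho>" "F \<in> multiplicity_space scl \<rho> N"
  shows "hom_mode prd n a F \<in> multiplicity_space scl \<rho> N"
proof -
  have mult: "\<rho> g (prd n a b) = prd n a (\<rho> g b)" if "g \<in> SL2" for g b
    using action_automorphism[OF that] assms(1) that
    by (auto simp: va_automorphism_def fixed_points_def)
  show ?thesis
    using assms(2)
    by (auto simp: multiplicity_space_def hom_mode_def mult linear_facts[OF linear_right])
qed

end


section \<open>Characters\<close>

text \<open>All functions of \<open>q = e\<^bsup>2\<pi>i\<tau>\<^esup>\<close> are functions of \<open>\<tau>\<close>, which fixes all
  fractional powers of \<open>q\<close>.\<close>

definition qpow :: "complex \<Rightarrow> real \<Rightarrow> complex" where
  "qpow \<tau> a = exp (2 * of_real pi * \<i> * \<tau> * of_real a)"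

text \<open>
  \<open>has_character scl W L\<^sub>0 J\<^sub>0 y \<tau> t\<close>: the operator \<open>q\<^bsup>L\<^sub>0 - 1/4\<^esup> y\<^bsup>J\<^sub>0\<^esup>\<close> on the subspace \<open>W\<close>
  is diagonal in a basis \<open>S\<close> and its trace converges absolutely to \<open>t\<close>. The trace does not
  depend on the basis of joint eigenvectors.
\<close>

definition has_character ::
  "(complex \<Rightarrow> 'w::ab_group_add \<Rightarrow> 'w) \<Rightarrow> 'w set \<Rightarrow> ('w \<Rightarrow> 'w) \<Rightarrow> ('w \<Rightarrow> 'w) \<Rightarrow>
   complex \<Rightarrow> complex \<Rightarrow> complex \<Rightarrow> bool" where
  "has_character scl W L0 J0 y \<tau> t \<longleftrightarrow>
     (\<exists>S (wt :: 'w \<Rightarrow> real) (ch :: 'w \<Rightarrow> int).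
        \<not> module.dependent scl S \<and> module.span scl S = W \<and>
        (\<forall>w\<in>S. L0 w = scl (of_real (wt w)) w \<and> J0 w = scl (of_int (ch w)) w) \<and>
        ((\<lambda>w. qpow \<tau> (wt w - 1/4) * y powi ch w) has_sum t) S)"

definition half_odd :: "real set" where
  "half_odd = {of_int k + 1/2 | k. True}"

definition theta3 :: "complex \<Rightarrow> complex \<Rightarrow> complex" where
  "theta3 y \<tau> = (\<Sum>\<^sub>\<infinity>n\<in>(UNIV :: int set). y powi n * qpow \<tau> ((of_int n)\<^sup>2 / 2))"

definition eta :: "complex \<Rightarrow> complex" where
  "eta \<tau> = qpow \<tau> (1/24) * prodinf (\<lambda>n. 1 - qpow \<tau> (of_nat (Suc n)))"

definition typical_char :: "real \<Rightarrow> complex \<Rightarrow> complex \<Rightarrow> complex" where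
  "typical_char h y \<tau> = qpow \<tau> (h - 3/8) * (theta3 y \<tau>)\<^sup>2 / eta \<tau> ^ 3"

text \<open>
  The massless characters are invariant under \<open>y \<mapsto> 1/y\<close>, which requires the exponent
  \<open>\<alpha>(\<alpha>+1)/2\<close> of \<open>q\<close>. With \<open>\<alpha>(\<alpha>-1)/2\<close> instead, the sum would start with \<open>y q\<^bsup>-1/8\<^esup>\<close> and
  \<open>atypical_char_1\<close>, the character of the vacuum module, with \<open>q\<^bsup>-1/4\<^esup> (1 - 2 y)\<close>.
\<close>

definition atypical_char_0 :: "complex \<Rightarrow> complex \<Rightarrow> complex" where
  "atypical_char_0 y \<tau> = theta3 y \<tau> / eta \<tau> ^ 3 *
     (\<Sum>\<^sub>\<infinity>\<alpha>\<in>half_odd. y powi \<lfloor>\<alpha> + 1/2\<rfloor> * qpow \<tau> (\<alpha> * (\<alpha> + 1) / 2) / (1 + y * qpow \<tau> \<alpha>))"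

definition atypical_char_1 :: "complex \<Rightarrow> complex \<Rightarrow> complex" where
  "atypical_char_1 y \<tau> = typical_char (1/4) y \<tau> - 2 * atypical_char_0 y \<tau>"

definition h_fun :: "int \<Rightarrow> complex \<Rightarrow> complex" where
  "h_fun k \<tau> = (let N = real_of_int (k - 1) in
     1 / eta \<tau> ^ 3 *
     (\<Sum>\<^sub>\<infinity>(m, r, s) \<in> half_odd \<times> {r\<in>half_odd. r > 0} \<times> {s\<in>half_odd. s > 0}.
        (-1) powi \<lfloor>r + s + 1\<rfloor> *
        qpow \<tau> (r * \<bar>m\<bar> + s * \<bar>N - m\<bar> + (sgn m * r + sgn (m - N) * s)\<^sup>2 / 2 - N / 2)))"

definition atypical_part :: "nat \<Rightarrow> complex \<Rightarrow> complex \<Rightarrow> complex" where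
  "atypical_part N y \<tau> = theta3 y \<tau> / eta \<tau> ^ 3 *
     (\<Sum>\<^sub>\<infinity>\<alpha>\<in>half_odd. y powi \<lfloor>\<alpha> + 1/2\<rfloor> * qpow \<tau> (\<alpha> * (\<alpha> + 1) / 2) / (1 + y * qpow \<tau> \<alpha>)) *
     (if N = 0 then -2 else if N = 1 then 1 else 0)"

definition typical_part :: "nat \<Rightarrow> complex \<Rightarrow> complex \<Rightarrow> complex" where
  "typical_part N y \<tau> = (theta3 y \<tau>)\<^sup>2 / eta \<tau> ^ 3 *
     (h_fun (int N) \<tau> - 2 * h_fun (int N + 1) \<tau> + 2 * h_fun (int N + 3) \<tau> - h_fun (int N + 4) \<tau>)"

text \<open>The points \<open>(y, \<tau>)\<close> that are not poles of a summand of the massless characters.\<close>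

definition char_domain :: "(complex \<times> complex) set" where
  "char_domain = {(y, \<tau>). Im \<tau> > 0 \<and> y \<noteq> 0 \<and> (\<forall>\<alpha>\<in>half_odd. 1 + y * qpow \<tau> \<alpha> \<noteq> 0)}"

end

theory Submission
  imports Defs "HOL-Library.Multiset"
begin

text \<open>
  The ordered monomials in the creation modes, indexed by occupation numbers, are a basis of the free
  field algebra that diagonalises \<open>L\<^sub>0\<close>, \<open>J\<^sub>0\<close> and the diagonal torus of the group. The unipotent
  one-parameter subgroups act polynomially, and their first-order coefficients \<open>E\<close>, \<open>F\<close> are
  derivations that generate an action of \<open>sl\<^sub>2\<close>. A homomorphism from \<open>\<lambda>\<^sub>N\<close> is determined by the image
  of a highest weight vector, so \<open>V\<^bsub>\<lambda>\<^sub>N\<^esub>\<close> is the kernel of \<open>E\<close> in torus weight \<open>N\<close>. As \<open>E\<close> maps weight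
  \<open>N\<close> onto weight \<open>N + 2\<close>, the character is \<open>A\<^sub>N - A\<^bsub>N+2\<^esub>\<close> up to a power of \<open>q\<close>, where \<open>A\<^sub>N\<close> is the
  coefficient of \<open>u\<^sup>N\<close> in
  \<open>\<theta>(yu) \<theta>(y/u) (1 - u)\<^sup>2 e(u)\<^sup>2 / \<phi>\<^sup>6\<close>, with \<open>\<phi> = (\<Prod>n\<ge>1. 1 - q\<^sup>n)\<close> and \<open>\<phi>\<^sup>3 / e(u)\<close> the theta function
  that vanishes at \<open>u = 1\<close>. By Kronecker's identity \<open>\<theta>(yu) e(u)\<close> is the sum of
  \<open>\<theta>(y) u\<^sup>n / (1 + y q\<^bsup>n+1/2\<^esup>)\<close> over all \<open>n\<close>, so \<open>A\<^sub>N\<close> is a sum of products of two partial fractions in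
  \<open>y\<close>. For distinct poles these telescope to the typical part; the double poles, which occur for
  \<open>N = 0\<close> and \<open>N = 1\<close> only, give the massless characters.
\<close>

text \<open>Identities between theta-like functions are reduced to equality of coefficients of
  absolutely convergent Laurent series on one circle, so no residues occur. The obstacle is the
  double pole sum \<open>W y (- 1)\<close>. For |y| = 1 it expands in y with Lambert coefficients;
  after multiplication by \<open>th y\<close> its coefficients, up to q^(k^2/2), obey a recursion in
  k whose increment contains the derivative of theta at a zero, hence \<open>phi ^ 3\<close>, and
  the finite sums so produced are the coefficients of the Appell sum \<open>Sp\<close>. Off the
  circle this expansion fails, but after one more factor \<open>th y\<close> both sides are Laurent
  series in all of y \<noteq> 0, so the identity extends. In the triple sum of \<open>h_fun\<close>
  for N > 0 the ranges m < 0 and m > N cancel the off-diagonal part of 0 < m < N, and N/(1 - q^N)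
  remains, the value that the telescoping gives. On the algebraic side V has no topology and the
  action is not assumed algebraic: that unipotent curves act polynomially is deduced from the
  generators, and coefficients of powers of t replace derivatives. Independence of the monomials
  comes from number operators, so no model of V has to be constructed.\<close>

lemma summable_on_product_complex:
  fixes f :: "'a \<Rightarrow> complex" and g :: "'b \<Rightarrow> complex"
  assumes "f summable_on A" "g summable_on BB"
  shows "(\<lambda>(x, y). f x * g y) summable_on (A \<times> BB)"
proof -
  have "(\<lambda>p. norm ((\<lambda>(x, y). f x * g y) p)) summable_on A \<times> BB"
  proof (rule summable_on_SigmaI)
    fix x
    show "((\<lambda>y. norm ((\<lambda>(x, y). f x * g y) (x, y))) has_sum norm (f x) * (\<Sum>\<^sub>\<infinity>y\<in>BB. norm (g y))) BB"
      using assms(2) by (auto simp: norm_mult summable_on_iff_abs_summable_on_complex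
          intro!: has_sum_cmult_right has_sum_infsum)
  next
    show "(\<lambda>x. norm (f x) * (\<Sum>\<^sub>\<infinity>y\<in>BB. norm (g y))) summable_on A"
      using assms(1) by (intro summable_on_cmult_left)
        (simp add: summable_on_iff_abs_summable_on_complex)
  qed auto
  then show ?thesis by (rule abs_summable_summable)
qed

lemma has_sum_product_complex:
  fixes f :: "'a \<Rightarrow> complex" and g :: "'b \<Rightarrow> complex"
  assumes "(f has_sum a) A" "(g has_sum b) BB"
  shows "((\<lambda>(x, y). f x * g y) has_sum (a * b)) (A \<times> BB)"
proof (rule has_sum_SigmaI)
  show "((\<lambda>y. (\<lambda>(x, y). f x * g y) (x, y)) has_sum f x * b) BB" for x
    using has_sum_cmult_right[OF assms(2)] by simp
  show "((\<lambda>x. f x * b) has_sum a * b) A"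
    by (rule has_sum_cmult_left[OF assms(1)])
  show "(\<lambda>(x, y). f x * g y) summable_on A \<times> BB"
    using assms by (intro summable_on_product_complex) (auto simp: summable_on_def)
qed

section \<open>Laurent series\<close>

lemma has_sum_int_shift:
  assumes "(f has_sum s) UNIV"
  shows "((\<lambda>k::int. f (k - j)) has_sum s) UNIV"
proof -
  have "((\<lambda>k::int. f (k - j)) has_sum s) UNIV \<longleftrightarrow> (f has_sum s) UNIV"
    by (rule has_sum_reindex_bij_witness[where i = "\<lambda>k. k + j" and j = "\<lambda>k. k - j"]) auto
  with assms show ?thesis by blast
qed

lemma has_sum_int_uminus:
  assumes "(f has_sum s) UNIV"
  shows "((\<lambda>k::int. f (- k)) has_sum s) UNIV"
proof -
  have "((\<lambda>k::int. f (- k)) has_sum s) UNIV \<longleftrightarrow> (f has_sum s) UNIV"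
    by (rule has_sum_reindex_bij_witness[where i = uminus and j = uminus]) auto
  with assms show ?thesis by blast
qed

text \<open>Convergence is unordered, hence absolute, and \<open>A\<close> is an arbitrary set of
  points: an annulus, one circle and the punctured plane all occur. Excluding 0 keeps negative
  exponents meaningful.\<close>

definition has_laurent :: "(int \<Rightarrow> complex) \<Rightarrow> (complex \<Rightarrow> complex) \<Rightarrow> complex set \<Rightarrow> bool" where
  "has_laurent c f A \<longleftrightarrow> 0 \<notin> A \<and> (\<forall>z\<in>A. ((\<lambda>k. c k * z powi k) has_sum f z) UNIV)"

lemma has_laurentD: "has_laurent c f A \<Longrightarrow> z \<in> A \<Longrightarrow> ((\<lambda>k. c k * z powi k) has_sum f z) UNIV"
  by (simp add: has_laurent_def)

lemma has_laurent_nonzero: "has_laurent c f A \<Longrightarrow> 0 \<notin> A"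
  by (simp add: has_laurent_def)

lemma has_laurent_subset: "has_laurent c f A \<Longrightarrow> BB \<subseteq> A \<Longrightarrow> has_laurent c f BB"
  by (auto simp: has_laurent_def)

lemma has_laurent_value_unique:
  "has_laurent c f A \<Longrightarrow> has_laurent c g A \<Longrightarrow> z \<in> A \<Longrightarrow> f z = g z"
  using has_laurentD has_sum_unique by blast

lemma has_laurent_cong:
  assumes "has_laurent c f A" "\<And>k. c k = d k" "\<And>z. z \<in> A \<Longrightarrow> f z = g z"
  shows "has_laurent d g A"
proof -
  have "c = d" using assms(2) by auto
  then show ?thesis using assms by (auto simp: has_laurent_def)
qed

lemma has_laurent_add:
  "has_laurent c f A \<Longrightarrow> has_laurent d g A \<Longrightarrow> has_laurent (\<lambda>k. c k + d k) (\<lambda>z. f z + g z) A"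
  by (auto simp: has_laurent_def distrib_right intro!: has_sum_add)

lemma has_laurent_cmult: "has_laurent c f A \<Longrightarrow> has_laurent (\<lambda>k. a * c k) (\<lambda>z. a * f z) A"
  by (auto simp: has_laurent_def mult.assoc intro!: has_sum_cmult_right)

lemma has_laurent_diff:
  "has_laurent c f A \<Longrightarrow> has_laurent d g A \<Longrightarrow> has_laurent (\<lambda>k. c k - d k) (\<lambda>z. f z - g z) A"
  using has_laurent_add[OF _ has_laurent_cmult[of d g A "-1"]] by simp

lemma has_laurent_shift:
  assumes "has_laurent c f A"
  shows "has_laurent (\<lambda>k. c (k - j)) (\<lambda>z. z powi j * f z) A"
  unfolding has_laurent_def
proof (intro conjI ballI)
  show "0 \<notin> A" using assms by (rule has_laurent_nonzero)
  fix z assume z: "z \<in> A"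
  with \<open>0 \<notin> A\<close> have nz: "z \<noteq> 0" by auto
  have "((\<lambda>k. z powi j * (c k * z powi k)) has_sum z powi j * f z) UNIV"
    by (intro has_sum_cmult_right has_laurentD[OF assms z])
  then have "((\<lambda>k. z powi j * (c (k - j) * z powi (k - j))) has_sum z powi j * f z) UNIV"
    by (rule has_sum_int_shift)
  moreover have "z powi j * (c (k - j) * z powi (k - j)) = c (k - j) * z powi k" for k
    using nz by (simp add: power_int_diff)
  ultimately show "((\<lambda>k. c (k - j) * z powi k) has_sum z powi j * f z) UNIV"
    by simp
qed

lemma has_laurent_scale:
  assumes "has_laurent c f A" "a \<noteq> 0" "(\<lambda>z. a * z) ` BB \<subseteq> A"
  shows "has_laurent (\<lambda>k. c k * a powi k) (\<lambda>z. f (a * z)) BB"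
proof -
  have "0 \<notin> BB" using assms(1,3) by (force simp: has_laurent_def)
  moreover have "((\<lambda>k. c k * a powi k * z powi k) has_sum f (a * z)) UNIV" if "z \<in> BB" for z
    using has_laurentD[OF assms(1), of "a * z"] that assms(3)
    by (auto simp: power_int_mult_distrib mult.assoc)
  ultimately show ?thesis by (simp add: has_laurent_def)
qed

lemma has_laurent_inverse:
  assumes "has_laurent c f A" "inverse ` BB \<subseteq> A"
  shows "has_laurent (\<lambda>k. c (- k)) (\<lambda>z. f (inverse z)) BB"
proof -
  have "0 \<notin> BB" using assms by (force simp: has_laurent_def)
  moreover have "((\<lambda>k. c (- k) * z powi k) has_sum f (inverse z)) UNIV" if "z \<in> BB" for z
  proof -
    have "((\<lambda>k. c k * (inverse z) powi k) has_sum f (inverse z)) UNIV"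
      using has_laurentD[OF assms(1), of "inverse z"] that assms(2) by auto
    then have "((\<lambda>k. c (- k) * (inverse z) powi (- k)) has_sum f (inverse z)) UNIV"
      by (rule has_sum_int_uminus)
    moreover have "inverse z powi (- k) = z powi k" for k
      by (metis power_int_inverse power_int_minus inverse_inverse_eq)
    ultimately show ?thesis by (simp only:)
  qed
  ultimately show ?thesis by (simp add: has_laurent_def)
qed

text \<open>Regroups an absolutely convergent family by exponent. Fibres may be infinite; on a fibre
  the power of z is a nonzero constant, so dividing by it shows that the coefficients alone are
  summable. Products of series and weight decompositions of traces are instances.\<close>

lemma has_laurent_family:
  assumes f: "\<And>z. z \<in> A \<Longrightarrow> ((\<lambda>i. a i * z powi e i) has_sum f z) I"
    and A: "0 \<notin> A"
  shows "has_laurent (\<lambda>k. infsum a {i\<in>I. e i = k}) f A"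
  unfolding has_laurent_def
proof (intro conjI ballI A)
  fix z assume z: "z \<in> A"
  with A have nz: "z \<noteq> 0" by auto
  let ?BB = "\<lambda>k. {i\<in>I. e i = k}"
  have bij: "bij_betw snd (Sigma UNIV ?BB) I"
    by (rule bij_betwI[where g = "\<lambda>i. (e i, i)"]) auto
  have s: "((\<lambda>p. a (snd p) * z powi e (snd p)) has_sum f z) (Sigma UNIV ?BB)"
    using has_sum_reindex_bij_betw[OF bij, of "\<lambda>i. a i * z powi e i"] f[OF z] by simp
  show "((\<lambda>k. infsum a (?BB k) * z powi k) has_sum f z) UNIV"
  proof (rule has_sum_Sigma'[OF s])
    fix k
    have "(\<lambda>i. a i * z powi e i) summable_on ?BB k"
      using has_sum_imp_summable[OF f[OF z]] by (rule summable_on_subset_banach) auto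
    then have "(\<lambda>i. a i * z powi k) summable_on ?BB k"
      by (rule summable_on_cong[THEN iffD1, rotated]) auto
    then have "(\<lambda>i. a i * z powi k * z powi (- k)) summable_on ?BB k"
      by (rule summable_on_cmult_left)
    then have "a summable_on ?BB k"
    proof -
      have "a i * z powi k * z powi (- k) = a i" for i
        using nz by (simp add: power_int_minus)
      then show ?thesis using \<open>(\<lambda>i. a i * z powi k * z powi (- k)) summable_on ?BB k\<close>
        by (simp only:)
    qed
    then have "((\<lambda>i. a i * z powi k) has_sum infsum a (?BB k) * z powi k) (?BB k)"
      by (rule has_sum_cmult_left[OF has_sum_infsum])
    then show "((\<lambda>i. a (snd (k, i)) * z powi e (snd (k, i))) has_sum infsum a (?BB k) * z powi k) (?BB k)"
      by (rule has_sum_cong[THEN iffD1, rotated]) auto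
  qed
qed

lemma has_laurent_mult:
  assumes "has_laurent c f A" "has_laurent d g A"
  shows "has_laurent (\<lambda>k. \<Sum>\<^sub>\<infinity>i. c i * d (k - i)) (\<lambda>z. f z * g z) A"
proof -
  have z: "0 \<notin> A" using assms by (simp add: has_laurent_def)
  have "has_laurent (\<lambda>k. infsum (\<lambda>(i, j). c i * d j) {p \<in> UNIV \<times> UNIV. (\<lambda>(i, j). i + j) p = k}) (\<lambda>z. f z * g z) A"
  proof (rule has_laurent_family[OF _ z])
    fix x assume x: "x \<in> A"
    with z have nz: "x \<noteq> 0" by auto
    show "((\<lambda>p. (case p of (i, j) \<Rightarrow> c i * d j) * x powi (case p of (i, j) \<Rightarrow> i + j)) has_sum f x * g x)
          (UNIV \<times> UNIV)"
      using has_sum_product_complex[OF has_laurentD[OF assms(1) x] has_laurentD[OF assms(2) x]]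
      by (rule has_sum_cong[THEN iffD1, rotated]) (auto simp: power_int_add nz)
  qed
  moreover have "infsum (\<lambda>(i, j). c i * d j) {p \<in> UNIV \<times> UNIV. (\<lambda>(i, j). i + j) p = k}
      = (\<Sum>\<^sub>\<infinity>i. c i * d (k - i))" for k
    by (rule infsum_reindex_bij_witness[where i = "\<lambda>i. (i, k - i)" and j = fst]) auto
  ultimately show ?thesis by (simp only:)
qed

text \<open>The summands are the powers of one M-th root of unity, which differs from 1 because M
  does not divide k. This is the discrete substitute for integrating over a circle.\<close>

lemma sum_roots_of_unity:
  assumes "M > 0" "\<not> int M dvd k"
  shows "(\<Sum>j<M. (cis (2 * pi / M) ^ j) powi k) = 0"
proof -
  let ?w = "cis (2 * pi * of_int k / M)"
  have w: "(cis (2 * pi / M) ^ j) powi k = ?w ^ j" for j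
    unfolding power_int_power cis_power_int Complex.DeMoivre by (simp add: mult_ac)
  have "?w ^ M = 1"
    unfolding Complex.DeMoivre using assms(1) cis_multiple_2pi[of "of_int k"] by simp
  moreover have "?w \<noteq> 1"
  proof
    assume "?w = 1"
    then obtain x :: int where "2 * pi * of_int k / M = of_int x * (2 * pi)"
      by (auto simp: cis_conv_exp exp_eq_1)
    then have "real_of_int k = of_int (x * int M)"
      using assms(1) by (simp add: field_simps)
    then have "k = x * int M" by (simp only: of_int_eq_iff)
    then show False using assms(2) by simp
  qed
  ultimately show ?thesis
    by (simp add: w sum_gp_strict)
qed

text \<open>Up to half the size of the k-th term, a finite set \<open>G\<close> of exponents carries
  the whole absolute sum. Averaging the finite part against the M-th roots of unity isolates the
  k-th coefficient exactly, and the zero total bounds the average by half of it.\<close>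

lemma has_laurent_zero_coeff:
  assumes c: "has_laurent c (\<lambda>_. 0) A" and r: "r > 0" "\<And>z. norm z = r \<Longrightarrow> z \<in> A"
  shows "c k = 0"
proof (rule ccontr)
  assume nz: "c k \<noteq> 0"
  \<comment> \<open>The radius is absorbed into the coefficients, so only the unit circle
    remains.\<close>
  define b where "b i = c i * of_real r powi i" for i
  have b0: "b k \<noteq> 0" using nz r by (simp add: b_def)
  have sum0: "((\<lambda>i. b i * w powi i) has_sum 0) UNIV" if "norm w = 1" for w
  proof -
    have "((\<lambda>i. c i * (of_real r * w) powi i) has_sum 0) UNIV"
      using r that by (intro has_laurentD[OF c]) (auto simp: norm_mult)
    then show ?thesis by (simp add: b_def power_int_mult_distrib mult.assoc)
  qed
  have "(\<lambda>i. norm (b i)) summable_on UNIV"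
    using sum0[of 1] by (simp add: summable_on_iff_abs_summable_on_complex[symmetric] has_sum_imp_summable)
  then have ns: "((\<lambda>i. norm (b i)) has_sum (\<Sum>\<^sub>\<infinity>i. norm (b i))) UNIV" by simp
  obtain F where F: "finite F" "dist (\<Sum>i\<in>F. norm (b i)) (\<Sum>\<^sub>\<infinity>i. norm (b i)) \<le> norm (b k) / 2"
    using has_sum_finite_approximation[OF ns, of "norm (b k) / 2"] b0 by auto
  define G where "G = insert k F"
  have finG: "finite G" and kG: "k \<in> G" using F by (auto simp: G_def)
  have tail: "norm (\<Sum>i\<in>G. b i * w powi i) \<le> norm (b k) / 2" if w: "norm w = 1" for w
  proof -
    have "((\<lambda>i. b i * w powi i) has_sum (\<Sum>i\<in>G. b i * w powi i)) G"
      using finG by simp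
    from has_sum_Diff[OF sum0[OF w] this]
    have t1: "((\<lambda>i. b i * w powi i) has_sum (0 - (\<Sum>i\<in>G. b i * w powi i))) (UNIV - G)" by simp
    have t2: "((\<lambda>i. norm (b i)) has_sum ((\<Sum>\<^sub>\<infinity>i. norm (b i)) - (\<Sum>i\<in>G. norm (b i)))) (UNIV - G)"
      using has_sum_Diff[OF ns, of G "\<Sum>i\<in>G. norm (b i)"] finG by simp
    have "norm (0 - (\<Sum>i\<in>G. b i * w powi i)) \<le> (\<Sum>\<^sub>\<infinity>i. norm (b i)) - (\<Sum>i\<in>G. norm (b i))"
    proof -
      have "norm (infsum (\<lambda>i. b i * w powi i) (UNIV - G)) \<le> (\<Sum>\<^sub>\<infinity>i\<in>UNIV - G. norm (b i))"
      proof (rule norm_infsum_le[OF _ _ ])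
        show "((\<lambda>i. b i * w powi i) has_sum (infsum (\<lambda>i. b i * w powi i) (UNIV - G))) (UNIV - G)"
          using t1 by (simp add: infsumI)
        show "((\<lambda>i. norm (b i)) has_sum (\<Sum>\<^sub>\<infinity>i\<in>UNIV - G. norm (b i))) (UNIV - G)"
          using t2 by (simp add: infsumI)
      qed (use w in \<open>auto simp: norm_mult norm_power_int\<close>)
      then show ?thesis using infsumI[OF t1] infsumI[OF t2] by simp
    qed
    also have "(\<Sum>i\<in>F. norm (b i)) \<le> (\<Sum>i\<in>G. norm (b i))"
      using F by (intro sum_mono2) (auto simp: G_def)
    then have "(\<Sum>\<^sub>\<infinity>i. norm (b i)) - (\<Sum>i\<in>G. norm (b i)) \<le> norm (b k) / 2"
      using F(2) unfolding dist_real_def by linarith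
    finally show ?thesis by simp
  qed
  \<comment> \<open>With \<open>M\<close> above all distances |i - k| in \<open>G\<close>, only i =
    k is congruent to k modulo \<open>M\<close>, and the average sees no other exponent.\<close>
  obtain M :: nat where M: "M > 0" "\<And>i. i \<in> G \<Longrightarrow> \<bar>i - k\<bar> < int M"
  proof (rule that)
    fix i assume "i \<in> G"
    then have "nat \<bar>i - k\<bar> \<le> (\<Sum>i\<in>G. nat \<bar>i - k\<bar>)"
      using finG by (intro member_le_sum) auto
    then show "\<bar>i - k\<bar> < int (Suc (\<Sum>i\<in>G. nat \<bar>i - k\<bar>))" by linarith
  qed simp
  let ?w = "\<lambda>j. cis (2 * pi / M) ^ j"
  have nw: "norm (?w j) = 1" for j by (simp add: norm_power)
  have "(\<Sum>j<M. ?w j powi (- k) * (\<Sum>i\<in>G. b i * ?w j powi i))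
      = (\<Sum>i\<in>G. b i * (\<Sum>j<M. ?w j powi (i - k)))"
  proof -
    have "?w j powi (- k) * (b i * ?w j powi i) = b i * ?w j powi (i - k)" for i j
      using power_int_add[of "?w j" "- k" i] by simp
    then show ?thesis
      unfolding sum_distrib_left by (subst sum.swap) (simp only:)
  qed
  also have "\<dots> = (\<Sum>i\<in>G. if i = k then b k * of_nat M else 0)"
  proof (rule sum.cong[OF refl])
    fix i assume i: "i \<in> G"
    show "b i * (\<Sum>j<M. ?w j powi (i - k)) = (if i = k then b k * of_nat M else 0)"
    proof (cases "i = k")
      case False
      then have "\<not> int M dvd (i - k)" using M(2)[OF i]
        by (metis abs_of_nat dvd_imp_le_int eq_iff_diff_eq_0 not_le)
      then show ?thesis using False sum_roots_of_unity[OF M(1)] by simp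
    qed simp
  qed
  also have "\<dots> = b k * of_nat M" using finG kG by simp
  finally have eq: "b k * of_nat M = (\<Sum>j<M. ?w j powi (- k) * (\<Sum>i\<in>G. b i * ?w j powi i))" ..
  have "norm (b k) * M \<le> (\<Sum>j<M. norm (b k) / 2)"
  proof -
    have "norm (b k) * M = norm (\<Sum>j<M. ?w j powi (- k) * (\<Sum>i\<in>G. b i * ?w j powi i))"
      using arg_cong[OF eq, of norm] by (simp add: norm_mult)
    also have "\<dots> \<le> (\<Sum>j<M. norm (b k) / 2)"
      using tail[OF nw] by (intro sum_norm_le) (simp add: norm_mult norm_power_int nw)
    finally show ?thesis .
  qed
  then show False using b0 M(1) by (simp add: field_simps)
qed

lemma has_laurent_coeff_unique:
  assumes "has_laurent c f A" "has_laurent d f A" "r > 0" "\<And>z. norm z = r \<Longrightarrow> z \<in> A"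
  shows "c k = d k"
proof -
  have "has_laurent (\<lambda>k. c k - d k) (\<lambda>_. 0) A"
    using has_laurent_diff[OF assms(1,2)] by simp
  from has_laurent_zero_coeff[OF this assms(3,4)] show ?thesis by simp
qed

text \<open>One circle determines all coefficients, hence the values on the rest of
  \<open>A\<close>. It plays the role of the identity theorem for holomorphic functions.\<close>

lemma has_laurent_identity:
  assumes "has_laurent c f A" "has_laurent d g A"
    and "r > 0" "\<And>z. norm z = r \<Longrightarrow> z \<in> A" "\<And>z. norm z = r \<Longrightarrow> f z = g z" "z \<in> A"
  shows "f z = g z"
proof -
  let ?CC = "{z. norm z = r}"
  have 1: "has_laurent c f ?CC" using assms(1) by (rule has_laurent_subset) (use assms(4) in auto)
  have "has_laurent d g ?CC" using assms(2) by (rule has_laurent_subset) (use assms(4) in auto)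
  then have "has_laurent d f ?CC" by (rule has_laurent_cong) (use assms(5) in auto)
  with 1 have "c k = d k" for k by (rule has_laurent_coeff_unique[OF _ _ assms(3)]) auto
  then have cd: "c = d" by (rule ext)
  have "has_laurent c g A" unfolding cd by (rule assms(2))
  then show ?thesis by (rule has_laurent_value_unique[OF assms(1) _ assms(6)])
qed

section \<open>Sums over multisets\<close>

text \<open>Separates the multiplicity of the largest index. \<open>O'\<close> is the set of allowed
  multiplicities: \<open>{0, 1}\<close> for odd modes, \<open>UNIV\<close> for even ones.\<close>

lemma multisets_Suc_bij:
  "bij_betw (\<lambda>(M, j). M + replicate_mset j K)
     ({M. set_mset M \<subseteq> {..<K} \<and> (\<forall>n. count M n \<in> O')} \<times> O')
     {M. set_mset M \<subseteq> {..<Suc K} \<and> (\<forall>n. count M n \<in> O')}"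
  if "0 \<in> O'" for O' :: "nat set" and K :: nat
proof (rule bij_betwI[where g = "\<lambda>M. (filter_mset (\<lambda>n. n < K) M, count M K)"])
  show "(\<lambda>(M, j). M + replicate_mset j K) \<in>
      {M. set_mset M \<subseteq> {..<K} \<and> (\<forall>n. count M n \<in> O')} \<times> O' \<rightarrow>
      {M. set_mset M \<subseteq> {..<Suc K} \<and> (\<forall>n. count M n \<in> O')}"
  proof (rule Pi_I)
    fix p assume "p \<in> {M. set_mset M \<subseteq> {..<K} \<and> (\<forall>n. count M n \<in> O')} \<times> O'"
    then obtain M j where p: "p = (M, j)" and M: "set_mset M \<subseteq> {..<K}" "\<And>n. count M n \<in> O'" "j \<in> O'"
      by auto
    have "count M K = 0" using M(1) by (auto simp: count_eq_zero_iff)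
    then have "count (M + replicate_mset j K) n \<in> O'" for n
      using M by (cases "n = K") auto
    moreover have "set_mset (M + replicate_mset j K) \<subseteq> {..<Suc K}"
      using M(1) by (auto simp: less_Suc_eq)
    ultimately show "(case p of (M, j) \<Rightarrow> M + replicate_mset j K) \<in>
        {M. set_mset M \<subseteq> {..<Suc K} \<and> (\<forall>n. count M n \<in> O')}"
      using p by simp
  qed
  show "(\<lambda>M. (filter_mset (\<lambda>n. n < K) M, count M K)) \<in>
      {M. set_mset M \<subseteq> {..<Suc K} \<and> (\<forall>n. count M n \<in> O')} \<rightarrow>
      {M. set_mset M \<subseteq> {..<K} \<and> (\<forall>n. count M n \<in> O')} \<times> O'"
    using that by auto
next
  fix p assume "p \<in> {M. set_mset M \<subseteq> {..<K} \<and> (\<forall>n. count M n \<in> O')} \<times> O'"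
  then obtain M j where p: "p = (M, j)" and M: "set_mset M \<subseteq> {..<K}" by auto
  have "count M K = 0" using M by (auto simp: count_eq_zero_iff)
  moreover have "filter_mset (\<lambda>n. n < K) M = M" using M by (auto simp: filter_mset_eq_conv)
  moreover have "filter_mset (\<lambda>n. n < K) (replicate_mset j K) = {#}"
    by (auto simp: filter_mset_eq_conv)
  ultimately show "(filter_mset (\<lambda>n. n < K) (case p of (M, j) \<Rightarrow> M + replicate_mset j K),
      count (case p of (M, j) \<Rightarrow> M + replicate_mset j K) K) = p"
    using p by simp
next
  fix M assume "M \<in> {M. set_mset M \<subseteq> {..<Suc K} \<and> (\<forall>n. count M n \<in> O')}"
  then have "set_mset M \<subseteq> {..<Suc K}" by auto
  then have "n \<notin># M" if "n > K" for n using that by (meson lessThan_iff not_less_eq subsetD)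
  then show "(case (filter_mset (\<lambda>n. n < K) M, count M K) of (M, j) \<Rightarrow> M + replicate_mset j K) = M"
    by (intro multiset_eqI) (auto simp: not_in_iff intro: linorder_neqE_nat)
qed

lemma has_sum_multisets_lessThan:
  fixes a :: "nat \<Rightarrow> complex"
  assumes O: "0 \<in> O'" and s: "\<And>n. ((\<lambda>j. a n ^ j) has_sum s n) O'"
  shows "((\<lambda>M. \<Prod>n\<in>#M. a n) has_sum (\<Prod>n<K. s n)) {M. set_mset M \<subseteq> {..<K} \<and> (\<forall>n. count M n \<in> O')}"
proof (induction K)
  case 0
  have "{M. set_mset M \<subseteq> {..<(0::nat)} \<and> (\<forall>n. count M n \<in> O')} = {{#}}" using O by auto
  then show ?case by (simp add: has_sum_finiteI)
next
  case (Suc K)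
  have "((\<lambda>(M, j). (\<Prod>n\<in>#M. a n) * a K ^ j) has_sum (\<Prod>n<K. s n) * s K)
      ({M. set_mset M \<subseteq> {..<K} \<and> (\<forall>n. count M n \<in> O')} \<times> O')"
    by (rule has_sum_product_complex[OF Suc.IH s])
  then have "((\<lambda>p. \<Prod>n\<in>#(case p of (M, j) \<Rightarrow> M + replicate_mset j K). a n) has_sum (\<Prod>n<Suc K. s n))
      ({M. set_mset M \<subseteq> {..<K} \<and> (\<forall>n. count M n \<in> O')} \<times> O')"
    by (simp add: case_prod_unfold mult.commute)
  then show ?case
    by (subst (asm) has_sum_reindex_bij_betw[OF multisets_Suc_bij[OF O]])
qed

text \<open>Summability is given, so the value may be computed along any increasing exhaustion. This
  is how partial products become a sum over all multisets.\<close>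

lemma has_sum_exhaustion:
  fixes f :: "'a \<Rightarrow> 'b :: real_normed_vector"
  assumes f: "f summable_on A" and BB: "\<And>n. BB n \<subseteq> A" "incseq BB" "(\<Union>n. BB n) = A"
    and s: "\<And>n. (f has_sum s n) (BB n)" and L: "s \<longlonglongrightarrow> L"
  shows "(f has_sum L) A"
proof -
  obtain S where S: "(f has_sum S) A" using f by (auto simp: summable_on_def)
  have "s \<longlonglongrightarrow> S"
  proof (rule LIMSEQ_I)
    fix e :: real assume e: "e > 0"
    have "\<forall>\<^sub>F F in finite_subsets_at_top A. dist (sum f F) S < e / 2"
      using tendstoD[OF S[unfolded has_sum_def], of "e / 2"] e by simp
    then obtain F0 where F0: "finite F0" "F0 \<subseteq> A"
      "\<And>F. finite F \<Longrightarrow> F0 \<subseteq> F \<Longrightarrow> F \<subseteq> A \<Longrightarrow> dist (sum f F) S < e / 2"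
      by (auto simp: eventually_finite_subsets_at_top)
    have "\<forall>x\<in>F0. \<exists>n. x \<in> BB n" using F0(2) BB(3) by blast
    then obtain k where k: "\<And>x. x \<in> F0 \<Longrightarrow> x \<in> BB (k x)" by metis
    define N where "N = (\<Sum>x\<in>F0. k x)"
    have N: "F0 \<subseteq> BB N"
    proof
      fix x assume x: "x \<in> F0"
      then have "k x \<le> N" unfolding N_def using F0(1) by (intro member_le_sum) auto
      then show "x \<in> BB N" using k[OF x] BB(2) by (meson incseqD subsetD)
    qed
    have "norm (s n - S) < e" if n: "n \<ge> N" for n
    proof -
      have F0n: "F0 \<subseteq> BB n" using N BB(2) n by (meson incseqD order_trans)
      have "\<forall>\<^sub>F F in finite_subsets_at_top (BB n). dist (sum f F) (s n) < e / 2"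
        using tendstoD[OF s[of n, unfolded has_sum_def], of "e / 2"] e by simp
      then obtain F1 where F1: "finite F1" "F1 \<subseteq> BB n"
        "\<And>F. finite F \<Longrightarrow> F1 \<subseteq> F \<Longrightarrow> F \<subseteq> BB n \<Longrightarrow> dist (sum f F) (s n) < e / 2"
        by (auto simp: eventually_finite_subsets_at_top)
      let ?F = "F0 \<union> F1"
      have "dist (sum f ?F) S < e / 2" "dist (sum f ?F) (s n) < e / 2"
        using F0 F1 F0n BB(1)[of n] by auto
      then have "dist (s n) S < e"
        using dist_triangle2[of "s n" S "sum f ?F"] by (simp add: dist_commute)
      then show ?thesis by (simp add: dist_norm)
    qed
    then show "\<exists>no. \<forall>n\<ge>no. norm (s n - S) < e" by blast
  qed
  then show ?thesis using L S LIMSEQ_unique by blast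
qed

lemma norm_prod_mset: "norm (\<Prod>n\<in>#M. (a n :: complex)) = (\<Prod>n\<in>#M. norm (a n))"
  by (induction M) (auto simp: norm_mult)

text \<open>A product over n < K is exactly the sum over multisets supported below K. Uniformly
  bounded products of norms bound all finite partial sums, which gives absolute summability, and
  letting K grow then identifies the value.\<close>

lemma has_sum_multisets:
  fixes a :: "nat \<Rightarrow> complex"
  assumes O: "0 \<in> O'" and s: "\<And>n. ((\<lambda>j. a n ^ j) has_sum s n) O'"
    and b: "\<And>n. ((\<lambda>j. norm (a n) ^ j) has_sum b n) O'" and bound: "\<And>K. (\<Prod>n<K. b n) \<le> b'"
    and L: "(\<lambda>K. \<Prod>n<K. s n) \<longlonglongrightarrow> L"
  shows "((\<lambda>M. \<Prod>n\<in>#M. a n) has_sum L) {M. \<forall>n. count M n \<in> O'}"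
proof (rule has_sum_exhaustion)
  let ?M = "\<lambda>K. {M :: nat multiset. set_mset M \<subseteq> {..<K} \<and> (\<forall>n. count M n \<in> O')}"
  show "((\<lambda>M. \<Prod>n\<in>#M. a n) has_sum (\<Prod>n<K. s n)) (?M K)" for K
    by (rule has_sum_multisets_lessThan[OF O s])
  show "?M K \<subseteq> {M. \<forall>n. count M n \<in> O'}" for K by auto
  show "incseq ?M" by (auto simp: incseq_def)
  have ex: "\<exists>K. set_mset M \<subseteq> {..<K}" for M :: "nat multiset"
    using finite_nat_set_iff_bounded[of "set_mset M"] by auto
  then show "(\<Union>K. ?M K) = {M. \<forall>n. count M n \<in> O'}" by auto
  show "(\<lambda>M. \<Prod>n\<in>#M. a n) summable_on {M. \<forall>n. count M n \<in> O'}"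
  proof (rule abs_summable_summable, rule nonneg_bdd_above_summable_on)
    show "bdd_above (sum (\<lambda>M. norm (\<Prod>n\<in>#M. a n)) ` {F. F \<subseteq> {M. \<forall>n. count M n \<in> O'} \<and> finite F})"
    proof (rule bdd_aboveI2)
      fix F :: "nat multiset set" assume "F \<in> {F. F \<subseteq> {M. \<forall>n. count M n \<in> O'} \<and> finite F}"
      then have F: "finite F" "F \<subseteq> {M. \<forall>n. count M n \<in> O'}" by auto
      have "finite (\<Union>M\<in>F. set_mset M)" using F by simp
      then obtain K where K: "(\<Union>M\<in>F. set_mset M) \<subseteq> {..<K}"
        unfolding finite_nat_set_iff_bounded by (meson lessThan_iff subsetI)
      have "((\<lambda>j. complex_of_real (norm (a n)) ^ j) has_sum of_real (b n)) O'" for n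
        using has_sum_of_real[OF b[of n], where 'a = complex] by simp
      then have "((\<lambda>M. \<Prod>n\<in>#M. complex_of_real (norm (a n))) has_sum
          (\<Prod>n<K. complex_of_real (b n))) (?M K)"
        by (rule has_sum_multisets_lessThan[OF O])
      then have "((\<lambda>M. Re (\<Prod>n\<in>#M. complex_of_real (norm (a n)))) has_sum
          Re (\<Prod>n<K. complex_of_real (b n))) (?M K)"
        by (rule has_sum_Re)
      moreover have "(\<Prod>n\<in>#M. complex_of_real (norm (a n))) = of_real (\<Prod>n\<in>#M. norm (a n))" for M
        by (induction M) auto
      moreover have "(\<Prod>n<K. complex_of_real (b n)) = of_real (\<Prod>n<K. b n)"
        by simp
      ultimately have hs: "((\<lambda>M. norm (\<Prod>n\<in>#M. a n)) has_sum (\<Prod>n<K. b n)) (?M K)"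
        by (simp only: norm_prod_mset Re_complex_of_real)
      have "sum (\<lambda>M. norm (\<Prod>n\<in>#M. a n)) F \<le> (\<Prod>n<K. b n)"
        by (rule has_sum_mono2[OF has_sum_finite[OF F(1)] hs]) (use K F(2) in auto)
      also have "\<dots> \<le> b'" using bound[of K] by simp
      finally show "sum (\<lambda>M. norm (\<Prod>n\<in>#M. a n)) F \<le> b'" .
    qed
  qed simp
qed (rule L)

text \<open>The boson case: each index contributes a geometric series. The bound on the products of
  \<open>inverse (1 - norm (a n))\<close> comes from convergence of the infinite product.\<close>

lemma has_sum_multisets_UNIV:
  fixes a :: "nat \<Rightarrow> complex"
  assumes a: "\<And>n. norm (a n) < 1" "summable (\<lambda>n. norm (a n))"
    and L: "(\<lambda>K. \<Prod>n<K. 1 - a n) \<longlonglongrightarrow> L" "L \<noteq> 0"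
  shows "((\<lambda>M. \<Prod>n\<in>#M. a n) has_sum inverse L) UNIV"
proof -
  have g: "((\<lambda>j. x ^ j) has_sum inverse (1 - x)) UNIV" if "norm x < 1" for x :: "'b :: {real_normed_field, banach}"
    using that geometric_sums[of x]
    by (intro norm_summable_imp_has_sum) (simp_all add: norm_power summable_geometric inverse_eq_divide)
  have conv: "convergent_prod (\<lambda>n. 1 - norm (a n))"
    using a(2) by (intro abs_convergent_prod_imp_convergent_prod)
      (simp add: abs_convergent_prod_conv_summable)
  then have "convergent_prod (\<lambda>n. inverse (1 - norm (a n)))"
    using convergent_prod_inverse by blast
  then have lim: "(\<lambda>K. \<Prod>n<K. inverse (1 - norm (a n))) \<longlonglongrightarrow> prodinf (\<lambda>n. inverse (1 - norm (a n)))"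
    by (intro has_prod_imp_tendsto' convergent_prod_has_prod)
  then have "Bseq (\<lambda>K. \<Prod>n<K. inverse (1 - norm (a n)))"
    using convergentI convergent_imp_Bseq by blast
  then obtain b' where b': "\<And>K. norm (\<Prod>n<K. inverse (1 - norm (a n))) \<le> b'"
    by (auto simp: Bseq_def)
  have "((\<lambda>M. \<Prod>n\<in>#M. a n) has_sum inverse L) {M. \<forall>n. count M n \<in> UNIV}"
  proof (rule has_sum_multisets)
    show "((\<lambda>j. a n ^ j) has_sum inverse (1 - a n)) UNIV" for n using a(1) by (rule g)
    show "((\<lambda>j. norm (a n) ^ j) has_sum inverse (1 - norm (a n))) UNIV" for n using a(1) by (intro g) simp
    show "(\<Prod>n<K. inverse (1 - norm (a n))) \<le> b'" for K using b'[of K] by simp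
    show "(\<lambda>K. \<Prod>n<K. inverse (1 - a n)) \<longlonglongrightarrow> inverse L"
      using tendsto_inverse[OF L] by (simp add: prod_inversef[symmetric] o_def)
  qed simp
  then show ?thesis by simp
qed

text \<open>The fermion case: each index contributes \<open>1 + a n\<close>, and the products of
  norms are bounded by the exponential of the sum.\<close>

lemma has_sum_multisets_le_1:
  fixes a :: "nat \<Rightarrow> complex"
  assumes a: "summable (\<lambda>n. norm (a n))" and L: "(\<lambda>K. \<Prod>n<K. 1 + a n) \<longlonglongrightarrow> L"
  shows "((\<lambda>M. \<Prod>n\<in>#M. a n) has_sum L) {M. \<forall>n. count M n \<le> 1}"
proof -
  have "((\<lambda>M. \<Prod>n\<in>#M. a n) has_sum L) {M. \<forall>n. count M n \<in> {0, 1}}"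
  proof (rule has_sum_multisets[OF _ _ _ _ L])
    show "((\<lambda>j. a n ^ j) has_sum 1 + a n) {0, 1}" for n by (rule has_sum_finiteI) auto
    show "((\<lambda>j. norm (a n) ^ j) has_sum 1 + norm (a n)) {0, 1}" for n by (rule has_sum_finiteI) auto
    show "(\<Prod>n<K. 1 + norm (a n)) \<le> exp (suminf (\<lambda>n. norm (a n)))" for K
    proof -
      have "(\<Prod>n<K. 1 + norm (a n)) \<le> exp (\<Sum>n<K. norm (a n))"
        by (rule prod_le_exp_sum) simp
      also have "\<dots> \<le> exp (suminf (\<lambda>n. norm (a n)))"
        using a by (simp add: sum_le_suminf)
      finally show ?thesis .
    qed
  qed simp
  moreover have "{M :: nat multiset. \<forall>n. count M n \<in> {0, 1}} = {M. \<forall>n. count M n \<le> 1}"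
    by (auto simp: le_Suc_eq)
  ultimately show ?thesis by simp
qed

section \<open>Powers of q\<close>

lemma qpow_mult: "qpow \<tau> a * qpow \<tau> b = qpow \<tau> (a + b)"
  by (simp add: qpow_def exp_add[symmetric] algebra_simps)

lemma qpow_0 [simp]: "qpow \<tau> 0 = 1"
  by (simp add: qpow_def)

lemma qpow_nonzero [simp]: "qpow \<tau> a \<noteq> 0"
  by (simp add: qpow_def)

lemma qpow_minus: "qpow \<tau> (- a) = inverse (qpow \<tau> a)"
  by (simp add: qpow_def exp_minus)

lemma qpow_power: "qpow \<tau> a ^ n = qpow \<tau> (real n * a)"
  by (simp add: qpow_def exp_of_nat_mult[symmetric] algebra_simps)

lemma qpow_powi: "qpow \<tau> a powi n = qpow \<tau> (of_int n * a)"
  by (cases n rule: int_cases2)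
    (simp_all add: qpow_power power_int_minus qpow_minus)

lemma norm_qpow: "norm (qpow \<tau> a) = exp (- (2 * pi * Im \<tau>) * a)"
  by (simp add: qpow_def)

lemma neg_one_powi: "(- 1 :: complex) powi j = (if even j then 1 else - 1)"
  by (cases j rule: int_cases2) (auto simp: power_int_minus)

lemma minus_powi: "(- a :: complex) powi j = (-1) powi j * a powi j"
  by (metis mult_minus1 power_int_mult_distrib)

lemma infsum_nat_Suc:
  fixes f :: "nat \<Rightarrow> complex"
  assumes "f summable_on UNIV"
  shows "(\<Sum>\<^sub>\<infinity>j. f j) = f 0 + (\<Sum>\<^sub>\<infinity>j. f (Suc j))"
proof -
  have "f summable_on (range Suc)" using assms by (rule summable_on_subset_banach) auto
  then have "((\<lambda>j. f (Suc j)) has_sum (\<Sum>\<^sub>\<infinity>j. f (Suc j))) UNIV"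
    by (intro has_sum_infsum) (simp add: summable_on_reindex o_def)
  then have "(f has_sum (\<Sum>\<^sub>\<infinity>j. f (Suc j))) (range Suc)"
    by (simp add: has_sum_reindex o_def)
  moreover have "(f has_sum f 0) {0}" by (simp add: has_sum_finiteI)
  ultimately have "(f has_sum f 0 + (\<Sum>\<^sub>\<infinity>j. f (Suc j))) ({0} \<union> range Suc)"
    by (intro has_sum_Un_disjoint) auto
  moreover have "{0} \<union> range Suc = UNIV" using not0_implies_Suc by auto
  ultimately show ?thesis by (simp add: infsumI)
qed

lemma summable_on_int:
  fixes f :: "int \<Rightarrow> complex"
  assumes "summable (\<lambda>n. norm (f (int n)))" "summable (\<lambda>n. norm (f (- int n)))"
  shows "f summable_on UNIV"
proof -
  have "(\<lambda>n. f (int n)) summable_on UNIV" "(\<lambda>n. f (- int n)) summable_on UNIV"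
    using assms by (auto intro: norm_summable_imp_summable_on)
  then have "f summable_on range int" "f summable_on range (\<lambda>n. - int n)"
    by (simp_all add: summable_on_reindex inj_on_def o_def)
  then have "f summable_on (range int \<union> range (\<lambda>n. - int n))"
    by (rule summable_on_union)
  moreover have "k \<in> range int \<union> range (\<lambda>n. - int n)" for k
    by (cases k rule: int_cases2) auto
  then have "range int \<union> range (\<lambda>n. - int n) = UNIV" by blast
  ultimately show ?thesis by simp
qed

lemma summable_on_geometric_int:
  fixes f :: "int \<Rightarrow> complex"
  assumes "\<And>k. norm (f (int k)) \<le> c * a ^ k" "\<And>k. norm (f (- int k)) \<le> c * b ^ k"
    and "0 \<le> a" "a < 1" "0 \<le> b" "b < 1"
  shows "f summable_on UNIV"
proof (rule summable_on_int)
  show "summable (\<lambda>n. norm (f (int n)))"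
    by (rule summable_comparison_test'[where g = "\<lambda>k. c * a ^ k" and N = 0])
      (use assms in \<open>auto intro!: summable_mult summable_geometric\<close>)
  show "summable (\<lambda>n. norm (f (- int n)))"
    by (rule summable_comparison_test'[where g = "\<lambda>k. c * b ^ k" and N = 0])
      (use assms in \<open>auto intro!: summable_mult summable_geometric\<close>)
qed

section \<open>Theta functions at a fixed nome\<close>

locale nome =
  fixes \<tau> :: complex
  assumes Im_pos: "Im \<tau> > 0"
begin

abbreviation Q :: "real \<Rightarrow> complex" where "Q \<equiv> qpow \<tau>"

definition p :: real where "p = norm (Q 1)"

lemma p_pos: "p > 0" and p_less_1: "p < 1"
  using Im_pos by (auto simp: p_def norm_qpow)

lemma norm_Q: "norm (Q a) = p powr a"
  by (simp add: p_def norm_qpow powr_def)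

lemma Q_ne_1: "a \<noteq> 0 \<Longrightarrow> Q a \<noteq> 1"
proof
  assume "a \<noteq> 0" "Q a = 1"
  then have "p powr a = 1" by (metis norm_Q norm_one)
  then show False using \<open>a \<noteq> 0\<close> p_pos p_less_1 by (simp add: powr_def)
qed

lemma norm_Q_less_1: "a > 0 \<Longrightarrow> norm (Q a) < 1"
  using p_pos p_less_1 by (simp add: norm_Q powr_def mult_pos_neg)

lemma norm_Q_le_1: "a \<ge> 0 \<Longrightarrow> norm (Q a) \<le> 1"
  using p_pos p_less_1 by (simp add: norm_Q powr_le1)

lemma norm_Q_mono: "a \<le> b \<Longrightarrow> norm (Q b) \<le> norm (Q a)"
  using p_pos p_less_1 by (simp add: norm_Q powr_mono')

text \<open>The quotient of consecutive terms has norm |y| p^(n + 1/2), which tends to 0.\<close>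

lemma summable_theta_nat: "summable (\<lambda>n. norm (y ^ n * Q ((real n)\<^sup>2 / 2)))"
proof -
  have "(\<lambda>n. norm y * p powr (real n + 1 / 2)) \<longlonglongrightarrow> 0"
  proof -
    have "(\<lambda>n. norm y * p powr (1 / 2) * p ^ n) \<longlonglongrightarrow> norm y * p powr (1 / 2) * 0"
      using p_pos p_less_1 by (intro tendsto_intros LIMSEQ_realpow_zero) auto
    then show ?thesis using p_pos by (simp add: powr_add powr_realpow mult_ac)
  qed
  then have "\<forall>\<^sub>F n in sequentially. norm y * p powr (real n + 1 / 2) < 1 / 2"
    by (rule order_tendstoD) simp
  then obtain N where N: "\<And>n. n \<ge> N \<Longrightarrow> norm y * p powr (real n + 1 / 2) < 1 / 2"
    by (auto simp: eventually_sequentially)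
  show ?thesis
  proof (rule summable_ratio_test[where c = "1 / 2" and N = N])
    fix n assume n: "N \<le> n"
    have "Q ((real (Suc n))\<^sup>2 / 2) = Q ((real n)\<^sup>2 / 2) * Q (real n + 1 / 2)"
      by (simp add: qpow_mult power2_eq_square field_simps)
    then have "norm (y ^ Suc n * Q ((real (Suc n))\<^sup>2 / 2))
        = (norm y * p powr (real n + 1 / 2)) * norm (y ^ n * Q ((real n)\<^sup>2 / 2))"
      by (simp add: norm_mult norm_Q[of "real n + 1 / 2"])
    also have "\<dots> \<le> 1 / 2 * norm (y ^ n * Q ((real n)\<^sup>2 / 2))"
      using N[OF n] by (intro mult_right_mono) auto
    finally show "norm (norm (y ^ Suc n * Q ((real (Suc n))\<^sup>2 / 2)))
        \<le> 1 / 2 * norm (norm (y ^ n * Q ((real n)\<^sup>2 / 2)))"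
      by simp
  qed simp
qed

lemma summable_theta: "(\<lambda>n. y powi n * Q ((of_int n)\<^sup>2 / 2)) summable_on UNIV"
proof (rule summable_on_int)
  show "summable (\<lambda>n. norm (y powi int n * Q ((of_int (int n))\<^sup>2 / 2)))"
    using summable_theta_nat[of y] by simp
  show "summable (\<lambda>n. norm (y powi (- int n) * Q ((of_int (- int n))\<^sup>2 / 2)))"
    using summable_theta_nat[of "inverse y"] by (simp add: power_int_minus power_inverse)
qed

definition th :: "complex \<Rightarrow> complex" where "th y = theta3 y \<tau>"

lemma th_has_laurent: "has_laurent (\<lambda>n. Q ((of_int n)\<^sup>2 / 2)) th (- {0})"
  using summable_theta by (auto simp: has_laurent_def th_def theta3_def mult.commute)

lemma th_has_laurent_scale:
  "y \<noteq> 0 \<Longrightarrow> has_laurent (\<lambda>n. y powi n * Q ((of_int n)\<^sup>2 / 2)) (\<lambda>u. th (y * u)) (- {0})"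
  using has_laurent_scale[OF th_has_laurent, of y "- {0}"]
  by (rule has_laurent_cong) (auto simp: mult.commute)

lemma th_inverse: "y \<noteq> 0 \<Longrightarrow> th (inverse y) = th y"
proof -
  assume y: "y \<noteq> 0"
  have "has_laurent (\<lambda>n. Q ((of_int n)\<^sup>2 / 2)) (\<lambda>y. th (inverse y)) (- {0})"
    by (rule has_laurent_cong[OF has_laurent_inverse[OF th_has_laurent]]) auto
  from has_laurent_value_unique[OF this th_has_laurent, of y] y show ?thesis by simp
qed

subsection \<open>The Lerch coefficients\<close>

definition lc_term :: "int \<Rightarrow> int \<Rightarrow> complex" where
  "lc_term k j = (-1) powi j * Q (of_int (j * (j + 1)) / 2 + of_int (j * k))"

text \<open>A partial theta series. By \<open>e0_theta\<close> and \<open>J_phi\<close> these are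
  the Laurent coefficients, on p < |u| < 1, of \<open>phi ^ 3\<close> divided by the theta function
  that vanishes at u = 1.\<close>

definition lc :: "int \<Rightarrow> complex" where
  "lc k = (\<Sum>\<^sub>\<infinity>j. lc_term k (int j))"

lemma lc_term_summable: "lc_term k summable_on UNIV"
proof -
  have "lc_term k j = (- Q (of_int k + 1 / 2)) powi j * Q ((of_int j)\<^sup>2 / 2)" for j
  proof -
    have "Q (of_int (j * (j + 1)) / 2 + of_int (j * k))
        = Q (of_int j * (of_int k + 1 / 2)) * Q ((of_int j)\<^sup>2 / 2)"
      unfolding qpow_mult by (rule arg_cong[of _ _ Q]) (simp add: power2_eq_square field_simps)
    then show ?thesis
      by (simp add: lc_term_def minus_powi[of "Q (of_int k + 1 / 2)"] qpow_powi)
  qed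
  then show ?thesis using summable_theta by presburger
qed

lemma lc_term_summable_nat: "(\<lambda>j. lc_term k (int j)) summable_on UNIV"
proof -
  have "lc_term k summable_on (range int)"
    using lc_term_summable by (rule summable_on_subset_banach) auto
  then show ?thesis by (simp add: summable_on_reindex o_def)
qed

text \<open>The reflection of j to -1 - 2k - j preserves the exponent of q and reverses the sign, so
  the sum is its own negative.\<close>

lemma lc_term_sum_zero: "(lc_term k has_sum 0) UNIV"
proof -
  obtain s where s: "(lc_term k has_sum s) UNIV"
    using lc_term_summable by (auto simp: summable_on_def)
  have refl: "lc_term k (- (j - (- 1 - 2 * k))) = - lc_term k j" for j
  proof -
    have "(- 1 :: complex) powi (- (j - (- 1 - 2 * k))) = - ((- 1) powi j)"
      by (simp add: neg_one_powi)
    moreover have "of_int ((- (j - (- 1 - 2 * k))) * (- (j - (- 1 - 2 * k)) + 1)) / 2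
        + of_int ((- (j - (- 1 - 2 * k))) * k) = (of_int (j * (j + 1)) / 2 + of_int (j * k) :: real)"
      by (simp add: field_simps)
    ultimately show ?thesis unfolding lc_term_def by simp
  qed
  have "((\<lambda>j. lc_term k (- (j - (- 1 - 2 * k)))) has_sum s) UNIV"
    using has_sum_int_shift[OF has_sum_int_uminus[OF s], of "- 1 - 2 * k"] .
  then have "((\<lambda>j. - lc_term k j) has_sum s) UNIV" by (simp only: refl)
  moreover have "((\<lambda>j. - lc_term k j) has_sum - s) UNIV" using s by (rule has_sum_uminusI)
  ultimately have "s = - s" by (rule has_sum_unique)
  then show ?thesis using s by simp
qed

text \<open>The term j = 0 equals 1, and shifting j by one turns the rest into a multiple of
  \<open>lc (k + 1)\<close>. This recursion drives the inversion of theta, Kronecker's identity and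
  the decay of \<open>mc\<close>.\<close>

lemma lc_rec: "lc k = 1 - Q (of_int (k + 1)) * lc (k + 1)"
proof -
  have "lc k = lc_term k 0 + (\<Sum>\<^sub>\<infinity>j. lc_term k (int (Suc j)))"
    unfolding lc_def using infsum_nat_Suc[OF lc_term_summable_nat] by simp
  also have "lc_term k (int (Suc j)) = - Q (of_int (k + 1)) * lc_term (k + 1) (int j)" for j
  proof -
    have "Q (of_int (int (Suc j) * (int (Suc j) + 1)) / 2 + of_int (int (Suc j) * k))
        = Q (of_int (k + 1)) * Q (of_int (int j * (int j + 1)) / 2 + of_int (int j * (k + 1)))"
      unfolding qpow_mult by (rule arg_cong[of _ _ Q]) (simp add: field_simps)
    then show ?thesis unfolding lc_term_def by (simp add: neg_one_powi)
  qed
  then have "(\<Sum>\<^sub>\<infinity>j. lc_term k (int (Suc j))) = - Q (of_int (k + 1)) * lc (k + 1)"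
    unfolding lc_def by (simp only: infsum_cmult_right')
  finally show ?thesis by (simp add: lc_term_def)
qed

text \<open>The sum over all integers j vanishes, so the half j >= 0 is minus the half j < 0;
  replacing j by -j - 1 identifies the latter with a multiple of \<open>lc k\<close>. It yields the
  decay of \<open>lc\<close> at negative indices.\<close>

lemma lc_uminus: "lc (- k) = Q (of_int k) * lc k"
proof -
  have pos: "(lc_term (- k) has_sum lc (- k)) (range int)"
    using has_sum_infsum[OF lc_term_summable_nat[of "- k"]]
    by (simp add: lc_def has_sum_reindex o_def)
  have e: "lc_term (- k) (- int j - 1) = - Q (of_int k) * lc_term k (int j)" for j
  proof -
    have "Q (of_int ((- int j - 1) * (- int j - 1 + 1)) / 2 + of_int ((- int j - 1) * (- k)))
        = Q (of_int k) * Q (of_int (int j * (int j + 1)) / 2 + of_int (int j * k))"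
      unfolding qpow_mult by (rule arg_cong[of _ _ Q]) (simp add: field_simps)
    then show ?thesis unfolding lc_term_def by (simp add: neg_one_powi)
  qed
  have "((\<lambda>j. lc_term (- k) (- int j - 1)) has_sum - Q (of_int k) * lc k) UNIV"
    unfolding e lc_def by (intro has_sum_cmult_right has_sum_infsum lc_term_summable_nat)
  then have neg: "(lc_term (- k) has_sum - Q (of_int k) * lc k) (range (\<lambda>j. - int j - 1))"
    by (subst has_sum_reindex) (auto simp: o_def inj_on_def)
  have "(lc_term (- k) has_sum lc (- k) + - Q (of_int k) * lc k) (range int \<union> range (\<lambda>j. - int j - 1))"
    using pos neg by (rule has_sum_Un_disjoint) auto
  moreover have "range int \<union> range (\<lambda>j. - int j - 1) = UNIV"
  proof -
    have "x \<in> range int \<union> range (\<lambda>j. - int j - 1)" for x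
    proof (cases x rule: int_cases)
      case (neg n)
      then have "x = - int n - 1" by simp
      then show ?thesis by blast
    qed auto
    then show ?thesis by blast
  qed
  ultimately have "lc (- k) + - Q (of_int k) * lc k = 0"
    using lc_term_sum_zero[of "- k"] has_sum_unique by fastforce
  then show ?thesis by simp
qed

definition lc_bound :: real where "lc_bound = (\<Sum>\<^sub>\<infinity>j. norm (lc_term 0 (int j)))"

lemma norm_lc_pos: "norm (lc (int k)) \<le> lc_bound"
proof -
  have "norm (lc_term (int k) (int j)) \<le> norm (lc_term 0 (int j))" for j
    by (auto simp: lc_term_def norm_mult neg_one_powi intro!: norm_Q_mono)
  then show ?thesis unfolding lc_def lc_bound_def
    using lc_term_summable_nat[of "int k"] lc_term_summable_nat[of 0]
    by (intro norm_infsum_le[OF has_sum_infsum has_sum_infsum])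
      (auto simp: summable_on_iff_abs_summable_on_complex)
qed

lemma norm_lc_neg: "norm (lc (- int k)) \<le> lc_bound * p ^ k"
  using norm_lc_pos[of k] p_pos
  by (simp add: lc_uminus norm_mult norm_Q powr_realpow mult.commute mult_right_mono)

lemma lc_bound_nonneg: "lc_bound \<ge> 0"
  using norm_lc_pos[of 0] norm_ge_zero order_trans by blast

lemma norm_lc: "norm (lc k) \<le> lc_bound"
proof (cases k rule: int_cases2)
  case (nonpos n)
  have "lc_bound * p ^ n \<le> lc_bound * 1"
    using lc_bound_nonneg p_pos p_less_1 by (intro mult_left_mono power_le_one) auto
  then show ?thesis using norm_lc_neg[of n] nonpos by simp
qed (use norm_lc_pos in auto)

text \<open>Here the bounds on \<open>lc\<close> suffice for convergence: constant for k >= 0 and of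
  order p^|k| for k < 0.\<close>

definition ann :: "complex set" where "ann = {u. p < norm u \<and> norm u < 1}"

definition e0 :: "complex \<Rightarrow> complex" where "e0 u = (\<Sum>\<^sub>\<infinity>k. lc k * u powi k)"

lemma e0_has_laurent: "has_laurent lc e0 ann"
  unfolding has_laurent_def
proof (intro conjI ballI)
  show "0 \<notin> ann" using p_pos by (simp add: ann_def)
  fix u assume u: "u \<in> ann"
  then have nz: "u \<noteq> 0" using p_pos by (auto simp: ann_def)
  have "(\<lambda>k. lc k * u powi k) summable_on UNIV"
  proof (rule summable_on_geometric_int[where c = lc_bound and a = "norm u" and b = "p / norm u"])
    show "norm (lc (int k) * u powi int k) \<le> lc_bound * norm u ^ k" for k
      using norm_lc_pos by (simp add: norm_mult norm_power mult_right_mono)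
    show "norm (lc (- int k) * u powi - int k) \<le> lc_bound * (p / norm u) ^ k" for k
    proof -
      have "norm (lc (- int k) * u powi - int k) \<le> lc_bound * p ^ k * (inverse (norm u ^ k))"
        using norm_lc_neg[of k]
        by (simp add: norm_mult power_int_minus norm_inverse norm_power mult_right_mono)
      then show ?thesis by (simp add: divide_inverse power_mult_distrib power_inverse mult.assoc)
    qed
  qed (use u p_pos nz in \<open>auto simp: ann_def\<close>)
  then show "((\<lambda>k. lc k * u powi k) has_sum e0 u) UNIV"
    by (simp add: e0_def)
qed

text \<open>The coefficients of theta in a variable u rescaled so that one zero lies at u = 1; the
  vanishing there is \<open>tc_has_sum\<close>.\<close>

definition tc :: "int \<Rightarrow> complex" where "tc i = (-1) powi i * Q (of_int (i * (i - 1)) / 2)"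

lemma tc_conv: "tc i = (- Q (- 1 / 2)) powi i * Q ((of_int i)\<^sup>2 / 2)"
proof -
  have "Q (of_int (i * (i - 1)) / 2) = Q (of_int i * (- 1 / 2)) * Q ((of_int i)\<^sup>2 / 2)"
    unfolding qpow_mult by (rule arg_cong[of _ _ Q]) (simp add: power2_eq_square field_simps)
  then show ?thesis
    unfolding tc_def minus_powi[of "Q (- 1 / 2)"] qpow_powi by (simp only: mult.assoc)
qed

lemma tc_has_laurent: "has_laurent tc (\<lambda>u. th (- Q (- 1 / 2) * u)) (- {0})"
  using th_has_laurent_scale[of "- Q (- 1 / 2)"]
  by (rule has_laurent_cong) (auto simp: tc_conv)

lemma tc_has_sum: "(tc has_sum 0) UNIV"
proof -
  have "tc = lc_term (- 1)" by (auto simp: tc_def lc_term_def field_simps)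
  then show ?thesis using lc_term_sum_zero by simp
qed

lemma summable_on_bounded_mult:
  fixes f g :: "'a \<Rightarrow> complex"
  assumes "f summable_on A" "\<And>x. x \<in> A \<Longrightarrow> norm (g x) \<le> C0"
  shows "(\<lambda>x. f x * g x) summable_on A"
proof -
  have "(\<lambda>x. norm (f x) * C0) summable_on A"
    using assms(1) by (intro summable_on_cmult_left)
      (simp add: summable_on_iff_abs_summable_on_complex)
  then have "(\<lambda>x. norm (f x * g x)) summable_on A"
    by (rule Infinite_Sum.abs_summable_on_comparison_test')
      (auto simp: norm_mult assms(2) intro!: mult_left_mono)
  then show ?thesis by (rule abs_summable_summable)
qed

definition J :: complex where "J = (\<Sum>\<^sub>\<infinity>i. tc i * lc (- i))"

lemma tc_lc_summable: "(\<lambda>i. tc i * lc (k - i)) summable_on UNIV"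
  using has_sum_imp_summable[OF tc_has_sum] norm_lc by (rule summable_on_bounded_mult)

text \<open>Inserting \<open>lc_rec\<close> in each term expresses the convolution P at k as the sum
  of \<open>tc\<close>, which is 0, plus q^k P. Since q^k differs from 1 for k nonzero, P vanishes
  there.\<close>

lemma tc_lc_conv: "(\<Sum>\<^sub>\<infinity>i. tc i * lc (k - i)) = (if k = 0 then J else 0)"
proof (cases "k = 0")
  case False
  let ?P = "\<Sum>\<^sub>\<infinity>i. tc i * lc (k - i)"
  have P: "((\<lambda>i. tc i * lc (k - i)) has_sum ?P) UNIV"
    using tc_lc_summable by simp
  have e: "tc i * lc (k - i) = tc i + Q (of_int k) * (tc (i - 1) * lc (k - (i - 1)))" for i
  proof -
    have "Q (of_int (i * (i - 1)) / 2) * Q (of_int (k - (i - 1)))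
        = Q (of_int k) * Q (of_int ((i - 1) * (i - 1 - 1)) / 2)"
      unfolding qpow_mult by (rule arg_cong[of _ _ Q]) (simp add: field_simps)
    then have 1: "tc i * Q (of_int (k - (i - 1))) = - (Q (of_int k) * tc (i - 1))"
      by (simp add: tc_def neg_one_powi)
    have 2: "k - i + 1 = k - (i - 1)" by simp
    have "tc i * lc (k - i) = tc i - tc i * Q (of_int (k - (i - 1))) * lc (k - (i - 1))"
      by (subst lc_rec) (simp only: 2 right_diff_distrib mult_1_right mult.assoc)
    then show ?thesis unfolding 1 by simp
  qed
  have "((\<lambda>i. tc i + Q (of_int k) * (tc (i - 1) * lc (k - (i - 1)))) has_sum (0 + Q (of_int k) * ?P)) UNIV"
    by (intro has_sum_add tc_has_sum has_sum_cmult_right has_sum_int_shift[OF P])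
  then have "((\<lambda>i. tc i * lc (k - i)) has_sum (0 + Q (of_int k) * ?P)) UNIV"
    by (simp only: e[symmetric])
  then have "?P = 0 + Q (of_int k) * ?P" using P has_sum_unique by blast
  then have "?P * (1 - Q (of_int k)) = 0" by (simp add: algebra_simps)
  then show ?thesis using False Q_ne_1[of "of_int k"] by auto
qed (simp add: J_def)

lemma e0_theta: "u \<in> ann \<Longrightarrow> th (- Q (- 1 / 2) * u) * e0 u = J"
proof -
  assume u: "u \<in> ann"
  have nz: "u \<noteq> 0" using u p_pos by (auto simp: ann_def)
  have "has_laurent (\<lambda>k. if k = 0 then J else 0) (\<lambda>u. th (- Q (- 1 / 2) * u) * e0 u) ann"
    using has_laurent_mult[OF has_laurent_subset[OF tc_has_laurent] e0_has_laurent]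
      has_laurent_nonzero[OF e0_has_laurent] by (simp add: tc_lc_conv)
  then have "((\<lambda>k. (if k = 0 then J else 0) * u powi k) has_sum th (- Q (- 1 / 2) * u) * e0 u) UNIV"
    using u by (rule has_laurentD)
  moreover have "((\<lambda>k. (if k = 0 then J else 0) * u powi k) has_sum J) UNIV"
    by (rule has_sum_finite_neutralI[where B = "{0}"]) auto
  ultimately show ?thesis by (rule has_sum_unique)
qed

lemma ann_nonzero: "ann \<subseteq> - {0}"
  using p_pos by (auto simp: ann_def)

text \<open>The mechanism of \<open>tc_lc_conv\<close> again: adding the convolution shifted by one,
  times y q^(n+1/2), completes each \<open>lc (n - i)\<close> by \<open>lc_rec\<close> to 1 and
  leaves the theta series. Written as a product the identity also covers the poles in y.\<close>

lemma kronecker_coeff: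
  assumes y: "y \<noteq> 0"
  shows "(1 + y * Q (of_int n + 1 / 2)) * (\<Sum>\<^sub>\<infinity>i. (y powi i * Q ((of_int i)\<^sup>2 / 2)) * lc (n - i)) = th y"
proof -
  let ?a = "\<lambda>i. y powi i * Q ((of_int i)\<^sup>2 / 2)"
  let ?P = "\<Sum>\<^sub>\<infinity>i. ?a i * lc (n - i)"
  have a: "(?a has_sum th y) UNIV"
    using summable_theta by (simp add: th_def theta3_def)
  have P: "((\<lambda>i. ?a i * lc (n - i)) has_sum ?P) UNIV"
    using summable_on_bounded_mult[OF has_sum_imp_summable[OF a] norm_lc] by simp
  have "((\<lambda>i. ?a i * lc (n - i) + y * Q (of_int n + 1 / 2) * (?a (i - 1) * lc (n - (i - 1))))
      has_sum ?P + y * Q (of_int n + 1 / 2) * ?P) UNIV"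
    by (intro has_sum_add P has_sum_cmult_right has_sum_int_shift[OF P])
  moreover have "?a i * lc (n - i) + y * Q (of_int n + 1 / 2) * (?a (i - 1) * lc (n - (i - 1))) = ?a i" for i
  proof -
    have 1: "y * Q (of_int n + 1 / 2) * ?a (i - 1) = ?a i * Q (of_int (n - i + 1))"
    proof -
      have "Q (of_int n + 1 / 2) * Q ((of_int (i - 1))\<^sup>2 / 2) = Q ((of_int i)\<^sup>2 / 2) * Q (of_int (n - i + 1))"
        unfolding qpow_mult by (rule arg_cong[of _ _ Q]) (simp add: power2_eq_square field_simps)
      moreover have "y * y powi (i - 1) = y powi i"
        using power_int_add_1'[of y "i - 1"] y by simp
      moreover have "y * Q (of_int n + 1 / 2) * (y powi (i - 1) * Q ((of_int (i - 1))\<^sup>2 / 2))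
          = (y * y powi (i - 1)) * (Q (of_int n + 1 / 2) * Q ((of_int (i - 1))\<^sup>2 / 2))"
        by (simp only: mult_ac)
      ultimately show ?thesis by (simp only: mult.assoc)
    qed
    have 2: "n - i + 1 = n - (i - 1)" by simp
    have "y * Q (of_int n + 1 / 2) * (?a (i - 1) * lc (n - (i - 1)))
        = ?a i * (Q (of_int (n - i + 1)) * lc (n - i + 1))"
      unfolding 2[symmetric] mult.assoc[symmetric] 1[symmetric] ..
    then show ?thesis
      by (subst lc_rec[of "n - i"]) (simp add: right_diff_distrib)
  qed
  ultimately have "(?a has_sum ?P + y * Q (of_int n + 1 / 2) * ?P) UNIV" by simp
  then have "th y = ?P + y * Q (of_int n + 1 / 2) * ?P" using a has_sum_unique by blast
  then show ?thesis by (simp add: distrib_right)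
qed

lemma kronecker:
  assumes y: "y \<noteq> 0" "\<And>n::int. 1 + y * Q (of_int n + 1 / 2) \<noteq> 0"
  shows "has_laurent (\<lambda>n. th y / (1 + y * Q (of_int n + 1 / 2))) (\<lambda>u. th (y * u) * e0 u) ann"
proof -
  have "has_laurent (\<lambda>k. \<Sum>\<^sub>\<infinity>i. (y powi i * Q ((of_int i)\<^sup>2 / 2)) * lc (k - i)) (\<lambda>u. th (y * u) * e0 u) ann"
    by (rule has_laurent_mult[OF has_laurent_subset[OF th_has_laurent_scale[OF y(1)] ann_nonzero] e0_has_laurent])
  then show ?thesis
  proof (rule has_laurent_cong)
    show "(\<Sum>\<^sub>\<infinity>i. (y powi i * Q ((of_int i)\<^sup>2 / 2)) * lc (n - i)) = th y / (1 + y * Q (of_int n + 1 / 2))" for n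
      unfolding nonzero_eq_divide_eq[OF y(2)] using kronecker_coeff[OF y(1), of n] by (simp only: mult.commute)
  qed simp
qed


section \<open>Euler's product and its power series expansion\<close>

definition phi :: complex where "phi = prodinf (\<lambda>n. 1 - Q (real (Suc n)))"

lemma eta_conv: "eta \<tau> = Q (1 / 24) * phi"
  by (simp add: eta_def phi_def)

definition qp :: "nat \<Rightarrow> complex" where "qp k = (\<Prod>n<k. 1 - Q (real (Suc n)))"

lemma summable_Q: "c > 0 \<Longrightarrow> summable (\<lambda>n. norm (z * Q (real n + c)))"
proof -
  assume "c > 0"
  have "norm (z * Q (real n + c)) = norm z * p powr c * p ^ n" for n
    using p_pos by (simp add: norm_mult norm_Q powr_add powr_realpow)
  then show ?thesis using p_pos p_less_1 by (simp add: summable_geometric)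
qed

lemma convergent_phi: "convergent_prod (\<lambda>n. 1 - Q (real (Suc n)))"
  using summable_Q[of 1 1]
  by (intro abs_convergent_prod_imp_convergent_prod)
    (simp add: abs_convergent_prod_conv_summable add.commute)

lemma qp_tendsto: "qp \<longlonglongrightarrow> phi"
  using has_prod_imp_tendsto'[OF convergent_prod_has_prod[OF convergent_phi]]
  unfolding qp_def[abs_def] phi_def .

lemma phi_nonzero: "phi \<noteq> 0"
  unfolding phi_def
  by (rule prodinf_nonzero[OF convergent_phi]) (metis Q_ne_1 eq_iff_diff_eq_0 of_nat_eq_0_iff nat.simps(3))

lemma qp_nonzero: "qp k \<noteq> 0"
  unfolding qp_def by simp (metis Q_ne_1 of_nat_eq_0_iff nat.simps(3) of_nat_Suc add.commute)

definition eps :: "int \<Rightarrow> complex" where "eps k = (if k \<ge> 0 then inverse (qp (nat k)) else 0)"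

definition eps_bound :: real where "eps_bound = (SUP k. norm (inverse (qp k)))"

lemma norm_eps: "norm (eps k) \<le> eps_bound"
proof -
  have "(\<lambda>k. inverse (qp k)) \<longlonglongrightarrow> inverse phi"
    using qp_tendsto phi_nonzero by (rule tendsto_inverse)
  then have "Bseq (\<lambda>k. inverse (qp k))" using convergentI convergent_imp_Bseq by blast
  then obtain b where "\<And>k. norm (inverse (qp k)) \<le> b" unfolding Bseq_def by blast
  then have bdd: "bdd_above (range (\<lambda>k. norm (inverse (qp k))))" by (rule bdd_aboveI2)
  have le: "norm (inverse (qp j)) \<le> eps_bound" for j
    unfolding eps_bound_def using bdd by (intro cSUP_upper) auto
  then have "0 \<le> eps_bound" using norm_ge_zero order_trans by blast
  then show ?thesis using le by (simp add: eps_def)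
qed

lemma eps_bound_nonneg: "eps_bound \<ge> 0"
  using norm_eps norm_ge_zero order_trans by blast

text \<open>Euler's coefficients q^(k^2/2) / ((1 - q)...(1 - q^k)) of the product of all 1 + z
  q^(n+1/2), extended by 0 to negative k; the function \<open>G\<close> is that product, see
  \<open>G_tendsto\<close>.\<close>

definition eul :: "int \<Rightarrow> complex" where "eul k = Q ((of_int k)\<^sup>2 / 2) * eps k"

definition G :: "complex \<Rightarrow> complex" where "G z = (\<Sum>\<^sub>\<infinity>k. eul k * z powi k)"

lemma G_has_laurent: "has_laurent eul G (- {0})"
proof -
  have "(\<lambda>k. eul k * z powi k) summable_on UNIV" for z
    using summable_on_bounded_mult[OF summable_theta[of z] norm_eps]
    by (simp add: eul_def mult_ac)
  then show ?thesis by (auto simp: has_laurent_def G_def)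
qed

lemma eul_rec: "eul k = eul k * Q (of_int k) + Q (1 / 2) * (eul (k - 1) * Q (of_int (k - 1)))"
proof -
  consider "k < 0" | "k = 0" | "k > 0" by linarith
  then show ?thesis
  proof cases
    case 3
    then obtain n where n: "k = int (Suc n)"
      by (metis gr0_implies_Suc zero_less_imp_eq_int)
    have 1: "Q (1 / 2) * Q ((real n)\<^sup>2 / 2) * Q (real n) = Q ((real (Suc n))\<^sup>2 / 2)"
      unfolding qpow_mult by (rule arg_cong[of _ _ Q]) (simp add: power2_eq_square field_simps)
    have 2: "inverse (qp n) = inverse (qp (Suc n)) * (1 - Q (real (Suc n)))"
      using qp_nonzero[of "Suc n"] by (simp add: qp_def)
    have "Q (1 / 2) * (eul (k - 1) * Q (of_int (k - 1))) = Q ((real (Suc n))\<^sup>2 / 2) * inverse (qp n)"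
      using 1 by (simp add: eul_def eps_def n mult_ac)
    also have "\<dots> = eul k * (1 - Q (of_int k))"
      unfolding 2 by (simp add: eul_def eps_def n nat_add_distrib)
    finally show ?thesis by (simp add: algebra_simps)
  qed (auto simp: eul_def eps_def)
qed

lemma G_rec:
  assumes z: "z \<noteq> 0"
  shows "G z = (1 + z * Q (1 / 2)) * G (z * Q 1)"
proof -
  have G1: "has_laurent (\<lambda>k. eul k * Q (of_int k)) (\<lambda>z. G (Q 1 * z)) (- {0})"
    by (rule has_laurent_cong[OF has_laurent_scale[OF G_has_laurent, of "Q 1"]])
      (auto simp: qpow_powi)
  have "has_laurent (\<lambda>k. eul k * Q (of_int k) + Q (1 / 2) * (eul (k - 1) * Q (of_int (k - 1))))
      (\<lambda>z. G (Q 1 * z) + Q (1 / 2) * (z powi 1 * G (Q 1 * z))) (- {0})"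
    by (intro has_laurent_add G1 has_laurent_cmult has_laurent_shift[OF G1])
  then have "has_laurent eul (\<lambda>z. G (Q 1 * z) + Q (1 / 2) * (z powi 1 * G (Q 1 * z))) (- {0})"
    by (simp only: eul_rec[symmetric])
  from has_laurent_value_unique[OF G_has_laurent this, of z] z
  show ?thesis by (simp add: algebra_simps)
qed

lemma G_prod: "z \<noteq> 0 \<Longrightarrow> G z = (\<Prod>n<K. 1 + z * Q (real n + 1 / 2)) * G (z * Q (real K))"
proof (induction K)
  case (Suc K)
  have "G (z * Q (real K)) = (1 + z * Q (real K) * Q (1 / 2)) * G (z * Q (real K) * Q 1)"
    using Suc.prems by (intro G_rec) simp
  also have "z * Q (real K) * Q 1 = z * Q (real (Suc K))"
    by (simp add: mult.assoc qpow_mult add.commute)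
  also have "z * Q (real K) * Q (1 / 2) = z * Q (real K + 1 / 2)"
    by (simp add: mult.assoc qpow_mult)
  finally show ?case using Suc by (simp add: mult.assoc)
qed simp

text \<open>The coefficients vanish for k < 0 and \<open>eul 0 = 1\<close>, so every remaining term
  contains at least one factor w.\<close>

lemma norm_G_minus_1: "\<exists>b. \<forall>w. w \<noteq> 0 \<longrightarrow> norm w \<le> 1 \<longrightarrow> norm (G w - 1) \<le> b * norm w"
proof (intro exI allI impI)
  fix w :: complex assume w: "w \<noteq> 0" "norm w \<le> 1"
  have eul0: "eul 0 = 1" by (simp add: eul_def eps_def qp_def)
  have s: "((\<lambda>k. eul k * z powi k) has_sum G z) UNIV" if "z \<noteq> 0" for z
    using has_laurentD[OF G_has_laurent, of z] that by simp
  have 1: "((\<lambda>k. eul k * w powi k) has_sum G w - 1) (UNIV - {0})"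
    using has_sum_Diff[OF s[OF w(1)], of "{0}" 1] by (simp add: eul0 has_sum_finiteI)
  have "eul summable_on UNIV" using has_sum_imp_summable[OF s[of 1]] by simp
  then have "eul summable_on (UNIV - {0})" by (rule summable_on_subset_banach) simp
  then have "(\<lambda>k. norm (eul k)) summable_on (UNIV - {0})"
    by (simp only: summable_on_iff_abs_summable_on_complex)
  then have "((\<lambda>k. norm (eul k) * norm w) has_sum (\<Sum>\<^sub>\<infinity>k\<in>UNIV - {0}. norm (eul k)) * norm w) (UNIV - {0})"
    by (intro has_sum_cmult_left has_sum_infsum)
  with 1 show "norm (G w - 1) \<le> (\<Sum>\<^sub>\<infinity>k\<in>UNIV - {0}. norm (eul k)) * norm w"
  proof (rule norm_infsum_le)
    fix k :: int assume k: "k \<in> UNIV - {0}"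
    show "norm (eul k * w powi k) \<le> norm (eul k) * norm w"
    proof (cases "k > 0")
      case True
      then obtain n where n: "k = int (Suc n)"
        by (metis gr0_implies_Suc zero_less_imp_eq_int)
      have "norm w * norm w ^ n \<le> norm w * 1"
        using w by (intro mult_left_mono power_le_one) auto
      then show ?thesis
        unfolding n norm_mult norm_power_int by (intro mult_left_mono) (auto simp: nat_add_distrib power_int_def)
    next
      case False
      then have "eul k = 0" using k by (simp add: eul_def eps_def)
      then show ?thesis by simp
    qed
  qed
qed

lemma G_tendsto_0:
  assumes z: "z \<noteq> 0"
  shows "(\<lambda>K. G (z * Q (real K))) \<longlonglongrightarrow> 1"
proof -
  obtain b where b: "\<And>w. w \<noteq> 0 \<Longrightarrow> norm w \<le> 1 \<Longrightarrow> norm (G w - 1) \<le> b * norm w"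
    using norm_G_minus_1 by blast
  have lim: "(\<lambda>K. norm (z * Q (real K))) \<longlonglongrightarrow> 0"
  proof -
    have "(\<lambda>K. norm z * p ^ K) \<longlonglongrightarrow> norm z * 0"
      using p_pos p_less_1 by (intro tendsto_intros LIMSEQ_realpow_zero) auto
    then show ?thesis using p_pos by (simp add: norm_mult norm_Q powr_realpow)
  qed
  have ev: "\<forall>\<^sub>F K in sequentially. norm (z * Q (real K)) < 1"
    using lim by (rule order_tendstoD) simp
  have "(\<lambda>K. G (z * Q (real K)) - 1) \<longlonglongrightarrow> 0"
  proof (rule Lim_null_comparison)
    show "\<forall>\<^sub>F K in sequentially. norm (G (z * Q (real K)) - 1) \<le> b * norm (z * Q (real K))"
      using ev by eventually_elim (use z in \<open>auto intro: b\<close>)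
    show "(\<lambda>K. b * norm (z * Q (real K))) \<longlonglongrightarrow> 0"
      using tendsto_mult_right_zero[OF lim] .
  qed
  then show ?thesis by (simp add: LIM_zero_iff)
qed

text \<open>Iterating \<open>G_rec\<close> splits off the first K factors, and the remaining
  \<open>G (z * Q (real K))\<close> tends to 1.\<close>

lemma G_tendsto:
  assumes z: "z \<noteq> 0"
  shows "(\<lambda>K. \<Prod>n<K. 1 + z * Q (real n + 1 / 2)) \<longlonglongrightarrow> G z"
proof -
  have "\<forall>\<^sub>F K in sequentially. G (z * Q (real K)) \<noteq> 0"
    using tendsto_imp_eventually_ne[OF G_tendsto_0[OF z], of 0] by simp
  then have ev: "\<forall>\<^sub>F K in sequentially. G z / G (z * Q (real K)) = (\<Prod>n<K. 1 + z * Q (real n + 1 / 2))"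
  proof eventually_elim
    case (elim K)
    then show ?case using G_prod[OF z, of K] by simp
  qed
  have "(\<lambda>K. G z / G (z * Q (real K))) \<longlonglongrightarrow> G z / 1"
    by (intro tendsto_divide tendsto_const G_tendsto_0 z) simp
  then show ?thesis using ev by (simp add: Lim_transform_eventually)
qed

subsection \<open>The triple product\<close>

definition jc :: "int \<Rightarrow> complex" where "jc k = (\<Sum>\<^sub>\<infinity>i. eul i * eul (- (k - i)))"

lemma jc_has_laurent: "has_laurent jc (\<lambda>z. G z * G (inverse z)) (- {0})"
proof -
  have "has_laurent (\<lambda>k. eul (- k)) (\<lambda>z. G (inverse z)) (- {0})"
    by (rule has_laurent_inverse[OF G_has_laurent]) auto
  from has_laurent_mult[OF G_has_laurent this] show ?thesis unfolding jc_def .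
qed

text \<open>Passing from z to q z removes the factor 1 + z q^(1/2) from the first \<open>G\<close>
  and adds 1 + 1/(z q^(1/2)) to the second. The quotient of the two is the monomial 1/(z q^(1/2)),
  so the coefficients satisfy a two-term recursion.\<close>

lemma jc_rec: "jc k = Q (of_int k - 1 / 2) * jc (k - 1)"
proof -
  let ?F = "\<lambda>z. G z * G (inverse z)"
  have F1: "has_laurent (\<lambda>k. jc k * Q (of_int k)) (\<lambda>z. ?F (Q 1 * z)) (- {0})"
    by (rule has_laurent_cong[OF has_laurent_scale[OF jc_has_laurent, of "Q 1"]])
      (auto simp: qpow_powi)
  have "has_laurent (\<lambda>k. Q (1 / 2) * (jc (k - 1) * Q (of_int (k - 1))))
      (\<lambda>z. Q (1 / 2) * (z powi 1 * ?F (Q 1 * z))) (- {0})"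
    by (intro has_laurent_cmult has_laurent_shift[OF F1])
  then have "has_laurent (\<lambda>k. Q (1 / 2) * (jc (k - 1) * Q (of_int (k - 1)))) ?F (- {0})"
  proof (rule has_laurent_cong)
    fix z :: complex assume "z \<in> - {0}"
    then have z: "z \<noteq> 0" by simp
    have "G (inverse (Q 1 * z)) = (1 + inverse (Q 1 * z) * Q (1 / 2)) * G (inverse (Q 1 * z) * Q 1)"
      using z by (intro G_rec) simp
    moreover have "inverse (Q 1 * z) * Q (1 / 2) * (z * Q (1 / 2)) = 1"
      using z qpow_mult[of \<tau> "1 / 2" "1 / 2"] by (simp add: field_simps)
    moreover have "inverse (Q 1 * z) * Q 1 = inverse z" using z by (simp add: field_simps)
    ultimately have "z * Q (1 / 2) * G (inverse (Q 1 * z)) = (1 + z * Q (1 / 2)) * G (inverse z)"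
      by (simp add: algebra_simps)
    then have "Q (1 / 2) * (z powi 1 * ?F (Q 1 * z)) = ((1 + z * Q (1 / 2)) * G (z * Q 1)) * G (inverse z)"
      by (simp add: mult_ac)
    then show "Q (1 / 2) * (z powi 1 * ?F (Q 1 * z)) = ?F z"
      using G_rec[OF z] by simp
  qed simp
  then have "jc k = Q (1 / 2) * (jc (k - 1) * Q (of_int (k - 1)))"
    by (rule has_laurent_coeff_unique[OF jc_has_laurent, where r = 1]) auto
  also have "\<dots> = Q (of_int k - 1 / 2) * jc (k - 1)"
    using qpow_mult[of \<tau> "1 / 2" "of_int (k - 1)"] by (simp add: algebra_simps)
  finally show ?thesis .
qed

lemma jc_conv: "jc k = Q ((of_int k)\<^sup>2 / 2) * jc 0"
proof (induction k rule: int_induct[where k = 0])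
  case (step1 i)
  have "jc (i + 1) = Q (of_int (i + 1) - 1 / 2) * Q ((of_int i)\<^sup>2 / 2) * jc 0"
    using jc_rec[of "i + 1"] step1.IH by (simp add: mult.assoc)
  also have "Q (of_int (i + 1) - 1 / 2) * Q ((of_int i)\<^sup>2 / 2) = Q ((of_int (i + 1))\<^sup>2 / 2)"
    unfolding qpow_mult by (rule arg_cong[of _ _ Q]) (simp add: power2_eq_square field_simps)
  finally show ?case .
next
  case (step2 i)
  have e: "Q ((of_int (i - 1))\<^sup>2 / 2) * jc 0 * Q (of_int i - 1 / 2) = Q ((of_int i)\<^sup>2 / 2) * jc 0"
  proof -
    have "Q ((of_int (i - 1))\<^sup>2 / 2) * Q (of_int i - 1 / 2) = Q ((of_int i)\<^sup>2 / 2)"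
      unfolding qpow_mult by (rule arg_cong[of _ _ Q]) (simp add: power2_eq_square field_simps)
    then show ?thesis by (simp add: mult_ac)
  qed
  have "jc (i - 1) * Q (of_int i - 1 / 2) = jc i"
    by (subst jc_rec[of i]) (rule mult.commute)
  then have "jc (i - 1) * Q (of_int i - 1 / 2) = Q ((of_int (i - 1))\<^sup>2 / 2) * jc 0 * Q (of_int i - 1 / 2)"
    unfolding e step2.IH .
  then show ?case by (rule mult_right_cancel[THEN iffD1, rotated]) simp
qed simp

text \<open>The constant of proportionality is the limit of \<open>q\<^bsup>-K\<^sup>2/2\<^esup>\<close> times the \<open>K\<close>-th coefficient.\<close>

lemma jc_0: "jc 0 = inverse phi"
proof -
  define b where "b = (\<Sum>\<^sub>\<infinity>i. norm (eul i))"
  have s1: "(eul has_sum G 1) UNIV"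
    using has_laurentD[OF G_has_laurent, of 1] by simp
  have "(\<lambda>k. norm (eul k)) summable_on UNIV"
    using has_sum_imp_summable[OF s1] by (simp only: summable_on_iff_abs_summable_on_complex)
  then have sn: "((\<lambda>i. norm (eul i)) has_sum b) UNIV"
    unfolding b_def by (rule has_sum_infsum)
  have sn': "(\<lambda>k. norm (eul k)) summable_on (UNIV - {0})"
    using has_sum_imp_summable[OF sn] by (rule summable_on_subset_banach) simp
  \<comment> \<open>After a shift of the index, the term i = 0 is \<open>eps (int K)\<close>, which
    tends to the inverse of \<open>phi\<close>; terms with i < 0 vanish and those with i > 0 carry a
    factor q^(iK).\<close>
  have est: "norm (jc 0 - eps (int K)) \<le> eps_bound * b * p ^ K" for K
  proof -
    have sm: "(\<lambda>i. eul i * eul (- (int K - i))) summable_on UNIV"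
    proof (rule summable_on_bounded_mult[OF has_sum_imp_summable[OF s1]])
      show "norm (eul (- (int K - i))) \<le> eps_bound" for i
        using norm_eps[of "- (int K - i)"] norm_Q_le_1[of "(of_int (- (int K - i)))\<^sup>2 / 2"]
          mult_mono[of "norm (Q ((of_int (- (int K - i)))\<^sup>2 / 2))" 1 "norm (eps (- (int K - i)))" eps_bound]
        by (simp add: eul_def norm_mult)
    qed
    have 1: "((\<lambda>i. Q (- ((real K)\<^sup>2 / 2)) * (eul i * eul (- (int K - i)))) has_sum jc 0) UNIV"
    proof -
      have "((\<lambda>i. Q (- ((real K)\<^sup>2 / 2)) * (eul i * eul (- (int K - i)))) has_sum
          Q (- ((real K)\<^sup>2 / 2)) * jc (int K)) UNIV"
        unfolding jc_def by (intro has_sum_cmult_right has_sum_infsum sm)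
      also have "Q (- ((real K)\<^sup>2 / 2)) * jc (int K) = jc 0"
        by (subst jc_conv) (simp add: qpow_minus)
      finally show ?thesis .
    qed
    have e: "Q (- ((real K)\<^sup>2 / 2)) * (eul (i + int K) * eul i)
        = eps (i + int K) * (eul i * Q (of_int i * real K + (of_int i)\<^sup>2 / 2))" for i
    proof -
      have "Q (- ((real K)\<^sup>2 / 2)) * Q ((of_int (i + int K))\<^sup>2 / 2) = Q (of_int i * real K + (of_int i)\<^sup>2 / 2)"
        unfolding qpow_mult by (rule arg_cong[of _ _ Q]) (simp add: power2_eq_square field_simps)
      then have "Q (- ((real K)\<^sup>2 / 2)) * eul (i + int K) = eps (i + int K) * Q (of_int i * real K + (of_int i)\<^sup>2 / 2)"
        by (simp add: eul_def mult.commute mult.left_commute)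
      then show ?thesis by (metis mult.assoc mult.commute)
    qed
    have 2: "((\<lambda>i. eps (i + int K) * (eul i * Q (of_int i * real K + (of_int i)\<^sup>2 / 2))) has_sum jc 0) UNIV"
      using has_sum_int_shift[OF 1, of "- int K"] by (simp add: e)
    have 3: "((\<lambda>i. eps (i + int K) * (eul i * Q (of_int i * real K + (of_int i)\<^sup>2 / 2))) has_sum
        jc 0 - eps (int K)) (UNIV - {0})"
      using has_sum_Diff[OF 2, of "{0}" "eps (int K)"]
      by (simp add: has_sum_finiteI eul_def eps_def qp_def)
    have 4: "((\<lambda>i. norm (eul i) * (eps_bound * p ^ K)) has_sum
        (\<Sum>\<^sub>\<infinity>i\<in>UNIV - {0}. norm (eul i)) * (eps_bound * p ^ K)) (UNIV - {0})"
      by (intro has_sum_cmult_left has_sum_infsum sn')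
    have "norm (jc 0 - eps (int K)) \<le> (\<Sum>\<^sub>\<infinity>i\<in>UNIV - {0}. norm (eul i)) * (eps_bound * p ^ K)"
    proof (rule norm_infsum_le[OF 3 4])
      fix i :: int assume i: "i \<in> UNIV - {0}"
      show "norm (eps (i + int K) * (eul i * Q (of_int i * real K + (of_int i)\<^sup>2 / 2)))
          \<le> norm (eul i) * (eps_bound * p ^ K)"
      proof (cases "i > 0")
        case True
        have "real K \<le> of_int i * real K"
          using True mult_right_mono[of 1 "real_of_int i" "real K"] by simp
        then have "real K \<le> of_int i * real K + (of_int i)\<^sup>2 / 2" by (simp add: add_increasing2)
        from norm_Q_mono[OF this] have "norm (Q (of_int i * real K + (of_int i)\<^sup>2 / 2)) \<le> p ^ K"
          using p_pos by (simp add: norm_Q powr_realpow)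
        then have "norm (eps (i + int K)) * norm (Q (of_int i * real K + (of_int i)\<^sup>2 / 2)) \<le> eps_bound * p ^ K"
          using norm_eps eps_bound_nonneg by (intro mult_mono) auto
        then have "norm (eul i) * (norm (eps (i + int K)) * norm (Q (of_int i * real K + (of_int i)\<^sup>2 / 2)))
            \<le> norm (eul i) * (eps_bound * p ^ K)"
          by (rule mult_left_mono) simp
        then show ?thesis by (simp add: norm_mult mult_ac)
      next
        case False
        then have "eul i = 0" using i by (simp add: eul_def eps_def)
        then show ?thesis by simp
      qed
    qed
    also have "(\<Sum>\<^sub>\<infinity>i\<in>UNIV - {0}. norm (eul i)) \<le> b"
      unfolding b_def by (rule infsum_mono2[OF sn' has_sum_imp_summable[OF sn]]) auto
    then have "(\<Sum>\<^sub>\<infinity>i\<in>UNIV - {0}. norm (eul i)) * (eps_bound * p ^ K) \<le> b * (eps_bound * p ^ K)"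
      using eps_bound_nonneg p_pos by (intro mult_right_mono) auto
    finally show ?thesis by (simp add: mult_ac)
  qed
  have "(\<lambda>K. eps_bound * b * p ^ K) \<longlonglongrightarrow> eps_bound * b * 0"
    using p_pos p_less_1 by (intro tendsto_intros LIMSEQ_realpow_zero) auto
  then have "(\<lambda>K. eps_bound * b * p ^ K) \<longlonglongrightarrow> 0" by simp
  with always_eventually[OF allI[OF est]] have "(\<lambda>K. jc 0 - eps (int K)) \<longlonglongrightarrow> 0"
    by (rule Lim_null_comparison)
  then have "(\<lambda>K. jc 0 - (jc 0 - eps (int K))) \<longlonglongrightarrow> jc 0 - 0"
    by (intro tendsto_diff tendsto_const)
  then have "(\<lambda>K. inverse (qp K)) \<longlonglongrightarrow> jc 0" by (simp add: eps_def)
  moreover have "(\<lambda>K. inverse (qp K)) \<longlonglongrightarrow> inverse phi"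
    using qp_tendsto phi_nonzero by (rule tendsto_inverse)
  ultimately show ?thesis by (rule LIMSEQ_unique)
qed

theorem triple_product:
  assumes "z \<noteq> 0"
  shows "th z = phi * (G z * G (inverse z))"
proof -
  have "has_laurent (\<lambda>k. phi * jc k) (\<lambda>z. phi * (G z * G (inverse z))) (- {0})"
    by (rule has_laurent_cmult[OF jc_has_laurent])
  moreover have "phi * jc k = Q ((of_int k)\<^sup>2 / 2)" for k
    using phi_nonzero by (subst jc_conv) (simp add: jc_0)
  ultimately have "has_laurent (\<lambda>k. Q ((of_int k)\<^sup>2 / 2)) (\<lambda>z. phi * (G z * G (inverse z))) (- {0})"
    by simp
  from has_laurent_value_unique[OF th_has_laurent this, of z] assms show ?thesis by simp
qed

text \<open>The theta function vanishing at u = 1 with \<open>phi * (1 - u)\<close> divided out, see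
  \<open>th_Bl\<close>. Its inverse is also the partition function of two even generators of
  opposite torus weight.\<close>

definition Bl :: "complex \<Rightarrow> complex" where
  "Bl u = G (- Q (1 / 2) * u) * G (- Q (1 / 2) * inverse u)"

lemma th_Bl:
  assumes u: "u \<noteq> 0"
  shows "th (- Q (- 1 / 2) * u) = phi * ((1 - u) * Bl u)"
proof -
  have 1: "- Q (- 1 / 2) * u * Q (1 / 2) = - u"
    using qpow_mult[of \<tau> "- 1 / 2" "1 / 2"] by simp
  have 2: "- Q (- 1 / 2) * u * Q 1 = - Q (1 / 2) * u"
    using qpow_mult[of \<tau> "- 1 / 2" 1] by simp
  have 3: "inverse (- Q (- 1 / 2) * u) = - Q (1 / 2) * inverse u"
    using qpow_minus[of \<tau> "1 / 2"] by simp
  have "G (- Q (- 1 / 2) * u) = (1 + - Q (- 1 / 2) * u * Q (1 / 2)) * G (- Q (- 1 / 2) * u * Q 1)"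
    using u by (intro G_rec) simp
  then have "G (- Q (- 1 / 2) * u) = (1 - u) * G (- Q (1 / 2) * u)"
    unfolding 1 2 by simp
  then show ?thesis
    using triple_product[of "- Q (- 1 / 2) * u"] u unfolding 3 Bl_def by simp
qed

lemma Bl_laurent: "\<exists>bl. has_laurent bl Bl (- {0})"
proof -
  have 1: "has_laurent (\<lambda>k. eul k * (- Q (1 / 2)) powi k) (\<lambda>u. G (- Q (1 / 2) * u)) (- {0})"
    by (rule has_laurent_scale[OF G_has_laurent]) auto
  have 2: "has_laurent (\<lambda>k. eul (- k) * (- Q (1 / 2)) powi (- k)) (\<lambda>u. G (- Q (1 / 2) * inverse u)) (- {0})"
    by (rule has_laurent_inverse[OF 1]) auto
  show ?thesis using has_laurent_mult[OF 1 2] unfolding Bl_def by blast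
qed

lemma Bl_1: "Bl 1 = phi ^ 2"
proof -
  have e: "- Q (1 / 2) * Q (real n + 1 / 2) = - Q (real (Suc n))" for n
    using qpow_mult[of \<tau> "1 / 2" "real n + 1 / 2"] by (simp add: algebra_simps)
  have "(\<lambda>K. \<Prod>n<K. 1 + - Q (1 / 2) * Q (real n + 1 / 2)) \<longlonglongrightarrow> G (- Q (1 / 2))"
    by (rule G_tendsto) simp
  then have "qp \<longlonglongrightarrow> G (- Q (1 / 2))"
    unfolding e qp_def[abs_def] by simp
  then have "G (- Q (1 / 2)) = phi" using qp_tendsto LIMSEQ_unique by blast
  then show ?thesis by (simp add: Bl_def power2_eq_square)
qed

end

section \<open>Evaluation of the constant \<open>J\<close> by continuation to u = 1\<close>

lemma has_sum_minus:
  fixes f g :: "'a \<Rightarrow> complex"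
  assumes "(f has_sum a) A" "(g has_sum b) A"
  shows "((\<lambda>x. f x - g x) has_sum a - b) A"
  using has_sum_add[OF assms(1) has_sum_uminusI[OF assms(2)]] by simp

lemma has_sum_telescope_int:
  fixes g :: "int \<Rightarrow> complex"
  assumes s: "(\<lambda>i. g i - g (i - 1)) summable_on UNIV"
    and lim: "(\<lambda>n. g (int n)) \<longlonglongrightarrow> L" "(\<lambda>n. g (- int n)) \<longlonglongrightarrow> L'"
  shows "((\<lambda>i. g i - g (i - 1)) has_sum L - L') UNIV"
proof (rule has_sum_exhaustion[OF s])
  let ?B = "\<lambda>n. {- int n..int n}"
  have sum: "(\<Sum>i\<in>?B n. g i - g (i - 1)) = g (int n) - g (- int (Suc n))" for n
  proof (induction n)
    case (Suc n)
    have "?B (Suc n) = insert (int (Suc n)) (insert (- int (Suc n)) (?B n))" by auto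
    then show ?case using Suc.IH by (simp add: algebra_simps)
  qed simp
  show "((\<lambda>i. g i - g (i - 1)) has_sum g (int n) - g (- int (Suc n))) (?B n)" for n
    by (rule has_sum_finiteI) (simp_all only: sum finite_atLeastAtMost_int)
  show "incseq ?B" by (auto simp: incseq_def)
  show "(\<Union>n. ?B n) = UNIV"
  proof -
    have "i \<in> ?B (nat \<bar>i\<bar>)" for i by auto
    then show ?thesis by blast
  qed
  show "(\<lambda>n. g (int n) - g (- int (Suc n))) \<longlonglongrightarrow> L - L'"
    using lim(1) LIMSEQ_Suc[OF lim(2)] by (rule tendsto_diff)
qed auto

lemma LIMSEQ_geometric_bound:
  fixes f :: "nat \<Rightarrow> complex"
  assumes "\<And>n. norm (f n - L) \<le> c * a ^ n" "0 \<le> a" "a < 1"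
  shows "f \<longlonglongrightarrow> L"
proof -
  have "(\<lambda>n. c * a ^ n) \<longlonglongrightarrow> c * 0"
    using assms by (intro tendsto_intros LIMSEQ_realpow_zero) auto
  then have "(\<lambda>n. c * a ^ n) \<longlonglongrightarrow> 0" by simp
  with always_eventually[OF allI[OF assms(1)]] have "(\<lambda>n. f n - L) \<longlonglongrightarrow> 0"
    by (rule Lim_null_comparison)
  then show ?thesis by (rule LIM_zero_cancel)
qed

context nome
begin

text \<open>Coefficients of (1 - u) \<open>e0 u\<close>. The factor 1 - u removes the pole at u = 1,
  so these decay in both directions and converge on the unit circle.\<close>

definition mc :: "int \<Rightarrow> complex" where "mc k = lc k - lc (k - 1)"

text \<open>Both terms are rewritten by \<open>lc_rec\<close>; the constants 1 cancel and each
  remainder carries at least a factor q^k.\<close>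

lemma norm_mc_pos: "norm (mc (int k)) \<le> 2 * lc_bound * p ^ k"
proof -
  have a: "lc (int k) = 1 - Q (of_int (int k + 1)) * lc (int k + 1)" by (rule lc_rec)
  have b: "lc (int k - 1) = 1 - Q (of_int (int k)) * lc (int k)"
    using lc_rec[of "int k - 1"] by simp
  have "mc (int k) = Q (of_int (int k)) * lc (int k) - Q (of_int (int k + 1)) * lc (int k + 1)"
    unfolding mc_def b by (subst a) simp
  then have "norm (mc (int k)) \<le> norm (Q (of_int (int k)) * lc (int k)) + norm (Q (of_int (int k + 1)) * lc (int k + 1))"
    by (simp only: norm_triangle_ineq4)
  also have "\<dots> \<le> p ^ k * lc_bound + p ^ k * lc_bound"
  proof (intro add_mono)
    have 1: "norm (Q (of_int (int k))) \<le> p ^ k" using p_pos by (simp add: norm_Q powr_realpow)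
    have "norm (Q (of_int (int k + 1))) \<le> norm (Q (of_int (int k)))" by (rule norm_Q_mono) simp
    with 1 have 2: "norm (Q (of_int (int k + 1))) \<le> p ^ k" by linarith
    show "norm (Q (of_int (int k)) * lc (int k)) \<le> p ^ k * lc_bound"
      unfolding norm_mult using 1 norm_lc p_pos by (intro mult_mono) auto
    show "norm (Q (of_int (int k + 1)) * lc (int k + 1)) \<le> p ^ k * lc_bound"
      unfolding norm_mult using 2 norm_lc p_pos by (intro mult_mono) auto
  qed
  finally show ?thesis by (simp add: mult_ac)
qed

lemma norm_mc_neg: "norm (mc (- int k)) \<le> 2 * lc_bound * p ^ k"
proof -
  have Suc_int: "- int (Suc k) = - int k - 1" by simp
  have "norm (mc (- int k)) \<le> norm (lc (- int k)) + norm (lc (- int (Suc k)))"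
    unfolding mc_def Suc_int by (rule norm_triangle_ineq4)
  also have "\<dots> \<le> lc_bound * p ^ k + lc_bound * p ^ Suc k"
    by (intro add_mono norm_lc_neg)
  also have "lc_bound * p ^ Suc k \<le> lc_bound * p ^ k"
    using p_pos p_less_1 lc_bound_nonneg by (intro mult_left_mono) (auto simp: mult_left_le_one_le)
  finally show ?thesis by simp
qed

text \<open>The partial sums telescope: \<open>lc\<close> tends to 1 at plus infinity and to 0 at
  minus infinity.\<close>

lemma mc_has_sum: "(mc has_sum 1) UNIV"
proof -
  have s: "mc summable_on UNIV"
    by (rule summable_on_geometric_int[OF norm_mc_pos norm_mc_neg]) (use p_pos p_less_1 in auto)
  have "(\<lambda>n. lc (int n)) \<longlonglongrightarrow> 1"
  proof (rule LIMSEQ_geometric_bound)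
    fix n
    have "norm (Q (of_int (int n + 1))) \<le> norm (Q (real n))" by (rule norm_Q_mono) simp
    also have "\<dots> = p ^ n" using p_pos by (simp add: norm_Q powr_realpow)
    finally have "norm (Q (of_int (int n + 1)) * lc (int n + 1)) \<le> lc_bound * p ^ n"
      unfolding norm_mult using norm_lc[of "int n + 1"] lc_bound_nonneg
      by (subst mult.commute) (intro mult_mono, auto)
    moreover have "lc (int n) - 1 = - (Q (of_int (int n + 1)) * lc (int n + 1))"
      by (subst lc_rec) simp
    ultimately show "norm (lc (int n) - 1) \<le> lc_bound * p ^ n" by (simp only: norm_minus_cancel)
  qed (use p_pos p_less_1 in auto)
  moreover have "(\<lambda>n. lc (- int n)) \<longlonglongrightarrow> 0"
    by (rule LIMSEQ_geometric_bound[of _ _ lc_bound p]) (use norm_lc_neg p_pos p_less_1 in auto)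
  ultimately show ?thesis
    using has_sum_telescope_int[of lc 1 0] s by (simp add: mc_def[abs_def])
qed

definition ann2 :: "complex set" where "ann2 = {u. p < norm u \<and> p * norm u < 1}"

definition mf :: "complex \<Rightarrow> complex" where "mf u = (\<Sum>\<^sub>\<infinity>k. mc k * u powi k)"

lemma mf_has_laurent: "has_laurent mc mf ann2"
  unfolding has_laurent_def
proof (intro conjI ballI)
  show "0 \<notin> ann2" using p_pos by (simp add: ann2_def)
  fix u assume u: "u \<in> ann2"
  then have nz: "norm u > 0" using p_pos by (auto simp: ann2_def)
  have "(\<lambda>k. mc k * u powi k) summable_on UNIV"
  proof (rule summable_on_geometric_int[where c = "2 * lc_bound" and a = "p * norm u" and b = "p / norm u"])
    show "norm (mc (int k) * u powi int k) \<le> 2 * lc_bound * (p * norm u) ^ k" for k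
      using mult_right_mono[OF norm_mc_pos[of k], of "norm u ^ k"]
      by (simp add: norm_mult norm_power power_mult_distrib mult.assoc)
    show "norm (mc (- int k) * u powi - int k) \<le> 2 * lc_bound * (p / norm u) ^ k" for k
      using mult_right_mono[OF norm_mc_neg[of k], of "inverse (norm u ^ k)"]
      by (simp add: norm_mult norm_power power_int_minus norm_inverse divide_inverse
          power_mult_distrib power_inverse mult.assoc)
  qed (use u p_pos nz in \<open>auto simp: ann2_def\<close>)
  then show "((\<lambda>k. mc k * u powi k) has_sum mf u) UNIV"
    unfolding mf_def by (rule has_sum_infsum)
qed

lemma ann_ann2: "ann \<subseteq> ann2"
proof
  fix u assume "u \<in> ann"
  moreover from this have "p * norm u < 1"
    using p_pos p_less_1 mult_strict_mono[of p 1 "norm u" 1] by (auto simp: ann_def)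
  ultimately show "u \<in> ann2" by (simp add: ann_def ann2_def)
qed

lemma mf_conv: "u \<in> ann \<Longrightarrow> mf u = (1 - u) * e0 u"
proof -
  assume u: "u \<in> ann"
  have 1: "has_laurent mc (\<lambda>u. e0 u - u powi 1 * e0 u) ann"
    unfolding mc_def[abs_def]
    by (intro has_laurent_diff e0_has_laurent has_laurent_shift[OF e0_has_laurent])
  from has_laurent_value_unique[OF has_laurent_subset[OF mf_has_laurent ann_ann2] 1 u]
  show ?thesis by (simp add: algebra_simps)
qed

text \<open>The geometric mean of the two radii of \<open>ann\<close>; its circle is used to compare
  coefficients on \<open>ann\<close>.\<close>

definition r0 :: real where "r0 = sqrt p"

lemma r0: "0 < r0" "p < r0" "r0 < 1" "norm z = r0 \<Longrightarrow> z \<in> ann"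
proof -
  show a: "0 < r0" and b: "r0 < 1" using p_pos p_less_1 by (auto simp: r0_def)
  have "p = r0 * r0" using p_pos by (simp add: r0_def)
  then show c: "p < r0" using a b by simp
  show "norm z = r0 \<Longrightarrow> z \<in> ann" using b c by (simp add: ann_def)
qed

text \<open>On \<open>ann\<close> the product of \<open>mf\<close> and \<open>phi * Bl\<close> is
  theta times \<open>e0\<close>, hence \<open>J\<close>. Both sides are Laurent series on
  \<open>ann2\<close>, which contains 1, and there \<open>mf 1 = 1\<close> and
  \<open>Bl 1 = phi ^ 2\<close>.\<close>

lemma J_phi: "J = phi ^ 3"
proof -
  obtain bl where bl: "has_laurent bl Bl (- {0})" using Bl_laurent by blast
  have sub: "ann2 \<subseteq> - {0}" using p_pos by (auto simp: ann2_def)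
  have L: "has_laurent (\<lambda>k. \<Sum>\<^sub>\<infinity>i. mc i * (phi * bl (k - i))) (\<lambda>u. mf u * (phi * Bl u)) ann2"
    by (intro has_laurent_mult mf_has_laurent has_laurent_cmult has_laurent_subset[OF bl sub])
  have R: "has_laurent (\<lambda>k. if k = 0 then J else 0) (\<lambda>u. J) ann2"
    using sub by (auto simp: has_laurent_def intro!: has_sum_finite_neutralI[where B = "{0}"] split: if_splits)
  have "mf 1 * (phi * Bl 1) = J"
  proof (rule has_laurent_identity[OF L R r0(1)])
    show "z \<in> ann2" if "norm z = r0" for z using r0(4)[OF that] ann_ann2 by blast
    show "mf z * (phi * Bl z) = J" if "norm z = r0" for z
    proof -
      have z: "z \<in> ann" using that by (rule r0(4))
      then have "z \<noteq> 0" using ann_nonzero by auto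
      then show ?thesis using e0_theta[OF z] th_Bl[of z] mf_conv[OF z] by (simp add: mult_ac)
    qed
    show "1 \<in> ann2" using p_less_1 by (simp add: ann2_def)
  qed
  moreover have "mf 1 = 1" using infsumI[OF mc_has_sum] by (simp add: mf_def)
  ultimately show ?thesis
    unfolding power3_eq_cube by (simp add: Bl_1 power2_eq_square mult.assoc)
qed

lemma Bl_e0: "u \<in> ann \<Longrightarrow> Bl u \<noteq> 0" "u \<in> ann \<Longrightarrow> inverse (Bl u) = (1 - u) * e0 u / phi ^ 2"
proof -
  assume u: "u \<in> ann"
  then have "u \<noteq> 0" using ann_nonzero by auto
  then have e: "phi * ((1 - u) * Bl u) * e0 u = phi ^ 3"
    using e0_theta[OF u] th_Bl[of u] by (simp add: J_phi)
  then show nz: "Bl u \<noteq> 0" using phi_nonzero by auto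
  have "Bl u * ((1 - u) * e0 u) = phi ^ 2"
    using e phi_nonzero by (simp add: power3_eq_cube power2_eq_square mult_ac)
  then show "inverse (Bl u) = (1 - u) * e0 u / phi ^ 2"
    using nz phi_nonzero by (simp add: field_simps)
qed

text \<open>Jacobi's formula for the derivative of theta at its zero u = 1: theta is
  \<open>phi * ((1 - u) * Bl u)\<close>, so the derivative is \<open>- phi * Bl 1\<close>. It is
  carried out on coefficients, by writing \<open>tc\<close> as a difference and summing by
  parts.\<close>

lemma tc_weighted: "((\<lambda>n. of_int n * tc n) has_sum - (phi ^ 3)) UNIV"
proof -
  obtain bl where bl: "has_laurent bl Bl (- {0})" using Bl_laurent by blast
  have "has_laurent (\<lambda>k. phi * (bl k - bl (k - 1))) (\<lambda>u. phi * (Bl u - u powi 1 * Bl u)) (- {0})"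
    by (intro has_laurent_cmult has_laurent_diff bl has_laurent_shift[OF bl])
  then have L: "has_laurent (\<lambda>k. phi * (bl k - bl (k - 1))) (\<lambda>u. th (- Q (- 1 / 2) * u)) (- {0})"
  proof (rule has_laurent_cong)
    fix z :: complex assume "z \<in> - {0}"
    then have z: "z \<noteq> 0" by simp
    show "phi * (Bl z - z powi 1 * Bl z) = th (- Q (- 1 / 2) * z)"
      unfolding th_Bl[OF z] by (simp add: algebra_simps)
  qed simp
  have tc: "tc k = phi * (bl k - bl (k - 1))" for k
    by (rule has_laurent_coeff_unique[OF tc_has_laurent L, where r = 1]) auto
  \<comment> \<open>|n| is at most 2^n + 2^(-n), so absolute convergence at 2 and 1/2 dominates the
    weighted series.\<close>
  have s: "(\<lambda>n. of_int n * bl n) summable_on UNIV"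
  proof -
    have "(\<lambda>k. norm (bl k * z powi k)) summable_on UNIV" if "z \<noteq> 0" for z
      using has_sum_imp_summable[OF has_laurentD[OF bl, of z]] that
      by (simp add: summable_on_iff_abs_summable_on_complex)
    from summable_on_add[OF this[of 2] this[of "1 / 2"]]
    have "(\<lambda>k. norm (bl k * 2 powi k) + norm (bl k * (1 / 2) powi k)) summable_on UNIV" by simp
    then have "(\<lambda>n. norm (of_int n * bl n)) summable_on UNIV"
    proof (rule Infinite_Sum.abs_summable_on_comparison_test')
      fix k :: int
      have "\<bar>real_of_int k\<bar> \<le> 2 powi k + (1 / 2) powi k"
      proof (cases k rule: int_cases2)
        case (nonneg n)
        have "real n \<le> 2 ^ n" by (simp add: of_nat_less_two_power less_imp_le)
        then show ?thesis using nonneg by (simp add: add_increasing2)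
      next
        case (nonpos n)
        have "real n \<le> 2 ^ n" by (simp add: of_nat_less_two_power less_imp_le)
        then show ?thesis using nonpos by (simp add: add_increasing power_int_minus power_one_over)
      qed
      from mult_right_mono[OF this norm_ge_zero[of "bl k"]]
      show "norm (of_int k * bl k) \<le> norm (bl k * 2 powi k) + norm (bl k * (1 / 2) powi k)"
        by (simp add: norm_mult norm_power_int norm_divide algebra_simps)
    qed
    then show ?thesis by (rule abs_summable_summable)
  qed
  define S where "S = (\<Sum>\<^sub>\<infinity>n. of_int n * bl n)"
  have 1: "((\<lambda>n. of_int n * bl n) has_sum S) UNIV" using s by (simp add: S_def)
  have "(bl has_sum Bl 1) UNIV" using has_laurentD[OF bl, of 1] by simp
  note 2 = has_sum_int_shift[OF this, of 1]
  have "((\<lambda>n. phi * (of_int n * bl n - (of_int (n - 1) * bl (n - 1) + bl (n - 1)))) has_sum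
      phi * (S - (S + Bl 1))) UNIV"
    by (intro has_sum_cmult_right has_sum_minus has_sum_add 1 2 has_sum_int_shift[OF 1])
  moreover have "phi * (of_int n * bl n - (of_int (n - 1) * bl (n - 1) + bl (n - 1))) = of_int n * tc n" for n
    by (simp add: tc algebra_simps)
  ultimately show ?thesis by (simp add: Bl_1 power3_eq_cube power2_eq_square mult.assoc)
qed

subsection \<open>Partial fractions\<close>

definition dom :: "complex \<Rightarrow> bool" where
  "dom y \<longleftrightarrow> y \<noteq> 0 \<and> (\<forall>n::int. 1 + y * Q (of_int n + 1 / 2) \<noteq> 0)"

lemma dom_inverse: "dom y \<Longrightarrow> dom (inverse y)"
  unfolding dom_def
proof (intro conjI allI)
  assume y: "y \<noteq> 0 \<and> (\<forall>n::int. 1 + y * Q (of_int n + 1 / 2) \<noteq> 0)"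
  then show "inverse y \<noteq> 0" by simp
  fix n :: int
  have "1 + inverse y * Q (of_int n + 1 / 2) = inverse y * Q (of_int n + 1 / 2) * (1 + y * Q (of_int (- n - 1) + 1 / 2))"
    using y qpow_mult[of \<tau> "of_int n + 1 / 2" "of_int (- n - 1) + 1 / 2"] by (simp add: field_simps)
  moreover have "1 + y * Q (of_int (- n - 1) + 1 / 2) \<noteq> 0" using y by blast
  ultimately show "1 + inverse y * Q (of_int n + 1 / 2) \<noteq> 0" using y by simp
qed

text \<open>Kronecker's coefficients divided by \<open>th y\<close>. By \<open>pf_bound\<close> they
  tend to 1 at plus infinity and to 0 at minus infinity.\<close>

definition pf :: "complex \<Rightarrow> int \<Rightarrow> complex" where "pf y n = 1 / (1 + y * Q (of_int n + 1 / 2))"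

lemma pf_bound:
  assumes "dom y"
  shows "\<exists>b. \<forall>n. norm (pf y (int n) - 1) \<le> b * p ^ n \<and> norm (pf y (- int n)) \<le> b * p ^ n"
proof -
  have y: "y \<noteq> 0" and nz: "1 + y * Q (of_int n + 1 / 2) \<noteq> 0" for n :: int
    using assms by (auto simp: dom_def)
  have Q0: "(\<lambda>n. z * Q (real n)) \<longlonglongrightarrow> 0" for z
    by (rule LIMSEQ_geometric_bound[of _ _ "norm z" p])
      (use p_pos p_less_1 in \<open>auto simp: norm_mult norm_Q powr_realpow\<close>)
  have "(\<lambda>n. 1 / (1 + y * Q (1 / 2) * Q (real n))) \<longlonglongrightarrow> 1 / (1 + 0)"
    by (intro tendsto_divide tendsto_add tendsto_const Q0) simp
  then have "Bseq (\<lambda>n. 1 / (1 + y * Q (1 / 2) * Q (real n)))"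
    using convergentI convergent_imp_Bseq by blast
  then obtain b1 where b1: "\<And>n. norm (1 / (1 + y * Q (1 / 2) * Q (real n))) \<le> b1"
    unfolding Bseq_def by blast
  have "(\<lambda>n. 1 / (1 * Q (real n) + y * Q (1 / 2))) \<longlonglongrightarrow> 1 / (0 + y * Q (1 / 2))"
    by (intro tendsto_divide tendsto_add tendsto_const Q0) (use y in simp)
  then have "Bseq (\<lambda>n. 1 / (1 * Q (real n) + y * Q (1 / 2)))"
    using convergentI convergent_imp_Bseq by blast
  then obtain b2 where b2: "\<And>n. norm (1 / (1 * Q (real n) + y * Q (1 / 2))) \<le> b2"
    unfolding Bseq_def by blast
  define b where "b = max (norm y * norm (Q (1 / 2)) * b1) b2"
  have "norm (pf y (int n) - 1) \<le> b * p ^ n \<and> norm (pf y (- int n)) \<le> b * p ^ n" for n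
  proof
    have e: "y * Q (of_int (int n) + 1 / 2) = y * Q (1 / 2) * Q (real n)"
      by (simp add: mult.assoc qpow_mult add.commute)
    have "pf y (int n) - 1 = - (y * Q (1 / 2) * Q (real n) * (1 / (1 + y * Q (1 / 2) * Q (real n))))"
      using nz[of "int n"] unfolding pf_def e by (simp add: field_simps)
    then have "norm (pf y (int n) - 1) = norm y * norm (Q (1 / 2)) * norm (Q (real n)) * norm (1 / (1 + y * Q (1 / 2) * Q (real n)))"
      by (simp only: norm_minus_cancel norm_mult)
    also have "\<dots> \<le> norm y * norm (Q (1 / 2)) * norm (Q (real n)) * b1"
      by (intro mult_left_mono b1) auto
    also have "\<dots> = norm y * norm (Q (1 / 2)) * b1 * p ^ n"
      using p_pos by (simp add: norm_Q[of "real n"] powr_realpow mult_ac)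
    also have "\<dots> \<le> b * p ^ n" using p_pos by (intro mult_right_mono) (auto simp: b_def)
    finally show "norm (pf y (int n) - 1) \<le> b * p ^ n" .
    have e: "y * Q (of_int (- int n) + 1 / 2) * Q (real n) = y * Q (1 / 2)"
      by (simp add: mult.assoc qpow_mult)
    have e2: "(1 + y * Q (of_int (- int n) + 1 / 2)) * Q (real n) = 1 * Q (real n) + y * Q (1 / 2)"
      using e by (simp add: distrib_right)
    have "pf y (- int n) = Q (real n) * (1 / (1 * Q (real n) + y * Q (1 / 2)))"
      unfolding pf_def e2[symmetric] using nz[of "- int n"] by simp
    then have "norm (pf y (- int n)) = p ^ n * norm (1 / (1 * Q (real n) + y * Q (1 / 2)))"
      using p_pos by (simp only: norm_mult norm_Q powr_realpow)
    also have "\<dots> \<le> p ^ n * b2" using p_pos by (intro mult_left_mono b2) auto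
    also have "\<dots> \<le> p ^ n * b" using p_pos by (intro mult_left_mono) (auto simp: b_def)
    finally show "norm (pf y (- int n)) \<le> b * p ^ n" by (simp add: mult.commute)
  qed
  then show ?thesis by blast
qed

lemma pf_telescope: "dom y \<Longrightarrow> ((\<lambda>i. pf y i - pf y (i - 1)) has_sum 1) UNIV"
proof -
  assume y: "dom y"
  then obtain b where b: "\<And>n. norm (pf y (int n) - 1) \<le> b * p ^ n" "\<And>n. norm (pf y (- int n)) \<le> b * p ^ n"
    using pf_bound by blast
  have b0: "b \<ge> 0" using b(1)[of 0] norm_ge_zero order_trans[of 0 "norm (pf y (int 0) - 1)" b] by simp
  have "((\<lambda>i. pf y i - pf y (i - 1)) has_sum 1 - 0) UNIV"
  proof (rule has_sum_telescope_int)
    show "(\<lambda>n. pf y (int n)) \<longlonglongrightarrow> 1"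
      by (rule LIMSEQ_geometric_bound[OF b(1)]) (use p_pos p_less_1 in auto)
    show "(\<lambda>n. pf y (- int n)) \<longlonglongrightarrow> 0"
      by (rule LIMSEQ_geometric_bound[of _ _ b p]) (use b(2) p_pos p_less_1 in auto)
    \<comment> \<open>In the constant, \<open>b + b / p\<close> bounds the two terms of the
      difference separately, and the last summand covers k = 0, where k - 1 is negative
      already.\<close>
    show "(\<lambda>i. pf y i - pf y (i - 1)) summable_on UNIV"
    proof (rule summable_on_geometric_int[where c = "(b + b / p) + norm (pf y 0 - pf y (- 1))" and a = p and b = p])
      fix k
      have nn: "0 \<le> norm (pf y 0 - pf y (- 1)) * p ^ k" using p_pos by simp
      show "norm (pf y (int k) - pf y (int k - 1)) \<le> (b + b / p + norm (pf y 0 - pf y (- 1))) * p ^ k"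
      proof (cases k)
        case 0
        then show ?thesis using b0 p_pos by simp
      next
        case (Suc j)
        have "norm (pf y (int k) - pf y (int k - 1)) \<le> norm (pf y (int k) - 1) + norm (pf y (int j) - 1)"
          using norm_triangle_ineq4[of "pf y (int k) - 1" "pf y (int j) - 1"] Suc by simp
        also have "\<dots> \<le> b * p ^ k + b * p ^ j" by (intro add_mono b)
        also have "\<dots> = (b + b / p) * p ^ k" using p_pos Suc by (simp add: field_simps)
        finally show ?thesis using nn by (simp add: distrib_right)
      qed
      have Suc_int: "- int (Suc k) = - int k - 1" by simp
      have "norm (pf y (- int k) - pf y (- int k - 1)) \<le> norm (pf y (- int k)) + norm (pf y (- int (Suc k)))"
        unfolding Suc_int by (rule norm_triangle_ineq4)
      also have "\<dots> \<le> b * p ^ k + b * p ^ Suc k" by (intro add_mono b)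
      also have "b * p ^ Suc k \<le> b / p * p ^ k"
      proof -
        have "p \<le> 1 / p" using p_pos p_less_1 mult_mono[of p 1 p 1] by (simp add: field_simps)
        then have "b * p ^ k * p \<le> b * p ^ k * (1 / p)" using b0 p_pos by (intro mult_left_mono) auto
        then show ?thesis by (simp add: mult_ac)
      qed
      finally show "norm (pf y (- int k) - pf y (- int k - 1)) \<le> (b + b / p + norm (pf y 0 - pf y (- 1))) * p ^ k"
        using nn by (simp add: distrib_right)
    qed (use p_pos p_less_1 in auto)
  qed
  then show ?thesis by simp
qed

lemma pf_telescope_nat: "dom y \<Longrightarrow> ((\<lambda>i. pf y i - pf y (i - int N)) has_sum of_nat N) UNIV"
proof (induction N)
  case (Suc N)
  have "((\<lambda>i. (pf y i - pf y (i - int N)) + (pf y (i - int N) - pf y (i - int N - 1))) has_sum of_nat N + 1) UNIV"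
    by (rule has_sum_add[OF Suc.IH[OF Suc.prems] has_sum_int_shift[OF pf_telescope[OF Suc.prems], of "int N"]])
  then show ?case by (simp add: algebra_simps)
qed simp

definition W :: "complex \<Rightarrow> int \<Rightarrow> complex" where
  "W y k = (\<Sum>\<^sub>\<infinity>i. pf y i * pf (inverse y) (k - i))"

text \<open>With a = y q^(i+1/2) the second factor is a/(a + q^N). The poles a = -1 and a = -q^N are
  distinct because q^N differs from 1, so the product splits into simple fractions, the second being
  the first shifted by N in i.\<close>

lemma pf_product:
  assumes y: "dom y" and k: "N \<noteq> 0"
  shows "pf y i * pf (inverse y) (N - 1 - i) = (1 / (1 - Q (of_int N))) * (pf y i - pf y (i - N))"
proof -
  define a where "a = y * Q (of_int i + 1 / 2)"
  have y0: "y \<noteq> 0" using y by (simp add: dom_def)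
  have a0: "a \<noteq> 0" using y0 by (simp add: a_def)
  have n1: "1 + a \<noteq> 0" using y by (simp add: dom_def a_def)
  have e1: "inverse y * Q (of_int (N - 1 - i) + 1 / 2) = Q (of_int N) / a"
  proof -
    have "Q (of_int (N - 1 - i) + 1 / 2) * Q (of_int i + 1 / 2) = Q (of_int N)"
      unfolding qpow_mult by (rule arg_cong[of _ _ Q]) simp
    then show ?thesis using y0 unfolding a_def by (simp add: field_simps)
  qed
  have e2: "y * Q (of_int (i - N) + 1 / 2) = a / Q (of_int N)"
  proof -
    have "Q (of_int (i - N) + 1 / 2) * Q (of_int N) = Q (of_int i + 1 / 2)"
      unfolding qpow_mult by (rule arg_cong[of _ _ Q]) simp
    then show ?thesis unfolding a_def by (simp add: field_simps)
  qed
  have n2: "1 + a / Q (of_int N) \<noteq> 0"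
    using y unfolding e2[symmetric] by (simp only: dom_def simp_thms)
  have n3: "a + Q (of_int N) \<noteq> 0" using n2 by (simp add: field_simps)
  have n4: "1 - Q (of_int N) \<noteq> 0" using Q_ne_1[of "of_int N"] k by auto
  show ?thesis
    unfolding pf_def e1 e2 a_def[symmetric] using a0 n1 n3 n4
    by (simp add: divide_simps) (simp add: algebra_simps)
qed

text \<open>The telescoped sum over a shift by N equals N, one for each unit step.\<close>

lemma W_pos: "dom y \<Longrightarrow> N > 0 \<Longrightarrow> W y (int N - 1) = of_nat N / (1 - Q (real N))"
proof -
  assume y: "dom y" and N: "N > 0"
  have nz: "int N \<noteq> 0" using N by simp
  have "((\<lambda>i. pf y i * pf (inverse y) (int N - 1 - i)) has_sum (1 / (1 - Q (of_int (int N)))) * of_nat N) UNIV"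
    unfolding pf_product[OF y nz] by (rule has_sum_cmult_right[OF pf_telescope_nat[OF y]])
  then show ?thesis unfolding W_def by (subst infsumI) auto
qed

lemma W_m2: "dom y \<Longrightarrow> W y (- 2) = Q 1 / (1 - Q 1)"
proof -
  assume y: "dom y"
  have "((\<lambda>i. - (pf y (i + 1) - pf y (i + 1 - 1))) has_sum - 1) UNIV"
    using has_sum_uminusI[OF has_sum_int_shift[OF pf_telescope[OF y], of "- 1"]] by simp
  then have 1: "((\<lambda>i. pf y i - pf y (i - (- 1))) has_sum - 1) UNIV" by simp
  have 2: "pf y i * pf (inverse y) (- 1 - 1 - i) = 1 / (1 - Q (of_int (- 1))) * (pf y i - pf y (i - (- 1)))" for i
    by (rule pf_product[OF y]) simp
  have "((\<lambda>i. pf y i * pf (inverse y) (- 1 - 1 - i)) has_sum (1 / (1 - Q (of_int (- 1)))) * - 1) UNIV"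
    unfolding 2 by (rule has_sum_cmult_right[OF 1])
  from infsumI[OF this] have "W y (- 2) = 1 / (1 - Q (- 1)) * - 1" unfolding W_def by simp
  also have "\<dots> = Q 1 / (1 - Q 1)"
    using Q_ne_1[of 1] Q_ne_1[of "- 1"] by (simp add: qpow_minus divide_simps) (simp add: algebra_simps)
  finally show ?thesis .
qed

lemma W_has_laurent:
  assumes y: "dom y"
  shows "has_laurent (\<lambda>k. (th y)\<^sup>2 * W y k) (\<lambda>u. th (y * u) * th (inverse y * u) * (e0 u)\<^sup>2) ann"
proof -
  have 1: "has_laurent (\<lambda>n. th y * pf y n) (\<lambda>u. th (y * u) * e0 u) ann" if "dom y" for y
    using kronecker[of y] that by (simp add: dom_def pf_def)
  have 2: "has_laurent (\<lambda>n. th y * pf (inverse y) n) (\<lambda>u. th (inverse y * u) * e0 u) ann"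
    using 1[OF dom_inverse[OF y]] th_inverse[of y] y by (simp add: dom_def)
  from has_laurent_mult[OF 1[OF y] 2]
  have "has_laurent (\<lambda>k. \<Sum>\<^sub>\<infinity>i. th y * pf y i * (th y * pf (inverse y) (k - i)))
      (\<lambda>u. th (y * u) * e0 u * (th (inverse y * u) * e0 u)) ann" .
  then show ?thesis
  proof (rule has_laurent_cong)
    fix k
    have "(\<Sum>\<^sub>\<infinity>i. th y * pf y i * (th y * pf (inverse y) (k - i)))
        = (\<Sum>\<^sub>\<infinity>i. (th y)\<^sup>2 * (pf y i * pf (inverse y) (k - i)))"
      by (rule infsum_cong) (simp add: power2_eq_square mult_ac)
    then show "(\<Sum>\<^sub>\<infinity>i. th y * pf y i * (th y * pf (inverse y) (k - i))) = (th y)\<^sup>2 * W y k"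
      by (simp add: W_def infsum_cmult_right')
  qed (simp add: power2_eq_square mult_ac)
qed

end

section \<open>The triple sums \<open>h_fun\<close>\<close>

lemma has_sum_geometric:
  fixes x :: complex
  assumes "norm x < 1"
  shows "((\<lambda>j. x ^ j) has_sum 1 / (1 - x)) UNIV"
  using assms geometric_sums[of x]
  by (intro norm_summable_imp_has_sum) (simp_all add: norm_power summable_geometric)

lemma bij_half_odd: "bij_betw (\<lambda>n::int. of_int n + 1 / 2 :: real) UNIV half_odd"
  by (auto simp: bij_betw_def half_odd_def inj_on_def)

lemma bij_half_odd_pos: "bij_betw (\<lambda>n::nat. real n + 1 / 2) UNIV {r \<in> half_odd. r > 0}"
proof (rule bij_betwI')
  fix r :: real assume "r \<in> {r \<in> half_odd. r > 0}"
  then obtain k :: int where k: "r = of_int k + 1 / 2" "r > 0" by (auto simp: half_odd_def)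
  then have "k \<ge> 0" by linarith
  then have "r = real (nat k) + 1 / 2" using k by simp
  then show "\<exists>n\<in>UNIV. r = real n + 1 / 2" by blast
next
  fix n :: nat
  have "real n + 1 / 2 = of_int (int n) + 1 / 2" by simp
  then have "real n + 1 / 2 \<in> half_odd" unfolding half_odd_def by blast
  then show "real n + 1 / 2 \<in> {r \<in> half_odd. r > 0}" by simp
qed auto

definition hexp :: "int \<Rightarrow> int \<Rightarrow> nat \<Rightarrow> nat \<Rightarrow> real" where
  "hexp N c a b = (let m = of_int c + 1 / 2; r = real a + 1 / 2; s = real b + 1 / 2 in
     r * \<bar>m\<bar> + s * \<bar>of_int N - m\<bar> + (sgn m * r + sgn (m - of_int N) * s)\<^sup>2 / 2 - of_int N / 2)"

text \<open>For m > N both signs are +1, and the square involves r + s only. With n = a + b fixed,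
  the exponent is linear in a and in d = c - N, so the inner sums are geometric.\<close>

lemma hexp_right:
  "N \<ge> 0 \<Longrightarrow> hexp N (N + int d) a b
    = real (a + b + 1) * real (a + b + 2) / 2 + real (a + b + 1) * real d + real a * of_int N"
proof -
  assume "N \<ge> 0"
  then have "\<bar>of_int (N + int d) + 1 / 2 :: real\<bar> = of_int N + real d + 1 / 2"
    "sgn (of_int (N + int d) + 1 / 2 :: real) = 1"
    "\<bar>of_int N - (of_int (N + int d) + 1 / 2) :: real\<bar> = real d + 1 / 2"
    "sgn (of_int (N + int d) + 1 / 2 - of_int N :: real) = 1"
    by (auto simp: sgn_if abs_if)
  then show ?thesis unfolding hexp_def Let_def by (simp add: power2_eq_square field_simps)
qed

lemma hexp_middle:
  "c < N \<Longrightarrow> hexp (int N) (int c) a b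
    = real a * (real c + 1 / 2) + real b * (real N - (real c + 1 / 2)) + (real a - real b)\<^sup>2 / 2"
proof -
  assume c: "c < N"
  then have "real N \<ge> real c + 1" by simp
  then have "\<bar>of_int (int c) + 1 / 2 :: real\<bar> = real c + 1 / 2"
    "sgn (of_int (int c) + 1 / 2 :: real) = 1"
    "\<bar>of_int (int N) - (of_int (int c) + 1 / 2) :: real\<bar> = real N - (real c + 1 / 2)"
    "sgn (of_int (int c) + 1 / 2 - of_int (int N) :: real) = - 1"
    by (auto simp: sgn_if abs_if)
  then show ?thesis unfolding hexp_def Let_def by (simp add: power2_eq_square field_simps)
qed

text \<open>Replacing m by N - m exchanges r and s and reverses both signs, which the square does
  not see.\<close>

lemma hexp_reflect: "hexp N (N - 1 - c) b a = hexp N c a b"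
proof -
  have e1: "of_int (N - 1 - c) + 1 / 2 = (of_int N - (of_int c + 1 / 2) :: real)" by simp
  have e2: "of_int N - (of_int N - (of_int c + 1 / 2)) = (of_int c + 1 / 2 :: real)" by simp
  have e3: "of_int N - (of_int c + 1 / 2) - of_int N = - (of_int c + 1 / 2 :: real)" by simp
  have e4: "of_int c + 1 / 2 - of_int N = - (of_int N - (of_int c + 1 / 2) :: real)" by simp
  show ?thesis unfolding hexp_def Let_def e1 e2 e3 e4 sgn_minus
    by (simp add: power2_eq_square algebra_simps)
qed

text \<open>Reversing m and N together changes only the term -N/2.\<close>

lemma hexp_uminus: "hexp (- N) (- 1 - c) a b = hexp N c a b + of_int N"
proof -
  have e1: "of_int (- 1 - c) + 1 / 2 = - (of_int c + 1 / 2 :: real)" by simp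
  have e2: "of_int (- N) - (- (of_int c + 1 / 2)) = - (of_int N - (of_int c + 1 / 2) :: real)" by simp
  have e3: "- (of_int c + 1 / 2) - of_int (- N) = - (of_int c + 1 / 2 - of_int N :: real)" by simp
  show ?thesis unfolding hexp_def Let_def e1 e2 e3 sgn_minus abs_minus_cancel
    by (simp add: power2_eq_square algebra_simps)
qed

context nome
begin

definition ht :: "int \<Rightarrow> int \<times> nat \<times> nat \<Rightarrow> complex" where
  "ht N = (\<lambda>(c, a, b). (-1) ^ (a + b) * Q (hexp N c a b))"

lemma h_fun_conv: "h_fun k \<tau> = infsum (ht (k - 1)) UNIV / eta \<tau> ^ 3"
proof -
  let ?e = "\<lambda>(c, a, b). (of_int c + 1 / 2, real a + 1 / 2, real b + 1 / 2)"
  let ?R = "{r \<in> half_odd. r > 0}"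
  have bij: "bij_betw ?e (UNIV \<times> UNIV \<times> UNIV) (half_odd \<times> ?R \<times> ?R)"
  proof -
    have "bij_betw (map_prod (\<lambda>n::int. of_int n + 1 / 2 :: real)
        (map_prod (\<lambda>n::nat. real n + 1 / 2) (\<lambda>n::nat. real n + 1 / 2)))
        (UNIV \<times> UNIV \<times> UNIV) (half_odd \<times> ?R \<times> ?R)"
      by (intro bij_betw_map_prod bij_half_odd bij_half_odd_pos)
    moreover have "map_prod (\<lambda>n::int. of_int n + 1 / 2 :: real)
        (map_prod (\<lambda>n::nat. real n + 1 / 2) (\<lambda>n::nat. real n + 1 / 2)) = ?e"
      by (auto simp: fun_eq_iff)
    ultimately show ?thesis by simp
  qed
  have fl: "\<lfloor>real a + 1 / 2 + (real b + 1 / 2) + 1\<rfloor> = int (a + b + 2)" for a b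
  proof -
    have "real a + 1 / 2 + (real b + 1 / 2) + 1 = of_int (int (a + b + 2))" by simp
    then show ?thesis by (simp only: floor_of_int)
  qed
  have sg: "(-1 :: complex) powi \<lfloor>real a + 1 / 2 + (real b + 1 / 2) + 1\<rfloor> = (-1) ^ (a + b)" for a b
    unfolding fl power_int_of_nat by simp
  have "ht (k - 1) = (\<lambda>p. (case ?e p of (m, r, s) \<Rightarrow> (-1) powi \<lfloor>r + s + 1\<rfloor> *
        qpow \<tau> (r * \<bar>m\<bar> + s * \<bar>real_of_int (k - 1) - m\<bar>
          + (sgn m * r + sgn (m - real_of_int (k - 1)) * s)\<^sup>2 / 2 - real_of_int (k - 1) / 2)))"
  proof (rule ext)
    fix p :: "int \<times> nat \<times> nat"
    obtain c a b where p: "p = (c, a, b)" by (cases p)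
    show "ht (k - 1) p = (case ?e p of (m, r, s) \<Rightarrow> (-1) powi \<lfloor>r + s + 1\<rfloor> *
        qpow \<tau> (r * \<bar>m\<bar> + s * \<bar>real_of_int (k - 1) - m\<bar>
          + (sgn m * r + sgn (m - real_of_int (k - 1)) * s)\<^sup>2 / 2 - real_of_int (k - 1) / 2))"
      unfolding ht_def hexp_def Let_def by (simp only: p prod.case sg)
  qed
  then show ?thesis
    unfolding h_fun_def Let_def
    using infsum_reindex_bij_betw[OF bij, of "\<lambda>(m, r, s). (-1) powi \<lfloor>r + s + 1\<rfloor> *
        qpow \<tau> (r * \<bar>m\<bar> + s * \<bar>real_of_int (k - 1) - m\<bar>
          + (sgn m * r + sgn (m - real_of_int (k - 1)) * s)\<^sup>2 / 2 - real_of_int (k - 1) / 2)"]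
    by simp
qed

text \<open>The summand of the range m > N in the coordinates n = a + b, a and d = c - N; the
  condition a <= n is part of \<open>Rs\<close>.\<close>

definition Rt :: "nat \<Rightarrow> nat \<times> nat \<times> nat \<Rightarrow> complex" where
  "Rt N = (\<lambda>(n, a, d). (-1) ^ n * Q (real (n + 1) * real (n + 2) / 2) * (Q (real N) ^ a * Q (real (n + 1)) ^ d))"

definition Rs :: "(nat \<times> nat \<times> nat) set" where "Rs = (SIGMA n:UNIV. {..n} \<times> UNIV)"

text \<open>For N = 0 the powers of \<open>Q (real N)\<close> give no decay in a. The triangular
  exponent provides p^n, and since a <= n this splits as p^(n-a) p^a, which gives a bound by a
  product of geometric series.\<close>

lemma Rt_summable: "Rt N summable_on Rs"
proof -
  have geo: "(\<lambda>n. (of_real p :: complex) ^ n) summable_on UNIV"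
    using has_sum_geometric[of "of_real p"] p_pos p_less_1 by (auto simp: summable_on_def)
  have inj: "inj_on (\<lambda>(n::nat, a, d). (n - a, a, d)) Rs"
    by (auto simp: inj_on_def Rs_def)
  have "(\<lambda>(j, a, d). (of_real p :: complex) ^ j * (of_real p ^ a * of_real p ^ d)) summable_on (UNIV \<times> UNIV \<times> UNIV :: (nat \<times> nat \<times> nat) set)"
    using summable_on_product_complex[OF geo summable_on_product_complex[OF geo geo]]
    by (simp add: case_prod_unfold)
  then have "(\<lambda>(j, a, d). (of_real p :: complex) ^ j * (of_real p ^ a * of_real p ^ d)) summable_on ((\<lambda>(n::nat, a, d). (n - a, a, d)) ` Rs)"
    by (rule summable_on_subset_banach) simp
  then have "(\<lambda>(n, a, d). (of_real p :: complex) ^ (n - a) * (of_real p ^ a * of_real p ^ d)) summable_on Rs"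
    by (subst (asm) summable_on_reindex[OF inj]) (simp add: o_def case_prod_unfold)
  then have "(\<lambda>x. norm ((\<lambda>(n, a, d). (of_real p :: complex) ^ (n - a) * (of_real p ^ a * of_real p ^ d)) x)) summable_on Rs"
    by (simp only: summable_on_iff_abs_summable_on_complex)
  then have "(\<lambda>x. norm (Rt N x)) summable_on Rs"
  proof (rule Infinite_Sum.abs_summable_on_comparison_test')
    fix x assume "x \<in> Rs"
    then obtain n a d where x: "x = (n, a, d)" and a: "a \<le> n" by (auto simp: Rs_def)
    have "real n \<le> real (n + 1) * real (n + 2) / 2" by (simp add: field_simps)
    from norm_Q_mono[OF this] have 1: "norm (Q (real (n + 1) * real (n + 2) / 2)) \<le> p ^ n"
      using p_pos by (simp add: norm_Q powr_realpow)
    have 2: "norm (Q (real N) ^ a) \<le> 1"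
      unfolding norm_power using norm_Q_le_1[of "real N"] by (simp add: power_le_one)
    have "norm (Q (real (n + 1))) \<le> p" using norm_Q_mono[of 1 "real (n + 1)"] by (simp add: p_def)
    then have 3: "norm (Q (real (n + 1)) ^ d) \<le> p ^ d" unfolding norm_power by (intro power_mono) auto
    have "norm (Rt N x) = norm (Q (real (n + 1) * real (n + 2) / 2)) * (norm (Q (real N) ^ a) * norm (Q (real (n + 1)) ^ d))"
      by (simp add: Rt_def x norm_mult norm_power)
    also have "\<dots> \<le> p ^ n * (1 * p ^ d)"
      using 1 2 3 p_pos by (intro mult_mono) auto
    also have "p ^ n = p ^ (n - a) * p ^ a" using a by (simp add: power_add[symmetric])
    finally show "norm (Rt N x) \<le> norm ((\<lambda>(n, a, d). (of_real p :: complex) ^ (n - a) * (of_real p ^ a * of_real p ^ d)) x)"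
      using p_pos by (simp add: x norm_mult norm_power)
  qed
  then show ?thesis by (rule abs_summable_summable)
qed

definition gin :: "nat \<Rightarrow> nat \<Rightarrow> complex" where
  "gin N n = (\<Sum>a\<le>n. Q (real N) ^ a) * (1 / (1 - Q (real (n + 1))))"

definition RS :: "nat \<Rightarrow> complex" where "RS N = infsum (Rt N) Rs"

lemma RS_has_sum: "((\<lambda>n. (-1) ^ n * Q (real (n + 1) * real (n + 2) / 2) * gin N n) has_sum RS N) UNIV"
proof -
  have "(Rt N has_sum RS N) (SIGMA n:UNIV. {..n} \<times> UNIV)"
    using Rt_summable unfolding RS_def Rs_def by (rule has_sum_infsum)
  then show ?thesis
  proof (rule has_sum_SigmaD)
    fix n
    have "((\<lambda>(a, d). Q (real N) ^ a * Q (real (n + 1)) ^ d) has_sum gin N n) ({..n} \<times> UNIV)"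
      unfolding gin_def
      by (intro has_sum_product_complex has_sum_geometric norm_Q_less_1 has_sum_finite) auto
    from has_sum_cmult_right[OF this, of "(-1) ^ n * Q (real (n + 1) * real (n + 2) / 2)"]
    show "((\<lambda>y. Rt N (n, y)) has_sum (-1) ^ n * Q (real (n + 1) * real (n + 2) / 2) * gin N n) ({..n} \<times> UNIV)"
      by (simp add: Rt_def case_prod_unfold)
  qed
qed

lemma ht_right: "(ht (int N) has_sum RS N) ({int N..} \<times> UNIV)"
proof -
  have "(Rt N has_sum RS N) Rs" using Rt_summable unfolding RS_def by (rule has_sum_infsum)
  moreover have "(Rt N has_sum RS N) Rs \<longleftrightarrow> (ht (int N) has_sum RS N) ({int N..} \<times> UNIV)"
  proof (rule has_sum_reindex_bij_witness[where j = "\<lambda>(n, a, d). (int N + int d, a, n - a)"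
        and i = "\<lambda>(c, a, b). (a + b, a, nat (c - int N))"])
    fix x assume "x \<in> Rs"
    then obtain n a d where x: "x = (n, a, d)" and a: "a \<le> n" by (auto simp: Rs_def)
    have e: "hexp (int N) (int N + int d) a (n - a) = real (n + 1) * real (n + 2) / 2 + (real a * real N + real d * real (n + 1))"
      using a by (simp add: hexp_right)
    show "ht (int N) (case x of (n, a, d) \<Rightarrow> (int N + int d, a, n - a)) = Rt N x"
      using a by (simp add: x ht_def Rt_def e qpow_power qpow_mult)
  qed (auto simp: Rs_def)
  ultimately show ?thesis by simp
qed

lemma ht_left: "(ht (int N) has_sum RS N) ({..<0} \<times> UNIV)"
proof -
  have "(ht (int N) has_sum RS N) ({..<0} \<times> UNIV) \<longleftrightarrow> (ht (int N) has_sum RS N) ({int N..} \<times> UNIV)"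
    by (rule has_sum_reindex_bij_witness[where j = "\<lambda>(c, a, b). (int N - 1 - c, b, a)"
        and i = "\<lambda>(c, a, b). (int N - 1 - c, b, a)"])
      (auto simp: ht_def hexp_reflect add.commute)
  with ht_right show ?thesis by blast
qed

text \<open>q^(N(n+1)) is both the (n+1)-st power of q^N and the N-th power of q^(n+1), so the
  finite and the infinite geometric series can exchange roles. This relates the outer ranges of m to
  the middle one.\<close>

lemma gin_conv: "N > 0 \<Longrightarrow> gin N n = (\<Sum>c<N. Q (real (n + 1)) ^ c) * (1 / (1 - Q (real N)))"
proof -
  assume N: "N > 0"
  have 1: "Q (real N) \<noteq> 1" "Q (real (n + 1)) \<noteq> 1"
    using Q_ne_1[of "real N"] Q_ne_1[of "real (n + 1)"] N by auto
  have "Q (real N) ^ Suc n = Q (real (n + 1)) ^ N"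
    unfolding qpow_power by (rule arg_cong[of _ _ Q]) simp
  then show ?thesis
    using 1 unfolding gin_def lessThan_Suc_atMost[symmetric] sum_gp_strict by (simp add: divide_simps)
qed

text \<open>The part a > b of the range 0 < m < N, with a = b + n + 1: the sign is (-1)^(n+1), and
  by \<open>gin_conv\<close> the inner sum equals that of the outer range. Hence the total is minus
  the outer sum.\<close>

lemma ht_middle_lower:
  assumes N: "N > 0"
  shows "((\<lambda>(n, c, b). (-1) ^ (n + 1) * Q (real (n + 1) * real (n + 2) / 2) * (Q (real (n + 1)) ^ c * Q (real N) ^ b)) has_sum - RS N)
      (UNIV \<times> {..<N} \<times> UNIV)" (is "(?f has_sum _) _")
proof -
  have inner: "((\<lambda>y. ?f (n, y)) has_sum - ((-1) ^ n * Q (real (n + 1) * real (n + 2) / 2) * gin N n)) ({..<N} \<times> UNIV)" for n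
  proof -
    have "((\<lambda>(c, b). Q (real (n + 1)) ^ c * Q (real N) ^ b) has_sum gin N n) ({..<N} \<times> UNIV)"
      unfolding gin_conv[OF N]
      by (intro has_sum_product_complex has_sum_geometric norm_Q_less_1 has_sum_finite) (use N in auto)
    from has_sum_cmult_right[OF this, of "(-1) ^ (n + 1) * Q (real (n + 1) * real (n + 2) / 2)"]
    show ?thesis by (simp add: case_prod_unfold)
  qed
  have geo: "(\<lambda>n. z ^ n) summable_on UNIV" if "norm z < 1" for z :: complex
    using has_sum_geometric[OF that] by (auto simp: summable_on_def)
  have "norm (complex_of_real p) < 1" using p_pos p_less_1 by simp
  note g1 = geo[OF this]
  have "norm (Q (real N)) < 1" using N by (intro norm_Q_less_1) simp
  note g2 = geo[OF this]
  have "(\<lambda>c. 1 :: complex) summable_on {..<N}" by simp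
  from summable_on_product_complex[OF g1 summable_on_product_complex[OF this g2]]
  have "(\<lambda>x. norm ((\<lambda>(n, c, b). complex_of_real p ^ n * (1 * Q (real N) ^ b)) x)) summable_on (UNIV \<times> {..<N} \<times> UNIV)"
    by (simp add: case_prod_unfold summable_on_iff_abs_summable_on_complex)
  then have "(\<lambda>x. norm (?f x)) summable_on (UNIV \<times> {..<N} \<times> UNIV)"
  proof (rule Infinite_Sum.abs_summable_on_comparison_test')
    fix x :: "nat \<times> nat \<times> nat"
    obtain n c b where x: "x = (n, c, b)" by (cases x)
    have "real n \<le> real (n + 1) * real (n + 2) / 2" by (simp add: field_simps)
    from norm_Q_mono[OF this] have 1: "norm (Q (real (n + 1) * real (n + 2) / 2)) \<le> p ^ n"
      using p_pos by (simp add: norm_Q powr_realpow)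
    have 2: "norm (Q (real (n + 1)) ^ c) \<le> 1"
      unfolding norm_power using norm_Q_le_1[of "real (n + 1)"] by (simp add: power_le_one)
    have "norm (?f x) = norm (Q (real (n + 1) * real (n + 2) / 2)) * (norm (Q (real (n + 1)) ^ c) * norm (Q (real N) ^ b))"
      by (simp add: x norm_mult norm_power)
    also have "\<dots> \<le> p ^ n * (1 * norm (Q (real N) ^ b))"
      using 1 2 p_pos by (intro mult_mono) auto
    finally show "norm (?f x) \<le> norm ((\<lambda>(n, c, b). complex_of_real p ^ n * (1 * Q (real N) ^ b)) x)"
      using p_pos by (simp add: x norm_mult norm_power)
  qed
  then have "?f summable_on (UNIV \<times> {..<N} \<times> UNIV)" by (rule abs_summable_summable)
  with has_sum_uminusI[OF RS_has_sum[of N]] show ?thesis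
    by (intro has_sum_SigmaI[where f = ?f, OF inner])
qed

text \<open>The parts a > b and a < b are exchanged by reflection and give \<open>- RS N\<close>
  each; the diagonal a = b gives N geometric series in q^N.\<close>

lemma ht_middle:
  assumes N: "N > 0"
  shows "(ht (int N) has_sum of_nat N / (1 - Q (real N)) - 2 * RS N) ({0..<int N} \<times> UNIV)"
proof -
  let ?f = "\<lambda>(n, c, b). (-1) ^ (n + 1) * Q (real (n + 1) * real (n + 2) / 2) * (Q (real (n + 1)) ^ c * Q (real N) ^ b)"
  let ?R = "{0..<int N}"
  define A1 where "A1 = ?R \<times> {(a::nat, b). a > b}"
  define A2 where "A2 = ?R \<times> {(a::nat, b). a < b}"
  define A3 where "A3 = ?R \<times> {(a::nat, b). a = b}"
  note low = ht_middle_lower[OF N]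
  have 1: "(ht (int N) has_sum - RS N) A1"
  proof -
    have "(?f has_sum - RS N) (UNIV \<times> {..<N} \<times> UNIV) \<longleftrightarrow> (ht (int N) has_sum - RS N) A1"
    proof (rule has_sum_reindex_bij_witness[where j = "\<lambda>(n, c, b). (int c, b + n + 1, b)"
          and i = "\<lambda>(c, a, b). (a - b - 1, nat c, b)"])
      fix x :: "nat \<times> nat \<times> nat" assume "x \<in> UNIV \<times> {..<N} \<times> UNIV"
      then obtain n c b where x: "x = (n, c, b)" and c: "c < N" by auto
      have e: "hexp (int N) (int c) (b + n + 1) b = real (n + 1) * real (n + 2) / 2 + (real c * real (n + 1) + real b * real N)"
        unfolding hexp_middle[OF c] by (simp add: power2_eq_square field_simps)
      have s: "(-1 :: complex) ^ (b + n + 1 + b) = (-1) ^ (n + 1)"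
        by (simp add: power_add mult_ac flip: power_mult_distrib)
      show "ht (int N) (case x of (n, c, b) \<Rightarrow> (int c, b + n + 1, b)) = ?f x"
        unfolding x prod.case ht_def s e by (simp only: qpow_power qpow_mult mult.assoc)
    qed (auto simp: A1_def)
    with low show ?thesis by blast
  qed
  have 2: "(ht (int N) has_sum - RS N) A2"
  proof -
    have "(ht (int N) has_sum - RS N) A2 \<longleftrightarrow> (ht (int N) has_sum - RS N) A1"
      by (rule has_sum_reindex_bij_witness[where j = "\<lambda>(c, a, b). (int N - 1 - c, b, a)"
        and i = "\<lambda>(c, a, b). (int N - 1 - c, b, a)"])
      (auto simp: A1_def A2_def ht_def hexp_reflect add.commute)
    with 1 show ?thesis by blast
  qed
  have 3: "(ht (int N) has_sum of_nat N * (1 / (1 - Q (real N)))) A3"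
  proof -
    have "((\<lambda>(c, b). 1 * Q (real N) ^ b) has_sum (\<Sum>c<N. 1) * (1 / (1 - Q (real N)))) ({..<N} \<times> UNIV)"
      by (intro has_sum_product_complex has_sum_geometric norm_Q_less_1 has_sum_finite) (use N in auto)
    moreover have "((\<lambda>(c, b). 1 * Q (real N) ^ b) has_sum (\<Sum>c<N. 1) * (1 / (1 - Q (real N)))) ({..<N} \<times> UNIV)
        \<longleftrightarrow> (ht (int N) has_sum (\<Sum>c<N. 1) * (1 / (1 - Q (real N)))) A3"
    proof (rule has_sum_reindex_bij_witness[where j = "\<lambda>(c, b). (int c, b, b)" and i = "\<lambda>(c, a, b). (nat c, b)"])
      fix x :: "nat \<times> nat" assume "x \<in> {..<N} \<times> UNIV"
      then obtain c b where x: "x = (c, b)" and c: "c < N" by auto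
      have e: "hexp (int N) (int c) b b = real b * real N"
        unfolding hexp_middle[OF c] by (simp add: field_simps)
      show "ht (int N) (case x of (c, b) \<Rightarrow> (int c, b, b)) = (case x of (c, b) \<Rightarrow> 1 * Q (real N) ^ b)"
        by (simp add: x ht_def e qpow_power power_add flip: power_mult_distrib)
    qed (auto simp: A3_def)
    ultimately show ?thesis by simp
  qed
  have "(ht (int N) has_sum (- RS N + - RS N) + of_nat N * (1 / (1 - Q (real N)))) ((A1 \<union> A2) \<union> A3)"
    by (intro has_sum_Un_disjoint 1 2 3) (auto simp: A1_def A2_def A3_def)
  moreover have "(A1 \<union> A2) \<union> A3 = ?R \<times> UNIV"
    by (auto simp: A1_def A2_def A3_def)
  ultimately show ?thesis by (simp add: algebra_simps)
qed

lemma hsum_pos: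
  assumes N: "N > 0"
  shows "(ht (int N) has_sum of_nat N / (1 - Q (real N))) UNIV"
proof -
  have "(ht (int N) has_sum (RS N + RS N) + (of_nat N / (1 - Q (real N)) - 2 * RS N))
      (({..<0} \<times> UNIV \<union> {int N..} \<times> UNIV) \<union> {0..<int N} \<times> UNIV)"
    by (intro has_sum_Un_disjoint ht_left ht_right ht_middle N) (use N in auto)
  moreover have "(({..<0} \<times> UNIV \<union> {int N..} \<times> UNIV) \<union> {0..<int N} \<times> UNIV) = (UNIV :: (int \<times> nat \<times> nat) set)"
    by auto
  ultimately show ?thesis by simp
qed

text \<open>With N = 0 the middle range is empty, so nothing cancels the two outer ranges.\<close>

lemma hsum_0: "(ht 0 has_sum 2 * RS 0) UNIV"
proof -
  have "(ht (int 0) has_sum RS 0 + RS 0) ({..<0} \<times> UNIV \<union> {int 0..} \<times> UNIV)"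
    by (intro has_sum_Un_disjoint ht_left ht_right) auto
  moreover have "{..<0} \<times> UNIV \<union> {int 0..} \<times> UNIV = (UNIV :: (int \<times> nat \<times> nat) set)"
    by auto
  ultimately show ?thesis by simp
qed

lemma hsum_m1: "(ht (- 1) has_sum Q 1 / (1 - Q 1)) UNIV"
proof -
  have "(ht 1 has_sum 1 / (1 - Q 1)) UNIV" using hsum_pos[of 1] by simp
  from has_sum_cmult_right[OF this, of "Q 1"]
  have "((\<lambda>x. Q 1 * ht 1 x) has_sum Q 1 / (1 - Q 1)) UNIV" by simp
  moreover have "((\<lambda>x. Q 1 * ht 1 x) has_sum Q 1 / (1 - Q 1)) UNIV \<longleftrightarrow> (ht (- 1) has_sum Q 1 / (1 - Q 1)) UNIV"
  proof (rule has_sum_reindex_bij_witness[where j = "\<lambda>(c, a, b). (- 1 - c, a, b)" and i = "\<lambda>(c, a, b). (- 1 - c, a, b)"])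
    fix x :: "int \<times> nat \<times> nat"
    obtain c a b where x: "x = (c, a, b)" by (cases x)
    have "hexp (- 1) (- 1 - c) a b = 1 + hexp 1 c a b" using hexp_uminus[of 1 c a b] by simp
    then show "ht (- 1) (case x of (c, a, b) \<Rightarrow> (- 1 - c, a, b)) = Q 1 * ht 1 x"
      by (simp add: x ht_def qpow_mult[symmetric])
  qed auto
  ultimately show ?thesis by simp
qed

text \<open>The triple sum in closed form. The value at -1 equals N/(1 - q^N) as well, so N = 0,
  where this quotient would be 0/0, is the only real exception.\<close>

definition gN :: "int \<Rightarrow> complex" where
  "gN N = (if N = - 1 then Q 1 / (1 - Q 1) else if N = 0 then 2 * RS 0 else of_int N / (1 - Q (of_int N)))"

lemma h_fun_gN: "N \<ge> - 1 \<Longrightarrow> h_fun (N + 1) \<tau> = gN N / eta \<tau> ^ 3"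
proof -
  assume N: "N \<ge> - 1"
  have "infsum (ht N) UNIV = gN N"
  proof -
    consider "N = - 1" | "N = 0" | "N > 0" using N by linarith
    then show ?thesis
    proof cases
      case 3
      then obtain n where n: "N = int n" "n > 0" using zero_less_imp_eq_int by blast
      then show ?thesis using infsumI[OF hsum_pos[OF n(2)]] by (simp add: gN_def)
    qed (auto simp: gN_def infsumI[OF hsum_m1] infsumI[OF hsum_0])
  qed
  then show ?thesis by (simp add: h_fun_conv)
qed


text \<open>With k = \<alpha> + 1/2 this is, up to a power of q, the sum in the massless characters,
  see \<open>appell_sum\<close>.\<close>

definition Sp :: "complex \<Rightarrow> complex" where
  "Sp y = (\<Sum>\<^sub>\<infinity>k. y powi k * Q ((of_int k)\<^sup>2 / 2) * pf y (k - 1))"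

lemma th_pf:
  assumes "dom y"
  shows "((\<lambda>i. (y powi i * Q ((of_int i)\<^sup>2 / 2)) * lc (n - i)) has_sum th y * pf y n) UNIV"
proof -
  have y: "y \<noteq> 0" and nz: "1 + y * Q (of_int n + 1 / 2) \<noteq> 0" using assms by (auto simp: dom_def)
  have "(\<lambda>i. (y powi i * Q ((of_int i)\<^sup>2 / 2)) * lc (n - i)) summable_on UNIV"
    by (rule summable_on_bounded_mult[OF summable_theta norm_lc])
  then have "((\<lambda>i. (y powi i * Q ((of_int i)\<^sup>2 / 2)) * lc (n - i)) has_sum
      (\<Sum>\<^sub>\<infinity>i. (y powi i * Q ((of_int i)\<^sup>2 / 2)) * lc (n - i))) UNIV" by (rule has_sum_infsum)
  also have "(\<Sum>\<^sub>\<infinity>i. (y powi i * Q ((of_int i)\<^sup>2 / 2)) * lc (n - i)) = th y * pf y n"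
    using kronecker_coeff[OF y, of n] nz unfolding pf_def by (simp add: field_simps)
  finally show ?thesis .
qed

text \<open>The poles of \<open>Sp\<close> are cancelled by the zeros of \<open>th\<close>: by
  \<open>th_pf\<close> each \<open>th y * pf y n\<close> is a convolution of theta with
  \<open>lc\<close>, and \<open>lc\<close> is bounded independently of n. The resulting double
  series converges for all nonzero y and defines the continuation f.\<close>

lemma thSp_laurent: "\<exists>c f. has_laurent c f (- {0}) \<and> (\<forall>y. dom y \<longrightarrow> f y = th y * Sp y)"
proof -
  let ?a = "\<lambda>(k, i). Q ((of_int k)\<^sup>2 / 2) * Q ((of_int i)\<^sup>2 / 2) * lc (k - 1 - i)"
  let ?e = "\<lambda>(k, i). k + i :: int"
  define f where "f y = infsum (\<lambda>x. ?a x * y powi ?e x) UNIV" for y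
  have conv: "?a x * y powi ?e x = (\<lambda>(k, i). (y powi k * Q ((of_int k)\<^sup>2 / 2)) * (y powi i * Q ((of_int i)\<^sup>2 / 2))) x * (\<lambda>(k, i). lc (k - 1 - i)) x"
    if "y \<noteq> 0" for x y
    using that by (cases x) (simp add: power_int_add mult_ac)
  have s: "(\<lambda>x. ?a x * y powi ?e x) summable_on UNIV" if y: "y \<noteq> 0" for y
  proof -
    have "(\<lambda>(k, i). (y powi k * Q ((of_int k)\<^sup>2 / 2)) * (y powi i * Q ((of_int i)\<^sup>2 / 2))) summable_on (UNIV \<times> UNIV)"
      by (intro summable_on_product_complex summable_theta)
    then have "(\<lambda>x. (\<lambda>(k, i). (y powi k * Q ((of_int k)\<^sup>2 / 2)) * (y powi i * Q ((of_int i)\<^sup>2 / 2))) x * (\<lambda>(k, i). lc (k - 1 - i)) x) summable_on (UNIV \<times> UNIV)"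
      by (rule summable_on_bounded_mult[of _ _ _ lc_bound]) (auto simp: norm_lc)
    then show ?thesis unfolding conv[OF y] by simp
  qed
  have hs: "((\<lambda>x. ?a x * y powi ?e x) has_sum f y) UNIV" if "y \<noteq> 0" for y
    unfolding f_def using s[OF that] by (rule has_sum_infsum)
  have "has_laurent (\<lambda>k. infsum ?a {i \<in> UNIV. ?e i = k}) f (- {0})"
    by (rule has_laurent_family) (use hs in auto)
  moreover have "f y = th y * Sp y" if y: "dom y" for y
  proof -
    have y0: "y \<noteq> 0" using y by (simp add: dom_def)
    have "((\<lambda>x. ?a x * y powi ?e x) has_sum f y) (UNIV \<times> UNIV)" using hs[OF y0] by simp
    then have "((\<lambda>k. (y powi k * Q ((of_int k)\<^sup>2 / 2)) * (th y * pf y (k - 1))) has_sum f y) UNIV"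
    proof (rule has_sum_SigmaD)
      fix k
      have "?a (k, i) * y powi ?e (k, i) = (y powi k * Q ((of_int k)\<^sup>2 / 2)) * ((y powi i * Q ((of_int i)\<^sup>2 / 2)) * lc (k - 1 - i))" for i
        using y0 by (simp add: power_int_add mult_ac)
      then show "((\<lambda>i. ?a (k, i) * y powi ?e (k, i)) has_sum (y powi k * Q ((of_int k)\<^sup>2 / 2)) * (th y * pf y (k - 1))) UNIV"
        using has_sum_cmult_right[OF th_pf[OF y, of "k - 1"]] by (simp only:)
    qed
    then have "f y = (\<Sum>\<^sub>\<infinity>k. (y powi k * Q ((of_int k)\<^sup>2 / 2)) * (th y * pf y (k - 1)))"
      by (rule infsumI[symmetric])
    also have "\<dots> = (\<Sum>\<^sub>\<infinity>k. th y * (y powi k * Q ((of_int k)\<^sup>2 / 2) * pf y (k - 1)))"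
      by (rule infsum_cong) (simp add: mult_ac)
    also have "\<dots> = th y * Sp y" unfolding Sp_def by (rule infsum_cmult_right')
    finally show ?thesis .
  qed
  ultimately show ?thesis by blast
qed

subsection \<open>Expansions on the unit circle\<close>

definition circ :: "complex set" where "circ = {y. norm y = 1}"

lemma circ_dom: "y \<in> circ \<Longrightarrow> dom y"
proof -
  assume y: "y \<in> circ"
  have "1 + y * Q (of_int n + 1 / 2) \<noteq> 0" for n :: int
  proof
    assume "1 + y * Q (of_int n + 1 / 2) = 0"
    then have "norm (y * Q (of_int n + 1 / 2)) = norm (- 1 :: complex)"
      by (metis add_eq_0_iff add.commute)
    then have "p powr (of_int n + 1 / 2) = 1" using y by (simp add: circ_def norm_mult norm_Q)
    then have "of_int n + 1 / 2 = (0 :: real)" using p_pos p_less_1 by (simp add: powr_def)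
    then have "of_int (2 * n + 1) = (0 :: real)" by simp
    then have "2 * n + 1 = 0" by (simp only: of_int_eq_0_iff)
    then show False by presburger
  qed
  then show ?thesis using y by (auto simp: dom_def circ_def)
qed

text \<open>Finite sums that arise when the geometric expansions of the summands of
  \<open>Sp\<close> are collected by the power of y, see \<open>spa_fiber\<close>.\<close>

definition sk :: "int \<Rightarrow> complex" where
  "sk k = (\<Sum>j<nat \<bar>k\<bar>. (-1) ^ j * Q (- (real j * real (j + 1) / 2)))"

text \<open>For |y| = 1 the fraction 1/(1 + a), a = y q^(k-1/2), expands in a for k >= 1 and in 1/a
  for k <= 0; \<open>spe\<close> records the resulting exponent of y.\<close>

definition spa :: "int \<times> nat \<Rightarrow> complex" where
  "spa = (\<lambda>(k, j). Q ((of_int k)\<^sup>2 / 2) * ((-1) ^ j * (if k \<ge> 1 then Q (real j * (of_int k - 1 / 2)) else Q (real (j + 1) * (1 / 2 - of_int k)))))"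

definition spe :: "int \<times> nat \<Rightarrow> int" where
  "spe = (\<lambda>(k, j). if k \<ge> 1 then k + int j else k - int j - 1)"

lemma spa_value: "spa (k, j) = Q ((of_int (spe (k, j)))\<^sup>2 / 2) * ((-1) ^ j * Q (- (real j * real (j + 1) / 2)))"
proof (cases "k \<ge> 1")
  case True
  have "Q ((of_int k)\<^sup>2 / 2) * Q (real j * (of_int k - 1 / 2)) = Q ((of_int (k + int j))\<^sup>2 / 2) * Q (- (real j * real (j + 1) / 2))"
    unfolding qpow_mult by (rule arg_cong[of _ _ Q]) (simp add: power2_eq_square field_simps)
  then show ?thesis using True by (simp add: spa_def spe_def)
next
  case False
  have "Q ((of_int k)\<^sup>2 / 2) * Q (real (j + 1) * (1 / 2 - of_int k)) = Q ((of_int (k - int j - 1))\<^sup>2 / 2) * Q (- (real j * real (j + 1) / 2))"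
    unfolding qpow_mult by (rule arg_cong[of _ _ Q]) (simp add: power2_eq_square field_simps)
  then show ?thesis using False by (simp add: spa_def spe_def)
qed

text \<open>Expansions in a have only positive exponents of y and those in 1/a only negative ones.
  The exponent k therefore has exactly |k| preimages, one for each j < |k|.\<close>

lemma spa_fiber: "infsum spa {x \<in> UNIV. spe x = k} = Q ((of_int k)\<^sup>2 / 2) * sk k"
proof -
  have "infsum spa {x \<in> UNIV. spe x = k} = infsum (\<lambda>j. Q ((of_int k)\<^sup>2 / 2) * ((-1) ^ j * Q (- (real j * real (j + 1) / 2)))) {..<nat \<bar>k\<bar>}"
  proof (rule infsum_reindex_bij_witness[where j = snd and i = "\<lambda>j. (if k \<ge> 1 then k - int j else k + int j + 1, j)"])
    fix x assume "x \<in> {x \<in> UNIV. spe x = k}"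
    then show "(if k \<ge> 1 then k - int (snd x) else k + int (snd x) + 1, snd x) = x"
      and "snd x \<in> {..<nat \<bar>k\<bar>}"
      by (auto simp: spe_def split: if_splits prod.splits)
    show "Q ((of_int k)\<^sup>2 / 2) * ((-1) ^ snd x * Q (- (real (snd x) * real (snd x + 1) / 2))) = spa x"
      using \<open>x \<in> {x \<in> UNIV. spe x = k}\<close> spa_value[of "fst x" "snd x"] by simp
  next
    fix j assume "j \<in> {..<nat \<bar>k\<bar>}"
    then show "(if k \<ge> 1 then k - int j else k + int j + 1, j) \<in> {x \<in> UNIV. spe x = k}"
      by (auto simp: spe_def)
  qed simp_all
  also have "\<dots> = Q ((of_int k)\<^sup>2 / 2) * sk k"
    by (simp add: sk_def sum_distrib_left)
  finally show ?thesis .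
qed

lemma geometric_p_half: "(\<lambda>j. Q (1 / 2) ^ j) summable_on UNIV"
  using has_sum_geometric[OF norm_Q_less_1[of "1 / 2"]] by (auto simp: summable_on_def)

lemma Sp_has_laurent: "has_laurent (\<lambda>k. Q ((of_int k)\<^sup>2 / 2) * sk k) Sp circ"
proof -
  have "((\<lambda>x. spa x * y powi spe x) has_sum Sp y) UNIV" if y: "y \<in> circ" for y
  proof -
    have ny: "norm y = 1" and y0: "y \<noteq> 0" using y by (auto simp: circ_def)
    have "(\<lambda>(k, j). (1 powi k * Q ((of_int k)\<^sup>2 / 2)) * Q (1 / 2) ^ j) summable_on (UNIV \<times> UNIV)"
      by (intro summable_on_product_complex summable_theta geometric_p_half)
    then have "(\<lambda>x. norm ((\<lambda>(k, j). (1 powi k * Q ((of_int k)\<^sup>2 / 2)) * Q (1 / 2) ^ j) x)) summable_on UNIV"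
      by (simp add: summable_on_iff_abs_summable_on_complex)
    then have "(\<lambda>x. norm (spa x * y powi spe x)) summable_on UNIV"
    proof (rule Infinite_Sum.abs_summable_on_comparison_test')
      fix x :: "int \<times> nat"
      obtain k j where x: "x = (k, j)" by (cases x)
      define w where "w = (if k \<ge> 1 then Q (real j * (of_int k - 1 / 2)) else Q (real (j + 1) * (1 / 2 - of_int k)))"
      have sw: "spa (k, j) = Q ((of_int k)\<^sup>2 / 2) * ((-1) ^ j * w)"
        by (simp only: spa_def prod.case w_def)
      have "norm w \<le> norm (Q (real j * (1 / 2)))"
      proof (cases "k \<ge> 1")
        case True
        have "real j * (1 / 2) \<le> real j * (of_int k - 1 / 2)"
          using True by (intro mult_left_mono) auto
        from norm_Q_mono[OF this] show ?thesis using True by (simp add: w_def)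
      next
        case False
        have "real j * (1 / 2) \<le> real (j + 1) * (1 / 2 - of_int k)"
          using False by (intro mult_mono) auto
        from norm_Q_mono[OF this] show ?thesis using False by (simp add: w_def)
      qed
      then show "norm (spa x * y powi spe x) \<le> norm ((\<lambda>(k, j). (1 powi k * Q ((of_int k)\<^sup>2 / 2)) * Q (1 / 2) ^ j) x)"
        unfolding x sw prod.case qpow_power by (simp add: norm_mult norm_power norm_power_int ny mult_left_mono)
    qed
    then have "(\<lambda>x. spa x * y powi spe x) summable_on UNIV" by (rule abs_summable_summable)
    then have hs: "((\<lambda>x. spa x * y powi spe x) has_sum infsum (\<lambda>x. spa x * y powi spe x) UNIV) (UNIV \<times> UNIV)"
      by simp
    then have "((\<lambda>k. y powi k * Q ((of_int k)\<^sup>2 / 2) * pf y (k - 1)) has_sum infsum (\<lambda>x. spa x * y powi spe x) UNIV) UNIV"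
    proof (rule has_sum_SigmaD)
      fix k :: int
      define a where "a = y * Q (of_int k - 1 / 2)"
      have na: "norm a = p powr (of_int k - 1 / 2)" by (simp add: a_def norm_mult ny norm_Q)
      have a0: "a \<noteq> 0" using y0 by (simp add: a_def)
      have pfa: "pf y (k - 1) = 1 / (1 + a)" by (simp add: pf_def a_def)
      show "((\<lambda>j. spa (k, j) * y powi spe (k, j)) has_sum y powi k * Q ((of_int k)\<^sup>2 / 2) * pf y (k - 1)) UNIV"
      proof (cases "k \<ge> 1")
        case True
        have "norm (- a) < 1" using True p_pos p_less_1 by (simp add: na powr_def mult_pos_neg)
        from has_sum_cmult_right[OF has_sum_geometric[OF this], of "y powi k * Q ((of_int k)\<^sup>2 / 2)"]
        have "((\<lambda>j. y powi k * Q ((of_int k)\<^sup>2 / 2) * (- a) ^ j) has_sum y powi k * Q ((of_int k)\<^sup>2 / 2) * pf y (k - 1)) UNIV"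
          by (simp add: pfa)
        moreover have "y powi k * Q ((of_int k)\<^sup>2 / 2) * (- a) ^ j = spa (k, j) * y powi spe (k, j)" for j
        proof -
          have "(- a) ^ j = (-1) ^ j * (y ^ j * Q (real j * (of_int k - 1 / 2)))"
            unfolding power_minus[of a] by (simp add: a_def power_mult_distrib qpow_power)
          then show ?thesis using True y0 by (simp add: spa_def spe_def power_int_add mult_ac)
        qed
        ultimately show ?thesis by simp
      next
        case False
        have "norm (- inverse a) < 1" using False p_pos p_less_1
          by (simp add: norm_inverse na powr_def exp_minus[symmetric] mult_neg_neg del: exp_minus)
        from has_sum_cmult_right[OF has_sum_geometric[OF this], of "y powi k * Q ((of_int k)\<^sup>2 / 2) * inverse a"]
        have "((\<lambda>j. y powi k * Q ((of_int k)\<^sup>2 / 2) * inverse a * (- inverse a) ^ j) has_sum y powi k * Q ((of_int k)\<^sup>2 / 2) * inverse a * (1 / (1 - - inverse a))) UNIV" .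
        also have "y powi k * Q ((of_int k)\<^sup>2 / 2) * inverse a * (1 / (1 - - inverse a)) = y powi k * Q ((of_int k)\<^sup>2 / 2) * pf y (k - 1)"
        proof -
          have "inverse a * (1 / (1 - - inverse a)) = pf y (k - 1)"
            unfolding pfa using a0 by (simp add: field_simps)
          then show ?thesis by (simp only: mult.assoc)
        qed
        also have "(\<lambda>j. y powi k * Q ((of_int k)\<^sup>2 / 2) * inverse a * (- inverse a) ^ j) = (\<lambda>j. spa (k, j) * y powi spe (k, j))"
        proof
          fix j
          have i: "inverse a = inverse y * Q (1 / 2 - of_int k)"
            using qpow_minus[of \<tau> "of_int k - 1 / 2"] by (simp add: a_def)
          have "inverse a * (- inverse a) ^ j = (-1) ^ j * inverse a ^ (j + 1)"
            unfolding power_minus[of "inverse a"] by simp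
          also have "inverse a ^ (j + 1) = inverse y ^ (j + 1) * Q (real (j + 1) * (1 / 2 - of_int k))"
            unfolding i power_mult_distrib qpow_power ..
          finally have 1: "inverse a * (- inverse a) ^ j = (-1) ^ j * (inverse y ^ (j + 1) * Q (real (j + 1) * (1 / 2 - of_int k)))" .
          have 2: "y powi spe (k, j) = y powi k * inverse y ^ (j + 1)"
          proof -
            have "spe (k, j) = k - int (j + 1)" using False by (simp add: spe_def)
            moreover have "y powi (k - int (j + 1)) = y powi k / y powi int (j + 1)"
              by (rule power_int_diff) (simp add: y0)
            ultimately show ?thesis by (simp only: power_int_of_nat divide_inverse power_inverse)
          qed
          show "y powi k * Q ((of_int k)\<^sup>2 / 2) * inverse a * (- inverse a) ^ j = spa (k, j) * y powi spe (k, j)"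
            using False unfolding mult.assoc 1 2 by (simp add: spa_def mult_ac)
        qed
        finally show ?thesis .
      qed
    qed
    then have "Sp y = infsum (\<lambda>x. spa x * y powi spe x) UNIV"
      unfolding Sp_def by (rule infsumI)
    then show ?thesis using hs by simp
  qed
  then have "has_laurent (\<lambda>k. infsum spa {x \<in> UNIV. spe x = k}) Sp circ"
    by (intro has_laurent_family) (auto simp: circ_def)
  then show ?thesis by (simp only: spa_fiber)
qed

text \<open>Summing a^n over all a = y q^(i+1/2) with i >= 0 gives the Lambert factor q^(n/2)/(1 -
  q^n); negative n come from the expansions in 1/a with i < 0.\<close>

definition cq :: "int \<Rightarrow> complex" where
  "cq n = - ((-1) powi n * of_int \<bar>n\<bar> * (Q (of_int \<bar>n\<bar> / 2) / (1 - Q (of_int \<bar>n\<bar>))))"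

text \<open>The pairs \<open>(i, n)\<close> index the expansions of \<open>a/(1 + a)\<^sup>2\<close>, \<open>a = y q\<^bsup>i+1/2\<^esup>\<close>, in powers \<open>a\<^bsup>n+1\<^esup>\<close> for
  \<open>i \<ge> 0\<close> and in powers of \<open>1/a\<close> for \<open>i < 0\<close>.\<close>

definition wa :: "complex \<Rightarrow> int \<times> nat \<Rightarrow> complex" where
  "wa y = (\<lambda>(i, n). (-1) ^ n * of_nat (n + 1) *
     (if i \<ge> 0 then y ^ (n + 1) * Q (real (n + 1) * (of_int i + 1 / 2))
      else inverse y ^ (n + 1) * Q (real (n + 1) * (- of_int i - 1 / 2))))"

lemma has_sum_square:
  fixes x :: complex
  assumes "norm x < 1"
  shows "((\<lambda>n. (-1) ^ n * of_nat (n + 1) * x ^ (n + 1)) has_sum x / (1 + x)\<^sup>2) UNIV"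
proof (rule norm_summable_imp_has_sum)
  have nx: "norm (- x) < 1" using assms by simp
  have "(\<lambda>n. of_nat (Suc n) * (- x) ^ n) sums (1 / (1 - - x)\<^sup>2)"
    by (rule geometric_deriv_sums[OF nx])
  from sums_mult[OF this, of x]
  show "(\<lambda>n. (-1) ^ n * of_nat (n + 1) * x ^ (n + 1)) sums (x / (1 + x)\<^sup>2)"
    unfolding power_minus[of x] by (simp add: mult_ac)
  have "norm (complex_of_real (norm x)) < 1" using assms by simp
  from sums_summable[OF geometric_deriv_sums[OF this]]
  have "summable (\<lambda>n. of_nat (Suc n) * complex_of_real (norm x) ^ n)" .
  from summable_Re[OF this] have "summable (\<lambda>n. real (Suc n) * norm x ^ n)"
    by (simp flip: of_real_power of_real_mult)
  from summable_mult[OF this, of "norm x"]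
  show "summable (\<lambda>n. norm ((-1) ^ n * of_nat (n + 1) * x ^ (n + 1)))"
    by (simp add: norm_mult norm_power mult_ac del: of_nat_Suc)
qed

lemma wa_summable: "y \<in> circ \<Longrightarrow> wa y summable_on UNIV"
proof -
  assume "y \<in> circ"
  then have ny: "norm y = 1" by (simp add: circ_def)
  have g: "(\<lambda>i::int. Q (of_int (if i \<ge> 0 then i else - 1 - i))) summable_on UNIV"
  proof (rule summable_on_geometric_int[where c = "1 / p" and a = p and b = p])
    fix k
    have 1: "1 \<le> 1 / p" using p_pos p_less_1 by simp
    have "p ^ k * 1 \<le> p ^ k * (1 / p)" using 1 p_pos by (intro mult_left_mono) auto
    then show "norm (Q (of_int (if int k \<ge> 0 then int k else - 1 - int k))) \<le> 1 / p * p ^ k"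
      using p_pos by (simp add: norm_Q powr_realpow)
    show "norm (Q (of_int (if - int k \<ge> 0 then - int k else - 1 - (- int k)))) \<le> 1 / p * p ^ k"
    proof (cases k)
      case (Suc j)
      have "real_of_int (int k - 1) = real j" using Suc by simp
      then show ?thesis using Suc p_pos by (simp add: norm_Q powr_realpow)
    qed (use 1 in simp)
  qed (use p_pos p_less_1 in auto)
  have h: "(\<lambda>n. (-1) ^ n * of_nat (n + 1) * Q (1 / 2) ^ (n + 1)) summable_on UNIV"
    using has_sum_square[OF norm_Q_less_1[of "1 / 2"]] by (auto simp: summable_on_def)
  have "(\<lambda>x. norm ((\<lambda>(i, n). Q (of_int (if i \<ge> 0 then i else - 1 - i)) * ((-1) ^ n * of_nat (n + 1) * Q (1 / 2) ^ (n + 1))) x)) summable_on UNIV"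
    using summable_on_product_complex[OF g h] by (simp add: summable_on_iff_abs_summable_on_complex)
  then have "(\<lambda>x. norm (wa y x)) summable_on UNIV"
  proof (rule Infinite_Sum.abs_summable_on_comparison_test')
    fix x :: "int \<times> nat"
    obtain i n where x: "x = (i, n)" by (cases x)
    define j where "j = (if i \<ge> 0 then i else - 1 - i)"
    have j: "j \<ge> 0" by (auto simp: j_def)
    have "norm (wa y x) = real (n + 1) * norm (Q (real (n + 1) * (of_int j + 1 / 2)))"
    proof (cases "i \<ge> 0")
      case True
      show ?thesis
        by (simp only: x wa_def prod.case if_P[OF True] j_def norm_mult norm_power norm_minus_cancel
            norm_one norm_of_nat ny power_one mult_1_left mult_1_right)
    next
      case False
      have "- of_int i - 1 / 2 = (of_int (- 1 - i) + 1 / 2 :: real)" by simp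
      then show ?thesis
        by (simp only: x wa_def prod.case if_not_P[OF False] j_def norm_mult norm_power norm_minus_cancel
            norm_one norm_of_nat norm_inverse ny power_one mult_1_left mult_1_right inverse_1)
    qed
    also have "\<dots> \<le> real (n + 1) * norm (Q (of_int j + real (n + 1) * (1 / 2)))"
    proof (intro mult_left_mono norm_Q_mono)
      have "1 * of_int j \<le> real (n + 1) * real_of_int j" using j by (intro mult_right_mono) auto
      then show "of_int j + real (n + 1) * (1 / 2) \<le> real (n + 1) * (of_int j + 1 / 2)"
        by (simp add: distrib_left)
    qed simp
    also have "\<dots> = norm (Q (of_int j) * ((-1) ^ n * of_nat (n + 1) * Q (1 / 2) ^ (n + 1)))"
      unfolding qpow_power qpow_mult[symmetric] norm_mult norm_power norm_of_nat by (simp add: mult_ac)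
    finally show "norm (wa y x) \<le> norm ((\<lambda>(i, n). Q (of_int (if i \<ge> 0 then i else - 1 - i)) * ((-1) ^ n * of_nat (n + 1) * Q (1 / 2) ^ (n + 1))) x)"
      by (simp add: x j_def)
  qed
  then show ?thesis by (rule abs_summable_summable)
qed

text \<open>Here the two poles of the partial fractions coincide, and the product is a/(1 + a)^2.
  This is invariant under inversion of a, so it can be expanded in whichever of a and 1/a is
  small.\<close>

lemma wa_has_sum: "y \<in> circ \<Longrightarrow> (wa y has_sum W y (- 1)) UNIV"
proof -
  assume y: "y \<in> circ"
  then have ny: "norm y = 1" and y0: "y \<noteq> 0" by (auto simp: circ_def)
  have hs: "(wa y has_sum infsum (wa y) UNIV) (UNIV \<times> UNIV)" using wa_summable[OF y] by simp
  then have "((\<lambda>i. pf y i * pf (inverse y) (- 1 - i)) has_sum infsum (wa y) UNIV) UNIV"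
  proof (rule has_sum_SigmaD)
    fix i :: int
    define a where "a = y * Q (of_int i + 1 / 2)"
    have na: "norm a = p powr (of_int i + 1 / 2)" by (simp add: a_def norm_mult ny norm_Q)
    have a0: "a \<noteq> 0" using y0 by (simp add: a_def)
    have n1: "1 + a \<noteq> 0" using circ_dom[OF y] by (simp add: dom_def a_def)
    have ia: "inverse a = inverse y * Q (- of_int i - 1 / 2)"
      using qpow_minus[of \<tau> "of_int i + 1 / 2"] by (simp add: a_def algebra_simps)
    have "of_int (- 1 - i) + 1 / 2 = (- of_int i - 1 / 2 :: real)" by simp
    then have "inverse y * Q (of_int (- 1 - i) + 1 / 2) = inverse a"
      unfolding ia by (simp only:)
    then have "pf y i * pf (inverse y) (- 1 - i) = 1 / (1 + a) * (1 / (1 + inverse a))"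
      unfolding pf_def a_def[symmetric] by simp
    also have "\<dots> = a / (1 + a)\<^sup>2" using a0 n1 by (simp add: field_simps power2_eq_square)
    finally have t: "pf y i * pf (inverse y) (- 1 - i) = a / (1 + a)\<^sup>2" .
    show "((\<lambda>n. wa y (i, n)) has_sum pf y i * pf (inverse y) (- 1 - i)) UNIV"
    proof (cases "i \<ge> 0")
      case True
      have "norm a < 1" using True p_pos p_less_1 by (simp add: na powr_def mult_pos_neg)
      from has_sum_square[OF this]
      show ?thesis unfolding t using True by (simp add: wa_def a_def power_mult_distrib qpow_power del: power_Suc of_nat_Suc of_nat_add)
    next
      case False
      have "norm (inverse a) < 1" using False p_pos p_less_1
        by (simp add: norm_inverse na powr_def exp_minus[symmetric] mult_neg_neg del: exp_minus)
      from has_sum_square[OF this]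
      have "((\<lambda>n. wa y (i, n)) has_sum inverse a / (1 + inverse a)\<^sup>2) UNIV"
        using False by (simp add: wa_def ia power_mult_distrib qpow_power del: power_Suc of_nat_Suc of_nat_add)
      also have "inverse a / (1 + inverse a)\<^sup>2 = a / (1 + a)\<^sup>2"
        using a0 n1 by (simp add: divide_simps power2_eq_square) (simp add: algebra_simps)
      finally show ?thesis unfolding t .
    qed
  qed
  then have "W y (- 1) = infsum (wa y) UNIV" unfolding W_def by (rule infsumI)
  then show ?thesis using hs by simp
qed

lemma W_m1_has_laurent: "has_laurent cq (\<lambda>y. W y (- 1)) circ"
  unfolding has_laurent_def
proof (intro conjI ballI)
  show "0 \<notin> circ" by (simp add: circ_def)
  fix y assume y: "y \<in> circ"
  then have ny: "norm y = 1" and y0: "y \<noteq> 0" by (auto simp: circ_def)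
  let ?f = "\<lambda>(n, j). - ((-1) powi n * of_int \<bar>n\<bar>) * y powi n * (Q (of_int \<bar>n\<bar> / 2) * Q (of_int \<bar>n\<bar>) ^ j)"
  let ?N = "- {0 :: int}"
  have "(wa y has_sum W y (- 1)) UNIV \<longleftrightarrow> (?f has_sum W y (- 1)) (?N \<times> UNIV)"
  proof (rule has_sum_reindex_bij_witness[where j = "\<lambda>(i, n). if i \<ge> 0 then (int n + 1, nat i) else (- int n - 1, nat (- 1 - i))"
        and i = "\<lambda>(n, j). if n > 0 then (int j, nat (n - 1)) else (- 1 - int j, nat (- n - 1))"])
    fix x :: "int \<times> nat"
    obtain i n where x: "x = (i, n)" by (cases x)
    show "?f (case x of (i, n) \<Rightarrow> if i \<ge> 0 then (int n + 1, nat i) else (- int n - 1, nat (- 1 - i))) = wa y x"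
    proof (cases "i \<ge> 0")
      case True
      have s: "- ((-1 :: complex) powi (int n + 1)) = (-1) ^ n" by (simp add: neg_one_powi minus_one_power_iff)
      have e: "Q (of_int (int n + 1) / 2) * Q (of_int (int n + 1)) ^ nat i = Q (real (n + 1) * (of_int i + 1 / 2))"
        unfolding qpow_power qpow_mult by (rule arg_cong[of _ _ Q]) (use True in \<open>simp add: algebra_simps\<close>)
      have py: "y powi (int n + 1) = y ^ (n + 1)"
        using power_int_of_nat[of y "n + 1"] by (simp only: of_nat_add of_nat_1)
      have ab: "\<bar>int n + 1\<bar> = int n + 1" by simp
      have nn: "(of_int (int n + 1) :: complex) = of_nat (n + 1)" by simp
      show ?thesis
        by (simp only: x prod.case if_P[OF True] wa_def ab e py nn s[symmetric] mult.assoc mult_minus_left)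
    next
      case False
      have s: "- ((-1 :: complex) powi (- int n - 1)) = (-1) ^ n" by (simp add: neg_one_powi minus_one_power_iff)
      have e: "Q (of_int (int n + 1) / 2) * Q (of_int (int n + 1)) ^ nat (- 1 - i) = Q (real (n + 1) * (- of_int i - 1 / 2))"
        unfolding qpow_power qpow_mult by (rule arg_cong[of _ _ Q]) (use False in \<open>simp add: field_simps\<close>)
      have ab: "\<bar>- int n - 1\<bar> = int n + 1" by simp
      have py: "y powi (- int n - 1) = inverse y ^ (n + 1)"
      proof -
        have "- int n - 1 = - int (n + 1)" by simp
        then show ?thesis by (simp only: power_int_minus power_int_of_nat power_inverse)
      qed
      have nn: "(of_int (int n + 1) :: complex) = of_nat (n + 1)" by simp
      show ?thesis
        by (simp only: x prod.case if_not_P[OF False] wa_def ab e py nn s[symmetric] mult.assoc mult_minus_left)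
    qed
  qed (auto split: if_splits prod.splits)
  with wa_has_sum[OF y] have "(?f has_sum W y (- 1)) (?N \<times> UNIV)" by blast
  then have "((\<lambda>n. cq n * y powi n) has_sum W y (- 1)) ?N"
  proof (rule has_sum_SigmaD)
    fix n :: int assume "n \<in> ?N"
    then have "norm (Q (of_int \<bar>n\<bar>)) < 1" by (intro norm_Q_less_1) simp
    from has_sum_cmult_right[OF has_sum_cmult_right[OF has_sum_geometric[OF this]], of "- ((-1) powi n * of_int \<bar>n\<bar>) * y powi n" "Q (of_int \<bar>n\<bar> / 2)"]
    show "((\<lambda>j. ?f (n, j)) has_sum cq n * y powi n) UNIV"
      by (simp add: cq_def mult_ac)
  qed
  moreover have "((\<lambda>n. cq n * y powi n) has_sum 0) {0}" by (simp add: cq_def has_sum_finiteI)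
  ultimately have "((\<lambda>n. cq n * y powi n) has_sum W y (- 1) + 0) (?N \<union> {0})"
    by (intro has_sum_Un_disjoint) auto
  moreover have "?N \<union> {0} = UNIV" by auto
  ultimately show "((\<lambda>n. cq n * y powi n) has_sum W y (- 1)) UNIV" by simp
qed

subsection \<open>Comparison of coefficients\<close>

text \<open>The coefficient of y^k in \<open>th y * W y (- 1)\<close> on the unit circle, with the
  factor q^(k^2/2) removed.\<close>

definition cc :: "int \<Rightarrow> complex" where
  "cc k = (\<Sum>\<^sub>\<infinity>i. cq i * Q ((of_int i)\<^sup>2 / 2 - of_int i * of_int k))"

lemma cc_has_sum: "((\<lambda>i. cq i * Q ((of_int i)\<^sup>2 / 2 - of_int i * of_int k)) has_sum cc k) UNIV"
proof -
  have "cq summable_on UNIV"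
    using has_laurentD[OF W_m1_has_laurent, of 1] by (auto simp: circ_def summable_on_def)
  then have "(\<lambda>i. cq i * Q ((of_int (k - i))\<^sup>2 / 2)) summable_on UNIV"
    by (rule summable_on_bounded_mult) (rule norm_Q_le_1, simp)
  then have "(\<lambda>i. Q (- (of_int k)\<^sup>2 / 2) * (cq i * Q ((of_int (k - i))\<^sup>2 / 2))) summable_on UNIV"
    by (rule summable_on_cmult_right)
  moreover have "Q (- (of_int k)\<^sup>2 / 2) * (cq i * Q ((of_int (k - i))\<^sup>2 / 2)) = cq i * Q ((of_int i)\<^sup>2 / 2 - of_int i * of_int k)" for i
  proof -
    have "Q (- (of_int k)\<^sup>2 / 2) * Q ((of_int (k - i))\<^sup>2 / 2) = Q ((of_int i)\<^sup>2 / 2 - of_int i * of_int k)"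
      unfolding qpow_mult by (rule arg_cong[of _ _ Q]) (simp add: power2_eq_square field_simps)
    then show ?thesis by (simp add: mult.left_commute)
  qed
  ultimately have "(\<lambda>i. cq i * Q ((of_int i)\<^sup>2 / 2 - of_int i * of_int k)) summable_on UNIV" by (simp only:)
  then show ?thesis unfolding cc_def by (rule has_sum_infsum)
qed

lemma cc_uminus: "cc (- k) = cc k"
proof -
  have "((\<lambda>i. cq (- i) * Q ((of_int (- i))\<^sup>2 / 2 - of_int (- i) * of_int k)) has_sum cc k) UNIV"
    by (rule has_sum_int_uminus[OF cc_has_sum])
  moreover have "cq (- i) = cq i" for i by (simp add: cq_def neg_one_powi)
  ultimately have "((\<lambda>i. cq i * Q ((of_int i)\<^sup>2 / 2 - of_int i * of_int (- k))) has_sum cc k) UNIV" by simp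
  then show ?thesis using cc_has_sum[of "- k"] has_sum_unique by blast
qed

text \<open>Going from k to k + 1 multiplies the i-th term by q^(-i), and q^(-i) - 1 cancels the
  Lambert denominator. What remains is the series \<open>tc\<close> shifted by k and weighted by i =
  (i - k) + k; the weight i - k gives \<open>- (phi ^ 3)\<close> by \<open>tc_weighted\<close>, and
  the constant weight gives 0.\<close>

lemma cc_Suc: "cc (int k + 1) = cc (int k) + phi ^ 3 * ((-1) ^ k * Q (- (real k * real (k + 1) / 2)))"
proof -
  let ?c = "(-1) ^ k * Q (- (real k * real (k + 1) / 2))"
  have t: "cq i * Q ((of_int i)\<^sup>2 / 2 - of_int i * of_int (int k + 1)) - cq i * Q ((of_int i)\<^sup>2 / 2 - of_int i * of_int (int k))
      = - ?c * (of_int (i - int k) * tc (i - int k) + of_nat k * tc (i - int k))" for i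
  proof (cases "i = 0")
    case True
    then show ?thesis by (simp add: cq_def)
  next
    case False
    have e1: "Q ((of_int i)\<^sup>2 / 2 - of_int i * of_int (int k + 1)) = Q ((of_int i)\<^sup>2 / 2 - of_int i * of_int (int k)) * Q (- of_int i)"
      unfolding qpow_mult by (rule arg_cong[of _ _ Q]) (simp add: algebra_simps)
    \<comment> \<open>For i > 0 one has q^(-i) - 1 = q^(-i) (1 - q^i); for i < 0 the quotient by the
      denominator is -1, and this sign turns |i| into i.\<close>
    have e2: "of_int \<bar>i\<bar> * (Q (of_int \<bar>i\<bar> / 2) / (1 - Q (of_int \<bar>i\<bar>))) * (Q (- of_int i) - 1) = of_int i * Q (- of_int i / 2)"
    proof (cases "i > 0")
      case True
      have n: "1 - Q (of_int i) \<noteq> 0" using Q_ne_1[of "of_int i"] False by auto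
      have "Q (- of_int i) - 1 = Q (- of_int i) * (1 - Q (of_int i))"
        by (simp add: right_diff_distrib qpow_mult)
      moreover have "Q (of_int i / 2) * Q (- of_int i) = Q (- of_int i / 2)"
        unfolding qpow_mult by (rule arg_cong[of _ _ Q]) simp
      ultimately show ?thesis using True n by simp
    next
      case neg: False
      have n: "1 - Q (- of_int i) \<noteq> 0" using Q_ne_1[of "- of_int i"] False by auto
      then have "(Q (- of_int i) - 1) / (1 - Q (- of_int i)) = - 1" by (simp add: field_simps)
      then show ?thesis using neg n by (simp add: field_simps)
    qed
    have e3: "Q (- of_int i / 2) * Q ((of_int i)\<^sup>2 / 2 - of_int i * of_int (int k))
        = Q (- (real k * real (k + 1) / 2)) * Q (of_int ((i - int k) * (i - int k - 1)) / 2)"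
      unfolding qpow_mult by (rule arg_cong[of _ _ Q]) (simp add: power2_eq_square field_simps)
    have s: "(-1 :: complex) powi i = (-1) ^ k * (-1) powi (i - int k)"
      by (simp add: neg_one_powi minus_one_power_iff)
    have "cq i * Q ((of_int i)\<^sup>2 / 2 - of_int i * of_int (int k + 1)) - cq i * Q ((of_int i)\<^sup>2 / 2 - of_int i * of_int (int k))
        = cq i * (Q (- of_int i) - 1) * Q ((of_int i)\<^sup>2 / 2 - of_int i * of_int (int k))"
      unfolding e1 by (simp add: algebra_simps)
    also have "cq i * (Q (- of_int i) - 1) = - ((-1) powi i * (of_int \<bar>i\<bar> * (Q (of_int \<bar>i\<bar> / 2) / (1 - Q (of_int \<bar>i\<bar>))) * (Q (- of_int i) - 1)))"
      unfolding cq_def by (simp only: mult.assoc mult_minus_left)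
    also have "\<dots> = - ((-1) powi i * of_int i * Q (- of_int i / 2))"
      unfolding e2 by (simp only: mult.assoc)
    also have "- ((-1) powi i * of_int i * Q (- of_int i / 2)) * Q ((of_int i)\<^sup>2 / 2 - of_int i * of_int (int k))
        = - ((-1) powi i * of_int i * (Q (- of_int i / 2) * Q ((of_int i)\<^sup>2 / 2 - of_int i * of_int (int k))))"
      by (simp only: mult.assoc mult_minus_left)
    also have "\<dots> = - ?c * (of_int i * tc (i - int k))"
      unfolding e3 s tc_def by (simp only: mult_ac mult_minus_left mult_minus_right)
    also have "of_int i = (of_int (i - int k) + of_nat k :: complex)" by simp
    finally show ?thesis by (simp only: distrib_right)
  qed
  have "((\<lambda>i. cq i * Q ((of_int i)\<^sup>2 / 2 - of_int i * of_int (int k + 1)) - cq i * Q ((of_int i)\<^sup>2 / 2 - of_int i * of_int (int k))) has_sum cc (int k + 1) - cc (int k)) UNIV"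
    by (rule has_sum_minus[OF cc_has_sum cc_has_sum])
  moreover have "((\<lambda>i. - ?c * (of_int (i - int k) * tc (i - int k) + of_nat k * tc (i - int k))) has_sum - ?c * (- (phi ^ 3) + of_nat k * 0)) UNIV"
    by (intro has_sum_cmult_right has_sum_add has_sum_int_shift[OF tc_weighted] has_sum_int_shift[OF tc_has_sum])
  ultimately have "cc (int k + 1) - cc (int k) = - ?c * (- (phi ^ 3) + of_nat k * 0)"
    unfolding t by (rule has_sum_unique)
  then show ?thesis by (simp add: algebra_simps)
qed

text \<open>At k = 0 the terms i = n + 1 and i = -(n + 1) both equal the n-th term of
  \<open>RS_has_sum\<close> for N = 0; together they give \<open>2 * RS 0\<close>.\<close>

lemma cc_0: "cc 0 = gN 0"
proof -
  let ?f = "\<lambda>i. cq i * Q ((of_int i)\<^sup>2 / 2 - of_int i * of_int 0)"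
  have f: "?f (int n + 1) = (-1) ^ n * Q (real (n + 1) * real (n + 2) / 2) * gin 0 n" for n
  proof -
    have s: "- ((-1 :: complex) powi (int n + 1)) = (-1) ^ n" by (simp add: neg_one_powi minus_one_power_iff)
    have e: "Q (of_int (int n + 1) / 2) * Q ((of_int (int n + 1))\<^sup>2 / 2 - of_int (int n + 1) * of_int 0) = Q (real (n + 1) * real (n + 2) / 2)"
      unfolding qpow_mult by (rule arg_cong[of _ _ Q]) (simp add: power2_eq_square field_simps)
    have "?f (int n + 1) = - ((-1) powi (int n + 1)) * (Q (of_int (int n + 1) / 2) * Q ((of_int (int n + 1))\<^sup>2 / 2 - of_int (int n + 1) * of_int 0)) * (of_int (int n + 1) / (1 - Q (of_int (int n + 1))))"
      by (simp add: cq_def)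
    also have "\<dots> = (-1) ^ n * Q (real (n + 1) * real (n + 2) / 2) * gin 0 n"
    proof -
      have i: "of_int (int n + 1) = real (n + 1)" "of_int (int n + 1) = (of_nat (n + 1) :: complex)" by simp_all
      have g: "gin 0 n = of_nat (n + 1) / (1 - Q (real (n + 1)))" by (simp add: gin_def add.commute)
      show ?thesis unfolding s e unfolding i g ..
    qed
    finally show ?thesis .
  qed
  have sym: "?f (- i) = ?f i" for i by (simp add: cq_def neg_one_powi)
  have pos: "(?f has_sum RS 0) (range (\<lambda>n. int n + 1))"
    using RS_has_sum[of 0] unfolding f[symmetric] by (subst has_sum_reindex) (auto simp: inj_on_def o_def)
  have neg: "(?f has_sum RS 0) (range (\<lambda>n. - (int n + 1)))"
  proof -
    have "((\<lambda>n. ?f (- (int n + 1))) has_sum RS 0) UNIV"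
      using RS_has_sum[of 0] unfolding f[symmetric] sym .
    then show ?thesis by (subst has_sum_reindex) (auto simp: inj_on_def o_def)
  qed
  have z: "(?f has_sum 0) {0}" by (rule has_sum_finiteI) (auto simp: cq_def)
  have "(?f has_sum (RS 0 + RS 0) + 0) ((range (\<lambda>n. int n + 1) \<union> range (\<lambda>n. - (int n + 1))) \<union> {0})"
    by (intro has_sum_Un_disjoint pos neg z) auto
  moreover have "(range (\<lambda>n. int n + 1) \<union> range (\<lambda>n. - (int n + 1))) \<union> {0} = UNIV"
  proof -
    have "i \<in> (range (\<lambda>n. int n + 1) \<union> range (\<lambda>n. - (int n + 1))) \<union> {0}" for i
    proof -
      consider "i = 0" | "i = int (nat (i - 1)) + 1" | "i = - (int (nat (- i - 1)) + 1)" by linarith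
      then show ?thesis by cases blast+
    qed
    then show ?thesis by blast
  qed
  ultimately have "(?f has_sum 2 * RS 0) UNIV" by simp
  then show ?thesis using cc_has_sum[of 0] has_sum_unique by (force simp: gN_def)
qed

lemma cc_conv: "cc k = gN 0 + phi ^ 3 * sk k"
proof -
  have nat: "cc (int n) = gN 0 + phi ^ 3 * sk (int n)" for n
  proof (induction n)
    case (Suc n)
    have "sk (int (Suc n)) = sk (int n) + (-1) ^ n * Q (- (real n * real (n + 1) / 2))"
      unfolding sk_def by (simp only: abs_of_nat nat_int sum.lessThan_Suc)
    then show ?case using Suc.IH cc_Suc[of n] by (simp add: algebra_simps)
  qed (simp add: cc_0 sk_def)
  show ?thesis
  proof (cases k rule: int_cases2)
    case (nonpos n)
    then show ?thesis using nat[of n] cc_uminus[of "int n"] by (simp add: sk_def)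
  qed (use nat in auto)
qed

text \<open>By \<open>cc_conv\<close> both sides have the coefficients q^(k^2/2) times
  \<open>gN 0 + phi ^ 3 * sk k\<close>.\<close>

lemma key_circ: "y \<in> circ \<Longrightarrow> th y * W y (- 1) = gN 0 * th y + phi ^ 3 * Sp y"
proof -
  assume y: "y \<in> circ"
  have sub: "circ \<subseteq> - {0}" by (auto simp: circ_def)
  have 1: "has_laurent (\<lambda>k. \<Sum>\<^sub>\<infinity>i. cq i * Q ((of_int (k - i))\<^sup>2 / 2)) (\<lambda>y. W y (- 1) * th y) circ"
    by (rule has_laurent_mult[OF W_m1_has_laurent has_laurent_subset[OF th_has_laurent sub]])
  have 2: "has_laurent (\<lambda>k. gN 0 * Q ((of_int k)\<^sup>2 / 2) + phi ^ 3 * (Q ((of_int k)\<^sup>2 / 2) * sk k))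
      (\<lambda>y. gN 0 * th y + phi ^ 3 * Sp y) circ"
    by (intro has_laurent_add has_laurent_cmult Sp_has_laurent has_laurent_subset[OF th_has_laurent sub])
  have e: "(\<Sum>\<^sub>\<infinity>i. cq i * Q ((of_int (k - i))\<^sup>2 / 2)) = gN 0 * Q ((of_int k)\<^sup>2 / 2) + phi ^ 3 * (Q ((of_int k)\<^sup>2 / 2) * sk k)" for k
  proof -
    have "(\<Sum>\<^sub>\<infinity>i. cq i * Q ((of_int (k - i))\<^sup>2 / 2)) = (\<Sum>\<^sub>\<infinity>i. Q ((of_int k)\<^sup>2 / 2) * (cq i * Q ((of_int i)\<^sup>2 / 2 - of_int i * of_int k)))"
    proof (rule infsum_cong)
      fix i
      have "Q ((of_int (k - i))\<^sup>2 / 2) = Q ((of_int k)\<^sup>2 / 2) * Q ((of_int i)\<^sup>2 / 2 - of_int i * of_int k)"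
        unfolding qpow_mult by (rule arg_cong[of _ _ Q]) (simp add: power2_eq_square field_simps)
      then show "cq i * Q ((of_int (k - i))\<^sup>2 / 2) = Q ((of_int k)\<^sup>2 / 2) * (cq i * Q ((of_int i)\<^sup>2 / 2 - of_int i * of_int k))"
        by (simp only: mult_ac)
    qed
    also have "\<dots> = Q ((of_int k)\<^sup>2 / 2) * cc k" unfolding cc_def by (rule infsum_cmult_right')
    finally show ?thesis unfolding cc_conv by (simp only: distrib_left mult_ac)
  qed
  have "W y (- 1) * th y = gN 0 * th y + phi ^ 3 * Sp y"
    by (rule has_laurent_value_unique[OF 1[unfolded e] 2 y])
  then show ?thesis by (simp only: mult.commute)
qed

end

section \<open>Occupation numbers\<close>

type_synonym fock_mode = "generator \<times> nat"

text \<open>The pair (g, n) stands for the creation operator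
  \<open>prd (- int n - 1) (\<phi> g)\<close>, see \<open>cre\<close>, which raises the conformal
  weight by n plus that of g.\<close>

fun mode_wt :: "fock_mode \<Rightarrow> real" where
  "mode_wt (g, n) = (if is_odd g then real n + 1 / 2 else real n + 1)"

fun gen_charge :: "generator \<Rightarrow> int" where
  "gen_charge (B _) = 1" | "gen_charge (C _) = - 1" | "gen_charge (X _) = 0" | "gen_charge (Y _) = 0"

text \<open>The exponent of s under the diagonal matrix with entries s and 1/s, see
  \<open>dt_gen\<close>.\<close>

fun gen_weight :: "generator \<Rightarrow> int" where
  "gen_weight (B i) = (if i = 1 then 1 else - 1)"
| "gen_weight (C i) = (if i = 1 then - 1 else 1)"
| "gen_weight (X i) = (if i = 1 then 1 else - 1)"
| "gen_weight (Y i) = (if i = 1 then - 1 else 1)"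

definition occ :: "fock_mode multiset set" where
  "occ = {M. \<forall>g n. is_odd g \<longrightarrow> count M (g, n) \<le> 1}"

definition occ_wt :: "fock_mode multiset \<Rightarrow> real" where "occ_wt M = (\<Sum>i\<in>#M. mode_wt i)"
definition occ_charge :: "fock_mode multiset \<Rightarrow> int" where "occ_charge M = (\<Sum>i\<in>#M. gen_charge (fst i))"
definition occ_weight :: "fock_mode multiset \<Rightarrow> int" where "occ_weight M = (\<Sum>i\<in>#M. gen_weight (fst i))"

lemma two_cases: "(i :: 2) = 1 \<or> i = 2" using exhaust_2 by blast

lemma UNIV_generator: "(UNIV :: generator set) = {B 1, B 2, C 1, C 2, X 1, X 2, Y 1, Y 2}"
proof -
  have "g \<in> {B 1, B 2, C 1, C 2, X 1, X 2, Y 1, Y 2}" for g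
  proof (cases g)
    case (B i) then show ?thesis using two_cases[of i] by auto
  next
    case (C i) then show ?thesis using two_cases[of i] by auto
  next
    case (X i) then show ?thesis using two_cases[of i] by auto
  next
    case (Y i) then show ?thesis using two_cases[of i] by auto
  qed
  then show ?thesis by blast
qed

definition gen_occ :: "generator \<Rightarrow> nat multiset set" where
  "gen_occ g = (if is_odd g then {K. \<forall>n. count K n \<le> 1} else UNIV)"

lemma count_image_Pair: "count (image_mset (Pair g) K) (g', n) = (if g' = g then count K n else 0)"
  by (induction K) auto

lemma count_image_snd_filter: "count (image_mset snd (filter_mset (\<lambda>i. fst i = g) M)) n = count M (g, n)"
  by (induction M) auto

lemma occ_insert_bij:
  assumes g: "g \<notin> A"
  shows "bij_betw (\<lambda>(M, K). M + image_mset (Pair g) K)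
    ({M \<in> occ. fst ` set_mset M \<subseteq> A} \<times> gen_occ g) {M \<in> occ. fst ` set_mset M \<subseteq> insert g A}"
proof (rule bij_betwI[where g = "\<lambda>M. (filter_mset (\<lambda>i. fst i \<noteq> g) M, image_mset snd (filter_mset (\<lambda>i. fst i = g) M))"])
  show "(\<lambda>(M, K). M + image_mset (Pair g) K) \<in>
      ({M \<in> occ. fst ` set_mset M \<subseteq> A} \<times> gen_occ g) \<rightarrow> {M \<in> occ. fst ` set_mset M \<subseteq> insert g A}"
  proof (rule Pi_I)
    fix x assume "x \<in> {M \<in> occ. fst ` set_mset M \<subseteq> A} \<times> gen_occ g"
    then obtain M K where x: "x = (M, K)" and M: "M \<in> occ" "fst ` set_mset M \<subseteq> A" and K: "K \<in> gen_occ g"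
      by auto
    have "count M (g, n) = 0" for n using M(2) g by (force simp: count_eq_zero_iff)
    then have "M + image_mset (Pair g) K \<in> occ"
      using M(1) K by (auto simp: occ_def count_image_Pair gen_occ_def)
    then show "(case x of (M, K) \<Rightarrow> M + image_mset (Pair g) K) \<in> {M \<in> occ. fst ` set_mset M \<subseteq> insert g A}"
      using M(2) by (auto simp: x)
  qed
  show "(\<lambda>M. (filter_mset (\<lambda>i. fst i \<noteq> g) M, image_mset snd (filter_mset (\<lambda>i. fst i = g) M))) \<in>
      {M \<in> occ. fst ` set_mset M \<subseteq> insert g A} \<rightarrow> {M \<in> occ. fst ` set_mset M \<subseteq> A} \<times> gen_occ g"
  proof (rule Pi_I)
    fix M assume "M \<in> {M \<in> occ. fst ` set_mset M \<subseteq> insert g A}"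
    then have M: "M \<in> occ" and "\<And>i. i \<in># M \<Longrightarrow> fst i \<in> insert g A" by auto
    then show "(filter_mset (\<lambda>i. fst i \<noteq> g) M, image_mset snd (filter_mset (\<lambda>i. fst i = g) M))
        \<in> {M \<in> occ. fst ` set_mset M \<subseteq> A} \<times> gen_occ g"
      by (auto simp: occ_def gen_occ_def count_image_snd_filter)
  qed
next
  fix x assume "x \<in> {M \<in> occ. fst ` set_mset M \<subseteq> A} \<times> gen_occ g"
  then obtain M K where x: "x = (M, K)" and M: "fst ` set_mset M \<subseteq> A" by auto
  have "filter_mset (\<lambda>i. fst i \<noteq> g) M = M" "filter_mset (\<lambda>i. fst i = g) M = {#}"
    using M g by (auto simp: filter_mset_eq_conv)
  moreover have "filter_mset (\<lambda>i. fst i \<noteq> g) (image_mset (Pair g) K) = {#}"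
    "filter_mset (\<lambda>i. fst i = g) (image_mset (Pair g) K) = image_mset (Pair g) K"
    by (auto simp: filter_mset_eq_conv)
  ultimately show "(filter_mset (\<lambda>i. fst i \<noteq> g) (case x of (M, K) \<Rightarrow> M + image_mset (Pair g) K),
      image_mset snd (filter_mset (\<lambda>i. fst i = g) (case x of (M, K) \<Rightarrow> M + image_mset (Pair g) K))) = x"
    by (simp add: x image_mset.compositionality o_def)
next
  fix M :: "fock_mode multiset"
  have "count (filter_mset (\<lambda>i. fst i \<noteq> g) M + image_mset (Pair g) (image_mset snd (filter_mset (\<lambda>i. fst i = g) M))) i = count M i" for i
    by (cases i) (simp add: count_image_Pair count_image_snd_filter)
  then show "(case (filter_mset (\<lambda>i. fst i \<noteq> g) M, image_mset snd (filter_mset (\<lambda>i. fst i = g) M)) of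
      (M, K) \<Rightarrow> M + image_mset (Pair g) K) = M"
    by (simp add: multiset_eq_iff)
qed

text \<open>Generators are added one at a time by \<open>occ_insert_bij\<close>, so the sum over
  occupation numbers factorises over the eight generators.\<close>

lemma has_sum_occ:
  fixes z :: "fock_mode \<Rightarrow> complex"
  assumes "\<And>g. ((\<lambda>K. \<Prod>n\<in>#K. z (g, n)) has_sum s g) (gen_occ g)"
  shows "((\<lambda>M. \<Prod>i\<in>#M. z i) has_sum (\<Prod>g\<in>UNIV. s g)) occ"
proof -
  have "((\<lambda>M. \<Prod>i\<in>#M. z i) has_sum (\<Prod>g\<in>A. s g)) {M \<in> occ. fst ` set_mset M \<subseteq> A}" if "finite A" for A
    using that
  proof induction
    case empty
    have "{M \<in> occ. fst ` set_mset M \<subseteq> {}} = {{#}}" by (auto simp: occ_def)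
    then show ?case by (simp add: has_sum_finiteI)
  next
    case (insert g A)
    have "((\<lambda>(M, K). (\<Prod>i\<in>#M. z i) * (\<Prod>n\<in>#K. z (g, n))) has_sum (\<Prod>g\<in>A. s g) * s g)
        ({M \<in> occ. fst ` set_mset M \<subseteq> A} \<times> gen_occ g)"
      by (rule has_sum_product_complex[OF insert.IH assms])
    then have "((\<lambda>x. \<Prod>i\<in>#(case x of (M, K) \<Rightarrow> M + image_mset (Pair g) K). z i) has_sum (\<Prod>g\<in>insert g A. s g))
        ({M \<in> occ. fst ` set_mset M \<subseteq> A} \<times> gen_occ g)"
      using insert.hyps by (simp add: case_prod_unfold mult.commute image_mset.compositionality o_def)
    then show ?case
      by (subst (asm) has_sum_reindex_bij_betw[OF occ_insert_bij[OF insert.hyps(2)]])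
  qed
  moreover have "finite (UNIV :: generator set)" unfolding UNIV_generator by simp
  ultimately have "((\<lambda>M. \<Prod>i\<in>#M. z i) has_sum (\<Prod>g\<in>UNIV. s g)) {M \<in> occ. fst ` set_mset M \<subseteq> UNIV}" .
  then show ?thesis by simp
qed

context nome
begin

lemma has_sum_odd: "z \<noteq> 0 \<Longrightarrow> ((\<lambda>K. \<Prod>n\<in>#K. z * Q (real n + 1 / 2)) has_sum G z) {K. \<forall>n. count K n \<le> 1}"
  by (rule has_sum_multisets_le_1[OF summable_Q G_tendsto]) auto

lemma has_sum_even:
  assumes z: "z \<noteq> 0" "p * norm z < 1" and G: "G (- Q (1 / 2) * z) \<noteq> 0"
  shows "((\<lambda>K. \<Prod>n\<in>#K. z * Q (real n + 1)) has_sum inverse (G (- Q (1 / 2) * z))) UNIV"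
proof (rule has_sum_multisets_UNIV[OF _ summable_Q _ G])
  show "norm (z * Q (real n + 1)) < 1" for n
  proof -
    have "norm (Q (real n + 1)) \<le> p" using norm_Q_mono[of 1 "real n + 1"] by (simp add: p_def)
    then have "norm z * norm (Q (real n + 1)) \<le> norm z * p" by (rule mult_left_mono) simp
    then show ?thesis using z(2) by (simp add: norm_mult mult.commute)
  qed
  have e: "- Q (1 / 2) * z * Q (real n + 1 / 2) = - (z * Q (real n + 1))" for n
    using qpow_mult[of \<tau> "1 / 2" "real n + 1 / 2"] by (simp add: algebra_simps)
  have "(\<lambda>K. \<Prod>n<K. 1 + - Q (1 / 2) * z * Q (real n + 1 / 2)) \<longlonglongrightarrow> G (- Q (1 / 2) * z)"
    by (rule G_tendsto) (use z in simp)
  then show "(\<lambda>K. \<Prod>n<K. 1 - z * Q (real n + 1)) \<longlonglongrightarrow> G (- Q (1 / 2) * z)"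
    unfolding e by simp
qed simp

definition zf :: "complex \<Rightarrow> complex \<Rightarrow> fock_mode \<Rightarrow> complex" where
  "zf y u = (\<lambda>i. y powi gen_charge (fst i) * u powi gen_weight (fst i) * Q (mode_wt i))"

lemma prod_zf:
  assumes "y \<noteq> 0" "u \<noteq> 0"
  shows "(\<Prod>i\<in>#M. zf y u i) = Q (occ_wt M) * y powi occ_charge M * u powi occ_weight M"
  by (induction M)
    (use assms in \<open>simp_all add: zf_def occ_wt_def occ_charge_def occ_weight_def power_int_add qpow_mult[symmetric] mult_ac\<close>)

definition gen_sum :: "complex \<Rightarrow> complex \<Rightarrow> generator \<Rightarrow> complex" where
  "gen_sum y u g = (let z = y powi gen_charge g * u powi gen_weight g in
     if is_odd g then G z else inverse (G (- Q (1 / 2) * z)))"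

text \<open>The four odd generators combine by the triple product into two theta functions over
  \<open>phi\<^sup>2\<close>; the four even ones give \<open>(inverse (Bl u))\<^sup>2\<close>, which
  \<open>Bl_e0\<close> turns into (1 - u)^2 times the square of \<open>e0 u\<close>, over
  \<open>phi ^ 4\<close>.\<close>

lemma gen_sum_prod:
  assumes y: "y \<noteq> 0" and u: "u \<in> ann"
  shows "(\<Prod>g\<in>UNIV. gen_sum y u g) = th (y * u) * th (inverse y * u) * (e0 u)\<^sup>2 * (1 - u)\<^sup>2 / phi ^ 6"
proof -
  have u0: "u \<noteq> 0" using u ann_nonzero by auto
  have ne: "(1 :: 2) \<noteq> 2" by simp
  have 1: "th (y * u) = phi * (G (y * u) * G (inverse y * inverse u))"
    using triple_product[of "y * u"] y u0 by simp
  have 2: "th (inverse y * u) = phi * (G (inverse y * u) * G (y * inverse u))"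
    using triple_product[of "inverse y * u"] y u0 by simp
  have "(\<Prod>g\<in>UNIV. gen_sum y u g) = G (y * u) * G (y * inverse u) * G (inverse y * inverse u) * G (inverse y * u)
      * (inverse (Bl u))\<^sup>2"
    unfolding UNIV_generator
    by (simp add: gen_sum_def Bl_def Let_def power_int_minus power2_eq_square mult_ac)
  also have "\<dots> = th (y * u) * th (inverse y * u) / phi\<^sup>2 * (inverse (Bl u))\<^sup>2"
    unfolding 1 2 using phi_nonzero by (simp add: power2_eq_square field_simps)
  also have "\<dots> = th (y * u) * th (inverse y * u) * (e0 u)\<^sup>2 * (1 - u)\<^sup>2 / phi ^ 6"
  proof -
    have "phi ^ 6 = phi\<^sup>2 * (phi\<^sup>2 * phi\<^sup>2)" by (simp add: power_add[symmetric])
    then show ?thesis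
      unfolding Bl_e0(2)[OF u] power_divide power_mult_distrib power2_eq_square[of "phi\<^sup>2"]
      by (simp only: divide_inverse inverse_mult_distrib mult_ac)
  qed
  finally show ?thesis .
qed

lemma occ_has_sum:
  assumes y: "y \<noteq> 0" and u: "u \<in> ann"
  shows "((\<lambda>M. Q (occ_wt M) * y powi occ_charge M * u powi occ_weight M) has_sum
    th (y * u) * th (inverse y * u) * (e0 u)\<^sup>2 * (1 - u)\<^sup>2 / phi ^ 6) occ"
proof -
  have u0: "u \<noteq> 0" using u ann_nonzero by auto
  have nu: "p < norm u" "norm u < 1" using u by (auto simp: ann_def)
  have Gnz: "G (- Q (1 / 2) * u) \<noteq> 0" "G (- Q (1 / 2) * inverse u) \<noteq> 0"
    using Bl_e0(1)[OF u] by (auto simp: Bl_def)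
  have pu: "p * norm u < 1" using u ann_ann2 by (auto simp: ann2_def)
  have "norm u > 0" using u0 by simp
  then have pu': "p * norm (inverse u) < 1"
    using nu by (simp only: norm_inverse divide_inverse[symmetric] pos_divide_less_eq mult_1_left)
  have s: "((\<lambda>K. \<Prod>n\<in>#K. zf y u (g, n)) has_sum gen_sum y u g) (gen_occ g)" for g
  proof (cases "is_odd g")
    case True
    then show ?thesis
      using has_sum_odd[of "y powi gen_charge g * u powi gen_weight g"] y u0
      by (simp add: gen_occ_def gen_sum_def zf_def)
  next
    case False
    define z where "z = y powi gen_charge g * u powi gen_weight g"
    have "gen_charge g = 0" "gen_weight g = 1 \<or> gen_weight g = - 1"
      using False by (cases g; simp)+
    then have "z = u \<or> z = inverse u" by (auto simp: z_def)
    then have "((\<lambda>K. \<Prod>n\<in>#K. z * Q (real n + 1)) has_sum inverse (G (- Q (1 / 2) * z))) UNIV"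
      using u0 pu pu' Gnz by (intro has_sum_even) auto
    then show ?thesis using False by (simp add: gen_occ_def gen_sum_def zf_def z_def)
  qed
  from has_sum_occ[OF s] show ?thesis
    unfolding prod_zf[OF y u0] gen_sum_prod[OF y u] .
qed

section \<open>Traces of fixed torus weight\<close>

definition A :: "int \<Rightarrow> complex \<Rightarrow> complex" where
  "A w y = (\<Sum>\<^sub>\<infinity>M\<in>{M \<in> occ. occ_weight M = w}. Q (occ_wt M) * y powi occ_charge M)"

lemma r0_ann: "complex_of_real r0 \<in> ann"
  by (rule r0(4)) (use r0(1) in simp)

text \<open>On a fixed torus weight the power of u is constant, so convergence of the full trace at
  u = \<open>r0\<close> carries over.\<close>

lemma A_has_sum:
  assumes y: "y \<noteq> 0"
  shows "((\<lambda>M. Q (occ_wt M) * y powi occ_charge M) has_sum A w y) {M \<in> occ. occ_weight M = w}"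
proof -
  let ?u = "complex_of_real r0"
  have u0: "?u \<noteq> 0" using r0(1) by simp
  have "(\<lambda>M. Q (occ_wt M) * y powi occ_charge M * ?u powi occ_weight M) summable_on {M \<in> occ. occ_weight M = w}"
    using has_sum_imp_summable[OF occ_has_sum[OF y r0_ann]] by (rule summable_on_subset_banach) auto
  then have "(\<lambda>M. Q (occ_wt M) * y powi occ_charge M * ?u powi occ_weight M * ?u powi (- w)) summable_on {M \<in> occ. occ_weight M = w}"
    by (rule summable_on_cmult_left)
  moreover have "Q (occ_wt M) * y powi occ_charge M * ?u powi occ_weight M * ?u powi (- w) = Q (occ_wt M) * y powi occ_charge M"
    if "M \<in> {M \<in> occ. occ_weight M = w}" for M
    using that u0 by (simp add: power_int_minus)
  then have "(\<lambda>M. Q (occ_wt M) * y powi occ_charge M * ?u powi occ_weight M * ?u powi (- w)) summable_on {M \<in> occ. occ_weight M = w}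
      \<longleftrightarrow> (\<lambda>M. Q (occ_wt M) * y powi occ_charge M) summable_on {M \<in> occ. occ_weight M = w}"
    by (rule summable_on_cong)
  ultimately have "(\<lambda>M. Q (occ_wt M) * y powi occ_charge M) summable_on {M \<in> occ. occ_weight M = w}"
    by blast
  then show ?thesis unfolding A_def by (rule has_sum_infsum)
qed

text \<open>Regularity at every nonzero y, poles of the partial fractions included, is what allows
  \<open>key\<close> to leave the unit circle.\<close>

lemma A_laurent_y: "\<exists>c. has_laurent c (A w) (- {0})"
proof -
  have "has_laurent (\<lambda>k. infsum (\<lambda>M. Q (occ_wt M)) {M \<in> {M \<in> occ. occ_weight M = w}. occ_charge M = k}) (A w) (- {0})"
    by (rule has_laurent_family) (auto intro: A_has_sum)
  then show ?thesis by blast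
qed

text \<open>The factor (1 - u)^2 takes the second difference of the coefficients in
  \<open>W_has_laurent\<close>.\<close>

lemma A_conv:
  assumes y: "dom y"
  shows "A w y = (th y)\<^sup>2 / phi ^ 6 * (W y w - 2 * W y (w - 1) + W y (w - 2))"
proof -
  have y0: "y \<noteq> 0" using y by (simp add: dom_def)
  let ?P = "\<lambda>u. th (y * u) * th (inverse y * u) * (e0 u)\<^sup>2"
  have 1: "has_laurent (\<lambda>w. A w y) (\<lambda>u. ?P u * (1 - u)\<^sup>2 / phi ^ 6) ann"
    unfolding A_def
    by (rule has_laurent_family) (use occ_has_sum[OF y0] ann_nonzero in auto)
  note L = W_has_laurent[OF y]
  have "has_laurent (\<lambda>k. 1 / phi ^ 6 * (((th y)\<^sup>2 * W y k - 2 * ((th y)\<^sup>2 * W y (k - 1))) + (th y)\<^sup>2 * W y (k - 2)))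
      (\<lambda>u. 1 / phi ^ 6 * ((?P u - 2 * (u powi 1 * ?P u)) + u powi 2 * ?P u)) ann"
    by (intro has_laurent_cmult has_laurent_add has_laurent_diff L has_laurent_shift[OF L])
  then have 2: "has_laurent (\<lambda>k. 1 / phi ^ 6 * (((th y)\<^sup>2 * W y k - 2 * ((th y)\<^sup>2 * W y (k - 1))) + (th y)\<^sup>2 * W y (k - 2)))
      (\<lambda>u. ?P u * (1 - u)\<^sup>2 / phi ^ 6) ann"
  proof (rule has_laurent_cong)
    fix u
    show "1 / phi ^ 6 * ((?P u - 2 * (u powi 1 * ?P u)) + u powi 2 * ?P u) = ?P u * (1 - u)\<^sup>2 / phi ^ 6"
      by (simp add: power2_diff algebra_simps add_divide_distrib diff_divide_distrib)
  qed simp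
  have "A w y = 1 / phi ^ 6 * (((th y)\<^sup>2 * W y w - 2 * ((th y)\<^sup>2 * W y (w - 1))) + (th y)\<^sup>2 * W y (w - 2))"
    by (rule has_laurent_coeff_unique[OF 1 2 r0(1) r0(4)])
  then show ?thesis by (simp add: divide_inverse algebra_simps)
qed

text \<open>The double pole sum is not given by one Laurent series on the punctured plane. But
  \<open>A 0 y\<close> contains it with coefficient -2 next to \<open>W y 0 + W y (- 2)\<close>,
  which is the constant \<open>k0\<close>. So \<open>(th y)\<^sup>2 * W y (- 1)\<close> is a
  combination of \<open>(th y)\<^sup>2\<close> and \<open>A 0 y\<close>, both Laurent series for all
  nonzero y, and agreement on the unit circle suffices.\<close>

lemma key:
  assumes y: "dom y"
  shows "(th y)\<^sup>2 * W y (- 1) = gN 0 * (th y)\<^sup>2 + phi ^ 3 * (th y * Sp y)"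
proof -
  obtain ca where ca: "has_laurent ca (A 0) (- {0})" using A_laurent_y by blast
  obtain cs f where cs: "has_laurent cs f (- {0})" and f: "\<And>y. dom y \<Longrightarrow> f y = th y * Sp y"
    using thSp_laurent by blast
  note T = has_laurent_mult[OF th_has_laurent th_has_laurent]
  define k0 where "k0 = 1 / (1 - Q 1) + Q 1 / (1 - Q 1)"
  have W0: "W y 0 + W y (- 2) = k0" if "dom y" for y
    using W_pos[OF that, of 1] W_m2[OF that] by (simp add: k0_def)
  have l: "2 * ((th y)\<^sup>2 * W y (- 1)) = k0 * (th y * th y) - phi ^ 6 * A 0 y" if "dom y" for y
  proof -
    have "phi ^ 6 * A 0 y = (th y)\<^sup>2 * (W y 0 - 2 * W y (- 1) + W y (- 2))"
      using A_conv[OF that, of 0] phi_nonzero by simp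
    also have "\<dots> = (th y)\<^sup>2 * ((W y 0 + W y (- 2)) - 2 * W y (- 1))" by (simp add: algebra_simps)
    finally show ?thesis unfolding W0[OF that] by (simp add: power2_eq_square algebra_simps)
  qed
  have "k0 * (th y * th y) - phi ^ 6 * A 0 y = 2 * (gN 0 * (th y * th y) + phi ^ 3 * f y)"
  proof (rule has_laurent_identity[where r = 1 and z = y and f = "\<lambda>y. k0 * (th y * th y) - phi ^ 6 * A 0 y"
        and g = "\<lambda>y. 2 * (gN 0 * (th y * th y) + phi ^ 3 * f y)"])
    show "has_laurent (\<lambda>k. k0 * (\<Sum>\<^sub>\<infinity>i. Q ((of_int i)\<^sup>2 / 2) * Q ((of_int (k - i))\<^sup>2 / 2)) - phi ^ 6 * ca k)
        (\<lambda>y. k0 * (th y * th y) - phi ^ 6 * A 0 y) (- {0})"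
      by (intro has_laurent_diff has_laurent_cmult T ca)
    show "has_laurent (\<lambda>k. 2 * (gN 0 * (\<Sum>\<^sub>\<infinity>i. Q ((of_int i)\<^sup>2 / 2) * Q ((of_int (k - i))\<^sup>2 / 2)) + phi ^ 3 * cs k))
        (\<lambda>y. 2 * (gN 0 * (th y * th y) + phi ^ 3 * f y)) (- {0})"
      by (intro has_laurent_add has_laurent_cmult T cs)
    show "k0 * (th z * th z) - phi ^ 6 * A 0 z = 2 * (gN 0 * (th z * th z) + phi ^ 3 * f z)" if "norm z = 1" for z
    proof -
      have z: "z \<in> circ" using that by (simp add: circ_def)
      have "(th z)\<^sup>2 * W z (- 1) = th z * (th z * W z (- 1))" by (simp add: power2_eq_square)
      also have "\<dots> = gN 0 * (th z * th z) + phi ^ 3 * f z"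
        unfolding key_circ[OF z] f[OF circ_dom[OF z]] by (simp add: algebra_simps)
      finally show ?thesis using l[OF circ_dom[OF z]] by simp
    qed
    show "z \<in> - {0}" if "norm z = 1" for z :: complex using that by auto
    show "y \<in> - {0}" using y by (simp add: dom_def)
  qed simp
  with l[OF y] have "2 * ((th y)\<^sup>2 * W y (- 1)) = 2 * (gN 0 * (th y * th y) + phi ^ 3 * f y)" by simp
  then have "(th y)\<^sup>2 * W y (- 1) = gN 0 * (th y * th y) + phi ^ 3 * f y"
    by (rule mult_left_cancel[THEN iffD1, rotated]) simp
  then show ?thesis unfolding f[OF y] by (simp add: power2_eq_square)
qed

lemma dom_iff: "dom y \<longleftrightarrow> (y, \<tau>) \<in> char_domain"
  using Im_pos by (auto simp: dom_def char_domain_def half_odd_def)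

text \<open>With k = \<alpha> + 1/2 the exponent \<alpha>(\<alpha> + 1)/2 is k^2/2 - 1/8.\<close>

lemma appell_sum: "(\<Sum>\<^sub>\<infinity>\<alpha>\<in>half_odd. y powi \<lfloor>\<alpha> + 1/2\<rfloor> * qpow \<tau> (\<alpha> * (\<alpha> + 1) / 2) / (1 + y * qpow \<tau> \<alpha>)) = Q (- 1 / 8) * Sp y"
proof -
  have "(\<Sum>\<^sub>\<infinity>\<alpha>\<in>half_odd. y powi \<lfloor>\<alpha> + 1/2\<rfloor> * qpow \<tau> (\<alpha> * (\<alpha> + 1) / 2) / (1 + y * qpow \<tau> \<alpha>))
      = (\<Sum>\<^sub>\<infinity>k. Q (- 1 / 8) * (y powi k * Q ((of_int k)\<^sup>2 / 2) * pf y (k - 1)))"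
  proof (rule infsum_reindex_bij_witness[where i = "\<lambda>k. of_int (k - 1) + 1 / 2" and j = "\<lambda>\<alpha>. \<lfloor>\<alpha> + 1 / 2\<rfloor>"])
    fix \<alpha> assume "\<alpha> \<in> half_odd"
    then obtain n :: int where n: "\<alpha> = of_int n + 1 / 2" by (auto simp: half_odd_def)
    have fl: "\<lfloor>\<alpha> + 1 / 2\<rfloor> = n + 1"
    proof -
      have "\<alpha> + 1 / 2 = of_int (n + 1)" using n by simp
      then show ?thesis by (simp only: floor_of_int)
    qed
    then show "of_int (\<lfloor>\<alpha> + 1 / 2\<rfloor> - 1) + 1 / 2 = \<alpha>" using n by simp
    have e: "Q (- 1 / 8) * Q ((of_int (n + 1))\<^sup>2 / 2) = Q (\<alpha> * (\<alpha> + 1) / 2)"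
      unfolding qpow_mult by (rule arg_cong[of _ _ Q]) (simp add: n power2_eq_square field_simps)
    show "Q (- 1 / 8) * (y powi \<lfloor>\<alpha> + 1 / 2\<rfloor> * Q ((of_int \<lfloor>\<alpha> + 1 / 2\<rfloor>)\<^sup>2 / 2) * pf y (\<lfloor>\<alpha> + 1 / 2\<rfloor> - 1))
        = y powi \<lfloor>\<alpha> + 1/2\<rfloor> * qpow \<tau> (\<alpha> * (\<alpha> + 1) / 2) / (1 + y * qpow \<tau> \<alpha>)"
      unfolding fl e[symmetric] pf_def by (simp add: n mult_ac)
  next
    fix k :: int
    have "of_int (k - 1) + 1 / 2 + 1 / 2 = (of_int k :: real)" by simp
    then show "\<lfloor>of_int (k - 1) + 1 / 2 + 1 / 2 :: real\<rfloor> = k" by (simp only: floor_of_int)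
    show "of_int (k - 1) + 1 / 2 \<in> half_odd" unfolding half_odd_def by blast
  qed auto
  also have "\<dots> = Q (- 1 / 8) * Sp y" unfolding Sp_def by (rule infsum_cmult_right')
  finally show ?thesis .
qed

lemma W_gN:
  assumes y: "dom y" and k: "k \<ge> - 1"
  shows "(th y)\<^sup>2 * W y (k - 1) = (th y)\<^sup>2 * gN k + (if k = 0 then phi ^ 3 * (th y * Sp y) else 0)"
proof -
  consider "k = - 1" | "k = 0" | "k > 0" using k by linarith
  then show ?thesis
  proof cases
    case 3
    then obtain n where n: "k = int n" "n > 0" using zero_less_imp_eq_int by blast
    then show ?thesis using W_pos[OF y n(2)] by (simp add: gN_def)
  qed (use W_m2[OF y] key[OF y] in \<open>auto simp: gN_def\<close>)
qed

text \<open>Subtracting the second differences at N and N + 2 cancels \<open>W y (int N)\<close> and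
  leaves the coefficients 1, -2, 2, -1. The exceptional term of \<open>W_gN\<close> enters where the
  index of \<open>gN\<close> is 0: with coefficient -2 for N = 0 and 1 for N = 1.\<close>

theorem trace_formula:
  assumes y: "dom y"
  shows "Q (- 1 / 4) * (A (int N) y - A (int N + 2) y) = atypical_part N y \<tau> + typical_part N y \<tau>"
proof -
  define S where "S k = (if k = 0 then phi ^ 3 * (th y * Sp y) else 0)" for k :: int
  let ?N = "int N"
  have eta3: "eta \<tau> ^ 3 = Q (1 / 8) * phi ^ 3" by (simp add: eta_conv power_mult_distrib qpow_power)
  have q8: "Q (1 / 8) * Q (1 / 8) = Q (1 / 4)" "Q (- 1 / 4) = inverse (Q (1 / 4))" "Q (- 1 / 8) = inverse (Q (1 / 8))"
    using qpow_mult[of \<tau> "1 / 8" "1 / 8"] qpow_minus[of \<tau> "1 / 4"] qpow_minus[of \<tau> "1 / 8"] by simp_all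
  define g where "g = gN (?N - 1) - 2 * gN ?N + 2 * gN (?N + 2) - gN (?N + 3)"
  define s where "s = S (?N - 1) - 2 * S ?N + 2 * S (?N + 2) - S (?N + 3)"
  have s: "s = phi ^ 3 * (th y * Sp y) * (if N = 0 then - 2 else if N = 1 then 1 else 0)"
    by (auto simp: s_def S_def)
  have t2: "(th y)\<^sup>2 * W y (k - 1) = (th y)\<^sup>2 * gN k + S k" if "k \<ge> - 1" for k
    using W_gN[OF y that] by (simp add: S_def)
  have "A ?N y - A (?N + 2) y
      = 1 / phi ^ 6 * ((th y)\<^sup>2 * W y (?N - 1 - 1) - 2 * ((th y)\<^sup>2 * W y (?N - 1))
        + 2 * ((th y)\<^sup>2 * W y (?N + 2 - 1)) - (th y)\<^sup>2 * W y (?N + 3 - 1))"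
    unfolding A_conv[OF y] by (simp add: divide_inverse algebra_simps)
  also have "\<dots> = 1 / phi ^ 6 * ((th y)\<^sup>2 * g + s)"
  proof -
    have t: "(th y)\<^sup>2 * W y (?N - 1 - 1) = (th y)\<^sup>2 * gN (?N - 1) + S (?N - 1)"
      "(th y)\<^sup>2 * W y (?N - 1) = (th y)\<^sup>2 * gN ?N + S ?N"
      "(th y)\<^sup>2 * W y (?N + 2 - 1) = (th y)\<^sup>2 * gN (?N + 2) + S (?N + 2)"
      "(th y)\<^sup>2 * W y (?N + 3 - 1) = (th y)\<^sup>2 * gN (?N + 3) + S (?N + 3)"
      by (rule t2, simp)+
    show ?thesis unfolding g_def s_def t by (simp add: divide_inverse algebra_simps)
  qed
  finally have A: "A ?N y - A (?N + 2) y = 1 / phi ^ 6 * ((th y)\<^sup>2 * g + s)" .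
  have h: "h_fun ?N \<tau> - 2 * h_fun (?N + 1) \<tau> + 2 * h_fun (?N + 3) \<tau> - h_fun (?N + 4) \<tau> = g / eta \<tau> ^ 3"
  proof -
    have "h_fun ?N \<tau> = gN (?N - 1) / eta \<tau> ^ 3" "h_fun (?N + 1) \<tau> = gN ?N / eta \<tau> ^ 3"
      "h_fun (?N + 3) \<tau> = gN (?N + 2) / eta \<tau> ^ 3" "h_fun (?N + 4) \<tau> = gN (?N + 3) / eta \<tau> ^ 3"
      using h_fun_gN[of "?N - 1"] h_fun_gN[of ?N] h_fun_gN[of "?N + 2"] h_fun_gN[of "?N + 3"]
      by (simp_all add: add.commute)
    then show ?thesis by (simp add: g_def divide_inverse algebra_simps)
  qed
  have tpart: "typical_part N y \<tau> = Q (- 1 / 4) * (1 / phi ^ 6 * ((th y)\<^sup>2 * g))"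
  proof -
    have "typical_part N y \<tau> = (th y)\<^sup>2 * g / (eta \<tau> ^ 3 * eta \<tau> ^ 3)"
      unfolding typical_part_def h th_def by simp
    also have "eta \<tau> ^ 3 * eta \<tau> ^ 3 = Q (1 / 4) * phi ^ 6"
      unfolding eta3 q8(1)[symmetric] by (simp add: mult_ac power_add[symmetric])
    finally have "typical_part N y \<tau> = (th y)\<^sup>2 * g / (Q (1 / 4) * phi ^ 6)" .
    moreover have "x / (c * f) = inverse c * (1 / f * x)" for x c f :: complex
      by (simp add: divide_inverse mult_ac)
    ultimately show ?thesis unfolding q8(2) by (simp only:)
  qed
  have apart: "atypical_part N y \<tau> = Q (- 1 / 4) * (1 / phi ^ 6 * s)"
  proof -
    have "atypical_part N y \<tau> = th y / eta \<tau> ^ 3 * (Q (- 1 / 8) * Sp y) * (if N = 0 then - 2 else if N = 1 then 1 else 0)"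
      unfolding atypical_part_def appell_sum th_def ..
    also have "th y / eta \<tau> ^ 3 * (Q (- 1 / 8) * Sp y) = Q (- 1 / 4) * (1 / phi ^ 6 * (phi ^ 3 * (th y * Sp y)))"
    proof -
      have p6: "phi ^ 6 = phi ^ 3 * phi ^ 3" by (simp add: power_add[symmetric])
      have e: "t / (a * f) * (inverse a * s) = inverse (a * a) * (1 / (f * f) * (f * (t * s)))"
        if "f \<noteq> 0" for t a f s :: complex
        using that by (simp add: field_simps)
      have "phi ^ 3 \<noteq> 0" using phi_nonzero by simp
      then show ?thesis unfolding eta3 q8(2,3) q8(1)[symmetric] p6 by (rule e)
    qed
    finally show ?thesis unfolding s by (simp only: mult.assoc)
  qed
  show ?thesis unfolding A tpart apart by (simp add: algebra_simps)
qed

end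

section \<open>Integral expansions\<close>

text \<open>The integer coefficients are chosen before \<tau>: one q-series serves the whole
  half-plane.\<close>

definition int_series :: "(complex \<Rightarrow> complex) \<Rightarrow> bool" where
  "int_series F \<longleftrightarrow> (\<exists>c :: nat \<Rightarrow> int. \<forall>\<tau>. Im \<tau> > 0 \<longrightarrow> ((\<lambda>n. of_int (c n) * qpow \<tau> (real n)) has_sum F \<tau>) UNIV)"

text \<open>Nonzero integers have absolute value at least 1, so absolute convergence at \<tau> = i
  leaves only finitely many nonzero terms with a given exponent. Each collected coefficient is then
  a finite sum of integers, the same for all \<tau>.\<close>

lemma int_series_family:
  assumes F: "\<And>\<tau>. Im \<tau> > 0 \<Longrightarrow> ((\<lambda>i. of_int (a i) * qpow \<tau> (real (e i))) has_sum F \<tau>) I"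
  shows "int_series F"
proof -
  define I' where "I' = {i \<in> I. a i \<noteq> 0}"
  have F': "((\<lambda>i. of_int (a i) * qpow \<tau> (real (e i))) has_sum F \<tau>) I'" if "Im \<tau> > 0" for \<tau>
    using F[OF that] by (rule has_sum_cong_neutral[THEN iffD1, rotated -1]) (auto simp: I'_def)
  have fin: "finite {i \<in> I'. e i = n}" for n
  proof (rule ccontr)
    assume inf: "infinite {i \<in> I'. e i = n}"
    have Im: "Im \<i> > 0" by simp
    have "(\<lambda>i. of_int (a i) * qpow \<i> (real (e i))) summable_on {i \<in> I'. e i = n}"
      using has_sum_imp_summable[OF F'[OF Im]] by (rule summable_on_subset_banach) auto
    then have "(\<lambda>i. norm (of_int (a i) * qpow \<i> (real (e i)))) summable_on {i \<in> I'. e i = n}"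
      by (simp only: summable_on_iff_abs_summable_on_complex)
    moreover have "norm (qpow \<i> (real n)) \<le> norm (of_int (a i) * qpow \<i> (real (e i)))" if "i \<in> {i \<in> I'. e i = n}" for i
    proof -
      have "1 \<le> \<bar>real_of_int (a i)\<bar>" using that by (auto simp: I'_def)
      from mult_right_mono[OF this, of "norm (qpow \<i> (real n))"] show ?thesis using that by (simp add: norm_mult)
    qed
    ultimately have "(\<lambda>i. norm (qpow \<i> (real n))) summable_on {i \<in> I'. e i = n}"
      by (rule summable_on_comparison_test) auto
    note s = this
    define b where "b = norm (qpow \<i> (real n))"
    have b: "b > 0" by (simp add: b_def)
    obtain k :: nat where k: "infsum (\<lambda>_. b) {i \<in> I'. e i = n} < of_nat k * b"
      using b reals_Archimedean3 by blast
    obtain K where K: "finite K" "card K = k" "K \<subseteq> {i \<in> I'. e i = n}"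
      using infinite_arbitrarily_large[OF inf] by blast
    have "(\<Sum>i\<in>K. b) \<le> infsum (\<lambda>_. b) {i \<in> I'. e i = n}"
      using s K b unfolding b_def[symmetric] by (intro finite_sum_le_infsum) auto
    then show False using k K(2) by simp
  qed
  define c where "c n = (\<Sum>i\<in>{i \<in> I'. e i = n}. a i)" for n
  have "((\<lambda>n. of_int (c n) * qpow \<tau> (real n)) has_sum F \<tau>) UNIV" if "Im \<tau> > 0" for \<tau>
  proof -
    have bij: "bij_betw snd (Sigma UNIV (\<lambda>n. {i \<in> I'. e i = n})) I'"
      by (rule bij_betwI[where g = "\<lambda>i. (e i, i)"]) auto
    have "((\<lambda>x. of_int (a (snd x)) * qpow \<tau> (real (e (snd x)))) has_sum F \<tau>) (Sigma UNIV (\<lambda>n. {i \<in> I'. e i = n}))"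
      using has_sum_reindex_bij_betw[OF bij, of "\<lambda>i. of_int (a i) * qpow \<tau> (real (e i))"] F'[OF that] by simp
    then show ?thesis
    proof (rule has_sum_SigmaD)
      fix n
      show "((\<lambda>i. of_int (a (snd (n, i))) * qpow \<tau> (real (e (snd (n, i))))) has_sum of_int (c n) * qpow \<tau> (real n)) {i \<in> I'. e i = n}"
        using fin[of n] by (intro has_sum_finiteI) (auto simp: c_def sum_distrib_right)
    qed
  qed
  then show ?thesis unfolding int_series_def by blast
qed

lemma int_series_add: "int_series F \<Longrightarrow> int_series F' \<Longrightarrow> int_series (\<lambda>\<tau>. F \<tau> + F' \<tau>)"
proof -
  assume "int_series F" "int_series F'"
  then obtain c c' where c: "\<And>\<tau>. Im \<tau> > 0 \<Longrightarrow> ((\<lambda>n. of_int (c n) * qpow \<tau> (real n)) has_sum F \<tau>) UNIV"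
    and c': "\<And>\<tau>. Im \<tau> > 0 \<Longrightarrow> ((\<lambda>n. of_int (c' n) * qpow \<tau> (real n)) has_sum F' \<tau>) UNIV"
    unfolding int_series_def by blast
  have "((\<lambda>n. of_int (c n + c' n) * qpow \<tau> (real n)) has_sum F \<tau> + F' \<tau>) UNIV" if "Im \<tau> > 0" for \<tau>
    using has_sum_add[OF c[OF that] c'[OF that]] by (simp add: distrib_right)
  then show ?thesis unfolding int_series_def by (intro exI[of _ "\<lambda>n. c n + c' n"]) blast
qed

lemma int_series_cmult: "int_series F \<Longrightarrow> int_series (\<lambda>\<tau>. of_int k * F \<tau>)"
proof -
  assume "int_series F"
  then obtain c where c: "\<And>\<tau>. Im \<tau> > 0 \<Longrightarrow> ((\<lambda>n. of_int (c n) * qpow \<tau> (real n)) has_sum F \<tau>) UNIV"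
    unfolding int_series_def by blast
  have "((\<lambda>n. of_int (k * c n) * qpow \<tau> (real n)) has_sum of_int k * F \<tau>) UNIV" if "Im \<tau> > 0" for \<tau>
    using has_sum_cmult_right[OF c[OF that], of "of_int k"] by (simp add: mult.assoc)
  then show ?thesis unfolding int_series_def by (intro exI[of _ "\<lambda>n. k * c n"]) blast
qed

lemma int_series_mult: "int_series F \<Longrightarrow> int_series F' \<Longrightarrow> int_series (\<lambda>\<tau>. F \<tau> * F' \<tau>)"
proof -
  assume "int_series F" "int_series F'"
  then obtain c c' where c: "\<And>\<tau>. Im \<tau> > 0 \<Longrightarrow> ((\<lambda>n. of_int (c n) * qpow \<tau> (real n)) has_sum F \<tau>) UNIV"
    and c': "\<And>\<tau>. Im \<tau> > 0 \<Longrightarrow> ((\<lambda>n. of_int (c' n) * qpow \<tau> (real n)) has_sum F' \<tau>) UNIV"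
    unfolding int_series_def by blast
  show ?thesis
  proof (rule int_series_family[where a = "\<lambda>(m, n). c m * c' n" and e = "\<lambda>(m, n). m + n" and I = "UNIV \<times> UNIV"])
    fix \<tau> assume t: "Im \<tau> > 0"
    have e: "(\<lambda>(m, n). (of_int (c m) * qpow \<tau> (real m)) * (of_int (c' n) * qpow \<tau> (real n)))
        = (\<lambda>i. of_int (case i of (m, n) \<Rightarrow> c m * c' n) * qpow \<tau> (real (case i of (m, n) \<Rightarrow> m + n)))"
      by (auto simp: fun_eq_iff qpow_mult[symmetric] mult_ac)
    from has_sum_product_complex[OF c[OF t] c'[OF t]]
    show "((\<lambda>i. of_int (case i of (m, n) \<Rightarrow> c m * c' n) * qpow \<tau> (real (case i of (m, n) \<Rightarrow> m + n))) has_sum F \<tau> * F' \<tau>) (UNIV \<times> UNIV)"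
      unfolding e .
  qed
qed

lemma int_series_cong: "int_series F \<Longrightarrow> (\<And>\<tau>. Im \<tau> > 0 \<Longrightarrow> F \<tau> = F' \<tau>) \<Longrightarrow> int_series F'"
  unfolding int_series_def by metis

lemma int_series_inverse_phi: "int_series (\<lambda>\<tau>. inverse (nome.phi \<tau>))"
proof (rule int_series_family[where a = "\<lambda>_. 1" and e = "\<lambda>K. \<Sum>n\<in>#K. n + 1" and I = UNIV])
  fix \<tau> assume "Im \<tau> > 0"
  then interpret nome \<tau> by unfold_locales
  have "((\<lambda>K. \<Prod>n\<in>#K. Q (real n + 1)) has_sum inverse phi) UNIV"
  proof (rule has_sum_multisets_UNIV[OF _ _ _ phi_nonzero])
    show "norm (Q (real n + 1)) < 1" for n by (rule norm_Q_less_1) simp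
    show "summable (\<lambda>n. norm (Q (real n + 1)))" using summable_Q[of 1 1] by simp
    have e: "qp K = (\<Prod>n<K. 1 - Q (real n + 1))" for K by (simp add: qp_def add.commute)
    show "(\<lambda>K. \<Prod>n<K. 1 - Q (real n + 1)) \<longlonglongrightarrow> phi" using qp_tendsto unfolding e[abs_def] .
  qed
  moreover have "(\<Prod>n\<in>#K. Q (real n + 1)) = Q (real (\<Sum>n\<in>#K. n + 1))" for K
    by (induction K) (simp_all add: qpow_mult[symmetric] add.commute)
  ultimately show "((\<lambda>K. of_int 1 * qpow \<tau> (real (\<Sum>n\<in>#K. n + 1))) has_sum inverse phi) UNIV" by simp
qed

lemma int_series_geometric: "N > 0 \<Longrightarrow> int_series (\<lambda>\<tau>. 1 / (1 - qpow \<tau> (real N)))"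
proof (rule int_series_family[where a = "\<lambda>_. 1" and e = "\<lambda>n. n * N" and I = UNIV])
  fix \<tau> assume N: "N > 0" and "Im \<tau> > 0"
  then interpret nome \<tau> by unfold_locales
  have "norm (Q (real N)) < 1" using N by (intro norm_Q_less_1) simp
  from has_sum_geometric[OF this]
  show "((\<lambda>n. of_int 1 * qpow \<tau> (real (n * N))) has_sum 1 / (1 - qpow \<tau> (real N))) UNIV"
    by (simp add: qpow_power)
qed

lemma int_series_gN: "N \<ge> - 1 \<Longrightarrow> int_series (\<lambda>\<tau>. nome.gN \<tau> N)"
proof -
  assume N: "N \<ge> - 1"
  consider "N = - 1" | "N = 0" | "N > 0" using N by linarith
  then show ?thesis
  proof cases
    case 1
    have q: "int_series (\<lambda>\<tau>. qpow \<tau> 1)"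
      by (rule int_series_family[where a = "\<lambda>_. 1" and e = "\<lambda>_. 1" and I = "{()}"]) (simp add: has_sum_finiteI)
    have "int_series (\<lambda>\<tau>. 1 / (1 - qpow \<tau> (real 1)))" by (rule int_series_geometric) simp
    from int_series_mult[OF q this] show ?thesis
      by (rule int_series_cong) (simp add: nome.gN_def nome_def 1)
  next
    case 2
    have "int_series (\<lambda>\<tau>. nome.RS \<tau> 0)"
    proof (rule int_series_family[where a = "\<lambda>(n, a, d). (-1) ^ n" and e = "\<lambda>(n, a, d). (n + 1) * (n + 2) div 2 + (n + 1) * d"
          and I = nome.Rs])
      fix \<tau> assume "Im \<tau> > 0"
      then interpret nome \<tau> by unfold_locales
      have h: "(Rt 0 has_sum RS 0) Rs" using Rt_summable unfolding RS_def by (rule has_sum_infsum)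
      have e: "Rt 0 x = of_int (case x of (n, a, d) \<Rightarrow> (-1) ^ n)
          * Q (real (case x of (n, a, d) \<Rightarrow> (n + 1) * (n + 2) div 2 + (n + 1) * d))" for x
      proof -
        obtain n a d where x: "x = (n, a, d)" by (cases x)
        have "2 dvd (n + 1) * (n + 2)" by simp
        from real_of_nat_div[OF this]
        have "real ((n + 1) * (n + 2) div 2) = real (n + 1) * real (n + 2) / 2"
          by (simp only: of_nat_mult of_nat_numeral)
        then have "real ((n + 1) * (n + 2) div 2 + (n + 1) * d) = real (n + 1) * real (n + 2) / 2 + real d * real (n + 1)"
          by (simp only: of_nat_add of_nat_mult mult.commute)
        then show ?thesis unfolding x prod.case Rt_def
          by (simp only: qpow_power qpow_mult[symmetric] mult.assoc) simp
      qed
      show "((\<lambda>x. of_int (case x of (n, a, d) \<Rightarrow> (-1) ^ n)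
          * qpow \<tau> (real (case x of (n, a, d) \<Rightarrow> (n + 1) * (n + 2) div 2 + (n + 1) * d))) has_sum RS 0) Rs"
        using h unfolding e[symmetric] .
    qed
    from int_series_cmult[OF this, of 2] show ?thesis
      by (rule int_series_cong) (simp add: nome.gN_def nome_def 2)
  next
    case 3
    then obtain n where n: "N = int n" "n > 0" using zero_less_imp_eq_int by blast
    from int_series_cmult[OF int_series_geometric[OF n(2)], of N] show ?thesis
      by (rule int_series_cong) (use n in \<open>simp add: nome.gN_def nome_def\<close>)
  qed
qed

text \<open>Of the two factors 1/\<eta>^3 in the typical part one belongs to
  \<open>typical_char\<close>. The other is q^(-1/8) times the inverse of \<open>phi ^ 3\<close>,
  and q^(-1/8) = q^(1/4 - 3/8); hence an integral power series in q gives the weights h = 1/4 +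
  n.\<close>

theorem typical_part_integral:
  "\<exists>(H :: real set) (a :: real \<Rightarrow> int). H \<subseteq> {1/4..} \<and> (\<forall>(y, \<tau>)\<in>char_domain.
     ((\<lambda>h. of_int (a h) * typical_char h y \<tau>) has_sum typical_part N y \<tau>) H)"
proof -
  let ?N = "int N"
  let ?g = "\<lambda>\<tau>. nome.gN \<tau> (?N - 1) + of_int (- 2) * nome.gN \<tau> ?N + of_int 2 * nome.gN \<tau> (?N + 2) + of_int (- 1) * nome.gN \<tau> (?N + 3)"
  let ?i = "\<lambda>\<tau>. inverse (nome.phi \<tau>)"
  have "int_series (\<lambda>\<tau>. ?g \<tau> * (?i \<tau> * (?i \<tau> * ?i \<tau>)))"
    by (intro int_series_mult int_series_add int_series_cmult int_series_inverse_phi int_series_gN) auto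
  then obtain c :: "nat \<Rightarrow> int" where c: "\<And>\<tau>. Im \<tau> > 0 \<Longrightarrow>
      ((\<lambda>n. of_int (c n) * qpow \<tau> (real n)) has_sum ?g \<tau> * (?i \<tau> * (?i \<tau> * ?i \<tau>))) UNIV"
    unfolding int_series_def by blast
  define H where "H = range (\<lambda>n::nat. 1 / 4 + real n)"
  define a :: "real \<Rightarrow> int" where "a h = c (nat \<lfloor>h - 1 / 4\<rfloor>)" for h
  have "((\<lambda>h. of_int (a h) * typical_char h y \<tau>) has_sum typical_part N y \<tau>) H" if d: "(y, \<tau>) \<in> char_domain" for y \<tau>
  proof -
    have Im: "Im \<tau> > 0" using d by (simp add: char_domain_def)
    then interpret nome \<tau> by unfold_locales
    let ?k = "(th y)\<^sup>2 / eta \<tau> ^ 3 * Q (- 1 / 8)"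
    have e3: "eta \<tau> ^ 3 = Q (1 / 8) * phi ^ 3" by (simp add: eta_conv power_mult_distrib qpow_power)
    have "((\<lambda>n. ?k * (of_int (c n) * Q (real n))) has_sum ?k * (?g \<tau> * (?i \<tau> * (?i \<tau> * ?i \<tau>)))) UNIV"
      by (rule has_sum_cmult_right[OF c[OF Im]])
    moreover have "?k * (of_int (c n) * Q (real n)) = of_int (a (1 / 4 + real n)) * typical_char (1 / 4 + real n) y \<tau>" for n
    proof -
      have "Q (1 / 4 + real n - 3 / 8) = Q (- 1 / 8) * Q (real n)"
        unfolding qpow_mult by (rule arg_cong[of _ _ Q]) simp
      then show ?thesis by (simp add: a_def typical_char_def th_def)
    qed
    moreover have "?k * (?g \<tau> * (?i \<tau> * (?i \<tau> * ?i \<tau>))) = typical_part N y \<tau>"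
    proof -
      have "h_fun ?N \<tau> = gN (?N - 1) / eta \<tau> ^ 3" "h_fun (?N + 1) \<tau> = gN ?N / eta \<tau> ^ 3"
        "h_fun (?N + 3) \<tau> = gN (?N + 2) / eta \<tau> ^ 3" "h_fun (?N + 4) \<tau> = gN (?N + 3) / eta \<tau> ^ 3"
        using h_fun_gN[of "?N - 1"] h_fun_gN[of ?N] h_fun_gN[of "?N + 2"] h_fun_gN[of "?N + 3"]
        by (simp_all add: add.commute)
      then have "typical_part N y \<tau> = (th y)\<^sup>2 / eta \<tau> ^ 3 * (?g \<tau> * inverse (eta \<tau> ^ 3))"
        unfolding typical_part_def th_def by (simp add: divide_inverse algebra_simps)
      also have "inverse (eta \<tau> ^ 3) = Q (- 1 / 8) * (?i \<tau> * (?i \<tau> * ?i \<tau>))"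
        unfolding e3 using qpow_minus[of \<tau> "1 / 8"] by (simp add: power3_eq_cube mult_ac)
      finally show ?thesis by (simp only: mult_ac)
    qed
    ultimately have "((\<lambda>n. of_int (a (1 / 4 + real n)) * typical_char (1 / 4 + real n) y \<tau>) has_sum typical_part N y \<tau>) UNIV"
      by (simp only:)
    then show ?thesis unfolding H_def by (subst has_sum_reindex) (auto simp: inj_on_def o_def)
  qed
  moreover have "H \<subseteq> {1 / 4..}" by (auto simp: H_def)
  ultimately show ?thesis by blast
qed

section \<open>Mode algebra of the free fields\<close>

lemma Sum_any_single:
  assumes "\<And>j. j \<noteq> j0 \<Longrightarrow> f j = 0"
  shows "Sum_any f = f j0"
proof -
  have "Sum_any f = sum f {j0}"
    by (rule Sum_any.expand_superset) (use assms in auto)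
  then show ?thesis by simp
qed

lemma Sum_any_zero: "(\<And>j :: nat. f j = 0) \<Longrightarrow> Sum_any f = 0"
  using Sum_any_single[of 0 f] by simp

lemma Sum_any_two:
  assumes "\<And>j :: nat. j \<ge> 2 \<Longrightarrow> f j = 0"
  shows "Sum_any f = f 0 + f 1"
proof -
  have "Sum_any f = sum f {0, 1}"
  proof (rule Sum_any.expand_superset)
    show "{a. f a \<noteq> 0} \<subseteq> {0, 1}"
    proof
      fix j assume "j \<in> {a. f a \<noteq> 0}"
      then have "\<not> j \<ge> 2" using assms by auto
      then show "j \<in> {0, 1}" by auto
    qed
  qed simp
  then show ?thesis by simp
qed

lemma gbinomial_m1: "(- 1 :: complex) ^ j * (- 1 gchoose j) = 1"
  using gbinomial_minus[of "1 :: complex" j]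
  by (simp add: binomial_gbinomial[symmetric] flip: power_mult_distrib)

lemma gbinomial_m2: "(- 1 :: complex) ^ j * (- 2 gchoose j) = of_nat (j + 1)"
proof -
  have "(- 2 gchoose j) = (- 1) ^ j * ((2 + of_nat j - 1 :: complex) gchoose j)"
    by (rule gbinomial_minus)
  also have "(2 + of_nat j - 1 :: complex) = of_nat (j + 1)" by simp
  also have "(of_nat (j + 1) gchoose j :: complex) = of_nat (j + 1 choose j)"
    by (rule binomial_gbinomial[symmetric])
  finally show ?thesis by (simp flip: mult.assoc power_mult_distrib)
qed

context SL2_free_field_algebra
begin

lemma prd_0 [simp]: "prd n 0 b = 0" "prd n a 0 = 0"
  using linear_facts(3)[OF linear_left] linear_facts(3)[OF linear_right] by auto

lemma prd_diff: "prd n (a - a') b = prd n a b - prd n a' b" "prd n a (b - b') = prd n a b - prd n a b'"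
proof -
  show "prd n (a - a') b = prd n a b - prd n a' b" using prd_add(1)[of n "a - a'" a' b] by simp
  show "prd n a (b - b') = prd n a b - prd n a b'" using prd_add(2)[of n a "b - b'" b'] by simp
qed

lemma prd_sum: "prd n (\<Sum>i\<in>I. f i) b = (\<Sum>i\<in>I. prd n (f i) b)" "prd n a (\<Sum>i\<in>I. f i) = (\<Sum>i\<in>I. prd n a (f i))"
  by (induction I rule: infinite_finite_induct) (simp_all add: prd_add)

text \<open>The Borcherds identity at n = 0, where only j = 0 survives on the right.\<close>

lemma commutator:
  assumes "a \<in> par p" "b \<in> par p'"
  shows "prd m a (prd k b c) = scl (if p \<and> p' then - 1 else 1) (prd k b (prd m a c))
    + Sum_any (\<lambda>j::nat. scl (of_int m gchoose j) (prd (m + k - int j) (prd (int j) a b) c))"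
proof -
  have "Sum_any (\<lambda>j::nat. scl ((-1) ^ j * (of_int 0 gchoose j))
        (prd (m + 0 - int j) a (prd (k + int j) b c)
         - scl ((-1) powi 0 * (if p \<and> p' then -1 else 1)) (prd (0 + k - int j) b (prd (m + int j) a c))))
      = prd m a (prd k b c) - scl (if p \<and> p' then - 1 else 1) (prd k b (prd m a c))"
    by (subst Sum_any_single[of 0]) (auto simp: gbinomial_0_left)
  with borcherds[OF assms, of m k 0 c] show ?thesis by (simp add: algebra_simps)
qed

text \<open>The Borcherds identity at m = 0, where only j = 0 survives on the left.\<close>

lemma associativity:
  assumes "a \<in> par p" "b \<in> par p'"
  shows "prd k (prd n a b) c = Sum_any (\<lambda>j::nat. scl ((-1) ^ j * (of_int n gchoose j))
        (prd (n - int j) a (prd (k + int j) b c)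
         - scl ((-1) powi n * (if p \<and> p' then -1 else 1)) (prd (n + k - int j) b (prd (int j) a c))))"
proof -
  have e: "Sum_any (\<lambda>j::nat. scl (of_int 0 gchoose j) (prd (0 + k - int j) (prd (n + int j) a b) c)) = prd k (prd n a b) c"
    by (subst Sum_any_single[of 0]) (auto simp: gbinomial_0_left)
  show ?thesis using borcherds[OF assms, of 0 k n c] unfolding e unfolding add_0_left .
qed

lemma normal_product:
  assumes "a \<in> par p" "b \<in> par p'"
  shows "prd k (prd (- 1) a b) c = Sum_any (\<lambda>j::nat. prd (- 1 - int j) a (prd (k + int j) b c)
    + scl (if p \<and> p' then - 1 else 1) (prd (k - 1 - int j) b (prd (int j) a c)))"
  unfolding associativity[OF assms] by (rule arg_cong[of _ _ Sum_any]) (auto simp: gbinomial_m1 fun_eq_iff)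

definition tr :: "'v \<Rightarrow> 'v" where "tr a = prd (- 2) a vac"

text \<open>Translation covariance. In \<open>associativity\<close> with b = \<open>vac\<close> the
  vacuum modes vanish except for index -1, so at most one j contributes: from the first product if k
  < 0, from the second if k > 0.\<close>

lemma tr_mode: "a \<in> par p \<Longrightarrow> prd k (tr a) c = scl (- of_int k) (prd (k - 1) a c)"
proof -
  assume a: "a \<in> par p"
  let ?f = "\<lambda>j::nat. scl (of_nat (j + 1)) (prd (- 2 - int j) a (prd (k + int j) vac c) - prd (- 2 + k - int j) vac (prd (int j) a c))"
  have "prd k (tr a) c = Sum_any ?f"
    unfolding tr_def associativity[OF a vac_even]
    by (rule arg_cong[of _ _ Sum_any]) (auto simp: gbinomial_m2 fun_eq_iff simp del: of_nat_add of_nat_Suc)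
  also have "\<dots> = scl (- of_int k) (prd (k - 1) a c)"
  proof -
    consider "k < 0" | "k = 0" | "k > 0" by linarith
    then show ?thesis
    proof cases
      case 1
      have "Sum_any ?f = ?f (nat (- 1 - k))"
        by (rule Sum_any_single) (use 1 in \<open>auto simp: vac_left\<close>)
      then show ?thesis using 1 by (simp add: vac_left)
    next
      case 2
      have "Sum_any ?f = 0" by (rule Sum_any_zero) (use 2 in \<open>auto simp: vac_left\<close>)
      then show ?thesis using 2 by simp
    next
      case 3
      have "Sum_any ?f = ?f (nat (k - 1))"
        by (rule Sum_any_single) (use 3 in \<open>auto simp: vac_left\<close>)
      then show ?thesis using 3 by (simp add: vac_left algebra_simps)
    qed
  qed
  finally show ?thesis .
qed

definition kap :: "generator \<Rightarrow> generator \<Rightarrow> int \<Rightarrow> int \<Rightarrow> complex" where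
  "kap u v m k = (if m + k + 1 \<ge> 0 then (of_int m gchoose nat (m + k + 1)) * contraction u v (m + k + 1) else 0)"

definition sg :: "generator \<Rightarrow> generator \<Rightarrow> complex" where
  "sg u v = (if is_odd u \<and> is_odd v then - 1 else 1)"

text \<open>Products of two generators with nonnegative index are multiples of \<open>vac\<close>,
  whose only nonzero mode has index -1. So only j = m + k + 1 contributes, and the commutator is the
  scalar \<open>kap\<close>.\<close>

lemma gen_comm: "prd m (\<phi> u) (prd k (\<phi> v) c) = scl (sg u v) (prd k (\<phi> v) (prd m (\<phi> u) c)) + scl (kap u v m k) c"
proof -
  have "Sum_any (\<lambda>j::nat. scl (of_int m gchoose j) (prd (m + k - int j) (prd (int j) (\<phi> u) (\<phi> v)) c)) = scl (kap u v m k) c"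
    (is "Sum_any ?f = _")
  proof -
    have f: "?f j = (if int j = m + k + 1 then scl ((of_int m gchoose j) * contraction u v (int j)) c else 0)" for j
      by (auto simp: operator_product prd_scale vac_left)
    show ?thesis
    proof (cases "m + k + 1 \<ge> 0")
      case True
      have "Sum_any ?f = ?f (nat (m + k + 1))"
        by (rule Sum_any_single) (use f in auto)
      then show ?thesis using True unfolding f by (simp add: kap_def)
    next
      case False
      have "Sum_any ?f = 0" by (rule Sum_any_zero) (use False f in auto)
      then show ?thesis using False by (simp add: kap_def)
    qed
  qed
  then show ?thesis
    using commutator[OF generator_part generator_part, of m u k v c] by (simp add: sg_def)
qed

subsection \<open>Words in the creation operators\<close>

definition cre :: "fock_mode \<Rightarrow> 'v \<Rightarrow> 'v" where
  "cre i v = prd (- int (snd i) - 1) (\<phi> (fst i)) v"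

definition vec :: "fock_mode list \<Rightarrow> 'v" where "vec ws = foldr cre ws vac"

lemma vec_simps [simp]: "vec [] = vac" "vec (i # ws) = cre i (vec ws)"
  by (simp_all add: vec_def)

lemma cre_linear: "cre i (a + b) = cre i a + cre i b" "cre i (scl k a) = scl k (cre i a)" "cre i 0 = 0"
  by (simp_all add: cre_def prd_add prd_scale)

lemma cre_comm: "cre i (cre j v) = scl (sg (fst i) (fst j)) (cre j (cre i v))"
  unfolding cre_def using gen_comm[of "- int (snd i) - 1" "fst i" "- int (snd j) - 1" "fst j" v]
  by (simp add: kap_def)

text \<open>Modes of negative index are creation operators. The others are moved to the right by
  \<open>gen_comm\<close> until they annihilate \<open>vac\<close>; the scalar terms only shorten
  the word.\<close>

lemma prd_gen_span:
  assumes "c \<in> span (range vec)"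
  shows "prd m (\<phi> u) c \<in> span (range vec)"
  using assms
proof (induction rule: span_induct_alt)
  case (step k x y)
  then obtain ws where x: "x = vec ws" by auto
  have "prd m (\<phi> u) (vec ws) \<in> span (range vec)"
  proof (cases "m < 0")
    case True
    then have "prd m (\<phi> u) (vec ws) = vec ((u, nat (- m - 1)) # ws)" by (simp add: cre_def)
    then show ?thesis by (metis rangeI span_base)
  next
    case False
    then show ?thesis
    proof (induction ws)
      case Nil
      then show ?case by (simp add: vac_right_regular span_zero)
    next
      case (Cons i ws)
      have cl: "cre i d \<in> span (range vec)" if "d \<in> span (range vec)" for d
        using that
      proof (induction rule: span_induct_alt)
        case (step k x y)
        then obtain ws where "x = vec ws" by auto
        then have "cre i x = vec (i # ws)" by simp
        then have "cre i x \<in> span (range vec)" by (metis rangeI span_base)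
        then show ?case using step by (simp add: cre_linear span_add span_scale)
      qed (simp add: cre_linear span_zero)
      have "prd m (\<phi> u) (vec (i # ws)) = scl (sg u (fst i)) (cre i (prd m (\<phi> u) (vec ws))) + scl (kap u (fst i) m (- int (snd i) - 1)) (vec ws)"
        using gen_comm[of m u "- int (snd i) - 1" "fst i" "vec ws"] by (simp add: cre_def)
      then show ?case using cl[OF Cons.IH[OF Cons.prems]] by (simp add: span_add span_scale span_base)
    qed
  qed
  then show ?case using step unfolding x by (simp add: prd_add prd_scale span_add span_scale)
qed (simp add: span_zero)

definition wd :: "(generator \<times> int) list \<Rightarrow> 'v" where
  "wd ws = foldr (\<lambda>(u, m) v. prd m (\<phi> u) v) ws vac"

lemma wd_simps: "wd [] = vac" "wd ((u, m) # ws) = prd m (\<phi> u) (wd ws)"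
  by (simp_all add: wd_def)

lemma wd_part: "\<exists>p. wd ws \<in> par p"
proof (induction ws)
  case (Cons i ws)
  then obtain p where "wd ws \<in> par p" by blast
  moreover obtain u m where "i = (u, m)" by (cases i)
  ultimately show ?case using prd_part[OF generator_part[of u], of "wd ws" p m] by (simp only: wd_simps) blast
next
  case Nil
  then show ?case using vac_even by (simp only: wd_simps) blast
qed

lemma Sum_any_subspace: "subspace S \<Longrightarrow> (\<And>j. f j \<in> S) \<Longrightarrow> Sum_any f \<in> S"
  unfolding Sum_any.expand_set by (rule subspace_sum)

lemma prd_gen_wd:
  assumes "c \<in> span (range wd)"
  shows "prd m (\<phi> u) c \<in> span (range wd)"
  using assms
proof (induction rule: span_induct_alt)
  case (step k x y)
  then obtain ws where "x = wd ws" by auto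
  then have "prd m (\<phi> u) x = wd ((u, m) # ws)" by (simp add: wd_simps)
  then have "prd m (\<phi> u) x \<in> span (range wd)" by (metis rangeI span_base)
  then show ?case using step by (simp add: prd_add prd_scale span_add span_scale)
qed (simp add: span_zero)

text \<open>Induction on the word: \<open>associativity\<close> expresses the modes of
  \<open>prd m (\<phi> u) (wd ws)\<close> by modes of \<open>\<phi> u\<close> and of the shorter
  word. Hence the words span a vertex subalgebra.\<close>

lemma prd_wd: "c \<in> span (range wd) \<Longrightarrow> prd n (wd ws) c \<in> span (range wd)"
proof (induction ws arbitrary: n c)
  case Nil
  then show ?case by (simp add: wd_simps vac_left span_zero)
next
  case (Cons i ws)
  obtain u m where i: "i = (u, m)" by (cases i)
  obtain p where p: "wd ws \<in> par p" using wd_part by blast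
  show ?case
    unfolding i wd_simps associativity[OF generator_part p]
    by (intro Sum_any_subspace subspace_span span_scale span_diff prd_gen_wd Cons.IH Cons.prems)
qed

lemma span_wd: "span (range wd) = UNIV"
proof (rule generated)
  show "vertex_subalgebra scl vac prd (span (range wd))"
    unfolding vertex_subalgebra_def
  proof (intro conjI allI ballI subspace_span)
    show "vac \<in> span (range wd)" by (metis wd_simps(1) rangeI span_base)
    fix n a b assume a: "a \<in> span (range wd)" and b: "b \<in> span (range wd)"
    from a show "prd n a b \<in> span (range wd)"
    proof (induction rule: span_induct_alt)
      case (step k x y)
      then show ?case using prd_wd[OF b] by (auto simp: prd_add prd_scale span_add span_scale)
    qed (simp add: span_zero)
  qed
  show "range \<phi> \<subseteq> span (range wd)"
  proof
    fix x assume "x \<in> range \<phi>"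
    then obtain u where "x = wd [(u, - 1)]" by (auto simp: wd_simps vac_right)
    then show "x \<in> span (range wd)" by (metis rangeI span_base)
  qed
qed

lemma span_vec: "span (range vec) = UNIV"
proof -
  have "wd ws \<in> span (range vec)" for ws
  proof (induction ws)
    case Nil
    have "vec [] \<in> span (range vec)" by (intro span_base rangeI)
    then show ?case by (simp add: wd_simps)
  next
    case (Cons i ws)
    then show ?case by (cases i) (simp add: wd_simps prd_gen_span)
  qed
  then have "span (range wd) \<subseteq> span (range vec)"
    by (intro span_minimal subspace_span) auto
  then show ?thesis unfolding span_wd by auto
qed

text \<open>Number operators distinguish the words by their multisets of modes.\<close>

fun dual :: "generator \<Rightarrow> generator" where
  "dual (B i) = C i" | "dual (C i) = B i" | "dual (X i) = Y i" | "dual (Y i) = X i"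

lemma is_odd_dual [simp]: "is_odd (dual g) = is_odd g" by (cases g) auto

text \<open>The annihilation mode conjugate to \<open>cre i\<close>. Its index is n + 1 for even
  generators because their operator product has a second-order pole; the same pole makes the
  commutator n + 1, recorded in \<open>kn\<close>.\<close>

definition ann :: "fock_mode \<Rightarrow> 'v \<Rightarrow> 'v" where
  "ann i v = prd (if is_odd (fst i) then int (snd i) else int (snd i) + 1) (\<phi> (dual (fst i))) v"

definition kn :: "fock_mode \<Rightarrow> complex" where
  "kn i = (if is_odd (fst i) then 1 else of_nat (snd i + 1))"

lemma kn_nonzero [simp]: "kn i \<noteq> 0"
  by (auto simp: kn_def simp del: of_nat_add of_nat_Suc)

lemma kap_ann: "kap (dual (fst i)) (fst j) (if is_odd (fst i) then int (snd i) else int (snd i) + 1) (- int (snd j) - 1) = (if i = j then kn i else 0)"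
proof -
  obtain g n g' n' where ij: "i = (g, n)" "j = (g', n')" by (cases i, cases j)
  show ?thesis
    by (cases g; cases g') (auto simp: ij kap_def kn_def)
qed

lemma ann_cre: "ann i (cre j v) = scl (sg (fst i) (fst j)) (cre j (ann i v)) + scl (if i = j then kn i else 0) v"
  using gen_comm[of "if is_odd (fst i) then int (snd i) else int (snd i) + 1" "dual (fst i)" "- int (snd j) - 1" "fst j" v]
  unfolding kap_ann ann_def cre_def sg_def is_odd_dual .

definition num :: "fock_mode \<Rightarrow> 'v \<Rightarrow> 'v" where "num i v = scl (1 / kn i) (cre i (ann i v))"

lemma ann_linear: "ann i (a + b) = ann i a + ann i b" "ann i (scl k a) = scl k (ann i a)" "ann i 0 = 0"
  by (simp_all add: ann_def prd_add prd_scale)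

lemma num_linear: "num i (a + b) = num i a + num i b" "num i (scl k a) = scl k (num i a)"
  by (simp_all add: num_def cre_linear ann_linear scale_right_distrib mult.commute)

lemma num_cre: "num i (cre j v) = cre j (num i v) + (if i = j then cre j v else 0)"
proof -
  have s: "sg (fst i) (fst j) * sg (fst i) (fst j) = 1" by (simp add: sg_def)
  have "cre i (ann i (cre j v)) = scl (sg (fst i) (fst j) * sg (fst i) (fst j)) (cre j (cre i (ann i v))) + scl (if i = j then kn i else 0) (cre i v)"
    unfolding ann_cre by (simp add: cre_linear cre_comm[of i j])
  then show ?thesis by (simp add: num_def s cre_linear scale_right_distrib)
qed

lemma ann_vac: "ann i vac = 0"
  by (simp add: ann_def vac_right_regular)

lemma num_vec: "num i (vec ws) = scl (of_nat (count (mset ws) i)) (vec ws)"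
proof (induction ws)
  case Nil
  then show ?case by (simp add: num_def ann_vac cre_linear)
next
  case (Cons j ws)
  then show ?case
    by (cases "i = j") (simp_all add: num_cre cre_linear scale_left_distrib add.commute)
qed

lemma cre_cre_odd: "is_odd (fst i) \<Longrightarrow> cre i (cre i v) = 0"
proof -
  assume "is_odd (fst i)"
  then have "cre i (cre i v) = - cre i (cre i v)" using cre_comm[of i i v] by (simp add: sg_def)
  then have "scl 2 (cre i (cre i v)) = 0"
    using scale_left_distrib[of 1 1 "cre i (cre i v)"] by (simp add: eq_neg_iff_add_eq_0)
  then show ?thesis by simp
qed

text \<open>The annihilator of the first mode recovers the remaining word with the factor
  \<open>kn i\<close> times 1 + count for an even mode, and times 1 for an odd one, whose count in
  the rest is 0.\<close>

lemma vec_nonzero: "mset ws \<in> occ \<Longrightarrow> vec ws \<noteq> 0"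
proof (induction ws)
  case (Cons i ws)
  have "count (mset ws) (g, n) \<le> 1" if "is_odd g" for g n
  proof -
    have "count (mset (i # ws)) (g, n) \<le> 1" using Cons.prems that unfolding occ_def by blast
    moreover have "count (mset ws) (g, n) \<le> count (mset (i # ws)) (g, n)" by simp
    ultimately show ?thesis by linarith
  qed
  then have "mset ws \<in> occ" unfolding occ_def by blast
  then have nz: "vec ws \<noteq> 0" by (rule Cons.IH)
  have "cre i (ann i (vec ws)) = scl (kn i) (num i (vec ws))" by (simp add: num_def)
  then have "ann i (cre i (vec ws)) = scl (kn i * (1 + sg (fst i) (fst i) * of_nat (count (mset ws) i))) (vec ws)"
    unfolding ann_cre num_vec by (simp add: scale_left_distrib algebra_simps)
  moreover have "1 + sg (fst i) (fst i) * of_nat (count (mset ws) i) \<noteq> 0"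
  proof (cases "is_odd (fst i)")
    case True
    then have "count (mset (i # ws)) (fst i, snd i) \<le> 1" using Cons.prems unfolding occ_def by blast
    then have c: "count (mset ws) i = 0" by simp
    show ?thesis unfolding c by simp
  next
    case False
    have "1 + of_nat (count (mset ws) i) = (of_nat (1 + count (mset ws) i) :: complex)" by simp
    then show ?thesis using False by (simp add: sg_def del: of_nat_add of_nat_Suc)
  qed
  ultimately have "ann i (cre i (vec ws)) \<noteq> 0" using nz by simp
  then show ?case by (auto simp: ann_linear)
qed (simp add: vac_nonzero)

lemma vec_move: "\<exists>s. vec (xs @ i # ys) = scl s (vec (i # xs @ ys))"
proof (induction xs)
  case Nil
  have "vec ([] @ i # ys) = scl 1 (vec (i # [] @ ys))" by simp
  then show ?case by blast
next
  case (Cons j xs)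
  then obtain s where s: "vec (xs @ i # ys) = scl s (vec (i # xs @ ys))" by blast
  have "vec ((j # xs) @ i # ys) = scl (s * sg (fst j) (fst i)) (vec (i # (j # xs) @ ys))"
    using s by (simp add: cre_linear cre_comm[of j i])
  then show ?case by blast
qed

text \<open>Creation operators commute up to sign, since \<open>kap\<close> vanishes for two
  negative indices.\<close>

lemma vec_perm: "mset ws = mset ws' \<Longrightarrow> \<exists>s. vec ws = scl s (vec ws')"
proof (induction ws' arbitrary: ws)
  case Nil
  have "vec [] = scl 1 (vec [])" by simp
  then show ?case using Nil by (metis mset_zero_iff)
next
  case (Cons i ws')
  then have "i \<in> set ws" by (metis list.set_intros(1) mset_eq_setD)
  then obtain xs ys where ws: "ws = xs @ i # ys" by (meson split_list)
  then have "mset (xs @ ys) = mset ws'" using Cons.prems by simp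
  then obtain s where s: "vec (xs @ ys) = scl s (vec ws')" using Cons.IH by blast
  obtain t where t: "vec ws = scl t (vec (i # xs @ ys))" using vec_move ws by blast
  have "vec ws = scl (t * s) (vec (i # ws'))" unfolding t by (simp add: s cre_linear)
  then show ?case by blast
qed

lemma vec_zero: "mset ws \<notin> occ \<Longrightarrow> vec ws = 0"
proof -
  assume "mset ws \<notin> occ"
  then obtain g n where "is_odd g" "\<not> count (mset ws) (g, n) \<le> 1"
    unfolding occ_def by blast
  then have g: "is_odd g" "count (mset ws) (g, n) \<ge> 2" by simp_all
  have "{#(g, n), (g, n)#} \<subseteq># mset ws"
  proof (rule mset_subset_eqI)
    show "count {#(g, n), (g, n)#} x \<le> count (mset ws) x" for x
      by (cases "x = (g, n)") (use g in auto)
  qed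
  then obtain K where "mset ws = mset [(g, n), (g, n)] + K"
    by (auto simp: subset_mset.le_iff_add)
  moreover obtain ks where "mset ks = K" using ex_mset by blast
  ultimately have "mset ws = mset ((g, n) # (g, n) # ks)" by simp
  then obtain s where "vec ws = scl s (vec ((g, n) # (g, n) # ks))" using vec_perm by blast
  then show ?thesis using g(1) by (simp add: cre_cre_odd)
qed

text \<open>The order of the modes is an arbitrary choice. Another order changes the vector only by
  a sign, which affects neither spans nor eigenvalues.\<close>

definition mono :: "fock_mode multiset \<Rightarrow> 'v" where "mono M = vec (SOME ws. mset ws = M)"

lemma mono_eq: "\<exists>ws. mset ws = M \<and> mono M = vec ws"
  unfolding mono_def by (metis (mono_tags, lifting) ex_mset someI_ex)

lemma mono_nonzero: "M \<in> occ \<Longrightarrow> mono M \<noteq> 0"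
  using mono_eq[of M] vec_nonzero by auto

lemma num_mono: "num i (mono M) = scl (of_nat (count M i)) (mono M)"
  using mono_eq[of M] num_vec by metis

lemma span_mono: "span (mono ` occ) = UNIV"
proof -
  have "vec ws \<in> span (mono ` occ)" for ws
  proof (cases "mset ws \<in> occ")
    case True
    obtain ws' where "mset ws' = mset ws" "mono (mset ws) = vec ws'" using mono_eq by blast
    then obtain s where "vec ws = scl s (mono (mset ws))" using vec_perm by metis
    then show ?thesis using True by (simp add: span_scale span_base)
  qed (simp add: vec_zero span_zero)
  then have "span (range vec) \<subseteq> span (mono ` occ)" by (intro span_minimal subspace_span) auto
  then show ?thesis unfolding span_vec by auto
qed


text \<open>No single operator has to separate all eigenvectors. Applying \<open>Op i\<close> minus
  its eigenvalue at \<open>t0\<close> removes \<open>t0\<close> from the relation and rescales the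
  other terms, with i chosen to separate \<open>t0\<close> from the term under
  consideration.\<close>

lemma eigen_independent:
  fixes Op :: "'i \<Rightarrow> 'v \<Rightarrow> 'v" and ev :: "'t \<Rightarrow> 'i \<Rightarrow> complex" and v :: "'t \<Rightarrow> 'v"
  assumes "finite T" and lin: "\<And>i. Vector_Spaces.linear scl scl (Op i)"
    and "\<And>t i. t \<in> T \<Longrightarrow> Op i (v t) = scl (ev t i) (v t)"
    and "\<And>s t. s \<in> T \<Longrightarrow> t \<in> T \<Longrightarrow> s \<noteq> t \<Longrightarrow> \<exists>i. ev s i \<noteq> ev t i"
    and "(\<Sum>t\<in>T. v t) = 0" and "t \<in> T"
  shows "v t = 0"
  using assms(1,3-6)
proof (induction T arbitrary: v t rule: finite_induct)
  case (insert t0 T)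
  have sub: "v s = 0" if s: "s \<in> T" for s
  proof -
    obtain i where i: "ev s i \<noteq> ev t0 i" using insert.prems(2)[of s t0] insert.hyps s by auto
    let ?v = "\<lambda>t. scl (ev t i - ev t0 i) (v t)"
    interpret L: Vector_Spaces.linear scl scl "Op i" by (rule lin)
    have "Op i (v t) - scl (ev t0 i) (v t) = ?v t" if "t \<in> insert t0 T" for t
      using insert.prems(1)[OF that, of i] by (simp add: scale_left_diff_distrib)
    then have "(\<Sum>t\<in>insert t0 T. ?v t) = (\<Sum>t\<in>insert t0 T. Op i (v t) - scl (ev t0 i) (v t))"
      by (intro sum.cong) auto
    also have "\<dots> = Op i (\<Sum>t\<in>insert t0 T. v t) - scl (ev t0 i) (\<Sum>t\<in>insert t0 T. v t)"
      by (simp only: sum_subtractf L.sum scale_sum_right)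
    also have "\<dots> = 0" using insert.prems(3) by (simp add: L.zero)
    finally have "(\<Sum>t\<in>T. ?v t) = 0" using insert.hyps by simp
    moreover have "Op j (?v t) = scl (ev t j) (?v t)" if "t \<in> T" for t j
    proof -
      interpret Lj: Vector_Spaces.linear scl scl "Op j" by (rule lin)
      show ?thesis using insert.prems(1)[of t j] that by (simp add: Lj.scale mult.commute)
    qed
    ultimately have "?v s = 0"
      using insert.IH[of ?v s] insert.prems(2) s by simp
    then show ?thesis using i by simp
  qed
  then have "(\<Sum>t\<in>T. v t) = 0" by simp
  then have "v t0 = 0" using insert.prems(3) insert.hyps by simp
  then show ?case using sub insert.prems(4) by auto
qed simp

lemma num_is_linear: "Vector_Spaces.linear scl scl (num i)"
  by (simp add: Vector_Spaces.linear_iff vector_space_axioms num_linear)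

lemma mono_inj: "inj_on mono occ"
proof (rule inj_onI)
  fix M M' assume M: "M \<in> occ" "M' \<in> occ" and e: "mono M = mono M'"
  have "count M i = count M' i" for i
  proof -
    have "scl (of_nat (count M i)) (mono M) = scl (of_nat (count M' i)) (mono M)"
      using num_mono[of i M] num_mono[of i M', folded e] by metis
    then have "scl (of_nat (count M i) - of_nat (count M' i)) (mono M) = 0"
      by (simp add: scale_left_diff_distrib)
    then have "of_nat (count M i) - of_nat (count M' i) = (0 :: complex)"
      using mono_nonzero[OF M(1)] by (metis scale_eq_0_iff)
    then show ?thesis by simp
  qed
  then show "M = M'" by (simp add: multiset_eq_iff)
qed

lemma mono_coeff_zero:
  assumes "finite S" "S \<subseteq> occ" "(\<Sum>M\<in>S. scl (c M) (mono M)) = 0" "M \<in> S"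
  shows "c M = 0"
proof -
  have "scl (c M) (mono M) = 0"
  proof (rule eigen_independent[where Op = num and ev = "\<lambda>M i. of_nat (count M i)" and T = S])
    show "num i (scl (c M) (mono M)) = scl (of_nat (count M i)) (scl (c M) (mono M))" for M i
      by (simp add: num_linear num_mono mult.commute)
    show "\<exists>i. (of_nat (count s i) :: complex) \<noteq> of_nat (count t i)" if "s \<noteq> t" for s t
      using that by (auto simp: multiset_eq_iff)
  qed (use assms num_is_linear in auto)
  then show ?thesis using mono_nonzero assms(2,4) by auto
qed

lemma mono_independent: "S \<subseteq> occ \<Longrightarrow> \<not> dependent (mono ` S)"
proof
  assume S: "S \<subseteq> occ" and "dependent (mono ` S)"
  then obtain t u where t: "finite t" "t \<subseteq> mono ` S" "(\<Sum>v\<in>t. scl (u v) v) = 0" and u: "\<exists>v\<in>t. u v \<noteq> 0"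
    unfolding dependent_explicit by blast
  obtain T where T: "T \<subseteq> S" "t = mono ` T" using t(2) by (meson subset_imageE)
  have inj: "inj_on mono T" using mono_inj S T(1) by (meson inj_on_subset order_trans)
  have "finite T" using t(1) inj T(2) finite_imageD by blast
  moreover have "(\<Sum>M\<in>T. scl (u (mono M)) (mono M)) = 0"
    using t(3) inj unfolding T(2) by (simp add: sum.reindex)
  ultimately have "u (mono M) = 0" if "M \<in> T" for M
    using mono_coeff_zero[of T "\<lambda>M. u (mono M)" M] S T(1) that by auto
  then show False using u T(2) by auto
qed

subsection \<open>Conformal weights and charges\<close>

lemma op_vec:
  assumes "D vac = 0" and "\<And>i v. D (cre i v) = cre i (D v) + scl (d i) (cre i v)"
  shows "D (vec ws) = scl (\<Sum>i\<in>#mset ws. d i) (vec ws)"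
  using assms by (induction ws) (simp_all add: cre_linear scale_left_distrib add.commute)

lemma op_mono:
  assumes "D vac = 0" and "\<And>i v. D (cre i v) = cre i (D v) + scl (d i) (cre i v)"
  shows "D (mono M) = scl (\<Sum>i\<in>#M. d i) (mono M)"
  using op_vec[of D d, OF assms] mono_eq[of M] by metis

lemma prd_minus: "prd n (- a) b = - prd n a b" "prd n a (- b) = - prd n a b"
  using prd_diff(1)[of n 0 a b] prd_diff(2)[of n a 0 b] by simp_all

lemma generator_cases8:
  "v = B 1 \<or> v = B 2 \<or> v = C 1 \<or> v = C 2 \<or> v = X 1 \<or> v = X 2 \<or> v = Y 1 \<or> v = Y 2"
  using UNIV_I[of v] unfolding UNIV_generator by simp

abbreviation Jv :: 'v where "Jv \<equiv> heisenberg_vector prd \<phi>"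
abbreviation om :: 'v where "om \<equiv> conformal_vector scl vac prd \<phi>"

lemma subspace_par: "subspace (par p)" by (rule part_subspace)

lemma gp: "\<phi> (B i) \<in> par True" "\<phi> (C i) \<in> par True" "\<phi> (X i) \<in> par False" "\<phi> (Y i) \<in> par False"
  using generator_part[of "B i"] generator_part[of "C i"] generator_part[of "X i"] generator_part[of "Y i"] by simp_all

lemma tr_par: "a \<in> par p \<Longrightarrow> tr a \<in> par p"
  unfolding tr_def using prd_part[OF _ vac_even, of a p "- 2"] by simp

lemma Jv_even: "Jv \<in> par False"
  unfolding heisenberg_vector_def
  by (rule subspace_sum[OF subspace_par]) (use prd_part[OF gp(1) gp(2)] in simp)

lemma om_conv: "om = (\<Sum>i\<in>UNIV. prd (- 1) (\<phi> (X i)) (\<phi> (Y i))) +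
    scl (1 / 2) (\<Sum>i\<in>UNIV. prd (- 1) (tr (\<phi> (B i))) (\<phi> (C i)) - prd (- 1) (\<phi> (B i)) (tr (\<phi> (C i))))"
  unfolding conformal_vector_def Let_def tr_def ..

lemma om_even: "om \<in> par False"
  unfolding om_conv
  using prd_part[OF gp(3) gp(4)] prd_part[OF tr_par[OF gp(1)] gp(2)] prd_part[OF gp(1) tr_par[OF gp(2)]]
  by (intro subspace_add subspace_sum subspace_scale subspace_diff subspace_par) simp_all

lemma Jv_gen: "prd 0 Jv (\<phi> v) = scl (of_int (gen_charge v)) (\<phi> v)"
proof -
  have n: "prd 0 (prd (- 1) (\<phi> (B i)) (\<phi> (C i))) (\<phi> v)
      = scl (contraction (C i) v 0) (\<phi> (B i)) - scl (contraction (B i) v 0) (\<phi> (C i))" for i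
  proof -
    have z: "contraction (C i) v (int j) = 0" "contraction (B i) v (int j) = 0" if "j \<noteq> 0" for j
      using that by (cases v; simp)+
    have "prd 0 (prd (- 1) (\<phi> (B i)) (\<phi> (C i))) (\<phi> v) = Sum_any (\<lambda>j::nat. prd (- 1 - int j) (\<phi> (B i)) (prd (0 + int j) (\<phi> (C i)) (\<phi> v))
        + scl (if True \<and> True then - 1 else 1) (prd (0 - 1 - int j) (\<phi> (C i)) (prd (int j) (\<phi> (B i)) (\<phi> v))))"
      by (rule normal_product[OF gp(1) gp(2)])
    also have "\<dots> = scl (contraction (C i) v 0) (\<phi> (B i)) - scl (contraction (B i) v 0) (\<phi> (C i))"
      by (subst Sum_any_single[of 0]) (auto simp: operator_product z prd_scale vac_right)
    finally show ?thesis .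
  qed
  show ?thesis
    unfolding heisenberg_vector_def prd_sum n using generator_cases8[of v]
    by (elim disjE) (simp_all add: sum_2)
qed

lemma Jv_cre: "prd 0 Jv (cre i v) = cre i (prd 0 Jv v) + scl (of_int (gen_charge (fst i))) (cre i v)"
proof -
  have "Sum_any (\<lambda>j::nat. scl (of_int 0 gchoose j) (prd (0 + (- int (snd i) - 1) - int j) (prd (int j) Jv (\<phi> (fst i))) v))
      = prd (- int (snd i) - 1) (prd 0 Jv (\<phi> (fst i))) v"
    by (subst Sum_any_single[of 0]) (auto simp: gbinomial_0_left)
  then show ?thesis
    unfolding cre_def using commutator[OF Jv_even generator_part, of 0 "- int (snd i) - 1" "fst i" v]
    by (simp add: Jv_gen prd_scale)
qed

lemma Jv_mono: "prd 0 Jv (mono M) = scl (of_int (occ_charge M)) (mono M)"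
proof -
  have "prd 0 Jv (mono M) = scl (\<Sum>i\<in>#M. of_int (gen_charge (fst i))) (mono M)"
    by (rule op_mono[OF _ Jv_cre]) (simp add: vac_right_regular)
  also have "(\<Sum>i\<in>#M. of_int (gen_charge (fst i))) = (of_int (occ_charge M) :: complex)"
    unfolding occ_charge_def by (induction M) simp_all
  finally show ?thesis .
qed

lemma om_boson:
  assumes k: "k = 0 \<or> k = 1"
  shows "prd k (prd (- 1) (\<phi> (X i)) (\<phi> (Y i))) (\<phi> v)
    = scl (contraction (Y i) v 1) (prd (k - 2) (\<phi> (X i)) vac) + scl (contraction (X i) v 1) (prd (k - 2) (\<phi> (Y i)) vac)"
proof -
  have z: "contraction (X i) v n = 0" "contraction (Y i) v n = 0" if "n \<noteq> 1" for n
    using that by (cases v; simp)+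
  have e: "prd k (prd (- 1) (\<phi> (X i)) (\<phi> (Y i))) (\<phi> v) = Sum_any (\<lambda>j::nat. prd (- 1 - int j) (\<phi> (X i)) (prd (k + int j) (\<phi> (Y i)) (\<phi> v))
      + scl (if False \<and> False then - 1 else 1) (prd (k - 1 - int j) (\<phi> (Y i)) (prd (int j) (\<phi> (X i)) (\<phi> v))))"
    by (rule normal_product[OF gp(3) gp(4)])
  show ?thesis unfolding e
    by (subst Sum_any_two) (use k in \<open>auto simp: operator_product z prd_scale\<close>)
qed

lemma om_fermion1:
  assumes k: "k = 0 \<or> k = 1"
  shows "prd k (prd (- 1) (tr (\<phi> (B i))) (\<phi> (C i))) (\<phi> v)
    = scl ((1 - of_int k) * contraction (C i) v 0) (tr (\<phi> (B i))) + scl (contraction (B i) v 0) (prd (k - 2) (\<phi> (C i)) vac)"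
proof -
  have z: "contraction (C i) v n = 0" "contraction (B i) v n = 0" if "n \<noteq> 0" for n
    using that by (cases v; simp)+
  have e: "prd k (prd (- 1) (tr (\<phi> (B i))) (\<phi> (C i))) (\<phi> v) = Sum_any (\<lambda>j::nat. prd (- 1 - int j) (tr (\<phi> (B i))) (prd (k + int j) (\<phi> (C i)) (\<phi> v))
      + scl (if True \<and> True then - 1 else 1) (prd (k - 1 - int j) (\<phi> (C i)) (prd (int j) (tr (\<phi> (B i))) (\<phi> v))))"
    by (rule normal_product[OF tr_par[OF gp(1)] gp(2)])
  show ?thesis unfolding e
    by (subst Sum_any_two) (use k in \<open>auto simp: operator_product z prd_scale prd_minus tr_mode[OF gp(1)] vac_right tr_def[symmetric]\<close>)
qed

lemma om_fermion2:
  assumes k: "k = 0 \<or> k = 1"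
  shows "prd k (prd (- 1) (\<phi> (B i)) (tr (\<phi> (C i)))) (\<phi> v)
    = - scl (contraction (C i) v 0) (prd (k - 2) (\<phi> (B i)) vac) - scl ((1 - of_int k) * contraction (B i) v 0) (tr (\<phi> (C i)))"
proof -
  have z: "contraction (C i) v n = 0" "contraction (B i) v n = 0" if "n \<noteq> 0" for n
    using that by (cases v; simp)+
  have e: "prd k (prd (- 1) (\<phi> (B i)) (tr (\<phi> (C i)))) (\<phi> v) = Sum_any (\<lambda>j::nat. prd (- 1 - int j) (\<phi> (B i)) (prd (k + int j) (tr (\<phi> (C i))) (\<phi> v))
      + scl (if True \<and> True then - 1 else 1) (prd (k - 1 - int j) (tr (\<phi> (C i))) (prd (int j) (\<phi> (B i)) (\<phi> v))))"
    by (rule normal_product[OF gp(1) tr_par[OF gp(2)]])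
  show ?thesis unfolding e
    by (subst Sum_any_two) (use k in \<open>auto simp: operator_product z prd_scale prd_minus tr_mode[OF gp(2)] vac_right tr_def[symmetric]\<close>)
qed

lemma half_double: "scl (1 / 2) (a + a) = a"
proof -
  have "scl (1 / 2) (a + a) = scl (1 / 2 + 1 / 2) a" by (simp only: scale_left_distrib scale_right_distrib)
  then show ?thesis by simp
qed

text \<open>Modes 0 and 1 are enough: in the commutator of \<open>prd 1 om\<close> with a generator
  the binomial coefficient (1 choose j) is 0 for j >= 2.\<close>

lemma om_gen:
  "prd 0 om (\<phi> v) = tr (\<phi> v)" "prd 1 om (\<phi> v) = scl (if is_odd v then 1 / 2 else 1) (\<phi> v)"
proof -
  have e: "prd k om (\<phi> v) = (\<Sum>i\<in>UNIV. prd k (prd (- 1) (\<phi> (X i)) (\<phi> (Y i))) (\<phi> v)) +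
    scl (1 / 2) (\<Sum>i\<in>UNIV. prd k (prd (- 1) (tr (\<phi> (B i))) (\<phi> (C i))) (\<phi> v) - prd k (prd (- 1) (\<phi> (B i)) (tr (\<phi> (C i)))) (\<phi> v))" for k
    unfolding om_conv prd_add prd_scale prd_sum prd_diff ..
  show "prd 0 om (\<phi> v) = tr (\<phi> v)"
    unfolding e using generator_cases8[of v]
    by (elim disjE) (simp_all add: om_boson om_fermion1 om_fermion2 half_double sum_2 tr_def[symmetric])
  show "prd 1 om (\<phi> v) = scl (if is_odd v then 1 / 2 else 1) (\<phi> v)"
    unfolding e using generator_cases8[of v]
    by (elim disjE) (simp_all add: om_boson om_fermion1 om_fermion2 sum_2 vac_right)
qed

text \<open>The term j = 0 contributes n through \<open>tr_mode\<close>, the term j = 1 the weight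
  of the generator itself.\<close>

lemma om_cre: "prd 1 om (cre i v) = cre i (prd 1 om v) + scl (of_real (mode_wt i)) (cre i v)"
proof -
  obtain g n where i: "i = (g, n)" by (cases i)
  let ?k = "- int n - 1"
  have "Sum_any (\<lambda>j::nat. scl (of_int 1 gchoose j) (prd (1 + ?k - int j) (prd (int j) om (\<phi> g)) v))
      = prd (1 + ?k) (prd 0 om (\<phi> g)) v + prd ?k (prd 1 om (\<phi> g)) v"
  proof (subst Sum_any_two)
    fix j :: nat assume "j \<ge> 2"
    then have "(of_nat 1 gchoose j :: complex) = 0"
      unfolding binomial_gbinomial[symmetric] by simp
    then show "scl (of_int 1 gchoose j) (prd (1 + ?k - int j) (prd (int j) om (\<phi> g)) v) = 0" by simp
  qed simp
  also have "\<dots> = scl (of_int (int n)) (prd ?k (\<phi> g) v) + scl (if is_odd g then 1 / 2 else 1) (prd ?k (\<phi> g) v)"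
    unfolding om_gen prd_scale tr_mode[OF generator_part] by simp
  also have "\<dots> = scl (of_real (mode_wt i)) (prd ?k (\<phi> g) v)"
    by (simp add: i scale_left_distrib)
  finally show ?thesis
    unfolding cre_def using commutator[OF om_even generator_part, of 1 ?k g v] by (simp add: i)
qed

lemma om_mono: "prd 1 om (mono M) = scl (of_real (occ_wt M)) (mono M)"
proof -
  have "prd 1 om (mono M) = scl (\<Sum>i\<in>#M. of_real (mode_wt i)) (mono M)"
    by (rule op_mono[OF _ om_cre]) (simp add: vac_right_regular)
  also have "(\<Sum>i\<in>#M. of_real (mode_wt i)) = (of_real (occ_wt M) :: complex)"
    unfolding occ_wt_def by (induction M) simp_all
  finally show ?thesis .
qed

end

section \<open>The action of the group\<close>

definition mat2 :: "complex \<Rightarrow> complex \<Rightarrow> complex \<Rightarrow> complex \<Rightarrow> complex^2^2" where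
  "mat2 a b c d = (\<chi> i j. if i = 1 then (if j = 1 then a else b) else (if j = 1 then c else d))"

lemma mat2_nth [simp]: "mat2 a b c d $ 1 $ 1 = a" "mat2 a b c d $ 1 $ 2 = b"
  "mat2 a b c d $ 2 $ 1 = c" "mat2 a b c d $ 2 $ 2 = d"
  by (simp_all add: mat2_def)

lemma mat2_eta: "g = mat2 (g $ 1 $ 1) (g $ 1 $ 2) (g $ 2 $ 1) (g $ 2 $ 2)"
  by (simp add: vec_eq_iff forall_2)

lemma mat2_mult: "mat2 a b c d ** mat2 a' b' c' d' = mat2 (a * a' + b * c') (a * b' + b * d') (c * a' + d * c') (c * b' + d * d')"
  by (simp add: vec_eq_iff forall_2 matrix_matrix_mult_def sum_2)

lemma mat2_one: "mat 1 = mat2 1 0 0 1"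
  by (simp add: vec_eq_iff forall_2 mat_def)

lemma mat2_SL2: "mat2 a b c d \<in> SL2 \<longleftrightarrow> a * d - b * c = 1"
  by (simp add: SL2_def det_2)

lemma SL2_det: "g \<in> SL2 \<Longrightarrow> g $ 1 $ 1 * g $ 2 $ 2 - g $ 1 $ 2 * g $ 2 $ 1 = 1"
  by (simp add: SL2_def det_2)

lemma matrix_inv_mat2: "a * d - b * c = 1 \<Longrightarrow> matrix_inv (mat2 a b c d) = mat2 d (- b) (- c) a"
proof -
  assume d: "a * d - b * c = 1"
  let ?g = "mat2 a b c d" and ?h = "mat2 d (- b) (- c) a"
  have gh: "?g ** ?h = mat 1" "?h ** ?g = mat 1"
    unfolding mat2_mult mat2_one using d by (simp_all add: mult.commute algebra_simps)
  show ?thesis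
    unfolding matrix_inv_def
  proof (rule some_equality)
    show "?g ** ?h = mat 1 \<and> ?h ** ?g = mat 1" using gh by simp
    fix k assume k: "?g ** k = mat 1 \<and> k ** ?g = mat 1"
    have "k = k ** (?g ** ?h)" using gh by simp
    also have "\<dots> = ?h" using k by (simp add: matrix_mul_assoc)
    finally show "k = ?h" .
  qed
qed

lemma matrix_inv_SL2:
  assumes "g \<in> SL2"
  shows "matrix_inv g $ 1 $ 1 = g $ 2 $ 2" "matrix_inv g $ 1 $ 2 = - g $ 1 $ 2"
    "matrix_inv g $ 2 $ 1 = - g $ 2 $ 1" "matrix_inv g $ 2 $ 2 = g $ 1 $ 1"
  using matrix_inv_mat2[OF SL2_det[OF assms]] unfolding mat2_eta[symmetric] by simp_all

lemma SL2_mult: "g \<in> SL2 \<Longrightarrow> h \<in> SL2 \<Longrightarrow> g ** h \<in> SL2"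
  by (simp add: SL2_def det_mul)

definition ut :: "complex \<Rightarrow> complex^2^2" where "ut t = mat2 1 t 0 1"
definition lt :: "complex \<Rightarrow> complex^2^2" where "lt t = mat2 1 0 t 1"
definition dt :: "complex \<Rightarrow> complex^2^2" where "dt s = mat2 s 0 0 (inverse s)"

lemma curves_SL2: "ut t \<in> SL2" "lt t \<in> SL2" "s \<noteq> 0 \<Longrightarrow> dt s \<in> SL2"
  by (simp_all add: ut_def lt_def dt_def mat2_SL2)

section \<open>Polynomial curves\<close>

definition polyc :: "(complex \<Rightarrow> complex) \<Rightarrow> bool" where
  "polyc f \<longleftrightarrow> (\<exists>n c. \<forall>t. f t = (\<Sum>k\<le>n. c k * t ^ k))"

lemma polyc_const: "polyc (\<lambda>_. a)"
  unfolding polyc_def by (rule exI[of _ 0], rule exI[of _ "\<lambda>_. a"]) simp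

lemma polyc_ident: "polyc (\<lambda>t. t)"
  unfolding polyc_def by (rule exI[of _ 1], rule exI[of _ "\<lambda>k. of_nat k"]) simp

lemma polyc_linear: "polyc (\<lambda>t. a + t * b)"
  unfolding polyc_def by (rule exI[of _ 1], rule exI[of _ "\<lambda>k. if k = 0 then a else b"]) simp

context SL2_free_field_algebra
begin

definition polyv :: "(complex \<Rightarrow> 'v) \<Rightarrow> bool" where
  "polyv f \<longleftrightarrow> (\<exists>n c. \<forall>t. f t = (\<Sum>k\<le>n. scl (t ^ k) (c k)))"

lemma polyv_power: "polyv (\<lambda>t. scl (t ^ k) v)"
  unfolding polyv_def
  by (rule exI[of _ k], rule exI[of _ "\<lambda>i. if i = k then v else 0"]) (simp add: if_distrib cong: if_cong)

lemma polyv_const: "polyv (\<lambda>_. v)"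
  using polyv_power[of 0 v] by simp

lemma polyv_add: "polyv f \<Longrightarrow> polyv h \<Longrightarrow> polyv (\<lambda>t. f t + h t)"
proof -
  assume "polyv f" "polyv h"
  then obtain n c m d where f: "\<And>t. f t = (\<Sum>k\<le>n. scl (t ^ k) (c k))" and h: "\<And>t. h t = (\<Sum>k\<le>m. scl (t ^ k) (d k))"
    unfolding polyv_def by blast
  let ?N = "max n m"
  let ?c = "\<lambda>k. (if k \<le> n then c k else 0) + (if k \<le> m then d k else 0)"
  have "f t + h t = (\<Sum>k\<le>?N. scl (t ^ k) (?c k))" for t
  proof -
    have "(\<Sum>k\<le>n. scl (t ^ k) (c k)) = (\<Sum>k\<le>?N. scl (t ^ k) (if k \<le> n then c k else 0))"
      by (rule sum.mono_neutral_cong_left) auto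
    moreover have "(\<Sum>k\<le>m. scl (t ^ k) (d k)) = (\<Sum>k\<le>?N. scl (t ^ k) (if k \<le> m then d k else 0))"
      by (rule sum.mono_neutral_cong_left) auto
    ultimately show ?thesis unfolding f h scale_right_distrib sum.distrib by simp
  qed
  then show ?thesis unfolding polyv_def by (intro exI[of _ ?N] exI[of _ ?c]) simp
qed

lemma polyv_sum: "(\<And>i. i \<in> I \<Longrightarrow> polyv (f i)) \<Longrightarrow> polyv (\<lambda>t. \<Sum>i\<in>I. f i t)"
  by (induction I rule: infinite_finite_induct) (simp_all add: polyv_const polyv_add)

lemma polyv_linear: "polyv f \<Longrightarrow> Vector_Spaces.linear scl scl D \<Longrightarrow> polyv (\<lambda>t. D (f t))"
proof -
  assume "polyv f" and D: "Vector_Spaces.linear scl scl D"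
  then obtain n c where f: "\<And>t. f t = (\<Sum>k\<le>n. scl (t ^ k) (c k))" unfolding polyv_def by blast
  interpret L: Vector_Spaces.linear scl scl D by (rule D)
  have "D (f t) = (\<Sum>k\<le>n. scl (t ^ k) (D (c k)))" for t by (simp add: f L.sum L.scale)
  then show ?thesis unfolding polyv_def by (intro exI[of _ n] exI[of _ "\<lambda>k. D (c k)"]) simp
qed

lemma polyv_times: "polyv f \<Longrightarrow> polyv (\<lambda>t. scl t (f t))"
proof -
  assume "polyv f"
  then obtain n c where f: "\<And>t. f t = (\<Sum>k\<le>n. scl (t ^ k) (c k))" unfolding polyv_def by blast
  have "polyv (\<lambda>t. \<Sum>k\<le>n. scl (t ^ Suc k) (c k))"
    by (intro polyv_sum polyv_power)
  then show ?thesis by (simp add: f scale_sum_right)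
qed

lemma polyv_scl: "polyv f \<Longrightarrow> polyv (\<lambda>t. scl a (f t))"
  by (rule polyv_linear[where D = "scl a"]) (simp_all add: Vector_Spaces.linear_iff vector_space_axioms scale_right_distrib mult.commute)

lemma polyv_diff: "polyv f \<Longrightarrow> polyv h \<Longrightarrow> polyv (\<lambda>t. f t - h t)"
  using polyv_add[of f "\<lambda>t. scl (- 1) (h t)"] polyv_scl[of h "- 1"] by simp

lemma polyv_prd: "polyv f \<Longrightarrow> polyv h \<Longrightarrow> polyv (\<lambda>t. prd m (f t) (h t))"
proof -
  assume "polyv f" "polyv h"
  then obtain n c l d where f: "\<And>t. f t = (\<Sum>k\<le>n. scl (t ^ k) (c k))" and h: "\<And>t. h t = (\<Sum>k\<le>l. scl (t ^ k) (d k))"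
    unfolding polyv_def by blast
  have "polyv (\<lambda>t. \<Sum>i\<le>n. \<Sum>j\<le>l. scl (t ^ (i + j)) (prd m (c i) (d j)))"
    by (intro polyv_sum polyv_power)
  moreover have "prd m (f t) (h t) = (\<Sum>i\<le>n. \<Sum>j\<le>l. scl (t ^ (i + j)) (prd m (c i) (d j)))" for t
    unfolding f h prd_sum(1) by (simp add: prd_sum(2) prd_scale power_add mult.commute)
  ultimately show ?thesis by simp
qed

lemma polyv_polyc: "polyc f \<Longrightarrow> polyv (\<lambda>t. scl (f t) v)"
proof -
  assume "polyc f"
  then obtain n c where f: "\<And>t. f t = (\<Sum>k\<le>n. c k * t ^ k)" unfolding polyc_def by blast
  have "polyv (\<lambda>t. \<Sum>k\<le>n. scl (t ^ k) (scl (c k) v))" by (intro polyv_sum polyv_power)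
  then show ?thesis by (simp add: f scale_sum_left mult.commute)
qed

lemma independent_occ: "independent (mono ` occ)" by (rule mono_independent) simp

text \<open>Each coordinate in the monomial basis is a scalar polynomial with infinitely many
  zeros.\<close>

lemma vpoly_zero:
  assumes "infinite T" "\<And>t. t \<in> T \<Longrightarrow> (\<Sum>k\<le>n. scl (t ^ k) (c k)) = 0" "k \<le> n"
  shows "c k = 0"
proof -
  let ?r = "representation (mono ` occ)"
  have sp: "v \<in> span (mono ` occ)" for v by (simp add: span_mono)
  have "?r (c k) b = 0" for b
  proof (rule ccontr)
    assume nz: "?r (c k) b \<noteq> 0"
    have "(\<Sum>i\<le>n. ?r (c i) b * t ^ i) = ?r (\<Sum>k\<le>n. scl (t ^ k) (c k)) b" for t
      by (simp add: representation_sum[OF independent_occ] representation_scale[OF independent_occ] sp mult.commute)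
    then have "T \<subseteq> {t. (\<Sum>i\<le>n. ?r (c i) b * t ^ i) = 0}"
      using assms(2) by (auto simp: representation_zero)
    moreover have "finite {t. (\<Sum>i\<le>n. ?r (c i) b * t ^ i) = 0}"
      using polyfun_finite_roots[where c = "\<lambda>i. ?r (c i) b" and n = n] nz assms(3) by blast
    ultimately show False using assms(1) finite_subset by blast
  qed
  then have "(\<Sum>b | ?r (c k) b \<noteq> 0. scl (?r (c k) b) b) = 0" by simp
  moreover have "(\<Sum>b | ?r (c k) b \<noteq> 0. scl (?r (c k) b) b) = c k"
    by (rule sum_nonzero_representation_eq[OF independent_occ sp])
  ultimately show ?thesis by simp
qed

lemma infinite_nonzero: "infinite (- {0 :: complex})"
  by (simp add: infinite_UNIV_char_0 Compl_eq_Diff_UNIV)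

lemma polyv_zero: "polyv f \<Longrightarrow> (\<And>t. t \<noteq> 0 \<Longrightarrow> f t = 0) \<Longrightarrow> f t = 0"
proof -
  assume "polyv f" and z: "\<And>t. t \<noteq> 0 \<Longrightarrow> f t = 0"
  then obtain n c where f: "\<And>t. f t = (\<Sum>k\<le>n. scl (t ^ k) (c k))" unfolding polyv_def by blast
  have "c k = 0" if "k \<le> n" for k
  proof (rule vpoly_zero[OF infinite_nonzero _ that])
    fix t :: complex assume "t \<in> - {0}"
    then have "f t = 0" by (intro z) simp
    then show "(\<Sum>k\<le>n. scl (t ^ k) (c k)) = 0" by (simp only: f)
  qed
  then have "(\<Sum>k\<le>n. scl (t ^ k) (c k)) = 0" by simp
  then show "f t = 0" by (simp only: f)
qed

lemma polyv_eq: "polyv f \<Longrightarrow> polyv h \<Longrightarrow> (\<And>t. t \<noteq> 0 \<Longrightarrow> f t = h t) \<Longrightarrow> f t = h t"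
  using polyv_zero[OF polyv_diff, of f h t] by simp

subsection \<open>First-order coefficients\<close>

text \<open>A derivative at t = 0 in a space without topology: the remainder must be t^2 times a
  polynomial curve, which makes e unique.\<close>

definition has_d :: "(complex \<Rightarrow> 'v) \<Rightarrow> 'v \<Rightarrow> bool" where
  "has_d f e \<longleftrightarrow> (\<exists>r. polyv r \<and> (\<forall>t. f t = f 0 + scl t e + scl (t\<^sup>2) (r t)))"

lemma has_dI: "polyv r \<Longrightarrow> (\<And>t. f t = f 0 + scl t e + scl (t\<^sup>2) (r t)) \<Longrightarrow> has_d f e"
  unfolding has_d_def by (rule exI[of _ r], rule conjI, assumption, rule allI)

lemma has_d_polyv: "has_d f e \<Longrightarrow> polyv f"
proof -
  assume "has_d f e"
  then obtain r where r: "polyv r" "\<And>t. f t = f 0 + scl t e + scl (t\<^sup>2) (r t)" unfolding has_d_def by blast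
  have "polyv (\<lambda>t. f 0 + scl t e + scl t (scl t (r t)))"
    by (intro polyv_add polyv_times polyv_const r(1))
  moreover have "f = (\<lambda>t. f 0 + scl t e + scl t (scl t (r t)))"
    by (rule ext) (subst r(2), simp add: power2_eq_square)
  ultimately show ?thesis by simp
qed

lemma polyv_has_d: "polyv f \<Longrightarrow> \<exists>e. has_d f e"
proof -
  assume "polyv f"
  then obtain n c where f: "\<And>t. f t = (\<Sum>k\<le>n. scl (t ^ k) (c k))" unfolding polyv_def by blast
  define c' where "c' k = (if k \<le> n then c k else 0)" for k
  have f': "f t = (\<Sum>k\<le>n + 2. scl (t ^ k) (c' k))" for t
    unfolding f by (rule sum.mono_neutral_cong_left) (auto simp: c'_def)
  have split: "(\<Sum>k\<le>n + 2. scl (t ^ k) (c' k)) = c' 0 + scl t (c' 1) + scl (t\<^sup>2) (\<Sum>k\<le>n. scl (t ^ k) (c' (k + 2)))" for t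
    by (simp add: sum.atMost_Suc_shift scale_sum_right power2_eq_square mult.assoc add.assoc del: sum.atMost_Suc)
  have f0: "f 0 = c' 0" unfolding f' split by simp
  have "polyv (\<lambda>t. \<Sum>k\<le>n. scl (t ^ k) (c' (k + 2)))" by (intro polyv_sum polyv_power)
  moreover have "f t = c' 0 + scl t (c' 1) + scl (t\<^sup>2) (\<Sum>k\<le>n. scl (t ^ k) (c' (k + 2)))" for t
    by (simp only: f' split)
  ultimately show ?thesis unfolding has_d_def f0
    by (intro exI[of _ "c' 1"] exI[of _ "\<lambda>t. \<Sum>k\<le>n. scl (t ^ k) (c' (k + 2))"]) simp
qed

text \<open>Cancelling t leaves a polynomial curve that vanishes for t nonzero, hence also at t =
  0.\<close>

lemma has_d_unique: "has_d f e \<Longrightarrow> has_d f e' \<Longrightarrow> e = e'"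
proof -
  assume "has_d f e" "has_d f e'"
  then obtain r r' where r: "polyv r" "\<And>t. f t = f 0 + scl t e + scl (t\<^sup>2) (r t)"
    and r': "polyv r'" "\<And>t. f t = f 0 + scl t e' + scl (t\<^sup>2) (r' t)" unfolding has_d_def by blast
  have "(e - e') + scl t (r t - r' t) = 0" if "t \<noteq> 0" for t
  proof -
    have "f 0 + scl t e + scl (t\<^sup>2) (r t) = f 0 + scl t e' + scl (t\<^sup>2) (r' t)" using r(2) r'(2) by metis
    then have "scl t ((e - e') + scl t (r t - r' t)) = 0"
      by (simp add: scale_right_distrib scale_right_diff_distrib power2_eq_square algebra_simps)
    then show ?thesis using that by simp
  qed
  moreover have "polyv (\<lambda>t. (e - e') + scl t (r t - r' t))"
    by (intro polyv_add polyv_const polyv_times polyv_diff r(1) r'(1))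
  ultimately have "(e - e') + scl 0 (r 0 - r' 0) = 0" using polyv_zero[of "\<lambda>t. (e - e') + scl t (r t - r' t)" 0] by blast
  then show ?thesis by simp
qed

lemma has_d_affine: "has_d (\<lambda>t. a + scl t e) e"
  unfolding has_d_def by (rule exI[of _ "\<lambda>_. 0"]) (simp add: polyv_const)

lemma has_d_const: "has_d (\<lambda>t. a) 0"
  using has_d_affine[of a 0] by simp

lemma has_d_add: "has_d f e \<Longrightarrow> has_d h e' \<Longrightarrow> has_d (\<lambda>t. f t + h t) (e + e')"
proof -
  assume "has_d f e" "has_d h e'"
  then obtain r r' where r: "polyv r" "\<And>t. f t = f 0 + scl t e + scl (t\<^sup>2) (r t)"
    and r': "polyv r'" "\<And>t. h t = h 0 + scl t e' + scl (t\<^sup>2) (r' t)" unfolding has_d_def by blast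
  have "f t + h t = f 0 + h 0 + scl t (e + e') + scl (t\<^sup>2) (r t + r' t)" for t
    by (subst r(2), subst r'(2)) (simp add: scale_right_distrib algebra_simps)
  then show ?thesis by (rule has_dI[OF polyv_add[OF r(1) r'(1)]])
qed

lemma has_d_linear: "has_d f e \<Longrightarrow> Vector_Spaces.linear scl scl D \<Longrightarrow> has_d (\<lambda>t. D (f t)) (D e)"
proof -
  assume "has_d f e" and D: "Vector_Spaces.linear scl scl D"
  then obtain r where r: "polyv r" "\<And>t. f t = f 0 + scl t e + scl (t\<^sup>2) (r t)" unfolding has_d_def by blast
  interpret L: Vector_Spaces.linear scl scl D by (rule D)
  have "D (f t) = D (f 0) + scl t (D e) + scl (t\<^sup>2) (D (r t))" for t
    by (subst r(2)) (simp only: L.add L.scale)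
  then show ?thesis by (rule has_dI[OF polyv_linear[OF r(1) D]])
qed

lemma has_d_scl: "has_d f e \<Longrightarrow> has_d (\<lambda>t. scl a (f t)) (scl a e)"
  by (rule has_d_linear) (simp_all add: Vector_Spaces.linear_iff vector_space_axioms scale_right_distrib mult.commute)

lemma has_d_sum: "(\<And>i. i \<in> I \<Longrightarrow> has_d (f i) (e i)) \<Longrightarrow> has_d (\<lambda>t. \<Sum>i\<in>I. f i t) (\<Sum>i\<in>I. e i)"
  by (induction I rule: infinite_finite_induct) (simp_all add: has_d_const has_d_add)

lemma has_d_prd:
  assumes f: "has_d f e" and h: "has_d h e'"
  shows "has_d (\<lambda>t. prd m (f t) (h t)) (prd m e (h 0) + prd m (f 0) e')"
proof -
  from f h obtain r r' where r: "polyv r" "\<And>t. f t = f 0 + scl t e + scl (t\<^sup>2) (r t)"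
    and r': "polyv r'" "\<And>t. h t = h 0 + scl t e' + scl (t\<^sup>2) (r' t)" unfolding has_d_def by blast
  let ?R = "\<lambda>t. prd m (f 0) (r' t) + prd m e (e' + scl t (r' t)) + prd m (r t) (h t)"
  have R: "polyv ?R"
    by (intro polyv_add polyv_prd polyv_const polyv_times r(1) r'(1) has_d_polyv[OF h])
  have exp: "prd m (f t) (h t) = prd m (f 0) (h 0) + scl t (prd m e (h 0) + prd m (f 0) e') + scl (t\<^sup>2) (?R t)" for t
  proof -
    have "prd m (f t) (h t) = prd m (f 0) (h t) + scl t (prd m e (h t)) + scl (t\<^sup>2) (prd m (r t) (h t))"
      by (subst r(2)) (simp only: prd_add prd_scale)
    also have "prd m (f 0) (h t) = prd m (f 0) (h 0) + scl t (prd m (f 0) e') + scl (t\<^sup>2) (prd m (f 0) (r' t))"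
      by (subst r'(2)) (simp only: prd_add prd_scale)
    also have "prd m e (h t) = prd m e (h 0) + scl t (prd m e e') + scl (t\<^sup>2) (prd m e (r' t))"
      by (subst r'(2)) (simp only: prd_add prd_scale)
    finally show ?thesis
      by (simp add: prd_add prd_scale scale_right_distrib power2_eq_square algebra_simps)
  qed
  show ?thesis
    by (rule has_dI[of ?R "\<lambda>t. prd m (f t) (h t)" "prd m e (h 0) + prd m (f 0) e'", OF R exp])
qed

lemma power_shift_expansion: "\<exists>r. polyc r \<and> (\<forall>t. (s + t) ^ k = s ^ k + t * (of_nat k * s ^ (k - 1)) + t\<^sup>2 * r t)"
proof (induction k)
  case 0
  show ?case by (rule exI[of _ "\<lambda>_. 0"]) (simp add: polyc_const)
next
  case (Suc k)
  then obtain r n c where r: "\<And>t. (s + t) ^ k = s ^ k + t * (of_nat k * s ^ (k - 1)) + t\<^sup>2 * r t"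
    and c: "\<And>t. r t = (\<Sum>i\<le>n. c i * t ^ i)" unfolding polyc_def by blast
  let ?r = "\<lambda>t. of_nat k * s ^ (k - 1) + (s + t) * r t"
  define c' where "c' i = (if i = 0 then of_nat k * s ^ (k - 1) else 0) + (if i \<le> n then s * c i else 0) + (if i = 0 then 0 else c (i - 1))" for i
  have "?r t = (\<Sum>i\<le>Suc n. c' i * t ^ i)" for t
  proof -
    have "(\<Sum>i\<le>Suc n. c' i * t ^ i) = (\<Sum>i\<le>Suc n. (if i = 0 then of_nat k * s ^ (k - 1) else 0) * t ^ i)
        + (\<Sum>i\<le>Suc n. (if i \<le> n then s * c i else 0) * t ^ i) + (\<Sum>i\<le>Suc n. (if i = 0 then 0 else c (i - 1)) * t ^ i)"
      by (simp only: c'_def distrib_right sum.distrib)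
    also have "(\<Sum>i\<le>Suc n. (if i = 0 then of_nat k * s ^ (k - 1) else 0) * t ^ i) = of_nat k * s ^ (k - 1)"
      by (simp add: if_distrib[of "\<lambda>x. x * _"] cong: if_cong)
    also have "(\<Sum>i\<le>Suc n. (if i \<le> n then s * c i else 0) * t ^ i) = s * r t"
      by (simp add: c sum_distrib_left mult.assoc)
    also have "(\<Sum>i\<le>Suc n. (if i = 0 then 0 else c (i - 1)) * t ^ i) = t * r t"
      by (simp add: sum.atMost_Suc_shift c sum_distrib_left mult_ac del: sum.atMost_Suc)
    finally show ?thesis by (simp add: algebra_simps)
  qed
  then have "polyc ?r" unfolding polyc_def by (intro exI[of _ "Suc n"] exI[of _ c'] allI)
  moreover have "(s + t) ^ Suc k = s ^ Suc k + t * (of_nat (Suc k) * s ^ (Suc k - 1)) + t\<^sup>2 * ?r t" for t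
  proof (cases k)
    case 0
    then have "t * (t * r t) = 0" using r[of t] by (simp add: power2_eq_square)
    then have "(s + t) * (t * (t * r t)) = 0" by simp
    then show ?thesis using 0 by (simp add: algebra_simps power2_eq_square)
  next
    case (Suc j)
    have "(s + t) ^ Suc k = (s + t) * (s ^ k + t * (of_nat k * s ^ (k - 1)) + t\<^sup>2 * r t)"
      using r[of t] by simp
    then show ?thesis using Suc by (simp add: algebra_simps power2_eq_square)
  qed
  ultimately show ?case by (intro exI[of _ ?r] conjI allI)
qed

lemma has_d_shift: "has_d (\<lambda>t. scl ((s + t) ^ k) v) (scl (of_nat k * s ^ (k - 1)) v)"
proof -
  obtain r where r: "polyc r" "\<And>t. (s + t) ^ k = s ^ k + t * (of_nat k * s ^ (k - 1)) + t\<^sup>2 * r t"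
    using power_shift_expansion by blast
  have "scl ((s + t) ^ k) v = scl ((s + 0) ^ k) v + scl t (scl (of_nat k * s ^ (k - 1)) v) + scl (t\<^sup>2) (scl (r t) v)" for t
    unfolding r(2)[of t] by (simp only: scale_left_distrib scale_scale add_0_right)
  then show ?thesis by (rule has_dI[OF polyv_polyc[OF r(1)]])
qed

subsection \<open>Curves in the group\<close>

definition pcurve :: "(complex \<Rightarrow> complex^2^2) \<Rightarrow> bool" where
  "pcurve g \<longleftrightarrow> (\<forall>t. g t \<in> SL2) \<and> (\<forall>i j. polyc (\<lambda>t. g t $ i $ j))"

lemma rho_linear: "g \<in> SL2 \<Longrightarrow> Vector_Spaces.linear scl scl (\<rho> g)"
  using action_automorphism by (simp add: va_automorphism_def)

lemma rho_vac: "g \<in> SL2 \<Longrightarrow> \<rho> g vac = vac"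
  using action_automorphism by (simp add: va_automorphism_def)

lemma rho_prd: "g \<in> SL2 \<Longrightarrow> \<rho> g (prd n a b) = prd n (\<rho> g a) (\<rho> g b)"
  using action_automorphism by (simp add: va_automorphism_def)

lemma rho_lin: "g \<in> SL2 \<Longrightarrow> \<rho> g (a + b) = \<rho> g a + \<rho> g b" "g \<in> SL2 \<Longrightarrow> \<rho> g (scl k a) = scl k (\<rho> g a)" "g \<in> SL2 \<Longrightarrow> \<rho> g 0 = 0"
  using linear_facts[OF rho_linear] by auto

lemma generated_all:
  assumes "subspace U" "vac \<in> U" "\<And>n a b. a \<in> U \<Longrightarrow> b \<in> U \<Longrightarrow> prd n a b \<in> U" "\<And>u. \<phi> u \<in> U"
  shows "v \<in> U"
proof -
  have "U = UNIV" by (rule generated) (use assms in \<open>auto simp: vertex_subalgebra_def\<close>)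
  then show ?thesis by simp
qed

text \<open>The vectors with a polynomial orbit along g form a vertex subalgebra, and it contains
  the generators: in determinant 1 the entries of the inverse matrix are polynomial as well.\<close>

lemma pcurve_polyv:
  assumes g: "pcurve g"
  shows "polyv (\<lambda>t. \<rho> (g t) v)"
proof -
  have S: "g t \<in> SL2" and pc: "polyc (\<lambda>t. g t $ i $ j)" for t i j using g by (auto simp: pcurve_def)
  have pn: "polyv (\<lambda>t. scl (- (g t $ i $ j)) v)" for i j v
    using polyv_scl[OF polyv_polyc[OF pc], of "- 1"] by simp
  have "v \<in> {v. polyv (\<lambda>t. \<rho> (g t) v)}"
  proof (rule generated_all)
    show "subspace {v. polyv (\<lambda>t. \<rho> (g t) v)}"
      unfolding subspace_def by (auto simp: rho_lin[OF S] polyv_const polyv_add polyv_scl)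
    show "vac \<in> {v. polyv (\<lambda>t. \<rho> (g t) v)}" by (simp add: rho_vac[OF S] polyv_const)
    show "prd n a b \<in> {v. polyv (\<lambda>t. \<rho> (g t) v)}" if "a \<in> {v. polyv (\<lambda>t. \<rho> (g t) v)}" "b \<in> {v. polyv (\<lambda>t. \<rho> (g t) v)}" for n a b
      using that by (simp add: rho_prd[OF S] polyv_prd)
    show "\<phi> u \<in> {v. polyv (\<lambda>t. \<rho> (g t) v)}" for u
      using generator_cases8[of u]
      by (elim disjE) (simp_all add: action_B[OF S] action_X[OF S] action_C[OF S] action_Y[OF S] sum_2
          matrix_inv_SL2[OF S] polyv_add polyv_polyc[OF pc] pn del: scale_minus_left)
  qed
  then show ?thesis by simp
qed

lemma pcurve_ut: "pcurve ut" and pcurve_lt: "pcurve lt"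
proof -
  have c: "\<And>t. ut t $ 1 $ 1 = 1" "\<And>t. ut t $ 1 $ 2 = t" "\<And>t. ut t $ 2 $ 1 = 0" "\<And>t. ut t $ 2 $ 2 = 1"
    "\<And>t. lt t $ 1 $ 1 = 1" "\<And>t. lt t $ 1 $ 2 = 0" "\<And>t. lt t $ 2 $ 1 = t" "\<And>t. lt t $ 2 $ 2 = 1"
    by (simp_all add: ut_def lt_def)
  show "pcurve ut" "pcurve lt"
    unfolding pcurve_def forall_2 c by (simp_all add: curves_SL2 polyc_const polyc_ident)
qed

definition Dg :: "(complex \<Rightarrow> complex^2^2) \<Rightarrow> 'v \<Rightarrow> 'v" where
  "Dg g v = (THE e. has_d (\<lambda>t. \<rho> (g t) v) e)"

lemma Dg_eqI: "has_d (\<lambda>t. \<rho> (g t) v) e \<Longrightarrow> Dg g v = e"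
  unfolding Dg_def using has_d_unique by blast

lemma Dg_has_d: "pcurve g \<Longrightarrow> has_d (\<lambda>t. \<rho> (g t) v) (Dg g v)"
  using polyv_has_d[OF pcurve_polyv] Dg_eqI by metis

definition der :: "('v \<Rightarrow> 'v) \<Rightarrow> bool" where
  "der D \<longleftrightarrow> Vector_Spaces.linear scl scl D \<and> (\<forall>n a b. D (prd n a b) = prd n (D a) b + prd n a (D b))"

lemma derD: "der D \<Longrightarrow> D (prd n a b) = prd n (D a) b + prd n a (D b)"
  "der D \<Longrightarrow> D (a + b) = D a + D b" "der D \<Longrightarrow> D (scl k a) = scl k (D a)" "der D \<Longrightarrow> D 0 = 0"
  using linear_facts[of D] by (auto simp: der_def)

lemma derI:
  assumes "\<And>a b. D (a + b) = D a + D b" "\<And>k a. D (scl k a) = scl k (D a)"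
    "\<And>n a b. D (prd n a b) = prd n (D a) b + prd n a (D b)"
  shows "der D"
  using assms by (simp add: der_def Vector_Spaces.linear_iff vector_space_axioms)

lemma der_vac: "der D \<Longrightarrow> D vac = 0"
proof -
  assume D: "der D"
  have "D vac = D (prd (- 1) vac vac)" by (simp add: vac_left)
  also have "\<dots> = D vac + D vac" unfolding derD(1)[OF D] by (simp add: vac_left vac_right)
  finally show ?thesis by simp
qed

text \<open>Two derivations agree on a vertex subalgebra, so relations between derivations need to
  be checked on the generators only.\<close>

lemma der_eq:
  assumes D: "der D" "der D'" and e: "\<And>u. D (\<phi> u) = D' (\<phi> u)"
  shows "D v = D' v"
proof -
  have "v \<in> {v. D v = D' v}"
    by (rule generated_all) (auto simp: subspace_def derD[OF D(1)] derD[OF D(2)] der_vac[OF D(1)] der_vac[OF D(2)] e)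
  then show ?thesis by simp
qed

lemma der_commutator: "der D \<Longrightarrow> der D' \<Longrightarrow> der (\<lambda>v. D (D' v) - D' (D v))"
  by (rule derI) (simp_all add: derD prd_diff prd_add scale_right_diff_distrib algebra_simps)

lemma der_scl: "der D \<Longrightarrow> der (\<lambda>v. scl k (D v))"
  by (rule derI) (simp_all add: derD prd_scale scale_right_distrib mult.commute)

lemma der_Dg:
  assumes g: "pcurve g" and g0: "g 0 = mat 1"
  shows "der (Dg g)"
proof (rule derI)
  have S: "g t \<in> SL2" for t using g by (auto simp: pcurve_def)
  note d = Dg_has_d[OF g]
  show "Dg g (a + b) = Dg g a + Dg g b" for a b
    by (rule Dg_eqI) (use has_d_add[OF d d] in \<open>simp add: rho_lin[OF S]\<close>)
  show "Dg g (scl k a) = scl k (Dg g a)" for k a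
    by (rule Dg_eqI) (use has_d_scl[OF d] in \<open>simp add: rho_lin[OF S]\<close>)
  show "Dg g (prd n a b) = prd n (Dg g a) b + prd n a (Dg g b)" for n a b
  proof (rule Dg_eqI)
    have "has_d (\<lambda>t. prd n (\<rho> (g t) a) (\<rho> (g t) b)) (prd n (Dg g a) (\<rho> (g 0) b) + prd n (\<rho> (g 0) a) (Dg g b))"
      by (rule has_d_prd[OF d d])
    then show "has_d (\<lambda>t. \<rho> (g t) (prd n a b)) (prd n (Dg g a) b + prd n a (Dg g b))"
      by (simp only: rho_prd[OF S] g0 action_one)
  qed
qed

lemma Dg_fixed: "v \<in> fixed_points \<rho> \<Longrightarrow> pcurve g \<Longrightarrow> Dg g v = 0"
  by (rule Dg_eqI) (simp add: fixed_points_def pcurve_def has_d_const)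

definition Ev :: "'v \<Rightarrow> 'v" where "Ev = Dg ut"
definition Fv :: "'v \<Rightarrow> 'v" where "Fv = Dg lt"
text \<open>Defined as a commutator, so that one relation of sl_2 holds by definition;
  \<open>HE\<close> and \<open>HF\<close> are then checked on generators.\<close>

definition Hv :: "'v \<Rightarrow> 'v" where "Hv v = Ev (Fv v) - Fv (Ev v)"

lemma ut_0: "ut 0 = mat 1" "lt 0 = mat 1" by (simp_all add: ut_def lt_def mat2_one)

lemma der_E: "der Ev" and der_F: "der Fv"
  unfolding Ev_def Fv_def by (rule der_Dg[OF pcurve_ut ut_0(1)] der_Dg[OF pcurve_lt ut_0(2)])+

lemma der_H: "der Hv"
  unfolding Hv_def[abs_def] by (rule der_commutator[OF der_E der_F])

lemma ut_nth: "ut t $ 1 $ 1 = 1" "ut t $ 1 $ 2 = t" "ut t $ 2 $ 1 = 0" "ut t $ 2 $ 2 = 1"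
  and lt_nth: "lt t $ 1 $ 1 = 1" "lt t $ 1 $ 2 = 0" "lt t $ 2 $ 1 = t" "lt t $ 2 $ 2 = 1"
  by (simp_all add: ut_def lt_def)

lemma E_gen: "Ev (\<phi> (B 1)) = 0" "Ev (\<phi> (B 2)) = \<phi> (B 1)" "Ev (\<phi> (C 1)) = - \<phi> (C 2)" "Ev (\<phi> (C 2)) = 0"
  "Ev (\<phi> (X 1)) = 0" "Ev (\<phi> (X 2)) = \<phi> (X 1)" "Ev (\<phi> (Y 1)) = - \<phi> (Y 2)" "Ev (\<phi> (Y 2)) = 0"
  unfolding Ev_def
  by (rule Dg_eqI; use has_d_affine[of "\<phi> (B 2)" "\<phi> (B 1)"] has_d_affine[of "\<phi> (C 1)" "- \<phi> (C 2)"]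
      has_d_affine[of "\<phi> (X 2)" "\<phi> (X 1)"] has_d_affine[of "\<phi> (Y 1)" "- \<phi> (Y 2)"] in
      \<open>simp add: action_B action_C action_X action_Y curves_SL2 sum_2 matrix_inv_SL2 ut_nth has_d_const add.commute\<close>)+

lemma F_gen: "Fv (\<phi> (B 1)) = \<phi> (B 2)" "Fv (\<phi> (B 2)) = 0" "Fv (\<phi> (C 1)) = 0" "Fv (\<phi> (C 2)) = - \<phi> (C 1)"
  "Fv (\<phi> (X 1)) = \<phi> (X 2)" "Fv (\<phi> (X 2)) = 0" "Fv (\<phi> (Y 1)) = 0" "Fv (\<phi> (Y 2)) = - \<phi> (Y 1)"
  unfolding Fv_def
  by (rule Dg_eqI; use has_d_affine[of "\<phi> (B 1)" "\<phi> (B 2)"] has_d_affine[of "\<phi> (C 2)" "- \<phi> (C 1)"]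
      has_d_affine[of "\<phi> (X 1)" "\<phi> (X 2)"] has_d_affine[of "\<phi> (Y 2)" "- \<phi> (Y 1)"] in
      \<open>simp add: action_B action_C action_X action_Y curves_SL2 sum_2 matrix_inv_SL2 lt_nth has_d_const add.commute\<close>)+

lemma der_uminus: "der D \<Longrightarrow> D (- a) = - D a"
  using derD(3)[of D "- 1" a] by simp

lemma H_gen: "Hv (\<phi> g) = scl (of_int (gen_weight g)) (\<phi> g)"
  using generator_cases8[of g]
  by (elim disjE) (simp_all add: Hv_def E_gen F_gen derD(4)[OF der_E] derD(4)[OF der_F] der_uminus[OF der_E] der_uminus[OF der_F])

lemma HE: "Hv (Ev v) = Ev (Hv v) + scl 2 (Ev v)"
proof -
  have "Hv (Ev v) - Ev (Hv v) = scl 2 (Ev v)"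
  proof (rule der_eq[OF der_commutator[OF der_H der_E] der_scl[OF der_E]])
    show "Hv (Ev (\<phi> u)) - Ev (Hv (\<phi> u)) = scl 2 (Ev (\<phi> u))" for u
    proof -
      have two: "scl 2 a = a + a" for a using scale_left_distrib[of 1 1 a] by simp
      show ?thesis using generator_cases8[of u]
        by (elim disjE) (simp_all add: E_gen H_gen derD(3,4)[OF der_H] derD(3,4)[OF der_E] der_uminus[OF der_H] der_uminus[OF der_E] two)
    qed
  qed
  then show ?thesis by (simp add: algebra_simps)
qed

lemma HF: "Hv (Fv v) = Fv (Hv v) - scl 2 (Fv v)"
proof -
  have "Hv (Fv v) - Fv (Hv v) = scl (- 2) (Fv v)"
  proof (rule der_eq[OF der_commutator[OF der_H der_F] der_scl[OF der_F]])
    show "Hv (Fv (\<phi> u)) - Fv (Hv (\<phi> u)) = scl (- 2) (Fv (\<phi> u))" for u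
    proof -
      have two: "scl 2 a = a + a" for a using scale_left_distrib[of 1 1 a] by simp
      show ?thesis using generator_cases8[of u]
        by (elim disjE) (simp_all add: F_gen H_gen derD(3,4)[OF der_H] derD(3,4)[OF der_F] der_uminus[OF der_H] der_uminus[OF der_F] two)
    qed
  qed
  then show ?thesis by (simp add: algebra_simps)
qed

lemma H_mono: "Hv (mono M) = scl (of_int (occ_weight M)) (mono M)"
proof -
  have "Hv (mono M) = scl (\<Sum>i\<in>#M. of_int (gen_weight (fst i))) (mono M)"
  proof (rule op_mono[of Hv])
    show "Hv vac = 0" by (rule der_vac[OF der_H])
    show "Hv (cre i v) = cre i (Hv v) + scl (of_int (gen_weight (fst i))) (cre i v)" for i v
      by (simp add: cre_def derD(1)[OF der_H] H_gen prd_scale)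
  qed
  also have "(\<Sum>i\<in>#M. of_int (gen_weight (fst i))) = (of_int (occ_weight M) :: complex)"
    unfolding occ_weight_def by (induction M) simp_all
  finally show ?thesis .
qed

lemma E_modes: "Ev (prd n om v) = prd n om (Ev v)" "Ev (prd n Jv v) = prd n Jv (Ev v)"
proof -
  have "Ev om = 0" "Ev Jv = 0"
    unfolding Ev_def by (rule Dg_fixed[OF conformal_vector_fixed pcurve_ut] Dg_fixed[OF heisenberg_vector_fixed pcurve_ut])+
  then show "Ev (prd n om v) = prd n om (Ev v)" "Ev (prd n Jv v) = prd n Jv (Ev v)"
    by (simp_all add: derD(1)[OF der_E] linear_facts(3)[OF linear_left])
qed

lemma dt_gen: "s \<noteq> 0 \<Longrightarrow> \<rho> (dt s) (\<phi> g) = scl (s powi gen_weight g) (\<phi> g)"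
proof -
  assume s: "s \<noteq> 0"
  have n: "dt s $ 1 $ 1 = s" "dt s $ 1 $ 2 = 0" "dt s $ 2 $ 1 = 0" "dt s $ 2 $ 2 = inverse s"
    by (simp_all add: dt_def)
  show ?thesis using generator_cases8[of g]
    by (elim disjE) (simp_all add: action_B action_C action_X action_Y curves_SL2 s sum_2 matrix_inv_SL2 n power_int_minus)
qed

lemma dt_mono: "s \<noteq> 0 \<Longrightarrow> \<rho> (dt s) (mono M) = scl (s powi occ_weight M) (mono M)"
proof -
  assume s: "s \<noteq> 0"
  have "\<rho> (dt s) (vec ws) = scl (s powi occ_weight (mset ws)) (vec ws)" for ws
  proof (induction ws)
    case (Cons i ws)
    then show ?case
      using s by (simp add: cre_def rho_prd curves_SL2 dt_gen prd_scale occ_weight_def power_int_add)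
  qed (simp add: rho_vac curves_SL2 s occ_weight_def)
  then show ?thesis using mono_eq[of M] by metis
qed

text \<open>Compare the coefficients of \<open>s\<close> in \<open>\<rho> (ut (t + s)) v = \<rho> (ut t) (\<rho> (ut s) v)\<close>.\<close>

lemma E_zero_fixed:
  assumes "Ev v = 0"
  shows "\<rho> (ut t) v = v"
proof -
  obtain n c where f: "\<And>t. \<rho> (ut t) v = (\<Sum>k\<le>n. scl (t ^ k) (c k))"
    using pcurve_polyv[OF pcurve_ut, of v] unfolding polyv_def by blast
  have add: "ut s ** ut t = ut (s + t)" for s t by (simp add: ut_def mat2_mult add.commute)
  have hd: "has_d (\<lambda>t. \<rho> (ut t) v) 0" using Dg_has_d[OF pcurve_ut, of v] assms by (simp add: Ev_def)
  have z: "(\<Sum>k\<le>n. scl (of_nat k * s ^ (k - 1)) (c k)) = 0" for s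
  proof -
    have "has_d (\<lambda>t. \<rho> (ut s) (\<rho> (ut t) v)) (\<rho> (ut s) 0)"
      by (rule has_d_linear[OF hd rho_linear]) (rule curves_SL2)
    moreover have "\<rho> (ut s) (\<rho> (ut t) v) = (\<Sum>k\<le>n. scl ((s + t) ^ k) (c k))" for t
    proof -
      have "\<rho> (ut s) (\<rho> (ut t) v) = \<rho> (ut (s + t)) v"
        by (simp only: action_mult[OF curves_SL2(1) curves_SL2(1), symmetric] add)
      then show ?thesis by (simp only: f)
    qed
    ultimately have z0: "has_d (\<lambda>t. \<Sum>k\<le>n. scl ((s + t) ^ k) (c k)) 0" by (simp add: rho_lin curves_SL2)
    have "has_d (\<lambda>t. \<Sum>k\<le>n. scl ((s + t) ^ k) (c k)) (\<Sum>k\<le>n. scl (of_nat k * s ^ (k - 1)) (c k))"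
      by (intro has_d_sum has_d_shift)
    from has_d_unique[OF this z0] show ?thesis .
  qed
  have c0: "c k = 0" if k: "k \<le> n" "k \<noteq> 0" for k
  proof -
    have z': "(\<Sum>k\<le>n. scl (s ^ k) (scl (of_nat k) (c k))) = 0" for s
    proof -
      have "scl s (scl (of_nat k * s ^ (k - 1)) (c k)) = scl (s ^ k) (scl (of_nat k) (c k))" for k
        by (cases k) (simp_all add: mult_ac)
      then have "(\<Sum>k\<le>n. scl (s ^ k) (scl (of_nat k) (c k))) = scl s (\<Sum>k\<le>n. scl (of_nat k * s ^ (k - 1)) (c k))"
        by (simp only: scale_sum_right)
      then show ?thesis by (simp only: z scale_zero_right)
    qed
    have "scl (of_nat k) (c k) = 0"
      by (rule vpoly_zero[OF infinite_nonzero _ k(1)]) (rule z')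
    then show ?thesis using k(2) by simp
  qed
  have "\<rho> (ut t) v = c 0" for t
  proof -
    have "(\<Sum>k\<le>n. scl (t ^ k) (c k)) = (\<Sum>k\<in>{0}. scl (t ^ k) (c k))"
      by (rule sum.mono_neutral_right) (use c0 in auto)
    then show ?thesis by (simp add: f)
  qed
  from this[of t] this[of 0] show ?thesis by (simp add: ut_0 action_one)
qed

lemma E_fixed_zero: "(\<And>t. \<rho> (ut t) v = v) \<Longrightarrow> Ev v = 0"
  unfolding Ev_def by (rule Dg_eqI) (simp add: has_d_const)

section \<open>Highest weight vectors\<close>

lemma F_modes: "Fv (prd n om v) = prd n om (Fv v)" "Fv (prd n Jv v) = prd n Jv (Fv v)"
proof -
  have "Fv om = 0" "Fv Jv = 0"
    unfolding Fv_def by (rule Dg_fixed[OF conformal_vector_fixed pcurve_lt] Dg_fixed[OF heisenberg_vector_fixed pcurve_lt])+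
  then show "Fv (prd n om v) = prd n om (Fv v)" "Fv (prd n Jv v) = prd n Jv (Fv v)"
    by (simp_all add: derD(1)[OF der_F] linear_facts(3)[OF linear_left])
qed

text \<open>Joint eigenspaces of L_0, J_0 and H, where \<open>k\<close> is the pair of conformal
  weight and charge. They are finite-dimensional by \<open>W_span\<close> and
  \<open>finite_Idx\<close>, which makes a dimension count possible.\<close>

definition W :: "real \<times> int \<Rightarrow> int \<Rightarrow> 'v set" where
  "W k w = {v. prd 1 om v = scl (of_real (fst k)) v \<and> prd 0 Jv v = scl (of_int (snd k)) v \<and> Hv v = scl (of_int w) v}"

definition Idx :: "real \<times> int \<Rightarrow> int \<Rightarrow> fock_mode multiset set" where
  "Idx k w = {M \<in> occ. (occ_wt M, occ_charge M) = k \<and> occ_weight M = w}"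

lemma W_subspace: "subspace (W k w)"
  unfolding subspace_def W_def
  by (auto simp: linear_facts[OF linear_right] derD[OF der_H] scale_right_distrib mult.commute)

lemma mono_W: "M \<in> Idx k w \<Longrightarrow> mono M \<in> W k w"
  by (auto simp: Idx_def W_def om_mono Jv_mono H_mono)

lemma W_E: "v \<in> W k w \<Longrightarrow> Ev v \<in> W k (w + 2)"
  unfolding W_def
  by (auto simp: HE E_modes[symmetric] derD(3)[OF der_E] scale_left_distrib)

lemma W_F: "v \<in> W k w \<Longrightarrow> Fv v \<in> W k (w - 2)"
  unfolding W_def
  by (auto simp: HF F_modes[symmetric] derD(3)[OF der_F] scale_left_diff_distrib)

lemma W_indep:
  assumes T: "finite T" and x: "\<And>t. t \<in> T \<Longrightarrow> x t \<in> W (fst t) (snd t)" and s: "(\<Sum>t\<in>T. x t) = 0" and t: "t \<in> T"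
  shows "x t = 0"
proof (rule eigen_independent[where T = T and Op = "\<lambda>i::nat. if i = 0 then prd 1 om else if i = 1 then prd 0 Jv else Hv"
      and ev = "\<lambda>t i. if i = 0 then of_real (fst (fst t)) else if i = 1 then of_int (snd (fst t)) else of_int (snd t)"])
  show "Vector_Spaces.linear scl scl (if i = 0 then prd 1 om else if i = 1 then prd 0 Jv else Hv)" for i :: nat
    using linear_right der_H by (auto simp: der_def)
  show "(if i = 0 then prd 1 om else if i = 1 then prd 0 Jv else Hv) (x t)
      = scl (if i = 0 then of_real (fst (fst t)) else if i = 1 then of_int (snd (fst t)) else of_int (snd t)) (x t)"
    if "t \<in> T" for t and i :: nat
    using x[OF that] by (auto simp: W_def)
  show "\<exists>i::nat. (if i = 0 then of_real (fst (fst s)) else if i = 1 then of_int (snd (fst s)) else of_int (snd s) :: complex)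
      \<noteq> (if i = 0 then of_real (fst (fst t)) else if i = 1 then of_int (snd (fst t)) else of_int (snd t))"
    if "s \<noteq> t" for s t :: "(real \<times> int) \<times> int"
  proof -
    from that consider "fst (fst s) \<noteq> fst (fst t)" | "snd (fst s) \<noteq> snd (fst t)" | "snd s \<noteq> snd t"
      by (metis prod.expand)
    then show ?thesis
      by cases (rule exI[of _ 0], simp, rule exI[of _ 1], simp, rule exI[of _ 2], simp)
  qed
qed (use T s t in auto)

lemma W_decomp:
  "\<exists>T x. finite T \<and> (\<forall>t. x t \<in> span (mono ` Idx (fst t) (snd t))) \<and> v = (\<Sum>t\<in>T. x t)"
proof -
  have "v \<in> span (mono ` occ)" by (simp add: span_mono)
  then obtain S r where S: "finite S" "S \<subseteq> mono ` occ" and v: "v = (\<Sum>a\<in>S. scl (r a) a)"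
    unfolding span_explicit by blast
  obtain S' where S': "S' \<subseteq> occ" "S = mono ` S'" using S(2) by (meson subset_imageE)
  have inj: "inj_on mono S'" using mono_inj S'(1) inj_on_subset by blast
  then have fin: "finite S'" using S(1) S'(2) finite_imageD by blast
  have v': "v = (\<Sum>M\<in>S'. scl (r (mono M)) (mono M))" unfolding v S'(2) by (simp add: sum.reindex[OF inj])
  let ?key = "\<lambda>M. ((occ_wt M, occ_charge M), occ_weight M)"
  let ?x = "\<lambda>t. \<Sum>M\<in>{M \<in> S'. ?key M = t}. scl (r (mono M)) (mono M)"
  show ?thesis
  proof (rule exI[of _ "?key ` S'"], rule exI[of _ ?x], intro conjI allI)
    show "finite (?key ` S')" using fin by simp
    show "v = (\<Sum>t\<in>?key ` S'. ?x t)" unfolding v' by (rule sum.image_gen[OF fin])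
    show "?x t \<in> span (mono ` Idx (fst t) (snd t))" for t
      by (intro span_sum span_scale span_base imageI) (use S'(1) in \<open>auto simp: Idx_def\<close>)
  qed
qed

lemma span_Idx_W: "span (mono ` Idx k w) \<subseteq> W k w"
  by (rule span_minimal[OF _ W_subspace]) (rule image_subsetI, rule mono_W)

lemma W_span: "W k w = span (mono ` Idx k w)"
proof
  show "W k w \<subseteq> span (mono ` Idx k w)"
  proof
    fix v assume v: "v \<in> W k w"
    obtain T x where T: "finite T" "\<And>t. x t \<in> span (mono ` Idx (fst t) (snd t))" and s: "v = (\<Sum>t\<in>T. x t)"
      using W_decomp[of v] by (elim exE conjE) (rule that, assumption, erule spec, assumption)
    let ?t = "(k, w)"
    \<comment> \<open>The components of v, with v itself subtracted at its own label. They sum to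
      zero, so independence makes the entry at \<open>?t\<close> vanish: v is its component
      there.\<close>
    let ?z = "\<lambda>s. (if s \<in> T then x s else 0) - (if s = ?t then v else 0)"
    have "?z ?t = 0"
    proof (rule W_indep[of "insert ?t T" ?z ?t])
      show "?z s \<in> W (fst s) (snd s)" if "s \<in> insert ?t T" for s
      proof (rule subspace_diff[OF W_subspace])
        show "(if s \<in> T then x s else 0) \<in> W (fst s) (snd s)"
          using subsetD[OF span_Idx_W T(2)[of s]] subspace_0[OF W_subspace[of "fst s" "snd s"]] by (cases "s \<in> T") simp_all
        show "(if s = ?t then v else 0) \<in> W (fst s) (snd s)"
          using v subspace_0[OF W_subspace] by auto
      qed
      have "(\<Sum>s\<in>insert ?t T. if s \<in> T then x s else 0) = v"
        unfolding s by (rule sum.mono_neutral_cong_right) (use T(1) in auto)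
      moreover have "(\<Sum>s\<in>insert ?t T. if s = ?t then v else 0) = v"
        using T(1) by simp
      ultimately show "(\<Sum>s\<in>insert ?t T. ?z s) = 0" unfolding sum_subtractf by simp
    qed (use T(1) in auto)
    then show "v \<in> span (mono ` Idx k w)"
      using T(2)[of ?t] span_zero by (simp split: if_splits)
  qed
qed (rule span_Idx_W)

text \<open>A mode has torus weight at most 1 and conformal weight at least 1/2. As E raises the
  torus weight and keeps the conformal weight, it is locally nilpotent.\<close>

lemma Idx_bound:
  assumes "M \<in> Idx k w"
  shows "of_int w \<le> 2 * fst k"
proof -
  have "of_int (occ_weight M) \<le> 2 * occ_wt M"
    unfolding occ_weight_def occ_wt_def
  proof (induction M)
    case (add i M)
    have "of_int (gen_weight (fst i)) \<le> 2 * mode_wt i"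
      by (cases i; cases "fst i") (auto)
    then show ?case using add by simp
  qed simp
  then show ?thesis using assms by (auto simp: Idx_def)
qed

lemma W_zero: "2 * fst k < of_int w \<Longrightarrow> v \<in> W k w \<Longrightarrow> v = 0"
proof -
  assume w: "2 * fst k < of_int w" and v: "v \<in> W k w"
  have "Idx k w = {}" using Idx_bound w by fastforce
  then show "v = 0" using v by (simp add: W_span)
qed

text \<open>An infinite set would put infinitely many equal nonzero terms into the convergent trace
  at \<tau> = i, y = 1.\<close>

lemma finite_Idx: "finite (Idx k w)"
proof (rule ccontr)
  assume inf: "infinite (Idx k w)"
  interpret n: nome \<i> by unfold_locales simp
  let ?f = "\<lambda>M. qpow \<i> (occ_wt M) * 1 powi occ_charge M"
  have "(?f has_sum n.A w 1) {M \<in> occ. occ_weight M = w}" by (rule n.A_has_sum) simp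
  then have "?f summable_on Idx k w"
    by (rule summable_on_subset_banach[OF has_sum_imp_summable]) (auto simp: Idx_def)
  then have "(\<lambda>M. qpow \<i> (fst k)) summable_on Idx k w"
    by (rule summable_on_cong[THEN iffD1, rotated]) (auto simp: Idx_def)
  then have "bdd_above (sum (\<lambda>M. norm (qpow \<i> (fst k))) ` {F. F \<subseteq> Idx k w \<and> finite F})"
    unfolding summable_on_iff_abs_summable_on_complex abs_summable_iff_bdd_above .
  then obtain b where b: "\<And>F. F \<subseteq> Idx k w \<Longrightarrow> finite F \<Longrightarrow> of_nat (card F) * norm (qpow \<i> (fst k)) \<le> b"
    unfolding bdd_above_def by auto
  have pos: "norm (qpow \<i> (fst k)) > 0" by (simp add: qpow_def)
  obtain n :: nat where n: "b < of_nat n * norm (qpow \<i> (fst k))"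
    using reals_Archimedean3[OF pos] by blast
  obtain F where "finite F" "card F = n" "F \<subseteq> Idx k w" using infinite_arbitrarily_large[OF inf] by blast
  then show False using b[of F] n by simp
qed

text \<open>The usual commutation of E with powers of F, without assuming that E kills v. The
  truncated \<open>j - 1\<close> at j = 0 comes with the factor 0.\<close>

lemma sl2_EF: "Hv v = scl (of_int w) v \<Longrightarrow>
  Hv ((Fv ^^ j) v) = scl (of_int w - 2 * of_nat j) ((Fv ^^ j) v) \<and>
  Ev ((Fv ^^ j) v) = (Fv ^^ j) (Ev v) + scl (of_nat j * (of_int w - of_nat j + 1)) ((Fv ^^ (j - 1)) v)"
proof (induction j)
  case (Suc j)
  then have h: "Hv ((Fv ^^ j) v) = scl (of_int w - 2 * of_nat j) ((Fv ^^ j) v)"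
    and e: "Ev ((Fv ^^ j) v) = (Fv ^^ j) (Ev v) + scl (of_nat j * (of_int w - of_nat j + 1)) ((Fv ^^ (j - 1)) v)" by auto
  have H: "Hv ((Fv ^^ Suc j) v) = scl (of_int w - 2 * of_nat (Suc j)) ((Fv ^^ Suc j) v)"
  proof -
    have "Hv ((Fv ^^ Suc j) v) = scl (of_int w - 2 * of_nat j) ((Fv ^^ Suc j) v) - scl 2 ((Fv ^^ Suc j) v)"
      by (simp add: HF h derD(3)[OF der_F])
    also have "\<dots> = scl (of_int w - 2 * of_nat (Suc j)) ((Fv ^^ Suc j) v)"
      unfolding scale_left_diff_distrib[symmetric] by (rule arg_cong2[of _ _ _ _ scl]) (simp_all add: algebra_simps)
    finally show ?thesis .
  qed
  have "Ev (Fv u) = Fv (Ev u) + Hv u" for u by (simp add: Hv_def)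
  then have "Ev ((Fv ^^ Suc j) v) = Fv (Ev ((Fv ^^ j) v)) + Hv ((Fv ^^ j) v)" by simp
  also have "Fv (Ev ((Fv ^^ j) v)) = (Fv ^^ Suc j) (Ev v) + scl (of_nat j * (of_int w - of_nat j + 1)) ((Fv ^^ j) v)"
  proof -
    have "scl (of_nat j * c) (Fv ((Fv ^^ (j - 1)) v)) = scl (of_nat j * c) ((Fv ^^ j) v)" for c
      by (cases j) simp_all
    then show ?thesis by (simp only: e derD(2)[OF der_F] derD(3)[OF der_F] funpow.simps o_apply)
  qed
  finally have "Ev ((Fv ^^ Suc j) v) = (Fv ^^ Suc j) (Ev v)
      + (scl (of_nat j * (of_int w - of_nat j + 1)) ((Fv ^^ j) v) + scl (of_int w - 2 * of_nat j) ((Fv ^^ j) v))"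
    unfolding h by (simp add: add.assoc)
  also have "scl (of_nat j * (of_int w - of_nat j + 1)) ((Fv ^^ j) v) + scl (of_int w - 2 * of_nat j) ((Fv ^^ j) v)
      = scl (of_nat (Suc j) * (of_int w - of_nat (Suc j) + 1)) ((Fv ^^ (Suc j - 1)) v)"
    unfolding scale_left_distrib[symmetric] by (rule arg_cong2[of _ _ _ _ scl]) (simp_all add: algebra_simps)
  finally show ?case using H by simp
qed simp

lemma W_E_pow: "v \<in> W k w \<Longrightarrow> (Ev ^^ j) v \<in> W k (w + 2 * int j)"
proof (induction j)
  case (Suc j)
  then show ?case using W_E[of "(Ev ^^ j) v" k "w + 2 * int j"] by (simp add: algebra_simps)
qed simp

lemma W_F_pow: "v \<in> W k w \<Longrightarrow> (Fv ^^ j) v \<in> W k (w - 2 * int j)"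
proof (induction j)
  case (Suc j)
  then show ?case using W_F[of "(Fv ^^ j) v" k "w - 2 * int j"] by (simp add: algebra_simps)
qed simp

text \<open>On E^j u, of weight w + 2j, \<open>sl2_EF\<close> gives E F^(j+1) E^j u = F^(j+1)
  E^(j+1) u + (j+1)(w+j) F^j E^j u, with nonzero coefficient as w >= 1. So membership of F^j E^j u
  in the image descends from large j, where E^j u = 0, to j = 0.\<close>

lemma E_surj:
  assumes u: "u \<in> W k w" and w: "w \<ge> 1"
  shows "u \<in> Ev ` W k (w - 2)"
proof -
  let ?im = "Ev ` W k (w - 2)"
  have sub: "subspace ?im"
  proof -
    interpret L: Vector_Spaces.linear scl scl Ev using der_E by (simp add: der_def)
    show ?thesis by (rule L.subspace_image[OF W_subspace])
  qed
  have step: "(Fv ^^ j) ((Ev ^^ j) u) \<in> ?im \<Longrightarrow> u \<in> ?im" for j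
  proof (induction j)
    case (Suc j)
    let ?v = "(Ev ^^ j) u"
    have v: "?v \<in> W k (w + 2 * int j)" by (rule W_E_pow[OF u])
    then have h: "Hv ?v = scl (of_int (w + 2 * int j)) ?v" by (simp add: W_def)
    have p: "(Fv ^^ Suc j) ?v \<in> W k (w - 2)" using W_F_pow[OF v, of "Suc j"] by (simp add: algebra_simps)
    let ?a = "of_nat (Suc j) * (of_int (w + 2 * int j) - of_nat (Suc j) + 1) :: complex"
    have a: "?a \<noteq> 0"
    proof -
      have "?a = of_int (int (Suc j) * (w + int j))" by (simp add: algebra_simps)
      moreover have "int (Suc j) * (w + int j) \<noteq> 0" using w by simp
      ultimately show ?thesis using of_int_eq_0_iff by metis
    qed
    have "Ev ((Fv ^^ Suc j) ?v) = (Fv ^^ Suc j) (Ev ?v) + scl ?a ((Fv ^^ j) ?v)"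
      using sl2_EF[OF h, of "Suc j"] by simp
    then have "scl ?a ((Fv ^^ j) ?v) = Ev ((Fv ^^ Suc j) ?v) - (Fv ^^ Suc j) ((Ev ^^ Suc j) u)" by simp
    also have "\<dots> \<in> ?im" by (intro subspace_diff[OF sub] imageI p Suc.prems)
    finally have "scl (inverse ?a) (scl ?a ((Fv ^^ j) ?v)) \<in> ?im" by (rule subspace_scale[OF sub])
    moreover have "scl (inverse ?a) (scl ?a ((Fv ^^ j) ?v)) = (Fv ^^ j) ?v"
      unfolding scale_scale left_inverse[OF a] by simp
    ultimately have "(Fv ^^ j) ?v \<in> ?im" by simp
    then show ?case by (rule Suc.IH)
  qed simp
  obtain J :: nat where J: "2 * fst k - of_int w < real J" using reals_Archimedean2 by blast
  have "(Ev ^^ J) u = 0" by (rule W_zero[OF _ W_E_pow[OF u]]) (use J in simp)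
  moreover have "(Fv ^^ n) 0 = 0" for n by (induction n) (simp_all add: derD(4)[OF der_F])
  ultimately have "(Fv ^^ J) ((Ev ^^ J) u) = 0" by simp
  then have "(Fv ^^ J) ((Ev ^^ J) u) \<in> ?im" using subspace_0[OF sub] by simp
  then show ?thesis by (rule step)
qed


section \<open>Bases of highest weight vectors\<close>

definition K :: "nat \<Rightarrow> real \<times> int \<Rightarrow> 'v set" where
  "K N k = {v \<in> W k (int N). Ev v = 0}"

definition HW :: "nat \<Rightarrow> 'v set" where
  "HW N = {v. Hv v = scl (of_nat N) v \<and> Ev v = 0}"

lemma K_subspace: "subspace (K N k)"
  using W_subspace[of k "int N"] unfolding subspace_def K_def
  by (simp add: derD(2,3,4)[OF der_E])

lemma HW_subspace: "subspace (HW N)"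
  unfolding subspace_def HW_def
  by (simp add: derD(2,3,4)[OF der_E] derD(2,3,4)[OF der_H] scale_right_distrib mult.commute)

lemma K_HW: "K N k \<subseteq> HW N"
  by (auto simp: K_def HW_def W_def)

definition hwb :: "nat \<Rightarrow> real \<times> int \<Rightarrow> 'v set" where
  "hwb N k = (SOME S. S \<subseteq> K N k \<and> independent S \<and> K N k \<subseteq> span S)"

lemma hwb: "hwb N k \<subseteq> K N k" "independent (hwb N k)" "span (hwb N k) = K N k"
proof -
  have "\<exists>S. S \<subseteq> K N k \<and> independent S \<and> K N k \<subseteq> span S"
    using maximal_independent_subset[of "K N k"] by metis
  then have h: "hwb N k \<subseteq> K N k \<and> independent (hwb N k) \<and> K N k \<subseteq> span (hwb N k)"
    unfolding hwb_def by (rule someI_ex)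
  then show "hwb N k \<subseteq> K N k" "independent (hwb N k)" by simp_all
  show "span (hwb N k) = K N k" using h span_minimal[OF _ K_subspace] by (simp add: subset_antisym)
qed

lemma finite_hwb: "finite (hwb N k)"
proof -
  have "hwb N k \<subseteq> span (mono ` Idx k (int N))" using hwb(1)[of N k] unfolding W_span[symmetric] K_def by blast
  then show ?thesis using independent_span_bound[OF _ hwb(2)] finite_Idx by blast
qed

lemma independent_scalars:
  "independent S \<Longrightarrow> finite F \<Longrightarrow> F \<subseteq> S \<Longrightarrow> (\<Sum>b\<in>F. scl (c b) b) = 0 \<Longrightarrow> b \<in> F \<Longrightarrow> c b = 0"
  unfolding dependent_explicit by blast

lemma Idx_occ: "Idx k w \<subseteq> occ"
  by (auto simp: Idx_def)

lemma span_image_sum: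
  assumes "finite I" "v \<in> span (f ` I)"
  obtains c where "v = (\<Sum>i\<in>I. scl (c i) (f i))"
proof -
  have "\<exists>c. v = (\<Sum>i\<in>I. scl (c i) (f i))" using assms
  proof (induction I arbitrary: v rule: finite_induct)
    case (insert i I)
    then obtain k where "v - scl k (f i) \<in> span (f ` I)" unfolding image_insert span_insert by blast
    then obtain c where c: "v - scl k (f i) = (\<Sum>i\<in>I. scl (c i) (f i))" using insert.IH by blast
    have "v = (\<Sum>j\<in>insert i I. scl ((c(i := k)) j) (f j))"
    proof -
      have "(\<Sum>j\<in>I. scl ((c(i := k)) j) (f j)) = (\<Sum>i\<in>I. scl (c i) (f i))"
        using insert.hyps by (intro sum.cong) auto
      then show ?thesis using insert.hyps c by (simp add: algebra_simps)
    qed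
    then show ?case by blast
  qed simp
  then show ?thesis using that by blast
qed

text \<open>Rank and nullity of E from weight N onto weight N + 2: a basis of the kernel together
  with preimages of the monomials of weight N + 2 is a basis of weight N.\<close>

lemma card_Idx: "card (Idx k (int N)) = card (hwb N k) + card (Idx k (int N + 2))"
proof -
  let ?I = "Idx k (int N + 2)"
  have "\<exists>p \<in> W k (int N). Ev p = mono M" if "M \<in> ?I" for M
    using E_surj[OF mono_W[OF that]] by (auto simp: image_iff)
  then obtain p where p: "\<And>M. M \<in> ?I \<Longrightarrow> p M \<in> W k (int N)" and Ep: "\<And>M. M \<in> ?I \<Longrightarrow> Ev (p M) = mono M"
    by metis
  interpret L: Vector_Spaces.linear scl scl Ev using der_E by (simp add: der_def)
  have inj: "inj_on p ?I"
    by (rule inj_onI) (metis Ep Idx_occ inj_onD mono_inj subsetD)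
  have disj: "hwb N k \<inter> p ` ?I = {}"
  proof -
    have "p M \<notin> hwb N k" if "M \<in> ?I" for M
    proof
      assume "p M \<in> hwb N k"
      then have "mono M = 0" using subsetD[OF hwb(1)[of N k]] Ep[OF that] unfolding K_def by simp
      then show False using mono_nonzero[of M] subsetD[OF Idx_occ that] by simp
    qed
    then show ?thesis by blast
  qed
  let ?B = "hwb N k \<union> p ` ?I"
  have split: "(\<Sum>x\<in>?B. scl (f x) x) = (\<Sum>x\<in>hwb N k. scl (f x) x) + (\<Sum>M\<in>?I. scl (f (p M)) (p M))" for f
    using sum.union_disjoint[OF finite_hwb finite_imageI[OF finite_Idx] disj] by (simp add: sum.reindex[OF inj])
  have Eh: "Ev x = 0" if "x \<in> hwb N k" for x using hwb(1)[of N k] that by (auto simp: K_def)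
  have ind: "independent ?B"
  proof (rule independent_if_scalars_zero)
    show "finite ?B" by (simp add: finite_hwb finite_Idx)
    fix f x assume z: "(\<Sum>x\<in>?B. scl (f x) x) = 0" and x: "x \<in> ?B"
    have "Ev (\<Sum>x\<in>?B. scl (f x) x) = (\<Sum>M\<in>?I. scl (f (p M)) (mono M))"
      unfolding split L.add L.sum L.scale by (simp add: Eh Ep)
    then have "(\<Sum>M\<in>?I. scl (f (p M)) (mono M)) = 0" using z by (simp add: L.zero)
    then have fp: "f (p M) = 0" if "M \<in> ?I" for M
      by (rule mono_coeff_zero[OF finite_Idx Idx_occ _ that])
    then have "(\<Sum>x\<in>hwb N k. scl (f x) x) = 0" using z unfolding split by simp
    then have "f x = 0" if "x \<in> hwb N k" for x
      by (rule independent_scalars[OF hwb(2) finite_hwb subset_refl _ that])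
    then show "f x = 0" using fp x by blast
  qed
  have "span ?B = W k (int N)"
  proof (rule subset_antisym)
    show "span ?B \<subseteq> W k (int N)"
      by (rule span_minimal[OF _ W_subspace]) (use hwb(1)[of N k] p in \<open>auto simp: K_def\<close>)
    show "W k (int N) \<subseteq> span ?B"
    proof
      fix v assume v: "v \<in> W k (int N)"
      then have "Ev v \<in> span (mono ` ?I)" using W_E unfolding W_span[symmetric] by blast
      then obtain c where c: "Ev v = (\<Sum>M\<in>?I. scl (c M) (mono M))" using span_image_sum[OF finite_Idx] by metis
      let ?u = "\<Sum>M\<in>?I. scl (c M) (p M)"
      have "Ev ?u = Ev v" unfolding c L.sum L.scale by (simp add: Ep)
      then have "Ev (v - ?u) = 0" by (simp add: L.diff)
      moreover have "v - ?u \<in> W k (int N)"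
        by (intro subspace_diff[OF W_subspace] subspace_sum[OF W_subspace] subspace_scale[OF W_subspace] v p)
      ultimately have "v - ?u \<in> span (hwb N k)" unfolding hwb(3) K_def by simp
      then have "v - ?u \<in> span ?B" using Modules.module.span_mono[OF module_axioms, of "hwb N k" ?B] by blast
      moreover have "?u \<in> span ?B" by (intro span_sum span_scale span_base) simp
      ultimately have "v - ?u + ?u \<in> span ?B" by (rule span_add)
      then show "v \<in> span ?B" by simp
    qed
  qed
  then have "dim (W k (int N)) = card ?B" using dim_span_eq_card_independent[OF ind] by simp
  moreover have "dim (W k (int N)) = card (mono ` Idx k (int N))"
    unfolding W_span by (rule dim_span_eq_card_independent[OF mono_independent[OF Idx_occ]])
  moreover have "card (mono ` Idx k (int N)) = card (Idx k (int N))"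
    by (rule card_image) (rule inj_on_subset[OF mono_inj Idx_occ])
  moreover have "card ?B = card (hwb N k) + card ?I"
    using card_Un_disjoint[OF finite_hwb finite_imageI[OF finite_Idx] disj] card_image[OF inj] by simp
  ultimately show ?thesis by simp
qed

definition HB :: "nat \<Rightarrow> 'v set" where "HB N = (\<Union>k. hwb N k)"
definition hkey :: "nat \<Rightarrow> 'v \<Rightarrow> real \<times> int" where "hkey N v = (SOME k. v \<in> hwb N k)"

lemma W_key_unique: "v \<in> W k w \<Longrightarrow> v \<in> W k' w \<Longrightarrow> v \<noteq> 0 \<Longrightarrow> k = k'"
proof -
  assume v: "v \<in> W k w" "v \<in> W k' w" "v \<noteq> 0"
  then have "scl (of_real (fst k)) v = scl (of_real (fst k')) v" "scl (of_int (snd k)) v = scl (of_int (snd k')) v"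
    unfolding W_def by (metis (mono_tags, lifting) mem_Collect_eq)+
  then have "fst k = fst k'" "snd k = snd k'" using v(3) by (simp_all add: scale_cancel_right)
  then show ?thesis by (simp add: prod_eq_iff)
qed

lemma hwb_nonzero: "v \<in> hwb N k \<Longrightarrow> v \<noteq> 0"
  using hwb(2)[of N k] dependent_zero by metis

lemma hkey: "v \<in> hwb N k \<Longrightarrow> hkey N v = k"
proof -
  assume v: "v \<in> hwb N k"
  then have "v \<in> hwb N (hkey N v)" unfolding hkey_def by (rule someI)
  then show ?thesis using v hwb(1) W_key_unique[OF _ _ hwb_nonzero[OF v]] unfolding K_def by blast
qed

lemma HB_hkey: "v \<in> HB N \<Longrightarrow> v \<in> hwb N (hkey N v)"
  unfolding HB_def by (auto simp: hkey)

lemma HB_eigen: "v \<in> HB N \<Longrightarrow> prd 1 om v = scl (of_real (fst (hkey N v))) v \<and> prd 0 Jv v = scl (of_int (snd (hkey N v))) v"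
  using HB_hkey hwb(1) unfolding K_def W_def by blast

lemma HB_independent: "independent (HB N)"
  unfolding dependent_explicit
proof (intro notI, elim exE conjE bexE)
  fix F c v assume F: "finite F" "F \<subseteq> HB N" and s: "(\<Sum>v\<in>F. scl (c v) v) = 0" and v: "v \<in> F" "c v \<noteq> 0"
  let ?x = "\<lambda>t. \<Sum>u\<in>{u \<in> F. (hkey N u, int N) = t}. scl (c u) u"
  let ?t = "(hkey N v, int N)"
  have "?x ?t = 0"
  proof (rule W_indep[of "(\<lambda>u. (hkey N u, int N)) ` F" ?x ?t])
    show "?x t \<in> W (fst t) (snd t)" for t
    proof (intro subspace_sum[OF W_subspace] subspace_scale[OF W_subspace])
      fix u assume "u \<in> {u \<in> F. (hkey N u, int N) = t}"
      then have "u \<in> HB N" "t = (hkey N u, int N)" using F(2) by auto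
      then show "u \<in> W (fst t) (snd t)"
        using subsetD[OF hwb(1)[of N "hkey N u"] HB_hkey[of u N]] unfolding K_def by simp
    qed
    show "(\<Sum>t\<in>(\<lambda>u. (hkey N u, int N)) ` F. ?x t) = 0"
      using s sum.image_gen[OF F(1), of "\<lambda>v. scl (c v) v" "\<lambda>u. (hkey N u, int N)"] by simp
  qed (use F v in auto)
  moreover have "{u \<in> F. (hkey N u, int N) = ?t} \<subseteq> hwb N (hkey N v)"
    using subsetD[OF F(2)] HB_hkey by force
  ultimately have "c v = 0"
    using F v by (intro independent_scalars[OF hwb(2)[of N "hkey N v"], of "{u \<in> F. (hkey N u, int N) = ?t}"]) simp_all
  then show False using v by simp
qed

text \<open>The homogeneous components of a highest weight vector are again such: H acts on each
  component by the eigenvalue of its label, and E moves distinct labels to distinct labels. In both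
  relations the components therefore vanish separately.\<close>

lemma HB_span: "span (HB N) = HW N"
proof (rule subset_antisym)
  have "HB N \<subseteq> HW N" using hwb(1) K_HW unfolding HB_def by blast
  then show "span (HB N) \<subseteq> HW N" by (rule span_minimal[OF _ HW_subspace])
  show "HW N \<subseteq> span (HB N)"
  proof
    fix v assume "v \<in> HW N"
    then have v: "Hv v = scl (of_nat N) v" "Ev v = 0" by (auto simp: HW_def)
    obtain T x where T: "finite T" and x: "\<And>t. x t \<in> span (mono ` Idx (fst t) (snd t))" and s: "v = (\<Sum>t\<in>T. x t)"
      using W_decomp[of v] by (elim exE conjE) (rule that, assumption, erule spec, assumption)
    interpret L: Vector_Spaces.linear scl scl Ev using der_E by (simp add: der_def)
    interpret H: Vector_Spaces.linear scl scl Hv using der_H by (simp add: der_def)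
    have xW: "x t \<in> W (fst t) (snd t)" for t using x[of t] by (simp only: W_span)
    have xN: "x t = 0" if t: "t \<in> T" "snd t \<noteq> int N" for t
    proof -
      have "scl (of_int (snd t) - of_nat N) (x t) = 0"
      proof (rule W_indep[of T "\<lambda>t. scl (of_int (snd t) - of_nat N) (x t)", OF T _ _ t(1)])
        show "scl (of_int (snd t) - of_nat N) (x t) \<in> W (fst t) (snd t)" for t
          by (rule subspace_scale[OF W_subspace xW])
        have "Hv (x t) = scl (of_int (snd t)) (x t)" for t using xW[of t] by (simp add: W_def)
        then have "(\<Sum>t\<in>T. scl (of_int (snd t) - of_nat N) (x t)) = Hv v - scl (of_nat N) v"
          by (simp add: s H.sum scale_left_diff_distrib sum_subtractf scale_sum_right)
        then show "(\<Sum>t\<in>T. scl (of_int (snd t) - of_nat N) (x t)) = 0" using v by simp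
      qed
      moreover have "(of_int (snd t) - of_nat N :: complex) \<noteq> 0" using t(2) by (metis eq_iff_diff_eq_0 of_int_eq_iff of_int_of_nat_eq)
      ultimately show ?thesis by simp
    qed
    have xE: "Ev (x t) = 0" if t: "t \<in> T" for t
    proof -
      let ?sh = "\<lambda>t :: (real \<times> int) \<times> int. (fst t, snd t + 2)"
      let ?un = "\<lambda>t :: (real \<times> int) \<times> int. (fst t, snd t - 2)"
      have inj: "inj_on ?sh T" by (rule inj_onI) (simp add: prod_eq_iff)
      have "Ev (x (?un (?sh t))) = 0"
      proof (rule W_indep[of "?sh ` T" "\<lambda>t. Ev (x (?un t))" "?sh t"])
        show "Ev (x (?un t)) \<in> W (fst t) (snd t)" for t using W_E[OF xW[of "?un t"]] by simp
        show "(\<Sum>t\<in>?sh ` T. Ev (x (?un t))) = 0"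
          using v(2) unfolding s by (simp add: sum.reindex[OF inj] L.sum)
      qed (use T t in auto)
      then show ?thesis by simp
    qed
    have "x t \<in> span (HB N)" if t: "t \<in> T" for t
    proof (cases "snd t = int N")
      case True
      have "x t \<in> K N (fst t)" using xW[of t] xE[OF t] True by (simp add: K_def)
      then have "x t \<in> span (hwb N (fst t))" by (simp only: hwb(3))
      then show ?thesis using Modules.module.span_mono[OF module_axioms, of "hwb N (fst t)" "HB N"] unfolding HB_def by blast
    next
      case False
      then show ?thesis using xN[OF t] span_zero by simp
    qed
    then show "v \<in> span (HB N)" unfolding s by (rule span_sum)
  qed
qed

text \<open>The dimension count for every k, as a bijection of index sets that preserves weight and
  charge. It lets the infinite sums over \<open>HB N\<close> and over the monomials of weights N and
  N + 2 be compared by reindexing.\<close>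

lemma key_bijection:
  "\<exists>h. bij_betw h (Inl ` HB N \<union> Inr ` {M \<in> occ. occ_weight M = int N + 2}) {M \<in> occ. occ_weight M = int N}
    \<and> (\<forall>v\<in>HB N. (occ_wt (h (Inl v)), occ_charge (h (Inl v))) = hkey N v)
    \<and> (\<forall>M\<in>occ. occ_weight M = int N + 2 \<longrightarrow> (occ_wt (h (Inr M)), occ_charge (h (Inr M))) = (occ_wt M, occ_charge M))"
proof -
  let ?D = "\<lambda>k. Inl ` hwb N k \<union> Inr ` Idx k (int N + 2) :: ('v + fock_mode multiset) set"
  have "\<exists>h. bij_betw h (?D k) (Idx k (int N))" for k
  proof (rule finite_same_card_bij)
    show "finite (?D k)" by (simp add: finite_hwb finite_Idx)
    have "card (?D k) = card (hwb N k) + card (Idx k (int N + 2))"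
      by (subst card_Un_disjoint) (auto simp: finite_hwb finite_Idx card_image)
    then show "card (?D k) = card (Idx k (int N))" by (simp add: card_Idx)
  qed (rule finite_Idx)
  then obtain h where h: "\<And>k. bij_betw (h k) (?D k) (Idx k (int N))" by metis
  define key where "key x = (case x of Inl v \<Rightarrow> hkey N v | Inr M \<Rightarrow> (occ_wt M, occ_charge M))" for x :: "'v + fock_mode multiset"
  have key: "key x = k" if "x \<in> ?D k" for x k
    using that by (auto simp: key_def hkey Idx_def)
  let ?h = "\<lambda>x. h (key x) x"
  have b: "bij_betw ?h (?D k) (Idx k (int N))" for k
  proof -
    have "bij_betw ?h (?D k) (Idx k (int N)) \<longleftrightarrow> bij_betw (h k) (?D k) (Idx k (int N))"
      by (rule bij_betw_cong) (simp only: key)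
    then show ?thesis using h by simp
  qed
  have "bij_betw ?h (\<Union>k\<in>UNIV. ?D k) (\<Union>k\<in>UNIV. Idx k (int N))"
    by (rule bij_betw_UNION_disjoint[OF _ b]) (auto simp: disjoint_family_on_def Idx_def)
  moreover have "(\<Union>k\<in>UNIV. ?D k) = Inl ` HB N \<union> Inr ` {M \<in> occ. occ_weight M = int N + 2}"
    by (auto simp: HB_def Idx_def)
  moreover have "(\<Union>k\<in>UNIV. Idx k (int N)) = {M \<in> occ. occ_weight M = int N}"
    by (auto simp: Idx_def)
  moreover have kk: "(occ_wt (?h x), occ_charge (?h x)) = k" if "x \<in> ?D k" for x k
    using bij_betwE[OF b, of k] that by (auto simp: Idx_def)
  have "(occ_wt (?h (Inl v)), occ_charge (?h (Inl v))) = hkey N v" if "v \<in> HB N" for v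
    by (rule kk) (use HB_hkey[OF that] in simp)
  moreover have "(occ_wt (?h (Inr M)), occ_charge (?h (Inr M))) = (occ_wt M, occ_charge M)"
    if "M \<in> occ" "occ_weight M = int N + 2" for M
    by (rule kk) (use that in \<open>simp add: Idx_def\<close>)
  ultimately show ?thesis by (intro exI[of _ ?h]) simp
qed

lemma HB_has_sum:
  assumes "Im \<tau> > 0" "y \<noteq> 0"
  shows "((\<lambda>v. qpow \<tau> (fst (hkey N v)) * y powi snd (hkey N v)) has_sum
    nome.A \<tau> (int N) y - nome.A \<tau> (int N + 2) y) (HB N)"
proof -
  interpret n: nome \<tau> by unfold_locales (rule assms)
  let ?f = "\<lambda>M. qpow \<tau> (occ_wt M) * y powi occ_charge M"
  let ?P = "{M \<in> occ. occ_weight M = int N + 2}"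
  obtain h where h: "bij_betw h (Inl ` HB N \<union> Inr ` ?P) {M \<in> occ. occ_weight M = int N}"
    and hl: "\<forall>v\<in>HB N. (occ_wt (h (Inl v)), occ_charge (h (Inl v))) = hkey N v"
    and hr: "\<forall>M\<in>occ. occ_weight M = int N + 2 \<longrightarrow> (occ_wt (h (Inr M)), occ_charge (h (Inr M))) = (occ_wt M, occ_charge M)"
    using key_bijection[of N] by (elim exE conjE) (rule that)
  have all: "((\<lambda>x. ?f (h x)) has_sum n.A (int N) y) (Inl ` HB N \<union> Inr ` ?P)"
    unfolding has_sum_reindex_bij_betw[OF h, of ?f] by (rule n.A_has_sum[OF assms(2)])
  have "((\<lambda>M. ?f (h (Inr M))) has_sum n.A (int N + 2) y) ?P"
    using n.A_has_sum[OF assms(2), of "int N + 2"] by (rule has_sum_cong[THEN iffD1, rotated]) (use hr in simp)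
  then have "((\<lambda>x. ?f (h x)) has_sum n.A (int N + 2) y) (Inr ` ?P)"
    by (subst has_sum_reindex) (simp_all add: o_def)
  with all have "((\<lambda>x. ?f (h x)) has_sum n.A (int N) y - n.A (int N + 2) y) (Inl ` HB N \<union> Inr ` ?P - Inr ` ?P)"
    by (rule has_sum_Diff) blast
  moreover have "Inl ` HB N \<union> Inr ` ?P - Inr ` ?P = Inl ` HB N" by blast
  ultimately have "((\<lambda>v. ?f (h (Inl v))) has_sum n.A (int N) y - n.A (int N + 2) y) (HB N)"
    by (simp add: has_sum_reindex o_def)
  then show ?thesis
    by (rule has_sum_cong[THEN iffD1, rotated]) (use hl in \<open>auto simp: prod_eq_iff\<close>)
qed

end

section \<open>Binary forms and the multiplicity spaces\<close>

definition bmon :: "nat \<Rightarrow> nat \<Rightarrow> complex^2 \<Rightarrow> complex" where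
  "bmon N k = (\<lambda>z. (z $ 1) ^ k * (z $ 2) ^ (N - k))"

definition form :: "nat \<Rightarrow> (nat \<Rightarrow> complex) \<Rightarrow> complex^2 \<Rightarrow> complex" where
  "form N p = (\<lambda>z. \<Sum>k\<le>N. p k * bmon N k z)"

lemma form_add: "(\<lambda>z. form N p z + form N r z) = form N (\<lambda>k. p k + r k)"
  by (simp add: form_def fun_eq_iff sum.distrib distrib_right)

lemma form_scale: "(\<lambda>z. c * form N p z) = form N (\<lambda>k. c * p k)"
  by (simp add: form_def fun_eq_iff sum_distrib_left mult.assoc)

lemma form_bmon: "k \<le> N \<Longrightarrow> bmon N k = form N (\<lambda>i. if i = k then 1 else 0)"
  by (simp add: form_def fun_eq_iff if_distrib[of "\<lambda>x. x * _"] cong: if_cong)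

lemma form_zero: "form N (\<lambda>_. 0) = 0"
  by (simp add: form_def fun_eq_iff)

lemma binary_forms_eq: "binary_forms N = range (form N)"
proof -
  interpret fm: module "\<lambda>c (f :: complex^2 \<Rightarrow> complex) z. c * f z"
    by unfold_locales (simp_all add: fun_eq_iff algebra_simps)
  have gen: "{\<lambda>z. (z $ 1) ^ k * (z $ 2) ^ (N - k) | k. k \<le> N} = {bmon N k | k. k \<le> N}" by (simp add: bmon_def)
  have plus: "f + g = (\<lambda>z. f z + g z)" for f g :: "complex^2 \<Rightarrow> complex" by (simp add: fun_eq_iff)
  show ?thesis
    unfolding binary_forms_def gen
  proof (rule subset_antisym)
    show "fm.span {bmon N k | k. k \<le> N} \<subseteq> range (form N)"
    proof (rule fm.span_minimal)
      show "{bmon N k | k. k \<le> N} \<subseteq> range (form N)" using form_bmon by blast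
      show "fm.subspace (range (form N))"
      proof (rule fm.subspaceI)
        show "0 \<in> range (form N)" using rangeI[of "form N" "\<lambda>_. 0"] by (simp only: form_zero)
        show "f + g \<in> range (form N)" if "f \<in> range (form N)" "g \<in> range (form N)" for f g
          using that by (auto simp: plus form_add)
        show "(\<lambda>z. c * f z) \<in> range (form N)" if "f \<in> range (form N)" for c f
          using that by (auto simp: form_scale)
      qed
    qed
    show "range (form N) \<subseteq> fm.span {bmon N k | k. k \<le> N}"
    proof (rule image_subsetI)
      fix p
      have "(\<Sum>k\<le>N. (\<lambda>z. p k * bmon N k z)) \<in> fm.span {bmon N k | k. k \<le> N}"
        by (intro fm.span_sum fm.span_scale fm.span_base) blast
      moreover have "(\<Sum>k\<le>N. (\<lambda>z. p k * bmon N k z)) = form N p"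
      proof -
        have "(\<Sum>k\<in>I. (\<lambda>z. p k * bmon N k z)) z = (\<Sum>k\<in>I. p k * bmon N k z)" for I z
          by (induction I rule: infinite_finite_induct) simp_all
        then show ?thesis by (simp add: form_def fun_eq_iff)
      qed
      ultimately show "form N p \<in> fm.span {bmon N k | k. k \<le> N}" by simp
    qed
  qed
qed

lemma form_coeff: "form N p = form N r \<Longrightarrow> k \<le> N \<Longrightarrow> p k = r k"
proof -
  assume e: "form N p = form N r" and k: "k \<le> N"
  have "(\<Sum>i\<le>N. p i * t ^ i) = (\<Sum>i\<le>N. r i * t ^ i)" for t
    using fun_cong[OF e, of "\<chi> i. if i = 1 then t else 1"] by (simp add: form_def bmon_def)
  then show ?thesis using k polyfun_eq_coeffs[of p N r] by blast
qed

text \<open>The choice is determined only at k <= N; larger indices do not enter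
  \<open>form\<close>.\<close>

definition fcoef :: "nat \<Rightarrow> (complex^2 \<Rightarrow> complex) \<Rightarrow> nat \<Rightarrow> complex" where
  "fcoef N f = (SOME p. f = form N p)"

lemma fcoef_form: "k \<le> N \<Longrightarrow> fcoef N (form N p) k = p k"
proof -
  assume k: "k \<le> N"
  have "form N p = form N (fcoef N (form N p))" unfolding fcoef_def by (rule someI[of _ p]) simp
  from form_coeff[OF this k] show ?thesis by simp
qed

lemma form_fst: "(\<lambda>z. z $ 1 * form N p z) = form (Suc N) (\<lambda>k. if k = 0 then 0 else p (k - 1))"
proof
  fix z :: "complex^2"
  show "z $ 1 * form N p z = form (Suc N) (\<lambda>k. if k = 0 then 0 else p (k - 1)) z"
    unfolding form_def sum.atMost_Suc_shift by (simp add: bmon_def sum_distrib_left mult_ac)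
qed

lemma form_snd: "(\<lambda>z. z $ 2 * form N p z) = form (Suc N) (\<lambda>k. if k \<le> N then p k else 0)"
proof
  fix z :: "complex^2"
  have "(\<Sum>k\<le>N. z $ 2 * (p k * bmon N k z)) = (\<Sum>k\<le>N. (if k \<le> N then p k else 0) * bmon (Suc N) k z)"
    by (rule sum.cong) (auto simp: bmon_def Suc_diff_le)
  then show "z $ 2 * form N p z = form (Suc N) (\<lambda>k. if k \<le> N then p k else 0) z"
    by (simp add: form_def sum_distrib_left)
qed

lemma BF_add: "f \<in> binary_forms N \<Longrightarrow> g \<in> binary_forms N \<Longrightarrow> (\<lambda>z. f z + g z) \<in> binary_forms N"
  unfolding binary_forms_eq by (auto simp: form_add)

lemma BF_scale: "f \<in> binary_forms N \<Longrightarrow> (\<lambda>z. c * f z) \<in> binary_forms N"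
  unfolding binary_forms_eq by (auto simp: form_scale)

lemma BF_linear_mult: "f \<in> binary_forms N \<Longrightarrow> (\<lambda>z. (a * z $ 1 + b * z $ 2) * f z) \<in> binary_forms (Suc N)"
proof -
  assume f: "f \<in> binary_forms N"
  then have "(\<lambda>z. z $ 1 * f z) \<in> binary_forms (Suc N)" "(\<lambda>z. z $ 2 * f z) \<in> binary_forms (Suc N)"
    unfolding binary_forms_eq by (auto simp: form_fst form_snd)
  then have "(\<lambda>z. a * (z $ 1 * f z) + b * (z $ 2 * f z)) \<in> binary_forms (Suc N)"
    by (intro BF_add BF_scale)
  then show ?thesis by (simp add: algebra_simps)
qed

lemma BF_prod: "(\<lambda>z. (a * z $ 1 + b * z $ 2) ^ i * (c * z $ 1 + d * z $ 2) ^ j) \<in> binary_forms (i + j)"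
proof (induction i)
  case 0
  show ?case
  proof (induction j)
    case 0
    have "(\<lambda>z. 1) = form 0 (\<lambda>_. 1)" by (simp add: form_def bmon_def)
    then show ?case unfolding binary_forms_eq by auto
  next
    case (Suc j)
    then show ?case using BF_linear_mult[of "\<lambda>z. (c * z $ 1 + d * z $ 2) ^ j" j c d] by simp
  qed
next
  case (Suc i)
  then show ?case
    using BF_linear_mult[OF Suc.IH, of a b] by (simp add: mult.assoc)
qed

lemma form_action_SL2:
  assumes "g \<in> SL2"
  shows "form_action g f = (\<lambda>z. f (\<chi> i. if i = 1 then g $ 2 $ 2 * z $ 1 - g $ 1 $ 2 * z $ 2 else g $ 1 $ 1 * z $ 2 - g $ 2 $ 1 * z $ 1))"
proof -
  have "matrix_inv g *v z = (\<chi> i. if i = 1 then g $ 2 $ 2 * z $ 1 - g $ 1 $ 2 * z $ 2 else g $ 1 $ 1 * z $ 2 - g $ 2 $ 1 * z $ 1)" for z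
    by (simp add: vec_eq_iff forall_2 matrix_vector_mult_def sum_2 matrix_inv_SL2[OF assms])
  then show ?thesis by (simp add: form_action_def)
qed

lemma BF_sum: "finite I \<Longrightarrow> (\<And>i. i \<in> I \<Longrightarrow> f i \<in> binary_forms N) \<Longrightarrow> (\<lambda>z. \<Sum>i\<in>I. f i z) \<in> binary_forms N"
proof (induction I rule: finite_induct)
  case empty
  have "(\<lambda>z. 0) \<in> range (form N)" by (rule range_eqI[of _ _ "\<lambda>_. 0"]) (simp add: form_zero zero_fun_def)
  then show ?case by (simp add: binary_forms_eq)
qed (simp add: BF_add)

lemma BF_form_action: "g \<in> SL2 \<Longrightarrow> f \<in> binary_forms N \<Longrightarrow> form_action g f \<in> binary_forms N"
proof -
  assume g: "g \<in> SL2" and "f \<in> binary_forms N"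
  then obtain p where p: "f = form N p" by (auto simp: binary_forms_eq)
  have e: "form_action g f = (\<lambda>z. \<Sum>k\<le>N. p k * ((g $ 2 $ 2 * z $ 1 + (- g $ 1 $ 2) * z $ 2) ^ k * ((- g $ 2 $ 1) * z $ 1 + g $ 1 $ 1 * z $ 2) ^ (N - k)))"
    unfolding form_action_SL2[OF g] p form_def bmon_def by (simp add: fun_eq_iff)
  have "(\<lambda>z. (g $ 2 $ 2 * z $ 1 + (- g $ 1 $ 2) * z $ 2) ^ k * ((- g $ 2 $ 1) * z $ 1 + g $ 1 $ 1 * z $ 2) ^ (N - k)) \<in> binary_forms N"
    if "k \<le> N" for k
    using BF_prod[of "g $ 2 $ 2" "- g $ 1 $ 2" k "- g $ 2 $ 1" "g $ 1 $ 1" "N - k"] that by simp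
  then have B: "(\<lambda>z. \<Sum>k\<le>N. p k * ((g $ 2 $ 2 * z $ 1 + (- g $ 1 $ 2) * z $ 2) ^ k * ((- g $ 2 $ 1) * z $ 1 + g $ 1 $ 1 * z $ 2) ^ (N - k))) \<in> binary_forms N"
    by (intro BF_sum BF_scale) simp_all
  show ?thesis unfolding e by (rule B)
qed

lemma form_action_mult:
  assumes "g \<in> SL2" "h \<in> SL2"
  shows "form_action (g ** h) f = form_action g (form_action h f)"
  unfolding form_action_SL2[OF SL2_mult[OF assms]] form_action_SL2[OF assms(1)] form_action_SL2[OF assms(2)]
  by (intro ext arg_cong[of _ _ f])
    (simp add: vec_eq_iff forall_2 matrix_matrix_mult_def sum_2 algebra_simps)

text \<open>\<open>pform N 1 0\<close> is a highest weight vector of the irreducible representation,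
  and its image under g depends only on the first column (a, c) of g. These powers of linear forms
  span all binary forms, which \<open>flin_eqI\<close> exploits.\<close>

definition pform :: "nat \<Rightarrow> complex \<Rightarrow> complex \<Rightarrow> complex^2 \<Rightarrow> complex" where
  "pform N a c = (\<lambda>z. (a * z $ 2 - c * z $ 1) ^ N)"

lemma pform_form: "pform N a c = form N (\<lambda>k. of_nat (N choose k) * (- 1) ^ k * (a ^ (N - k) * c ^ k))"
proof
  fix z :: "complex^2"
  have "pform N a c z = (- c * z $ 1 + a * z $ 2) ^ N" by (simp add: pform_def)
  also have "\<dots> = (\<Sum>k\<le>N. of_nat (N choose k) * (- c * z $ 1) ^ k * (a * z $ 2) ^ (N - k))"
    by (rule binomial_ring)
  also have "\<dots> = form N (\<lambda>k. of_nat (N choose k) * (- 1) ^ k * (a ^ (N - k) * c ^ k)) z"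
    unfolding form_def bmon_def
    by (intro sum.cong refl) (simp add: power_mult_distrib power_minus[of "c * z $ 1"] mult_ac)
  finally show "pform N a c z = form N (\<lambda>k. of_nat (N choose k) * (- 1) ^ k * (a ^ (N - k) * c ^ k)) z" .
qed

lemma pform_BF: "pform N a c \<in> binary_forms N"
  unfolding binary_forms_eq pform_form by simp

lemma form_action_pform: "g \<in> SL2 \<Longrightarrow> form_action g (pform N 1 0) = pform N (g $ 1 $ 1) (g $ 2 $ 1)"
  by (simp add: form_action_SL2 pform_def)

context SL2_free_field_algebra
begin

definition flin :: "nat \<Rightarrow> ((complex^2 \<Rightarrow> complex) \<Rightarrow> 'v) \<Rightarrow> bool" where
  "flin N D \<longleftrightarrow> (\<forall>f\<in>binary_forms N. \<forall>g\<in>binary_forms N. D (\<lambda>z. f z + g z) = D f + D g) \<and>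
    (\<forall>f\<in>binary_forms N. \<forall>c. D (\<lambda>z. c * f z) = scl c (D f))"

lemma flinD:
  "flin N D \<Longrightarrow> f \<in> binary_forms N \<Longrightarrow> g \<in> binary_forms N \<Longrightarrow> D (\<lambda>z. f z + g z) = D f + D g"
  "flin N D \<Longrightarrow> f \<in> binary_forms N \<Longrightarrow> D (\<lambda>z. c * f z) = scl c (D f)"
  by (simp_all add: flin_def)

lemma flin_form:
  assumes D: "flin N D"
  shows "D (form N p) = (\<Sum>k\<le>N. scl (p k) (D (bmon N k)))"
proof -
  have b: "bmon N k \<in> binary_forms N" if "k \<le> N" for k
    unfolding binary_forms_eq using form_bmon[OF that] by auto
  have "D (\<lambda>z. \<Sum>k\<in>I. p k * bmon N k z) = (\<Sum>k\<in>I. scl (p k) (D (bmon N k)))" if "finite I" "I \<subseteq> {..N}" for I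
    using that
  proof (induction I rule: finite_induct)
    case empty
    have "D (\<lambda>z. 0 * bmon N 0 z) = scl 0 (D (bmon N 0))" by (rule flinD(2)[OF D b]) simp
    then show ?case by simp
  next
    case (insert i I)
    have i: "i \<le> N" using insert.prems by simp
    have I: "(\<lambda>z. \<Sum>k\<in>I. p k * bmon N k z) \<in> binary_forms N"
      using insert.prems insert.hyps by (intro BF_sum BF_scale b) auto
    have "D (\<lambda>z. p i * bmon N i z + (\<Sum>k\<in>I. p k * bmon N k z)) = D (\<lambda>z. p i * bmon N i z) + D (\<lambda>z. \<Sum>k\<in>I. p k * bmon N k z)"
      by (rule flinD(1)[OF D BF_scale[OF b[OF i]] I])
    moreover have "D (\<lambda>z. p i * bmon N i z) = scl (p i) (D (bmon N i))" by (rule flinD(2)[OF D b[OF i]])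
    ultimately show ?case using insert by simp
  qed
  from this[of "{..N}"] show ?thesis by (simp add: form_def)
qed

text \<open>As a polynomial in t, \<open>pform N 1 t\<close> has as its coefficients the monomials
  times nonzero binomial numbers up to sign; equality for all t therefore forces equality on each
  monomial.\<close>

lemma flin_eqI:
  assumes D: "flin N D" and D': "flin N D'" and e: "\<And>t. D (pform N 1 t) = D' (pform N 1 t)"
    and f: "f \<in> binary_forms N"
  shows "D f = D' f"
proof -
  have "D (bmon N k) = D' (bmon N k)" if k: "k \<le> N" for k
  proof -
    let ?c = "\<lambda>k. scl (of_nat (N choose k) * (- 1) ^ k) (D (bmon N k) - D' (bmon N k))"
    have z: "(\<Sum>k\<le>N. scl (t ^ k) (?c k)) = 0" for t
    proof -
      have "(\<Sum>k\<le>N. scl (t ^ k) (?c k)) = D (pform N 1 t) - D' (pform N 1 t)"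
        unfolding pform_form flin_form[OF D] flin_form[OF D'] sum_subtractf[symmetric]
        by (simp add: scale_right_diff_distrib mult_ac)
      then show ?thesis by (simp add: e)
    qed
    have "?c k = 0" by (rule vpoly_zero[where c = ?c, OF infinite_nonzero z k])
    then show ?thesis using k by simp
  qed
  moreover obtain p where "f = form N p" using f by (auto simp: binary_forms_eq)
  ultimately show ?thesis by (simp add: flin_form[OF D] flin_form[OF D'])
qed

lemma dt_nth: "dt s $ 1 $ 1 = s" "dt s $ 1 $ 2 = 0" "dt s $ 2 $ 1 = 0" "dt s $ 2 $ 2 = inverse s"
  by (simp_all add: dt_def)

lemma dt_W: "s \<noteq> 0 \<Longrightarrow> v \<in> W k w \<Longrightarrow> \<rho> (dt s) v = scl (s powi w) v"
proof -
  assume s: "s \<noteq> 0" and v: "v \<in> W k w"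
  have "subspace {v. \<rho> (dt s) v = scl (s powi w) v}"
    unfolding subspace_def by (simp add: rho_lin curves_SL2 s scale_right_distrib mult.commute)
  moreover have "mono ` Idx k w \<subseteq> {v. \<rho> (dt s) v = scl (s powi w) v}"
    by (auto simp: Idx_def dt_mono s)
  ultimately have "span (mono ` Idx k w) \<subseteq> {v. \<rho> (dt s) v = scl (s powi w) v}" by (intro span_minimal)
  then show ?thesis using v unfolding W_span by blast
qed

lemma dt_HW: "s \<noteq> 0 \<Longrightarrow> v \<in> HW N \<Longrightarrow> \<rho> (dt s) v = scl (s ^ N) v"
proof -
  assume s: "s \<noteq> 0" and v: "v \<in> HW N"
  have "subspace {v. \<rho> (dt s) v = scl (s ^ N) v}"
    unfolding subspace_def by (simp add: rho_lin curves_SL2 s scale_right_distrib mult.commute)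
  moreover have "HB N \<subseteq> {v. \<rho> (dt s) v = scl (s ^ N) v}"
  proof
    fix u assume "u \<in> HB N"
    then have "u \<in> W (hkey N u) (int N)" using HB_hkey hwb(1) unfolding K_def by blast
    from dt_W[OF s this] show "u \<in> {v. \<rho> (dt s) v = scl (s ^ N) v}" by simp
  qed
  ultimately have "span (HB N) \<subseteq> {v. \<rho> (dt s) v = scl (s ^ N) v}" by (intro span_minimal)
  then show ?thesis using v unfolding HB_span by blast
qed

text \<open>Invariance under all \<open>ut t\<close> gives \<open>Ev v = 0\<close>. One torus
  element is enough for the weight: the numbers 2^w for integers w are distinct, so components of
  weight other than N vanish.\<close>

lemma HWI:
  assumes u: "\<And>t. \<rho> (ut t) v = v" and d: "\<rho> (dt 2) v = scl (2 ^ N) v"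
  shows "v \<in> HW N"
proof -
  obtain T x where T: "finite T" and x: "\<And>t. x t \<in> span (mono ` Idx (fst t) (snd t))" and s: "v = (\<Sum>t\<in>T. x t)"
    using W_decomp[of v] by (elim exE conjE) (rule that, assumption, erule spec, assumption)
  interpret H: Vector_Spaces.linear scl scl Hv using der_H by (simp add: der_def)
  interpret L: Vector_Spaces.linear scl scl "\<rho> (dt 2)" by (rule rho_linear) (simp add: curves_SL2)
  have xW: "x t \<in> W (fst t) (snd t)" for t using x[of t] by (simp only: W_span)
  have Hx: "Hv (x t) = scl (of_nat N) (x t)" if t: "t \<in> T" for t
  proof (cases "snd t = int N")
    case True
    then show ?thesis using xW[of t] by (simp add: W_def)
  next
    case False
    have "scl (2 powi snd t - 2 ^ N) (x t) = 0"
    proof (rule W_indep[of T "\<lambda>t. scl (2 powi snd t - 2 ^ N) (x t)", OF T _ _ t])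
      show "scl (2 powi snd t - 2 ^ N) (x t) \<in> W (fst t) (snd t)" for t
        by (rule subspace_scale[OF W_subspace xW])
      have "\<rho> (dt 2) (x t) = scl (2 powi snd t) (x t)" for t using dt_W[OF _ xW] by simp
      then have "(\<Sum>t\<in>T. scl (2 powi snd t - 2 ^ N) (x t)) = \<rho> (dt 2) v - scl (2 ^ N) v"
        by (simp add: s L.sum scale_left_diff_distrib sum_subtractf scale_sum_right)
      then show "(\<Sum>t\<in>T. scl (2 powi snd t - 2 ^ N) (x t)) = 0" using d by simp
    qed
    moreover have "(2 :: complex) powi snd t - 2 ^ N \<noteq> 0"
    proof
      assume "(2 :: complex) powi snd t - 2 ^ N = 0"
      then have "norm ((2 :: complex) powi snd t) = norm ((2 :: complex) powi int N)" by simp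
      then have "(2 :: real) powi snd t = 2 powi int N" unfolding norm_power_int by simp
      then have "(2 :: real) powr of_int (snd t) = 2 powr of_int (int N)" by (simp add: powr_real_of_int' del: of_int_of_nat_eq)
      then have "real_of_int (snd t) = of_int (int N)" by (subst (asm) powr_inj) simp_all
      then show False using False by linarith
    qed
    ultimately have "x t = 0" by simp
    then show ?thesis by (simp add: H.zero)
  qed
  have "Hv v = (\<Sum>t\<in>T. Hv (x t))" unfolding s by (rule H.sum)
  also have "\<dots> = scl (of_nat N) v" unfolding s scale_sum_right by (rule sum.cong) (simp_all add: Hx)
  finally show ?thesis using E_fixed_zero[OF u] by (simp add: HW_def)
qed

text \<open>Every \<open>g\<close> with \<open>g\<^sub>1\<^sub>1 \<noteq> 0\<close> is a product of a lower unitriangular, a diagonal and an upper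
  unitriangular matrix; the curve through the Weyl element bounds the degree.\<close>

lemma HW_lower:
  assumes v: "v \<in> HW N"
  shows "\<exists>u. \<forall>g\<in>SL2. g $ 1 $ 1 \<noteq> 0 \<longrightarrow> \<rho> g v = (\<Sum>k\<le>N. scl ((g $ 1 $ 1) ^ (N - k) * (g $ 2 $ 1) ^ k) (u k))"
proof -
  have Ev0: "Ev v = 0" using v by (simp add: HW_def)
  obtain n c where c: "\<And>t. \<rho> (lt t) v = (\<Sum>k\<le>n. scl (t ^ k) (c k))"
    using pcurve_polyv[OF pcurve_lt, of v] unfolding polyv_def by blast
  have g: "\<rho> g v = scl ((g $ 1 $ 1) ^ N) (\<rho> (lt (g $ 2 $ 1 / g $ 1 $ 1)) v)" if S: "g \<in> SL2" and a: "g $ 1 $ 1 \<noteq> 0" for g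
  proof -
    let ?a = "g $ 1 $ 1" and ?b = "g $ 1 $ 2" and ?c = "g $ 2 $ 1" and ?d = "g $ 2 $ 2"
    have "g = lt (?c / ?a) ** (dt ?a ** ut (?b / ?a))"
      unfolding lt_def dt_def ut_def mat2_mult
      using a SL2_det[OF S] by (simp add: vec_eq_iff forall_2 field_simps)
    then have "\<rho> g v = \<rho> (lt (?c / ?a) ** (dt ?a ** ut (?b / ?a))) v" by simp
    also have "\<dots> = \<rho> (lt (?c / ?a)) (\<rho> (dt ?a) (\<rho> (ut (?b / ?a)) v))"
      using a by (simp add: action_mult curves_SL2 SL2_mult)
    also have "\<dots> = scl (?a ^ N) (\<rho> (lt (?c / ?a)) v)"
      by (simp add: E_zero_fixed[OF Ev0] dt_HW[OF a v] rho_lin curves_SL2)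
    finally show ?thesis .
  qed
  \<comment> \<open>For t nonzero this curve has first column (t, 1), so it acts on v as t^N times
    \<open>\<rho> (lt (1 / t))\<close>. A coefficient \<open>c k\<close> with k > N would produce
    the negative power t^(N-k), but the curve acts polynomially.\<close>
  let ?w = "\<lambda>t. mat2 t (- 1) 1 0"
  have w: "pcurve ?w"
    unfolding pcurve_def forall_2 by (simp add: mat2_SL2 polyc_const polyc_ident)
  obtain m e where e: "\<And>t. \<rho> (?w t) v = (\<Sum>k\<le>m. scl (t ^ k) (e k))"
    using pcurve_polyv[OF w, of v] unfolding polyv_def by blast
  have c0: "c k = 0" if k: "N < k" "k \<le> n" for k
  proof -
    \<comment> \<open>Multiplication by t^n clears all denominators: \<open>c k\<close> then sits at
      exponent N + n - k, which is below n for k > N, while the side of \<open>e\<close> starts at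
      n.\<close>
    let ?M = "m + n + N"
    let ?e = "\<lambda>i. if n \<le> i \<and> i \<le> n + m then e (i - n) else 0"
    let ?c = "\<lambda>i. if N \<le> i \<and> i \<le> N + n then c (N + n - i) else 0"
    have "(\<Sum>i\<le>?M. scl (t ^ i) (?e i - ?c i)) = 0" if t: "t \<noteq> 0" for t
    proof -
      have "(\<Sum>i\<le>?M. scl (t ^ i) (?e i)) = (\<Sum>j\<le>m. scl (t ^ (n + j)) (e j))"
      proof -
        have "(\<Sum>i\<in>(\<lambda>j. n + j) ` {..m}. scl (t ^ i) (?e i)) = (\<Sum>i\<le>?M. scl (t ^ i) (?e i))"
        proof (rule sum.mono_neutral_left)
          show "\<forall>i\<in>{..?M} - (\<lambda>j. n + j) ` {..m}. scl (t ^ i) (?e i) = 0"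
          proof
            fix i assume i: "i \<in> {..?M} - (\<lambda>j. n + j) ` {..m}"
            have "\<not> (n \<le> i \<and> i \<le> n + m)"
            proof
              assume "n \<le> i \<and> i \<le> n + m"
              then have "i = n + (i - n)" "i - n \<in> {..m}" by auto
              then show False using i by blast
            qed
            then show "scl (t ^ i) (?e i) = 0" by (simp only: if_False scale_zero_right)
          qed
        qed auto
        then show ?thesis by (simp add: sum.reindex)
      qed
      also have "\<dots> = scl (t ^ n) (\<rho> (?w t) v)" unfolding e scale_sum_right by (simp add: power_add)
      also have "\<dots> = scl (t ^ n * t ^ N) (\<Sum>k\<le>n. scl ((1 / t) ^ k) (c k))"
        using g[of "?w t"] t by (simp add: mat2_SL2 c)
      also have "\<dots> = (\<Sum>k\<le>n. scl (t ^ (N + n - k)) (c k))"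
        unfolding scale_sum_right using t
        by (intro sum.cong refl) (simp add: power_add power_diff field_simps)
      also have "\<dots> = (\<Sum>i\<le>?M. scl (t ^ i) (?c i))"
      proof -
        have "(\<Sum>i\<in>(\<lambda>k. N + n - k) ` {..n}. scl (t ^ i) (?c i)) = (\<Sum>i\<le>?M. scl (t ^ i) (?c i))"
        proof (rule sum.mono_neutral_left)
          show "\<forall>i\<in>{..?M} - (\<lambda>k. N + n - k) ` {..n}. scl (t ^ i) (?c i) = 0"
          proof
            fix i assume i: "i \<in> {..?M} - (\<lambda>k. N + n - k) ` {..n}"
            have "\<not> (N \<le> i \<and> i \<le> N + n)"
            proof
              assume "N \<le> i \<and> i \<le> N + n"
              then have "i = N + n - (N + n - i)" "N + n - i \<in> {..n}" by auto
              then show False using i by blast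
            qed
            then show "scl (t ^ i) (?c i) = 0" by (simp only: if_False scale_zero_right)
          qed
        qed auto
        moreover have "inj_on (\<lambda>k. N + n - k) {..n}" by (auto simp: inj_on_def)
        moreover have "(\<Sum>k\<le>n. scl (t ^ (N + n - k)) (c k)) = (\<Sum>k\<le>n. scl (t ^ (N + n - k)) (?c (N + n - k)))"
          by (rule sum.cong) auto
        ultimately show ?thesis by (simp only: sum.reindex o_def)
      qed
      finally show ?thesis by (simp add: scale_right_diff_distrib sum_subtractf)
    qed
    then have "?e (N + n - k) - ?c (N + n - k) = 0"
      using k by (intro vpoly_zero[OF infinite_nonzero, where n = ?M and c = "\<lambda>i. ?e i - ?c i"]) auto
    then show ?thesis using k by (simp split: if_splits)
  qed
  let ?u = "\<lambda>k. if k \<le> n then c k else 0"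
  have lt: "\<rho> (lt t) v = (\<Sum>k\<le>N. scl (t ^ k) (?u k))" for t
  proof -
    have "(\<Sum>k\<le>n. scl (t ^ k) (c k)) = (\<Sum>k\<le>max n N. scl (t ^ k) (?u k))"
      by (rule sum.mono_neutral_cong_left) auto
    also have "\<dots> = (\<Sum>k\<le>N. scl (t ^ k) (?u k))"
      by (rule sum.mono_neutral_right) (auto simp: c0)
    finally show ?thesis by (simp only: c)
  qed
  show ?thesis
  proof (rule exI[of _ ?u], intro ballI impI)
    fix g :: "complex^2^2" assume S: "g \<in> SL2" and a: "g $ 1 $ 1 \<noteq> 0"
    show "\<rho> g v = (\<Sum>k\<le>N. scl ((g $ 1 $ 1) ^ (N - k) * (g $ 2 $ 1) ^ k) (?u k))"
      unfolding g[OF S a] lt scale_sum_right scale_scale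
      by (intro sum.cong refl arg_cong2[of _ _ _ _ scl]) (use a in \<open>simp add: power_diff power_divide\<close>)
  qed
qed

text \<open>An element with vanishing corner entry is joined to elements with nonzero corner by a
  polynomial curve in the group; both sides are polynomial in the parameter and agree off t =
  0.\<close>

lemma HW_action:
  assumes v: "v \<in> HW N"
  shows "\<exists>u. \<forall>g\<in>SL2. \<rho> g v = (\<Sum>k\<le>N. scl ((g $ 1 $ 1) ^ (N - k) * (g $ 2 $ 1) ^ k) (u k))"
proof -
  obtain u where "\<forall>g\<in>SL2. g $ 1 $ 1 \<noteq> 0 \<longrightarrow> \<rho> g v = (\<Sum>k\<le>N. scl ((g $ 1 $ 1) ^ (N - k) * (g $ 2 $ 1) ^ k) (u k))"
    using HW_lower[OF v] by (elim exE) (rule that)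
  then have u: "\<rho> g v = (\<Sum>k\<le>N. scl ((g $ 1 $ 1) ^ (N - k) * (g $ 2 $ 1) ^ k) (u k))" if "g \<in> SL2" "g $ 1 $ 1 \<noteq> 0" for g
    using that by blast
  have "\<rho> g v = (\<Sum>k\<le>N. scl ((g $ 1 $ 1) ^ (N - k) * (g $ 2 $ 1) ^ k) (u k))" if S: "g \<in> SL2" and a: "g $ 1 $ 1 = 0" for g
  proof -
    let ?c = "g $ 2 $ 1" and ?d = "g $ 2 $ 2"
    have bc: "g $ 1 $ 2 * ?c = - 1" using SL2_det[OF S] a by (metis add.inverse_inverse diff_0 mult_zero_left)
    then have c: "?c \<noteq> 0" by auto
    \<comment> \<open>The second row is kept, and the upper right entry is solved from determinant
      1.\<close>
    let ?g = "\<lambda>t. mat2 t (- 1 / ?c + t * (?d / ?c)) ?c ?d"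
    have gS: "?g t \<in> SL2" for t using c by (simp add: mat2_SL2 field_simps)
    have pg: "pcurve ?g"
      unfolding pcurve_def forall_2 mat2_nth by (intro conjI allI gS polyc_const polyc_ident polyc_linear)
    have g0: "?g 0 = g" using a bc c by (simp add: vec_eq_iff forall_2 field_simps)
    have "\<rho> (?g 0) v = (\<Sum>k\<le>N. scl (0 ^ (N - k) * ?c ^ k) (u k))"
    proof (rule polyv_eq[of "\<lambda>t. \<rho> (?g t) v" "\<lambda>t. \<Sum>k\<le>N. scl (t ^ (N - k) * ?c ^ k) (u k)"])
      show "polyv (\<lambda>t. \<rho> (?g t) v)" by (rule pcurve_polyv[OF pg])
      have "polyv (\<lambda>t. \<Sum>k\<le>N. scl (t ^ (N - k)) (scl (?c ^ k) (u k)))" by (intro polyv_sum polyv_power)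
      then show "polyv (\<lambda>t. \<Sum>k\<le>N. scl (t ^ (N - k) * ?c ^ k) (u k))" by simp
      show "\<rho> (?g t) v = (\<Sum>k\<le>N. scl (t ^ (N - k) * ?c ^ k) (u k))" if "t \<noteq> 0" for t
        using u[OF gS, of t] that by simp
    qed
    then show ?thesis by (simp only: g0 a)
  qed
  with u have "\<forall>g\<in>SL2. \<rho> g v = (\<Sum>k\<le>N. scl ((g $ 1 $ 1) ^ (N - k) * (g $ 2 $ 1) ^ k) (u k))" by blast
  then show ?thesis by (rule exI[of _ u])
qed

lemma mult_space_flin: "F \<in> multiplicity_space scl \<rho> N \<Longrightarrow> flin N F"
  unfolding multiplicity_space_def flin_def by (elim CollectE conjE) (intro conjI)

lemma mult_space_action: "F \<in> multiplicity_space scl \<rho> N \<Longrightarrow> f \<in> binary_forms N \<Longrightarrow> g \<in> SL2 \<Longrightarrow> F (form_action g f) = \<rho> g (F f)"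
  unfolding multiplicity_space_def by (elim CollectE conjE) (drule bspec, assumption, erule bspec)

lemma mult_space_outside: "F \<in> multiplicity_space scl \<rho> N \<Longrightarrow> f \<notin> binary_forms N \<Longrightarrow> F f = 0"
  unfolding multiplicity_space_def by (elim CollectE conjE) (drule spec, erule mp, assumption)

lemma mult_space_HW:
  assumes F: "F \<in> multiplicity_space scl \<rho> N"
  shows "F (pform N 1 0) \<in> HW N"
proof (rule HWI)
  show "\<rho> (ut t) (F (pform N 1 0)) = F (pform N 1 0)" for t
    using mult_space_action[OF F pform_BF[of N 1 0] curves_SL2(1)[of t]]
    by (simp add: form_action_pform curves_SL2 ut_nth)
  have "\<rho> (dt 2) (F (pform N 1 0)) = F (pform N 2 0)"
    using mult_space_action[OF F pform_BF[of N 1 0] curves_SL2(3)[of 2]]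
    by (simp add: form_action_pform curves_SL2 dt_nth)
  also have "pform N 2 0 = (\<lambda>z. 2 ^ N * pform N 1 0 z)" by (simp add: pform_def power_mult_distrib)
  also have "F \<dots> = scl (2 ^ N) (F (pform N 1 0))"
    by (rule flinD(2)[OF mult_space_flin[OF F] pform_BF])
  finally show "\<rho> (dt 2) (F (pform N 1 0)) = scl (2 ^ N) (F (pform N 1 0))" .
qed

text \<open>\<open>pform N 1 t\<close> is the translate of \<open>pform N 1 0\<close> by
  \<open>lt t\<close>, so equivariance fixes the values on a spanning family.\<close>

lemma mult_space_eqI:
  assumes F: "F \<in> multiplicity_space scl \<rho> N" and F': "F' \<in> multiplicity_space scl \<rho> N"
    and e: "F (pform N 1 0) = F' (pform N 1 0)"
  shows "F = F'"
proof
  fix f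
  show "F f = F' f"
  proof (cases "f \<in> binary_forms N")
    case True
    show ?thesis
    proof (rule flin_eqI[OF mult_space_flin[OF F] mult_space_flin[OF F'] _ True])
      fix t
      have "form_action (lt t) (pform N 1 0) = pform N 1 t" by (simp add: form_action_pform curves_SL2 lt_nth)
      then have "D (pform N 1 t) = \<rho> (lt t) (D (pform N 1 0))" if "D \<in> multiplicity_space scl \<rho> N" for D
        using mult_space_action[OF that pform_BF curves_SL2(2)[of t], of 1 0] by (simp only:)
      from this[OF F] this[OF F'] show "F (pform N 1 t) = F' (pform N 1 t)" by (simp only: e)
    qed
  next
    case False
    then show ?thesis by (simp only: mult_space_outside[OF F False] mult_space_outside[OF F' False])
  qed
qed

text \<open>By \<open>HW_action\<close> the orbit of v depends on the first column of g in the same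
  shape as that of \<open>pform N 1 0\<close>. Matching coefficients defines F, and equivariance has
  to be verified only on the spanning forms \<open>pform N 1 t\<close>.\<close>

lemma mult_space_ex:
  assumes v: "v \<in> HW N"
  shows "\<exists>F \<in> multiplicity_space scl \<rho> N. F (pform N 1 0) = v"
proof -
  obtain u where u: "\<And>g. g \<in> SL2 \<Longrightarrow> \<rho> g v = (\<Sum>k\<le>N. scl ((g $ 1 $ 1) ^ (N - k) * (g $ 2 $ 1) ^ k) (u k))"
    using HW_action[OF v] by (elim exE) (rule that, erule bspec)
  \<comment> \<open>The scalar factors invert the coefficients
    \<open>of_nat (N choose k) * (- 1) ^ k\<close> of \<open>pform_form\<close>.\<close>
  define F where "F f = (if f \<in> binary_forms N then \<Sum>k\<le>N. scl (fcoef N f k * ((- 1) ^ k / of_nat (N choose k))) (u k) else 0)" for f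
  have Ff: "F (form N p) = (\<Sum>k\<le>N. scl (p k * ((- 1) ^ k / of_nat (N choose k))) (u k))" for p
    unfolding F_def by (simp add: binary_forms_eq fcoef_form)
  have lin: "flin N F"
    unfolding flin_def binary_forms_eq
    by (auto simp: form_add form_scale Ff distrib_right add_divide_distrib scale_left_distrib sum.distrib scale_sum_right mult.assoc)
  have pf: "F (pform N (g $ 1 $ 1) (g $ 2 $ 1)) = \<rho> g v" if g: "g \<in> SL2" for g
  proof -
    have "of_nat (N choose k) * (- 1) ^ k * (a ^ (N - k) * c ^ k) * ((- 1) ^ k / of_nat (N choose k)) = a ^ (N - k) * c ^ k"
      if "k \<le> N" for k and a c :: complex
    proof -
      have "(of_nat (N choose k) :: complex) \<noteq> 0" using that by simp
      moreover have "(- 1) ^ k * (- 1) ^ k = (1 :: complex)" by (simp flip: power_mult_distrib)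
      ultimately show ?thesis by (simp add: field_simps)
    qed
    then show ?thesis unfolding pform_form Ff u[OF g] by (intro sum.cong) auto
  qed
  have "F (form_action h f) = \<rho> h (F f)" if f: "f \<in> binary_forms N" and h: "h \<in> SL2" for f h
  proof (rule flin_eqI[where D = "\<lambda>f. F (form_action h f)" and D' = "\<lambda>f. \<rho> h (F f)", OF _ _ _ f])
    have pw: "form_action h (\<lambda>z. f z + g z) = (\<lambda>z. form_action h f z + form_action h g z)"
      "form_action h (\<lambda>z. c * f z) = (\<lambda>z. c * form_action h f z)" for f g c
      by (simp_all add: form_action_def)
    show "flin N (\<lambda>f. F (form_action h f))"
      using BF_form_action[OF h] by (simp add: flin_def pw flinD[OF lin])
    show "flin N (\<lambda>f. \<rho> h (F f))"
      by (simp add: flin_def rho_lin[OF h] flinD[OF lin])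
    fix t
    have "form_action h (pform N 1 t) = form_action (h ** lt t) (pform N 1 0)"
      by (simp add: form_action_mult[OF h curves_SL2(2)] form_action_pform curves_SL2 lt_nth)
    then have "F (form_action h (pform N 1 t)) = \<rho> (h ** lt t) v"
      using pf[OF SL2_mult[OF h curves_SL2(2)]] by (simp add: form_action_pform SL2_mult[OF h curves_SL2(2)])
    also have "\<dots> = \<rho> h (F (pform N 1 t))"
      using pf[OF curves_SL2(2)[of t]] by (simp add: action_mult[OF h curves_SL2(2)] lt_nth)
    finally show "F (form_action h (pform N 1 t)) = \<rho> h (F (pform N 1 t))" .
  qed
  then have "F \<in> multiplicity_space scl \<rho> N"
    using lin unfolding multiplicity_space_def flin_def by (simp add: F_def)
  moreover have "F (pform N 1 0) = v"
    using pf[of "mat 1"] by (simp add: mat2_one mat2_SL2) (simp add: mat2_one[symmetric] action_one)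
  ultimately show ?thesis by blast
qed

section \<open>Characters of the multiplicity spaces\<close>

lemma hom_vector_space: "vector_space (hom_scale scl)"
  by unfold_locales (simp_all add: hom_scale_def fun_eq_iff scale_right_distrib scale_left_distrib)

lemma mult_space_subspace: "module.subspace (hom_scale scl) (multiplicity_space scl \<rho> N)"
proof -
  interpret h: vector_space "hom_scale scl" by (rule hom_vector_space)
  show ?thesis
    by (rule h.subspaceI)
      (auto simp: multiplicity_space_def hom_scale_def rho_lin scale_right_distrib mult.commute algebra_simps)
qed

lemma hom_sum_apply: "(\<Sum>i\<in>I. hom_scale scl (c i) (D i)) f = (\<Sum>i\<in>I. scl (c i) (D i f))"
  by (induction I rule: infinite_finite_induct) (simp_all add: hom_scale_def)

text \<open>Evaluation at \<open>pform N 1 0\<close> is an isomorphism of the multiplicity space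
  onto \<open>HW N\<close> that commutes with the modes of invariant vectors. The basis
  \<open>HB N\<close> of joint eigenvectors is transported back along it.\<close>

lemma mult_space_has_character:
  assumes d: "(y, \<tau>) \<in> char_domain"
  shows "has_character (hom_scale scl) (multiplicity_space scl \<rho> N) (hom_mode prd 1 om) (hom_mode prd 0 Jv)
    y \<tau> (atypical_part N y \<tau> + typical_part N y \<tau>)"
proof -
  have \<tau>: "Im \<tau> > 0" and y: "y \<noteq> 0" using d by (auto simp: char_domain_def)
  interpret n: nome \<tau> by unfold_locales (rule \<tau>)
  interpret h: vector_space "hom_scale scl" by (rule hom_vector_space)
  let ?M = "multiplicity_space scl \<rho> N"
  let ?p = "pform N 1 0"
  obtain \<Phi> where \<Phi>: "\<And>v. v \<in> HW N \<Longrightarrow> \<Phi> v \<in> ?M" and \<Phi>p: "\<And>v. v \<in> HW N \<Longrightarrow> \<Phi> v ?p = v"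
    using mult_space_ex[of _ N] by metis
  have HB: "v \<in> HW N" if "v \<in> HB N" for v using that HB_span span_base by blast
  have inj: "inj_on \<Phi> (HB N)" by (rule inj_onI) (metis \<Phi>p HB)
  let ?S = "\<Phi> ` HB N"
  have ind: "\<not> h.dependent ?S"
    unfolding h.dependent_explicit
  proof (intro notI, elim exE conjE bexE)
    fix T u F assume T: "finite T" "T \<subseteq> ?S" and s: "(\<Sum>F\<in>T. hom_scale scl (u F) F) = 0" and F: "F \<in> T" "u F \<noteq> 0"
    obtain T' where T': "T' \<subseteq> HB N" "T = \<Phi> ` T'" using T(2) by (meson subset_imageE)
    have inj': "inj_on \<Phi> T'" using inj T'(1) inj_on_subset by blast
    have fin: "finite T'" using T(1) T'(2) inj' finite_imageD by blast
    have "(\<Sum>F\<in>T. scl (u F) (F ?p)) = 0"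
      using fun_cong[OF s, of ?p] hom_sum_apply[of u "\<lambda>F. F" T ?p] by simp
    then have "(\<Sum>v\<in>T'. scl (u (\<Phi> v)) v) = 0"
      unfolding T'(2) using T'(1) HB by (simp add: sum.reindex[OF inj'] \<Phi>p subset_eq)
    then have "u (\<Phi> v) = 0" if "v \<in> T'" for v
      by (rule independent_scalars[OF HB_independent fin T'(1) _ that])
    then show False using F T'(2) by auto
  qed
  have span: "h.span ?S = ?M"
  proof (rule subset_antisym)
    show "h.span ?S \<subseteq> ?M" by (rule h.span_minimal[OF _ mult_space_subspace]) (use \<Phi> HB in auto)
    show "?M \<subseteq> h.span ?S"
    proof
      fix F assume F: "F \<in> ?M"
      have "F ?p \<in> span (HB N)" using mult_space_HW[OF F] HB_span by simp
      then obtain T u where T: "finite T" "T \<subseteq> HB N" and e: "F ?p = (\<Sum>v\<in>T. scl (u v) v)"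
        unfolding span_explicit by blast
      let ?G = "\<Sum>v\<in>T. hom_scale scl (u v) (\<Phi> v)"
      have "?G \<in> ?M"
        using T(2) by (intro h.subspace_sum[OF mult_space_subspace] h.subspace_scale[OF mult_space_subspace] \<Phi> HB) blast
      moreover have "?G ?p = F ?p"
        unfolding hom_sum_apply e using T(2) by (intro sum.cong refl) (simp add: \<Phi>p HB subset_eq)
      ultimately have "?G = F" by (rule mult_space_eqI[OF _ F])
      moreover have "?G \<in> h.span ?S"
        using T(2) by (intro h.span_sum h.span_scale h.span_base) blast
      ultimately show "F \<in> h.span ?S" by simp
    qed
  qed
  have eig: "hom_mode prd m a (\<Phi> v) = hom_scale scl c (\<Phi> v)"
    if "v \<in> HB N" "a \<in> fixed_points \<rho>" "prd m a v = scl c v" for m a v c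
  proof (rule mult_space_eqI[OF hom_mode_closed[OF that(2) \<Phi>[OF HB[OF that(1)]]]])
    show "hom_scale scl c (\<Phi> v) \<in> ?M" by (rule h.subspace_scale[OF mult_space_subspace \<Phi>[OF HB[OF that(1)]]])
    show "hom_mode prd m a (\<Phi> v) ?p = hom_scale scl c (\<Phi> v) ?p"
      by (simp add: hom_mode_def hom_scale_def \<Phi>p HB that)
  qed
  have "((\<lambda>v. qpow \<tau> (- 1 / 4) * (qpow \<tau> (fst (hkey N v)) * y powi snd (hkey N v))) has_sum
      qpow \<tau> (- 1 / 4) * (n.A (int N) y - n.A (int N + 2) y)) (HB N)"
    by (intro has_sum_cmult_right HB_has_sum \<tau> y)
  moreover have "qpow \<tau> (- 1 / 4) * (n.A (int N) y - n.A (int N + 2) y) = atypical_part N y \<tau> + typical_part N y \<tau>"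
    using n.trace_formula d by (simp add: n.dom_iff)
  moreover have "qpow \<tau> (- 1 / 4) * (qpow \<tau> a * z) = qpow \<tau> (a - 1 / 4) * z" for a z
  proof -
    have "qpow \<tau> (- 1 / 4) * qpow \<tau> a = qpow \<tau> (a - 1 / 4)"
      unfolding qpow_mult by (rule arg_cong[of _ _ "qpow \<tau>"]) simp
    then show ?thesis by (simp only: mult.assoc[symmetric])
  qed
  ultimately have "((\<lambda>v. qpow \<tau> (fst (hkey N v) - 1 / 4) * y powi snd (hkey N v)) has_sum
      atypical_part N y \<tau> + typical_part N y \<tau>) (HB N)" by (simp only:)
  then have "((\<lambda>F. qpow \<tau> (fst (hkey N (F ?p)) - 1 / 4) * y powi snd (hkey N (F ?p))) has_sum
      atypical_part N y \<tau> + typical_part N y \<tau>) ?S"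
    unfolding has_sum_reindex[OF inj] o_def
    by (rule has_sum_cong[THEN iffD1, rotated]) (simp add: \<Phi>p HB)
  moreover have "hom_mode prd 1 om F = hom_scale scl (of_real (fst (hkey N (F ?p)))) F \<and>
      hom_mode prd 0 Jv F = hom_scale scl (of_int (snd (hkey N (F ?p)))) F" if F: "F \<in> ?S" for F
  proof -
    obtain v where v: "v \<in> HB N" "F = \<Phi> v" using F by blast
    show ?thesis
      unfolding v(2) \<Phi>p[OF HB[OF v(1)]]
      using eig[OF v(1) conformal_vector_fixed] eig[OF v(1) heisenberg_vector_fixed] HB_eigen[OF v(1)] by blast
  qed
  ultimately show ?thesis
    unfolding has_character_def using ind span
    by (intro exI[of _ ?S] exI[of _ "\<lambda>F. fst (hkey N (F ?p))"] exI[of _ "\<lambda>F. snd (hkey N (F ?p))"]) blast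
qed

end

theorem theorem3p12:
  fixes scl :: "complex \<Rightarrow> 'v::ab_group_add \<Rightarrow> 'v"
    and par :: "bool \<Rightarrow> 'v set"
    and vac :: 'v
    and prd :: "int \<Rightarrow> 'v \<Rightarrow> 'v \<Rightarrow> 'v"
    and \<phi> :: "generator \<Rightarrow> 'v"
    and \<rho> :: "complex^2^2 \<Rightarrow> 'v \<Rightarrow> 'v"
    and N :: nat
  assumes "SL2_free_field_algebra scl par vac prd \<phi> \<rho>"
  shows "(\<forall>(y, \<tau>)\<in>char_domain.
            has_character (hom_scale scl) (multiplicity_space scl \<rho> N)
              (hom_mode prd 1 (conformal_vector scl vac prd \<phi>))
              (hom_mode prd 0 (heisenberg_vector prd \<phi>))
              y \<tau> (atypical_part N y \<tau> + typical_part N y \<tau>))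
       \<and> (\<exists>a0 a1 :: int. \<forall>(y, \<tau>)\<in>char_domain.
            atypical_part N y \<tau> =
              of_int a0 * atypical_char_0 y \<tau> + of_int a1 * atypical_char_1 y \<tau>)
       \<and> (\<exists>(H :: real set) (a :: real \<Rightarrow> int). H \<subseteq> {1/4..} \<and> (\<forall>(y, \<tau>)\<in>char_domain.
            ((\<lambda>h. of_int (a h) * typical_char h y \<tau>) has_sum typical_part N y \<tau>) H))"
proof (intro conjI)
  interpret SL2_free_field_algebra scl par vac prd \<phi> \<rho> by (rule assms)
  show "\<forall>(y, \<tau>)\<in>char_domain.
            has_character (hom_scale scl) (multiplicity_space scl \<rho> N)
              (hom_mode prd 1 (conformal_vector scl vac prd \<phi>))
              (hom_mode prd 0 (heisenberg_vector prd \<phi>))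
              y \<tau> (atypical_part N y \<tau> + typical_part N y \<tau>)"
    using mult_space_has_character by blast
  \<comment> \<open>By its definition \<open>atypical_part\<close> is -2, 1 or 0 times
    \<open>atypical_char_0\<close>, which gives the witnesses.\<close>
  show "\<exists>a0 a1 :: int. \<forall>(y, \<tau>)\<in>char_domain.
            atypical_part N y \<tau> =
              of_int a0 * atypical_char_0 y \<tau> + of_int a1 * atypical_char_1 y \<tau>"
    by (rule exI[of _ "if N = 0 then - 2 else if N = 1 then 1 else 0"], rule exI[of _ 0])
      (auto simp: atypical_part_def atypical_char_0_def)
qed (rule typical_part_integral)

end
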